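(* Let $q\equiv1\pmod4$ be a prime, $a\in\mathbb{Z}$, and $J\ge1$ an integer. There are constants $c_{j,a}$ ($0\le j\le J$, depending on $q,a,j$) with $$c_{0,a}=1,\qquad c_{1,a}=\begin{cases}c_1+\frac{\log q}{2}&\text{if }a\equiv0\pmod q,\\ c_1-\frac{\log q}{2(q-1)}&\text{otherwise,}\end{cases}$$ such that, as $x\to\infty$, $$\sum_{\substack{n\le x\\ n\equiv a\pmod q}}\mathbf{1}_{\mathbf E}(n)=\frac{K}{q}\,x\sum_{j=0}^J\frac{c_{j,a}}{(\log x)^{1/2+j}}+O\Big(\frac{x}{(\log x)^{J+3/2}}\Big).$$
   Context: $\mathbf{1}_{\mathbf E}$ is the indicator of the set of integers of the form $a^2+b^2$ with $a,b\in\mathbb{Z}$. $K=\frac{1}{\sqrt2}\prod_{p\equiv 3\,(4)}(1-p^{-2})^{-1/2}$. The constants $c_0=1,c_1,c_2,\dots$ are those in the classical expansion (valid for every $J\ge1$) $\sum_{n\le x}\mathbf{1}_{\mathbf E}(n)=Kx\sum_{j=0}^J c_j(\log x)^{-1/2-j}+O(x(\log x)^{-3/2-J})$; numerically $c_1=0.581948659\ldots$. *)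

theory Defs
  imports "HOL-Analysis.Analysis" "HOL-Library.Landau_Symbols" "HOL-Number_Theory.Number_Theory"
begin

definition sum_two_squares :: "nat \<Rightarrow> bool" where
  "sum_two_squares n \<longleftrightarrow> (\<exists>a b :: int. int n = a^2 + b^2)"

definition indE :: "nat \<Rightarrow> real" where
  "indE n = (if sum_two_squares n then 1 else 0)"

definition countE :: "real \<Rightarrow> real" where
  "countE x = (\<Sum>n\<in>{1..nat \<lfloor>x\<rfloor>}. indE n)"

definition countE_ap :: "nat \<Rightarrow> int \<Rightarrow> real \<Rightarrow> real" where
  "countE_ap q a x = (\<Sum>n\<in>{n\<in>{1..nat \<lfloor>x\<rfloor>}. [int n = a] (mod int q)}. indE n)"

definition LR_K :: real where
  "LR_K = (1 / sqrt 2) *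
     (\<Prod>p. if prime p \<and> p mod 4 = (3::nat) then (1 - 1 / (real p)^2) powr (-1/2) else 1)"

text \<open>The constant c_1 of the classical expansion (with c_0 = 1), determined by the
  case J = 1 of that expansion (asymptotic expansion coefficients are unique).\<close>
definition classical_c1 :: real where
  "classical_c1 = (THE c. (\<lambda>x. countE x - LR_K * x * (ln x powr (-1/2) + c * ln x powr (-3/2)))
                          \<in> O(\<lambda>x. x * ln x powr (-5/2)))"

end

theory Submission
  imports Defs "HOL-Complex_Analysis.Complex_Analysis" "HOL-Probability.Probability"
begin

text \<open>
  For a Dirichlet character \<open>g\<close> let \<open>A\<^sub>g(s) = \<Sum> g(n) 1\<^sub>E(n) n\<^sup>-\<^sup>s\<close>. The two squares theorem gives
  \<open>A\<^sub>g(s)\<^sup>2 = L(s, g) L(s, g \<chi>\<^sub>4) H\<^sub>g(s)\<close> with \<open>H\<^sub>g\<close> holomorphic and bounded away from zero on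
  \<open>Re s > 3/4\<close>. Hence \<open>A\<^sub>g\<close> extends smoothly to the line \<open>Re s = 1\<close>, except for a factor \<open>(s - 1)\<^bsup>-1/2\<^esup>\<close>
  when \<open>g\<close> is principal, and the 3-4-1 inequality shows that all its derivatives grow there more slowly
  than any power of \<open>|Im s|\<close>. Instead of a contour shift into a zero-free region, the \<open>k\<close>-th derivative of
  \<open>A\<^sub>g(s) / (s (s + 1))\<close> is compared with explicit powers of \<open>s - 1\<close>: the difference is dominated on
  \<open>Re s > 1\<close> by an integrable function of \<open>Im s\<close>, and Fourier inversion at \<open>Re s = 1 + 1/X\<close>, with
  \<open>X = log x\<close>, turns \<open>k\<close> derivatives into a saving of \<open>(log x)\<^sup>-\<^sup>k\<close> for a smoothed sum; unsmoothing
  costs half of it.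
  For nonprincipal \<open>g\<close> modulo \<open>q\<close> there is no main term. So the classes prime to \<open>q\<close> share equally the
  numbers in \<open>E\<close> prime to \<open>q\<close>, counted by \<open>countE x - countE (x / q)\<close>, while the class of \<open>0\<close> contributes
  \<open>countE (x / q)\<close> because \<open>q n \<in> E \<longleftrightarrow> n \<in> E\<close>. Expanding \<open>(log x - log q)\<^sup>\<beta>\<close> gives the coefficients.
\<close>

section \<open>Euler products and Dirichlet series\<close>

text \<open>The square root in \<open>A_g\<close> is available without further work only where no
  L-function vanishes, and this holds trivially for \<open>Re s > 1\<close>. So \<open>A_g\<close>
  is estimated uniformly up to the line \<open>Re s = 1\<close> from the right; only in a small disc
  around 1 is it continued, and the nonvanishing of the L-functions at 1 supplies the holomorphic
  root there. The divisor \<open>s (s + 1)\<close> outweighs a growth of order 1/2, leaving the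
  integrable order -3/2 at infinity. Near 1, subtracting \<open>k\<close> powers from the
  \<open>k\<close>-th derivative leaves \<open>|s - 1|^(-1/2)\<close>, which is integrable in
  \<open>Im s\<close>. With \<open>k = 2 J + 4\<close>, half of the saving is \<open>J + 2\<close>,
  more than the \<open>J + 3/2\<close> required. The constant \<open>K\<close> arises as follows:
  \<open>(s - 1)^(1/2) A(s)\<close> tends to a number whose square is
  \<open>L(1, chi4) H(1) = (pi / 4) (4 K^2)\<close>, and its root \<open>sqrt pi * K\<close> loses
  the factor \<open>sqrt pi = Gamma(1/2)\<close> under the inverse Laplace transform. The number
  \<open>c_1\<close> is never evaluated. Uniqueness identifies it with the second coefficient of
  \<open>countE\<close>, and only its change under \<open>x -> x / q\<close> enters.\<close>

definition cmul :: "(nat \<Rightarrow> complex) \<Rightarrow> bool" where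
  "cmul f \<longleftrightarrow> f 0 = 0 \<and> f 1 = 1 \<and> (\<forall>a>0. \<forall>b>0. f (a * b) = f a * f b)"

lemma cmul_mult: "cmul f \<Longrightarrow> f (a * b) = f a * f b"
  unfolding cmul_def by (cases "a = 0"; cases "b = 0") auto

lemma cmul_power: "cmul f \<Longrightarrow> f (a ^ k) = f a ^ k"
  by (induction k) (auto simp: cmul_mult, auto simp: cmul_def)

text \<open>Sieve of Eratosthenes: among the numbers free of the primes in \<open>P\<close>, the
  multiples of a further prime \<open>p\<close> are exactly \<open>p\<close> times that same set.
  They carry the share \<open>f p\<close> of the sum, so removing them multiplies it by
  \<open>1 - f p\<close>.\<close>

lemma sieve_infsum:
  assumes "cmul f" "f summable_on UNIV" "finite P" "\<And>p. p \<in> P \<Longrightarrow> prime p"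
  shows "(\<Prod>p\<in>P. 1 - f p) * infsum f UNIV = infsum f {n. \<forall>p\<in>P. \<not> p dvd n}"
  using assms(3,4)
proof (induction P rule: finite_induct)
  case empty
  then show ?case by simp
next
  case (insert p P)
  define C where "C = {n. \<forall>r\<in>P. \<not> r dvd n}"
  define C' where "C' = {n. \<forall>r\<in>insert p P. \<not> r dvd n}"
  have p: "prime p" using insert by auto
  have dv: "r dvd k" if "r \<in> P" "r dvd p * k" for r k
  proof -
    have "prime r" "r \<noteq> p" using insert that by auto
    thus ?thesis using that p by (metis prime_dvd_multD prime_nat_iff primes_dvd_imp_eq)
  qed
  have C: "C = (*) p ` C \<union> C'"
  proof (rule Set.set_eqI, rule iffI)
    fix n assume n: "n \<in> C"
    show "n \<in> (*) p ` C \<union> C'"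
    proof (cases "p dvd n")
      case True
      then obtain k where k: "n = p * k" by (elim dvdE)
      hence "k \<in> C" using n unfolding C_def by auto
      thus ?thesis using k by auto
    qed (use n in \<open>auto simp: C_def C'_def\<close>)
  next
    fix n assume n: "n \<in> (*) p ` C \<union> C'"
    thus "n \<in> C" using dv unfolding C_def C'_def by blast
  qed
  have disj: "(*) p ` C \<inter> C' = {}"
    unfolding C'_def by auto
  have sm: "f summable_on X" for X
    using assms(2) summable_on_subset_banach by blast
  have "infsum f C = infsum f ((*) p ` C) + infsum f C'"
    using infsum_Un_disjoint[OF sm sm disj, folded C] .
  also have "infsum f ((*) p ` C) = infsum (f \<circ> (*) p) C"
    by (rule infsum_reindex) (use prime_gt_0_nat[OF p] in \<open>simp add: inj_on_def\<close>)
  also have "\<dots> = f p * infsum f C"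
    unfolding o_def cmul_mult[OF assms(1)] by (rule infsum_cmult_right')
  finally have e: "infsum f C = f p * infsum f C + infsum f C'" .
  have "infsum f C' = (1 - f p) * infsum f C"
    by (subst left_diff_distrib, subst mult_1_left, subst eq_diff_eq, subst add.commute, rule e[symmetric])
  moreover have "(\<Prod>p\<in>P. 1 - f p) * infsum f UNIV = infsum f C"
    unfolding C_def using insert by auto
  ultimately show ?case
    using insert.hyps by (simp add: C'_def mult.assoc)
qed

text \<open>After sieving by all primes up to \<open>N\<close> only 1 and numbers above
  \<open>N\<close> survive, so product times sum tends to 1. This limit also rules out that the sum
  is 0.\<close>

lemma
  assumes cm: "cmul f" and sum: "summable (\<lambda>n. norm (f n))"
  shows euler_product: "(\<lambda>N. \<Prod>p | prime p \<and> p \<le> N. 1 - f p) \<longlonglongrightarrow> 1 / suminf f"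
    and euler_product_nonzero: "suminf f \<noteq> 0"
proof -
  define Z where "Z = suminf f"
  have so: "(\<lambda>n. norm (f n)) summable_on UNIV"
    using sum by (subst summable_on_UNIV_nonneg_real_iff) auto
  have so': "f summable_on UNIV"
    using so abs_summable_summable by blast
  have Z: "infsum f UNIV = Z"
    unfolding Z_def using so' by (simp add: has_sum_imp_sums sums_unique)
  define S where "S N = {n. \<forall>p\<in>{p. prime p \<and> p \<le> N}. \<not> p dvd n}" for N :: nat
  define Q where "Q N = (\<Prod>p | prime p \<and> p \<le> N. 1 - f p)" for N :: nat
  have fin: "finite {p. prime p \<and> p \<le> N}" for N :: nat by simp
  have QZ: "Q N * Z = infsum f (S N)" for N
    using sieve_infsum[OF cm so' fin] unfolding Q_def S_def Z by auto
  \<comment> \<open>For \<open>N \<ge> 2\<close> the prime 2 takes part in the sieve and removes the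
    number 0, which every prime divides.\<close>
  have bound: "norm (infsum f (S N) - 1) \<le> (\<Sum>n. norm (f (n + Suc N)))" if "N \<ge> 2" for N
  proof -
    have 1: "1 \<in> S N" unfolding S_def using prime_nat_iff by auto
    have sub: "S N - {1} \<subseteq> {Suc N..}"
    proof
      fix n assume n: "n \<in> S N - {1}"
      then obtain p where p: "prime p" "p dvd n" using prime_factor_nat[of n] by auto
      with n have "p > N" unfolding S_def by auto
      moreover have "n \<noteq> 0" using n that unfolding S_def using two_is_prime_nat by force
      ultimately show "n \<in> {Suc N..}" using p dvd_imp_le[of p n] by auto
    qed
    have sm: "f summable_on X" for X using so' summable_on_subset_banach by blast
    have smn: "(\<lambda>n. norm (f n)) summable_on X" for X using so summable_on_subset_banach by blast
    have "infsum f (S N) = infsum f {1} + infsum f (S N - {1})"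
      using infsum_Un_disjoint[OF sm[of "{1}"] sm[of "S N - {1}"]] 1 by (simp add: insert_absorb)
    hence "infsum f (S N) - 1 = infsum f (S N - {1})"
      using cm by (simp add: cmul_def)
    also have "norm \<dots> \<le> infsum (\<lambda>n. norm (f n)) (S N - {1})"
      by (rule norm_infsum_bound[OF smn])
    also have "\<dots> \<le> infsum (\<lambda>n. norm (f n)) {Suc N..}"
      by (rule infsum_mono_neutral[OF smn smn]) (use sub in auto)
    also have "{Suc N..} = (\<lambda>n. n + Suc N) ` UNIV"
      by (auto simp: image_iff) (metis add.commute le_Suc_ex add_Suc_right add_Suc)
    also have "infsum (\<lambda>n. norm (f n)) \<dots> = infsum (\<lambda>n. norm (f (n + Suc N))) UNIV"
      by (subst infsum_reindex) (auto simp: inj_on_def o_def)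
    also have "\<dots> = (\<Sum>n. norm (f (n + Suc N)))"
    proof -
      have "(\<lambda>n. norm (f (n + Suc N))) summable_on UNIV"
        using summable_ignore_initial_segment[OF sum, of "Suc N"] by (subst summable_on_UNIV_nonneg_real_iff) auto
      thus ?thesis by (simp add: has_sum_imp_sums sums_unique)
    qed
    finally show ?thesis .
  qed
  have tail: "(\<lambda>N. \<Sum>n. norm (f (n + Suc N))) \<longlonglongrightarrow> 0"
    using filterlim_compose[OF suminf_exist_split2[OF sum] filterlim_Suc] by simp
  have "(\<lambda>N. infsum f (S N) - 1) \<longlonglongrightarrow> 0"
    by (rule Lim_null_comparison[OF _ tail]) (use bound in \<open>auto intro!: eventually_sequentiallyI[of 2]\<close>)
  hence lim: "(\<lambda>N. Q N * Z) \<longlonglongrightarrow> 1"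
    unfolding QZ using LIM_zero_iff by blast
  have "Z \<noteq> 0"
  proof
    assume "Z = 0"
    with lim have "(\<lambda>_. 0::complex) \<longlonglongrightarrow> 1" by simp
    thus False by (simp add: LIMSEQ_const_iff)
  qed
  thus "suminf f \<noteq> 0" unfolding Z_def .
  have "(\<lambda>N. Q N * Z / Z) \<longlonglongrightarrow> 1 / Z"
    using \<open>Z \<noteq> 0\<close> by (intro tendsto_divide lim tendsto_const)
  thus "(\<lambda>N. \<Prod>p | prime p \<and> p \<le> N. 1 - f p) \<longlonglongrightarrow> 1 / suminf f"
    unfolding Q_def[symmetric] Z_def[symmetric] using \<open>Z \<noteq> 0\<close> by simp
qed

text \<open>Each factor satisfies \<open>norm (1 - f p) \<le> exp (norm (f p))\<close>, and the
  products converge to the reciprocal of the sum. The bound depends only on the absolute sum, which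
  makes it uniform in \<open>s\<close> when applied to Dirichlet series.\<close>

lemma euler_product_lower_bound:
  assumes cm: "cmul f" and sum: "summable (\<lambda>n. norm (f n))"
  shows "norm (suminf f) \<ge> exp (- (\<Sum>n. norm (f n)))"
proof -
  define B where "B = (\<Sum>n. norm (f n))"
  have "norm (\<Prod>p | prime p \<and> p \<le> N. 1 - f p) \<le> exp B" for N
  proof -
    have "norm (\<Prod>p | prime p \<and> p \<le> N. 1 - f p) = (\<Prod>p | prime p \<and> p \<le> N. norm (1 - f p))"
      by (simp add: prod_norm)
    also have "\<dots> \<le> (\<Prod>p | prime p \<and> p \<le> N. exp (norm (f p)))"
    proof (rule prod_mono)
      fix p assume "p \<in> {p. prime p \<and> p \<le> N}"
      have "norm (1 - f p) \<le> 1 + norm (f p)" using norm_triangle_ineq4[of 1 "f p"] by simp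
      also have "\<dots> \<le> exp (norm (f p))" by (rule exp_ge_add_one_self)
      finally show "0 \<le> norm (1 - f p) \<and> norm (1 - f p) \<le> exp (norm (f p))" by simp
    qed
    also have "\<dots> = exp (\<Sum>p | prime p \<and> p \<le> N. norm (f p))" by (simp add: exp_sum)
    also have "(\<Sum>p | prime p \<and> p \<le> N. norm (f p)) \<le> B"
      unfolding B_def by (rule sum_le_suminf[OF sum]) auto
    finally show ?thesis by simp
  qed
  hence "norm (1 / suminf f) \<le> exp B"
    by (intro LIMSEQ_le_const2[OF tendsto_norm[OF euler_product[OF cm sum]]]) auto
  thus ?thesis using euler_product_nonzero[OF cm sum]
    unfolding B_def[symmetric] by (simp add: norm_divide exp_minus field_simps)
qed

text \<open>Expanding \<open>- ln (norm (1 - w))\<close> as the real part of the sum of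
  \<open>w ^ n / n\<close> reduces the claim termwise to
  \<open>3 + 4 Re v + Re (v^2) \<ge> 2 (1 + Re v)^2\<close> for \<open>norm v \<le> 1\<close>.
  Allowing \<open>norm z < 1\<close> covers the primes at which a character vanishes.\<close>

lemma three_four_one_factor:
  fixes z :: complex and r :: real
  assumes "0 \<le> r" "r < 1" "norm z \<le> 1"
  shows "norm ((1 - of_real r) ^ 3 * (1 - of_real r * z) ^ 4 * (1 - of_real r * z\<^sup>2)) \<le> 1"
proof -
  have L: "(\<lambda>n. Re (w ^ n) / real n) sums (- ln (norm (1 - w)))" and nz: "1 - w \<noteq> 0" if "norm w < 1" for w :: complex
  proof -
    show nz: "1 - w \<noteq> 0" using that by auto
    have "(\<lambda>n. (-1)^Suc n / of_nat n * (- w)^n) sums ln (1 + - w)"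
      using Ln_series[of "- w"] that by simp
    hence "(\<lambda>n. Re ((-1)^Suc n / of_nat n * (- w)^n)) sums Re (ln (1 + - w))" by (rule sums_Re)
    hence "(\<lambda>n. - Re ((-1)^Suc n / of_nat n * (- w)^n)) sums (- Re (ln (1 + - w)))" by (rule sums_minus)
    moreover have "- Re ((-1)^Suc n / of_nat n * (- w)^n) = Re (w ^ n) / real n" for n
    proof -
      have "(-1)^Suc n / of_nat n * (- w)^n = - (w ^ n / of_nat n)"
        using power_mult_distrib[of "-1" "- w" n] by (simp add: mult.assoc)
      thus ?thesis by (simp only: uminus_complex.sel Re_divide_of_nat minus_minus)
    qed
    ultimately show "(\<lambda>n. Re (w ^ n) / real n) sums (- ln (norm (1 - w)))"
      using Re_Ln[OF nz] by (simp only: add_uminus_conv_diff)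
  qed
  have n1: "norm (complex_of_real r) < 1" using assms by simp
  have n2: "norm (of_real r * z) < 1" using assms
    using mult_left_le[of "norm z" r] by (simp add: norm_mult)
  have n3: "norm (of_real r * z\<^sup>2) < 1" using assms
    using mult_left_le[of "norm z ^ 2" r] power_le_one[of "norm z" 2] by (simp add: norm_mult norm_power)
  have S: "(\<lambda>n. 3 * (Re (of_real r ^ n) / real n) + 4 * (Re ((of_real r * z) ^ n) / real n) + Re ((of_real r * z\<^sup>2) ^ n) / real n)
     sums (3 * (- ln (norm (1 - complex_of_real r))) + 4 * (- ln (norm (1 - of_real r * z))) + (- ln (norm (1 - of_real r * z\<^sup>2))))"
    by (intro sums_add sums_mult L n1 n2 n3)
  have nn: "3 * (Re (of_real r ^ n) / real n) + 4 * (Re ((of_real r * z) ^ n) / real n) + Re ((of_real r * z\<^sup>2) ^ n) / real n \<ge> 0" for n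
  proof -
    define v where "v = z ^ n"
    have v: "norm v \<le> 1" unfolding v_def using assms by (simp add: norm_power power_le_one)
    have "(Re v)\<^sup>2 + (Im v)\<^sup>2 \<le> 1" using v by (metis cmod_power2 norm_ge_zero power_le_one)
    hence "Re (v\<^sup>2) \<ge> 2 * (Re v)\<^sup>2 - 1" by (simp add: power2_eq_square)
    moreover have "2 * (1 + Re v)\<^sup>2 \<ge> 0" by simp
    ultimately have "3 + 4 * Re v + Re (v\<^sup>2) \<ge> 0" by (simp add: power2_eq_square algebra_simps)
    hence "r ^ n * (3 + 4 * Re v + Re (v\<^sup>2)) / real n \<ge> 0" using assms by simp
    moreover have e1: "Re (of_real r ^ n) = r ^ n" by (metis Re_complex_of_real of_real_power)
    moreover have e2: "Re ((of_real r * z) ^ n) = r ^ n * Re v"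
      unfolding v_def by (simp add: power_mult_distrib flip: of_real_power)
    moreover have e3: "Re ((of_real r * z\<^sup>2) ^ n) = r ^ n * Re (v\<^sup>2)"
      unfolding v_def by (simp add: power_mult_distrib mult.commute flip: of_real_power power_mult)
    ultimately show ?thesis
      unfolding e1 e2 e3 by (simp only: distrib_left add_divide_distrib) (simp only: ac_simps times_divide_eq_right)
  qed
  have "3 * (- ln (norm (1 - complex_of_real r))) + 4 * (- ln (norm (1 - of_real r * z))) + (- ln (norm (1 - of_real r * z\<^sup>2))) \<ge> 0"
    by (rule sums_le[OF _ sums_zero S]) (rule nn)
  moreover have "ln (norm ((1 - of_real r) ^ 3 * (1 - of_real r * z) ^ 4 * (1 - of_real r * z\<^sup>2)))
    = 3 * ln (norm (1 - complex_of_real r)) + 4 * ln (norm (1 - of_real r * z)) + ln (norm (1 - of_real r * z\<^sup>2))"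
    using nz[OF n1] nz[OF n2] nz[OF n3] by (simp add: norm_mult norm_power ln_mult ln_realpow)
  ultimately have "ln (norm ((1 - of_real r) ^ 3 * (1 - of_real r * z) ^ 4 * (1 - of_real r * z\<^sup>2))) \<le> 0" by linarith
  thus ?thesis using nz[OF n1] nz[OF n2] nz[OF n3] by (subst (asm) ln_le_zero_iff) auto
qed

lemma three_four_one:
  assumes "cmul f" "summable (\<lambda>n. norm (f n))" "cmul g" "summable (\<lambda>n. norm (g n))"
    "cmul h" "summable (\<lambda>n. norm (h n))"
    and loc: "\<And>p. prime p \<Longrightarrow> \<exists>r z. 0 \<le> r \<and> r < 1 \<and> norm z \<le> 1 \<and> f p = of_real r \<and> g p = of_real r * z \<and> h p = of_real r * z\<^sup>2"
  shows "norm (suminf f) ^ 3 * norm (suminf g) ^ 4 * norm (suminf h) \<ge> 1"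
proof -
  let ?P = "\<lambda>f N. \<Prod>p | prime p \<and> p \<le> N. 1 - f p"
  have "norm ((?P f N) ^ 3 * (?P g N) ^ 4 * ?P h N) \<le> 1" for N :: nat
  proof -
    have "norm ((?P f N) ^ 3 * (?P g N) ^ 4 * ?P h N) = (\<Prod>p | prime p \<and> p \<le> N. norm ((1 - f p) ^ 3 * (1 - g p) ^ 4 * (1 - h p)))"
      by (simp add: prod_power_distrib prod_norm prod.distrib norm_mult)
    also have "\<dots> \<le> 1"
    proof (rule prod_le_1)
      fix p assume "p \<in> {p. prime p \<and> p \<le> N}"
      then show "0 \<le> norm ((1 - f p) ^ 3 * (1 - g p) ^ 4 * (1 - h p)) \<and> norm ((1 - f p) ^ 3 * (1 - g p) ^ 4 * (1 - h p)) \<le> 1"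
        using loc[of p] three_four_one_factor by auto
    qed
    finally show ?thesis .
  qed
  moreover have "(\<lambda>N. norm ((?P f N) ^ 3 * (?P g N) ^ 4 * ?P h N)) \<longlonglongrightarrow> norm ((1 / suminf f) ^ 3 * (1 / suminf g) ^ 4 * (1 / suminf h))"
    using assms by (intro tendsto_intros euler_product)
  ultimately have "norm ((1 / suminf f) ^ 3 * (1 / suminf g) ^ 4 * (1 / suminf h)) \<le> 1"
    by (intro LIMSEQ_le_const2) auto
  moreover have "suminf f \<noteq> 0" "suminf g \<noteq> 0" "suminf h \<noteq> 0" using assms euler_product_nonzero by auto
  ultimately show ?thesis by (simp add: norm_mult norm_divide norm_power field_simps)
qed

text \<open>The index 0 contributes nothing because \<open>0 powr z = 0\<close>, so this is the
  usual series from 1 on.\<close>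

definition dser :: "(nat \<Rightarrow> complex) \<Rightarrow> complex \<Rightarrow> complex" where
  "dser c s = (\<Sum>n. c n * of_nat n powr (- s))"

definition tame :: "(nat \<Rightarrow> complex) \<Rightarrow> bool" where
  "tame c \<longleftrightarrow> (\<forall>e>0. \<exists>B. \<forall>n. norm (c n) \<le> B * (1 + real n) powr e)"

lemma norm_nat_powr: "norm (of_nat n powr (- s) :: complex) = real n powr (- Re s)"
  by (subst norm_powr_real_powr) auto

lemma tame_bounded:
  assumes "\<And>n. norm (c n) \<le> B"
  shows "tame c"
  unfolding tame_def
proof (intro allI impI exI)
  fix e :: real and n :: nat assume e: "e > 0"
  have "0 \<le> B" using assms[of 0] norm_ge_zero order_trans by blast
  moreover have "(1 + real n) powr e \<ge> 1" using e by (simp add: ge_one_powr_ge_zero)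
  ultimately have "B * 1 \<le> B * (1 + real n) powr e" by (intro mult_left_mono) auto
  thus "norm (c n) \<le> B * (1 + real n) powr e" using assms[of n] by linarith
qed

lemma tame_summable_real:
  assumes "tame c" "\<sigma> > 1"
  shows "summable (\<lambda>n. norm (c n) * real n powr (- \<sigma>))"
proof -
  define e where "e = (\<sigma> - 1) / 2"
  have e: "e > 0" using assms by (simp add: e_def)
  then obtain B where B: "\<And>n. norm (c n) \<le> B * (1 + real n) powr e"
    using assms unfolding tame_def by meson
  have B0: "0 \<le> B" using order_trans[OF norm_ge_zero B[of 0]] by simp
  show ?thesis
  proof (rule summable_comparison_test')
    show "summable (\<lambda>n. B * 2 powr e * real n powr (e - \<sigma>))"
      using assms by (intro summable_mult) (simp add: summable_real_powr_iff e_def field_simps)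
    fix n :: nat assume "n \<ge> 1"
    have "norm (c n) \<le> B * (2 * real n) powr e"
    proof -
      have "(1 + real n) powr e \<le> (2 * real n) powr e" using e \<open>n \<ge> 1\<close> by (intro powr_mono2) auto
      thus ?thesis using B[of n] mult_left_mono[OF _ B0] order_trans by blast
    qed
    also have "\<dots> = B * 2 powr e * real n powr e" by (simp add: powr_mult)
    finally have "norm (c n) * real n powr (- \<sigma>) \<le> B * 2 powr e * real n powr e * real n powr (- \<sigma>)"
      by (intro mult_right_mono) auto
    also have "\<dots> = B * 2 powr e * real n powr (e - \<sigma>)"
      by (simp add: powr_add[symmetric] mult.assoc)
    finally show "norm (norm (c n) * real n powr (- \<sigma>)) \<le> B * 2 powr e * real n powr (e - \<sigma>)"
      by simp
  qed
qed

lemma tame_summable: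
  assumes "tame c" "Re s > 1"
  shows "summable (\<lambda>n. norm (c n * of_nat n powr (- s)))"
  using tame_summable_real[OF assms] by (simp add: norm_mult norm_nat_powr)

lemma dser_has_field_derivative:
  assumes "tame c" "Re s > 1"
  shows "(dser c has_field_derivative dser (\<lambda>n. - of_real (ln (real n)) * c n) s) (at s)"
proof -
  define S where "S = {s. Re s > 1}"
  have S: "open S" unfolding S_def by (rule open_halfspace_Re_gt)
  define f where "f n s = c n * of_nat n powr (- s)" for n and s :: complex
  define f' where "f' n s = (- of_real (ln (real n)) * c n) * of_nat n powr (- s)" for n and s :: complex
  have D: "(f n has_field_derivative f' n x) (at x)" for n x
  proof (cases "n = 0")
    case False
    hence "((\<lambda>z. of_nat n powr (- z)) has_field_derivative (Ln (of_nat n) * of_nat n powr (- x)) * (- 1)) (at x)"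
      by (intro DERIV_chain2[OF has_field_derivative_powr_right]) (auto intro!: derivative_eq_intros)
    from DERIV_cmult[OF this, of "c n"] show ?thesis unfolding f_def f'_def
      using False by (simp add: Ln_of_nat algebra_simps)
  qed (simp add: f_def[abs_def] f'_def)
  have "\<exists>g g'. \<forall>x \<in> S. ((\<lambda>n. f n x) sums g x) \<and> ((\<lambda>n. f' n x) sums g' x) \<and> (g has_field_derivative g' x) (at x)"
  proof (rule series_and_derivative_comparison_local[OF S D])
    fix x assume x: "x \<in> S"
    define d where "d = (Re x - 1) / 2"
    have d: "d > 0" using x by (simp add: d_def S_def)
    show "\<exists>d h. 0 < d \<and> summable h \<and> (\<forall>\<^sub>F n in sequentially. \<forall>y\<in>ball x d \<inter> S. norm (f n y) \<le> h n)"
    proof (intro exI conjI)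
      show "summable (\<lambda>n. norm (c n) * real n powr (- (1 + d)))"
        using d by (intro tame_summable_real assms) auto
      show "\<forall>\<^sub>F n in sequentially. \<forall>y\<in>ball x d \<inter> S. norm (f n y) \<le> norm (c n) * real n powr (- (1 + d))"
      proof (intro always_eventually allI ballI)
        fix n y assume y: "y \<in> ball x d \<inter> S"
        have "\<bar>Re x - Re y\<bar> \<le> norm (x - y)" using abs_Re_le_cmod[of "x - y"] by simp
        hence "Re y \<ge> 1 + d" using y by (auto simp: dist_norm d_def field_simps)
        hence "real n powr (- Re y) \<le> real n powr (- (1 + d))"
          by (cases "n = 0") (auto intro!: powr_mono)
        thus "norm (f n y) \<le> norm (c n) * real n powr (- (1 + d))"
          unfolding f_def norm_mult norm_nat_powr by (intro mult_left_mono) auto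
      qed
    qed (use d in auto)
  qed
  then obtain g g' where g: "\<And>x. x \<in> S \<Longrightarrow> (\<lambda>n. f n x) sums g x"
    "\<And>x. x \<in> S \<Longrightarrow> (\<lambda>n. f' n x) sums g' x" "\<And>x. x \<in> S \<Longrightarrow> (g has_field_derivative g' x) (at x)" by metis
  have s: "s \<in> S" using assms by (simp add: S_def)
  have g': "g' s = dser (\<lambda>n. - of_real (ln (real n)) * c n) s"
    using g(2)[OF s] unfolding f'_def dser_def by (simp add: sums_iff)
  have "g x = dser c x" if "x \<in> S" for x
    using g(1)[OF that] unfolding f_def dser_def by (simp add: sums_iff)
  from has_field_derivative_transform_within_open[OF g(3)[OF s] S s this] show ?thesis
    unfolding g' .
qed

lemma dser_holomorphic: "tame c \<Longrightarrow> dser c holomorphic_on {s. Re s > 1}"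
  unfolding holomorphic_on_open[OF open_halfspace_Re_gt]
  using dser_has_field_derivative by blast

section \<open>Holomorphic functions of subpolynomial growth\<close>

text \<open>The cut at order \<open>k\<close> permits bootstrapping: if the derivative of a function
  is expressed through the function itself, order \<open>k\<close> yields order
  \<open>Suc k\<close>. The constant may depend on \<open>j\<close> and \<open>e\<close> but not on
  the point, so the bounds are uniform up to the boundary of \<open>S\<close>.\<close>

definition slow_upto :: "nat \<Rightarrow> complex set \<Rightarrow> (complex \<Rightarrow> complex) \<Rightarrow> bool" where
  "slow_upto k S f \<longleftrightarrow> f holomorphic_on S \<and>
     (\<forall>j\<le>k. \<forall>e>0. \<exists>C. \<forall>s\<in>S. norm ((deriv ^^ j) f s) \<le> C * (1 + \<bar>Im s\<bar>) powr e)"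

definition slow :: "complex set \<Rightarrow> (complex \<Rightarrow> complex) \<Rightarrow> bool" where
  "slow S f \<longleftrightarrow> (\<forall>k. slow_upto k S f)"

lemma slow_imp_upto: "slow S f \<Longrightarrow> slow_upto k S f"
  by (simp add: slow_def)

lemma slow_upto_mult:
  assumes "open S" "slow_upto k S f" "slow_upto k S g"
  shows "slow_upto k S (\<lambda>s. f s * g s)"
  unfolding slow_upto_def
proof (intro conjI allI impI)
  have hol: "f holomorphic_on S" "g holomorphic_on S" using assms by (auto simp: slow_upto_def)
  thus "(\<lambda>s. f s * g s) holomorphic_on S" by (intro holomorphic_intros)
  fix j and e :: real assume j: "j \<le> k" and e: "e > 0"
  \<comment> \<open>Each factor receives half of the exponent, so that the products in Leibniz's
    rule stay within \<open>e\<close>.\<close>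
  have "\<forall>i\<in>{..k}. \<exists>C. \<forall>s\<in>S. norm ((deriv ^^ i) f s) \<le> C * (1 + \<bar>Im s\<bar>) powr (e/2)"
    using assms(2) e unfolding slow_upto_def by auto
  then obtain A where A: "\<And>i s. i \<le> k \<Longrightarrow> s \<in> S \<Longrightarrow> norm ((deriv ^^ i) f s) \<le> A i * (1 + \<bar>Im s\<bar>) powr (e/2)"
    by (metis atMost_iff)
  have "\<forall>i\<in>{..k}. \<exists>C. \<forall>s\<in>S. norm ((deriv ^^ i) g s) \<le> C * (1 + \<bar>Im s\<bar>) powr (e/2)"
    using assms(3) e unfolding slow_upto_def by auto
  then obtain B where B: "\<And>i s. i \<le> k \<Longrightarrow> s \<in> S \<Longrightarrow> norm ((deriv ^^ i) g s) \<le> B i * (1 + \<bar>Im s\<bar>) powr (e/2)"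
    by (metis atMost_iff)
  show "\<exists>C. \<forall>s\<in>S. norm ((deriv ^^ j) (\<lambda>s. f s * g s) s) \<le> C * (1 + \<bar>Im s\<bar>) powr e"
  proof (intro exI ballI)
    fix s assume s: "s \<in> S"
    define X where "X = (1 + \<bar>Im s\<bar>) powr (e/2)"
    have X: "X > 0" unfolding X_def by simp
    have XX: "X * X = (1 + \<bar>Im s\<bar>) powr e" unfolding X_def by (simp flip: powr_add)
    have "norm ((deriv ^^ j) (\<lambda>s. f s * g s) s)
        = norm (\<Sum>i = 0..j. of_nat (j choose i) * (deriv ^^ i) f s * (deriv ^^ (j-i)) g s)"
      by (subst higher_deriv_mult[OF hol assms(1) s]) simp
    also have "\<dots> \<le> (\<Sum>i = 0..j. norm (of_nat (j choose i) * (deriv ^^ i) f s * (deriv ^^ (j-i)) g s))"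
      by (rule norm_sum)
    also have "\<dots> \<le> (\<Sum>i = 0..j. (real (j choose i) * A i * B (j-i)) * (X * X))"
    proof (rule sum_mono)
      fix i assume i: "i \<in> {0..j}"
      have a: "norm ((deriv ^^ i) f s) \<le> A i * X" using A[of i s] i j s by (auto simp: X_def)
      have b: "norm ((deriv ^^ (j-i)) g s) \<le> B (j-i) * X" using B[of "j-i" s] i j s by (auto simp: X_def)
      have "norm ((deriv ^^ i) f s) * norm ((deriv ^^ (j-i)) g s) \<le> (A i * X) * (B (j-i) * X)"
        using a b by (intro mult_mono) (auto intro: order_trans[OF norm_ge_zero])
      hence "real (j choose i) * (norm ((deriv ^^ i) f s) * norm ((deriv ^^ (j-i)) g s)) \<le> real (j choose i) * ((A i * X) * (B (j-i) * X))"
        by (intro mult_left_mono) auto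
      thus "norm (of_nat (j choose i) * (deriv ^^ i) f s * (deriv ^^ (j-i)) g s) \<le> (real (j choose i) * A i * B (j-i)) * (X * X)"
        by (simp add: norm_mult algebra_simps)
    qed
    also have "\<dots> = (\<Sum>i = 0..j. real (j choose i) * A i * B (j-i)) * (1 + \<bar>Im s\<bar>) powr e"
      unfolding XX by (simp add: sum_distrib_right)
    finally show "norm ((deriv ^^ j) (\<lambda>s. f s * g s) s) \<le> (\<Sum>i = 0..j. real (j choose i) * A i * B (j-i)) * (1 + \<bar>Im s\<bar>) powr e" .
  qed
qed

lemma slow_mult: "open S \<Longrightarrow> slow S f \<Longrightarrow> slow S g \<Longrightarrow> slow S (\<lambda>s. f s * g s)"
  unfolding slow_def using slow_upto_mult by blast

lemma slow_const: "slow S (\<lambda>s. c)"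
  unfolding slow_def slow_upto_def
proof (intro allI impI conjI)
  fix k j :: nat and e :: real assume e: "e > 0"
  show "\<exists>C. \<forall>s\<in>S. norm ((deriv ^^ j) (\<lambda>s. c) s) \<le> C * (1 + \<bar>Im s\<bar>) powr e"
  proof (intro exI[of _ "norm c"] ballI)
    fix s assume "s \<in> S"
    have "(1 + \<bar>Im s\<bar>) powr e \<ge> 1" using e by (simp add: ge_one_powr_ge_zero)
    hence "norm c * 1 \<le> norm c * (1 + \<bar>Im s\<bar>) powr e" by (intro mult_left_mono) auto
    thus "norm ((deriv ^^ j) (\<lambda>s. c) s) \<le> norm c * (1 + \<bar>Im s\<bar>) powr e" by (auto intro: order_trans[rotated])
  qed
qed auto

lemma slow_upto_Suc:
  assumes S: "open S" and f: "f holomorphic_on S" and 0: "slow_upto 0 S f" and g: "slow_upto k S g"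
    and eq: "\<And>s. s \<in> S \<Longrightarrow> deriv f s = g s"
  shows "slow_upto (Suc k) S f"
  unfolding slow_upto_def
proof (intro conjI allI impI f)
  fix j and e :: real assume j: "j \<le> Suc k" and e: "e > 0"
  show "\<exists>C. \<forall>s\<in>S. norm ((deriv ^^ j) f s) \<le> C * (1 + \<bar>Im s\<bar>) powr e"
  proof (cases j)
    case 0
    thus ?thesis using assms(3) e unfolding slow_upto_def by auto
  next
    case (Suc i)
    have "(deriv ^^ j) f s = (deriv ^^ i) g s" if "s \<in> S" for s
    proof -
      have "(deriv ^^ j) f s = (deriv ^^ i) (deriv f) s" unfolding Suc by (simp only: funpow_Suc_right o_apply)
      also have "\<dots> = (deriv ^^ i) g s"
        using g that by (intro higher_deriv_transform_within_open[OF _ _ S] holomorphic_deriv f S eq)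
           (auto simp: slow_upto_def)
      finally show ?thesis .
    qed
    thus ?thesis using g e j Suc unfolding slow_upto_def by auto
  qed
qed

lemma slow_deriv:
  assumes "open S" "slow S f" shows "slow S (deriv f)"
  unfolding slow_def slow_upto_def
proof (intro conjI allI impI)
  have hol: "f holomorphic_on S" using assms by (auto simp: slow_def slow_upto_def)
  thus "deriv f holomorphic_on S" using assms by (intro holomorphic_deriv)
  fix k j :: nat and e :: real assume "e > 0"
  thus "\<exists>C. \<forall>s\<in>S. norm ((deriv ^^ j) (deriv f) s) \<le> C * (1 + \<bar>Im s\<bar>) powr e"
    using assms(2)[unfolded slow_def slow_upto_def, rule_format, of "Suc j"]
    by (metis comp_apply funpow_Suc_right order_refl)
qed

text \<open>From \<open>f' = f g\<close>, control of \<open>f\<close> up to order \<open>k\<close>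
  controls \<open>f'\<close> up to order \<open>k\<close>. Only the size of \<open>f\<close> itself
  must be known beforehand, which suits a function given through its square.\<close>

lemma slow_of_logderiv:
  assumes S: "open S" and f: "f holomorphic_on S" and 0: "slow_upto 0 S f" and g: "slow S g"
    and eq: "\<And>s. s \<in> S \<Longrightarrow> deriv f s = f s * g s"
  shows "slow S f"
proof -
  have "slow_upto k S f" for k
  proof (induction k)
    case (Suc k)
    show ?case
      by (rule slow_upto_Suc[OF S f 0 slow_upto_mult[OF S Suc slow_imp_upto[OF g]] eq])
  qed (rule 0)
  thus ?thesis by (simp add: slow_def)
qed

text \<open>Bootstrapping with \<open>(1/f)' = - f' / f^2\<close>: once \<open>1/f\<close> is known
  to be of subpolynomial size, all its derivatives follow.\<close>

lemma slow_inverse: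
  assumes S: "open S" and f: "slow S f" and nz: "\<And>s. s \<in> S \<Longrightarrow> f s \<noteq> 0"
    and lower: "\<And>e. e > 0 \<Longrightarrow> \<exists>C. \<forall>s\<in>S. norm (inverse (f s)) \<le> C * (1 + \<bar>Im s\<bar>) powr e"
  shows "slow S (\<lambda>s. inverse (f s))"
proof -
  have hol: "f holomorphic_on S" using f by (auto simp: slow_def slow_upto_def)
  have hol': "(\<lambda>s. inverse (f s)) holomorphic_on S" using hol nz by (intro holomorphic_intros)
  have 0: "slow_upto 0 S (\<lambda>s. inverse (f s))"
    using lower hol' by (simp add: slow_upto_def)
  have "slow_upto k S (\<lambda>s. inverse (f s))" for k
  proof (induction k)
    case (Suc k)
    have "slow_upto k S (\<lambda>s. (-1) * ((inverse (f s) * inverse (f s)) * deriv f s))"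
      by (intro slow_upto_mult[OF S] slow_imp_upto[OF slow_const] Suc slow_imp_upto[OF slow_deriv[OF S f]])
    thus ?case
    proof (rule slow_upto_Suc[OF S hol' 0])
      fix s assume s: "s \<in> S"
      have "(f has_field_derivative deriv f s) (at s)" using hol S s by (simp add: holomorphic_derivI)
      from DERIV_inverse_fun[OF this nz[OF s]]
      show "deriv (\<lambda>s. inverse (f s)) s = (-1) * ((inverse (f s) * inverse (f s)) * deriv f s)"
        by (auto intro!: DERIV_imp_deriv simp: algebra_simps)
    qed
  qed (rule 0)
  thus ?thesis by (simp add: slow_def)
qed

lemma slow_cong:
  assumes S: "open S" and f: "slow S f" and eq: "\<And>s. s \<in> S \<Longrightarrow> g s = f s"
  shows "slow S g"
proof -
  have hol: "f holomorphic_on S" using f by (auto simp: slow_def slow_upto_def)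
  hence hol': "g holomorphic_on S" using eq by (metis holomorphic_cong)
  have "(deriv ^^ j) g s = (deriv ^^ j) f s" if "s \<in> S" for j s
    using higher_deriv_transform_within_open[OF hol' hol S that eq] .
  thus ?thesis using f hol' unfolding slow_def slow_upto_def by auto
qed

text \<open>Cauchy's inequality on discs whose radius may shrink with \<open>e\<close> but not with
  the point. A strip to the left of \<open>S\<close> whose width depends on the desired exponent
  therefore suffices.\<close>

lemma slow_Cauchy:
  assumes hol: "f holomorphic_on T" and ST: "open S" "S \<subseteq> T"
    and bound: "\<And>e. e > 0 \<Longrightarrow> \<exists>r>0. \<exists>C. \<forall>s\<in>S. cball s r \<subseteq> T \<and> (\<forall>z\<in>cball s r. norm (f z) \<le> C * (1 + \<bar>Im s\<bar>) powr e)"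
  shows "slow S f"
  unfolding slow_def slow_upto_def
proof (intro conjI allI impI)
  show "f holomorphic_on S" using hol ST holomorphic_on_subset by blast
  fix k j :: nat and e :: real assume "e > 0"
  then obtain r C where r: "r > 0" and C: "\<And>s z. s \<in> S \<Longrightarrow> cball s r \<subseteq> T"
    "\<And>s z. s \<in> S \<Longrightarrow> z \<in> cball s r \<Longrightarrow> norm (f z) \<le> C * (1 + \<bar>Im s\<bar>) powr e"
    using bound by meson
  show "\<exists>C. \<forall>s\<in>S. norm ((deriv ^^ j) f s) \<le> C * (1 + \<bar>Im s\<bar>) powr e"
  proof (intro exI ballI)
    fix s assume s: "s \<in> S"
    have "norm ((deriv ^^ j) f s) \<le> fact j * (C * (1 + \<bar>Im s\<bar>) powr e) / r ^ j"
    proof (rule Cauchy_inequality)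
      show "f holomorphic_on ball s r" using hol C(1)[OF s] holomorphic_on_subset ball_subset_cball by blast
      show "continuous_on (cball s r) f" using hol C(1)[OF s] holomorphic_on_subset holomorphic_on_imp_continuous_on by blast
      fix x assume "norm (s - x) = r"
      thus "norm (f x) \<le> C * (1 + \<bar>Im s\<bar>) powr e" using s by (intro C(2)) (auto simp: dist_norm)
    qed (rule r)
    thus "norm ((deriv ^^ j) f s) \<le> (fact j * C / r ^ j) * (1 + \<bar>Im s\<bar>) powr e" by (simp add: field_simps)
  qed
qed

section \<open>Sums of two squares\<close>

definition no3 :: "nat \<Rightarrow> bool" where
  "no3 n \<longleftrightarrow> n > 0 \<and> (\<forall>p. prime p \<longrightarrow> p dvd n \<longrightarrow> p mod 4 \<noteq> 3)"

definition only3 :: "nat \<Rightarrow> bool" where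
  "only3 n \<longleftrightarrow> n > 0 \<and> (\<forall>p. prime p \<longrightarrow> p dvd n \<longrightarrow> p mod 4 = 3)"

lemma sum_two_squares_mult:
  assumes "sum_two_squares m" "sum_two_squares n"
  shows "sum_two_squares (m * n)"
proof -
  from assms obtain a b c d :: int where "int m = a^2 + b^2" "int n = c^2 + d^2"
    unfolding sum_two_squares_def by blast
  hence "int (m * n) = (a * c - b * d)^2 + (a * d + b * c)^2"
    by (simp add: power2_eq_square algebra_simps)
  thus ?thesis unfolding sum_two_squares_def by blast
qed

text \<open>In Euler's criterion the exponent \<open>(p - 1) / 2\<close> is even, so the Legendre
  symbol of -1 is congruent to 1; as \<open>p > 2\<close>, it is not -1.\<close>

lemma minus_one_square_mod_prime:
  fixes p :: nat
  assumes p: "prime p" "p mod 4 = 1"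
  shows "\<exists>z::int. [z^2 = -1] (mod int p)"
proof -
  obtain k where k: "p = 4 * k + 1" using p by (metis mult_div_mod_eq)
  have "p \<noteq> 1" using p by auto
  hence "k > 0" using k by auto
  hence p5: "p \<ge> 5" using k by auto
  have "[Legendre (-1) (int p) = (-1) ^ ((nat (int p) - 1) div 2)] (mod int p)"
    using euler_criterion[of p "-1"] p p5 by simp
  moreover have "(nat (int p) - 1) div 2 = 2 * k" using k by simp
  ultimately have L: "[Legendre (-1) (int p) = 1] (mod int p)" by simp
  have "QuadRes (int p) (-1)"
  proof (rule ccontr)
    assume nq: "\<not> QuadRes (int p) (-1)"
    have "\<not> [-1 = 0] (mod int p)" using p5 by (auto simp: cong_iff_dvd_diff)
    hence "Legendre (-1) (int p) = -1" using nq by (simp add: Legendre_def)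
    hence "int p dvd (-1 - 1)" using L by (simp add: cong_iff_dvd_diff)
    hence "int p dvd 2" by simp
    thus False using p5 by (auto dest: zdvd_imp_le)
  qed
  thus ?thesis unfolding QuadRes_def .
qed

text \<open>Thue's pigeonhole argument. With \<open>z^2 = -1\<close> modulo \<open>p\<close> there
  are more than \<open>p\<close> pairs \<open>(i, j)\<close> with entries up to the integer part
  \<open>k\<close> of the root of \<open>p\<close>, so two of them agree in \<open>i + z j\<close>.
  Their difference \<open>(a, b)\<close> makes \<open>a^2 + b^2\<close> a positive multiple of
  \<open>p\<close> below \<open>2 p\<close>.\<close>

lemma prime_1_mod_4_sum_two_squares:
  fixes p :: nat
  assumes p: "prime p" "p mod 4 = 1"
  shows "sum_two_squares p"
proof -
  obtain z :: int where z: "[z^2 = -1] (mod int p)" using minus_one_square_mod_prime[OF p] by blast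
  define k where "k = nat \<lfloor>sqrt (real p)\<rfloor>"
  have p0: "p > 0" using p prime_gt_0_nat by blast
  have rk: "real k \<le> sqrt (real p)" "sqrt (real p) < real k + 1"
    unfolding k_def by (auto simp: of_nat_nat floor_le_iff)
  have "(real k)^2 \<le> real p" using rk(1) by (metis of_nat_0_le_iff real_sqrt_le_iff real_sqrt_pow2 power_mono real_sqrt_ge_zero)
  hence k1: "k^2 \<le> p" by (metis of_nat_le_iff of_nat_power)
  have "real p < (real k + 1)^2" using rk(2)
    by (metis of_nat_0_le_iff real_sqrt_ge_zero real_sqrt_pow2 power_strict_mono zero_less_numeral)
  hence k2: "p < (k + 1)^2" by (metis of_nat_less_iff of_nat_power of_nat_Suc Suc_eq_plus1 add.commute)
  \<comment> \<open>A prime is not a square; this gives the strict inequality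
    \<open>k^2 < p\<close>, which is needed for \<open>a^2 + b^2 < 2 p\<close>.\<close>
  have k3: "k^2 \<noteq> p"
  proof
    assume "k^2 = p"
    hence "k dvd p" "k \<noteq> 1" "k \<noteq> p" using p by (auto simp: power2_eq_square)
    thus False using p(1) prime_nat_iff by blast
  qed
  define A where "A = {0..k} \<times> {0..k}"
  define f where "f = (\<lambda>(i::nat, j::nat). (int i + z * int j) mod int p)"
  have "f ` A \<subseteq> {0..<int p}" using p0 by (auto simp: f_def)
  hence "card (f ` A) \<le> card {0..<int p}" by (intro card_mono) auto
  also have "\<dots> = p" by simp
  also have "\<dots> < card A" using k2 by (simp add: A_def power2_eq_square)
  finally have "\<not> inj_on f A" by (rule pigeonhole)
  then obtain i j i' j' where ij: "(i,j) \<in> A" "(i',j') \<in> A" "(i,j) \<noteq> (i',j')" "f (i,j) = f (i',j')"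
    unfolding inj_on_def by fast
  define a b where "a = int i - int i'" and "b = int j - int j'"
  have "[int i + z * int j = int i' + z * int j'] (mod int p)" using ij(4) by (simp add: f_def cong_def)
  hence "int p dvd a + z * b" by (simp add: cong_iff_dvd_diff a_def b_def algebra_simps)
  hence "int p dvd (a + z * b) * (a - z * b)" by simp
  hence 1: "int p dvd a^2 - z^2 * b^2" by (simp add: power2_eq_square algebra_simps)
  have "int p dvd (z^2 - (-1)) * b^2" using z by (simp add: cong_iff_dvd_diff)
  hence "int p dvd (a^2 - z^2 * b^2) + (z^2 - (-1)) * b^2" using 1 by (rule_tac dvd_add)
  hence dv: "int p dvd a^2 + b^2" by (simp add: algebra_simps)
  have ab: "\<bar>a\<bar> \<le> int k" "\<bar>b\<bar> \<le> int k" using ij by (auto simp: A_def a_def b_def)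
  have "a^2 \<le> (int k)^2" "b^2 \<le> (int k)^2" using ab by (auto simp: abs_le_square_iff[symmetric])
  moreover have "(int k)^2 < int p" using k1 k3 by (metis le_neq_implies_less of_nat_less_iff of_nat_power)
  ultimately have lt: "a^2 + b^2 < 2 * int p" by linarith
  have "a \<noteq> 0 \<or> b \<noteq> 0" using ij(3) by (auto simp: a_def b_def)
  hence pos: "a^2 + b^2 > 0" by (simp add: sum_power2_gt_zero_iff)
  obtain m where m: "a^2 + b^2 = int p * m" using dv by (elim dvdE)
  have "m > 0" using pos m p0 by (metis of_nat_0_less_iff zero_less_mult_pos)
  moreover have "m < 2" using lt m p0 by (metis mult.commute mult_less_cancel_right_pos of_nat_0_less_iff)
  ultimately have "m = 1" by simp
  thus ?thesis using m unfolding sum_two_squares_def by (metis mult.right_neutral)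
qed

text \<open>Otherwise \<open>p\<close> divides neither number. Raising \<open>x^2 = - y^2\<close> to
  the odd power \<open>(p - 1) / 2\<close> and applying Fermat to both sides gives
  \<open>1 = -1\<close> modulo \<open>p\<close>.\<close>

lemma prime_3_mod_4_dvd_sum_two_squares:
  fixes p :: nat and x y :: int
  assumes p: "prime p" "p mod 4 = 3" and dv: "int p dvd x^2 + y^2"
  shows "int p dvd x"
proof (rule ccontr)
  assume nx: "\<not> int p dvd x"
  have ip: "prime (int p)" using p by simp
  have ny: "\<not> int p dvd y"
  proof
    assume "int p dvd y"
    hence "int p dvd y^2" by (simp add: power2_eq_square)
    hence "int p dvd x^2" using dv by (simp add: dvd_add_left_iff)
    thus False using nx ip prime_dvd_power_int by blast
  qed
  obtain k where k: "p = 4 * k + 3" using p by (metis mult_div_mod_eq)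
  have fl: "[w ^ (p - 1) = 1] (mod int p)" if "\<not> int p dvd w" for w :: int
  proof -
    have "\<not> p dvd nat \<bar>w\<bar>" using that by (simp add: nat_dvd_iff int_dvd_int_iff[symmetric])
    hence "[nat \<bar>w\<bar> ^ (p - 1) = 1] (mod p)" using p by (intro fermat_theorem)
    hence "[int (nat \<bar>w\<bar> ^ (p - 1)) = int 1] (mod int p)" by (simp only: cong_int_iff)
    moreover have "int (nat \<bar>w\<bar> ^ (p - 1)) = \<bar>w\<bar> ^ (p - 1)" by (simp only: of_nat_power) simp
    ultimately have "[\<bar>w\<bar> ^ (p - 1) = 1] (mod int p)" by (simp only: of_nat_1)
    moreover have "\<bar>w\<bar> ^ (p - 1) = w ^ (p - 1)" using k by (intro power_even_abs) simp
    ultimately show ?thesis by simp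
  qed
  have e: "p - 1 = 2 * (2 * k + 1)" using k by simp
  have "[x^2 = - (y^2)] (mod int p)" using dv by (simp add: cong_iff_dvd_diff)
  hence "[(x^2) ^ (2 * k + 1) = (- (y^2)) ^ (2 * k + 1)] (mod int p)" by (rule cong_pow)
  moreover have "(- (y^2)) ^ (2 * k + 1) = - ((y^2) ^ (2 * k + 1))" by (rule power_minus_odd) simp
  moreover have "w ^ (p - 1) = (w^2) ^ (2 * k + 1)" for w :: int unfolding e by (rule power_mult)
  ultimately have "[x ^ (p - 1) = - (y ^ (p - 1))] (mod int p)" by (simp only:)
  hence "[1 = - 1] (mod int p)" using fl[OF nx] fl[OF ny]
    by (meson cong_minus_minus_iff cong_sym cong_trans)
  hence "int p dvd 2" by (simp add: cong_iff_dvd_diff)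
  thus False using k by (auto dest: zdvd_imp_le)
qed

lemma no3_imp_sum_two_squares: "no3 n \<Longrightarrow> sum_two_squares n"
proof (induction n rule: less_induct)
  case (less n)
  show ?case
  proof (cases "n = 1")
    case True
    have "int 1 = 1^2 + 0^2" by simp
    thus ?thesis unfolding True sum_two_squares_def by blast
  next
    case False
    then obtain p where p: "prime p" "p dvd n" using prime_factor_nat by blast
    then obtain m where m: "n = p * m" by (elim dvdE)
    have n0: "n > 0" using less.prems by (simp add: no3_def)
    have "m > 0" using m n0 by (cases m) auto
    hence "m < n" using m prime_gt_1_nat[OF p(1)] by simp
    moreover have "no3 m" using less.prems m n0 by (auto simp: no3_def)
    ultimately have sm: "sum_two_squares m" using less.IH by blast
    have "p mod 4 \<noteq> 3" using less.prems p by (simp add: no3_def)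
    have "sum_two_squares p"
    proof (cases "p = 2")
      case True
      have "int 2 = 1^2 + 1^2" by simp
      thus ?thesis unfolding True sum_two_squares_def by blast
    next
      case False
      hence "odd p" using p(1) primes_dvd_imp_eq two_is_prime_nat by blast
      hence "p mod 4 = 1" using \<open>p mod 4 \<noteq> 3\<close> by presburger
      thus ?thesis using prime_1_mod_4_sum_two_squares p by blast
    qed
    thus ?thesis unfolding m using sm by (rule sum_two_squares_mult)
  qed
qed

text \<open>Descent: a prime 3 modulo 4 dividing \<open>x^2 + y^2\<close> divides both
  \<open>x\<close> and \<open>y\<close>, so its square can be split off and moved into
  \<open>m\<close>. Conversely every prime factor of \<open>a\<close> is itself a sum of two
  squares.\<close>

theorem sum_two_squares_iff:
  assumes "n > 0"
  shows "sum_two_squares n \<longleftrightarrow> (\<exists>a m. no3 a \<and> only3 m \<and> n = a * m^2)"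
proof
  assume "\<exists>a m. no3 a \<and> only3 m \<and> n = a * m^2"
  then obtain a m where am: "no3 a" "n = a * m^2" by blast
  have "int (m^2) = (int m)^2 + 0^2" by simp
  hence "sum_two_squares (m^2)" unfolding sum_two_squares_def by blast
  thus "sum_two_squares n" using am no3_imp_sum_two_squares sum_two_squares_mult by blast
next
  assume "sum_two_squares n"
  thus "\<exists>a m. no3 a \<and> only3 m \<and> n = a * m^2" using assms
  proof (induction n rule: less_induct)
    case (less n)
    show ?case
    proof (cases "no3 n")
      case True
      moreover have "only3 1" unfolding only3_def using not_prime_1 by auto
      ultimately show ?thesis by (intro exI[of _ n] exI[of _ 1]) auto
    next
      case False
      then obtain p where p: "prime p" "p dvd n" "p mod 4 = 3" using less.prems by (auto simp: no3_def)
      obtain x y :: int where xy: "int n = x^2 + y^2" using less.prems unfolding sum_two_squares_def by blast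
      have "int p dvd x^2 + y^2" using p(2) by (simp flip: xy)
      hence "int p dvd x" "int p dvd y"
        using prime_3_mod_4_dvd_sum_two_squares[OF p(1,3), of x y] prime_3_mod_4_dvd_sum_two_squares[OF p(1,3), of y x]
        by (auto simp: add.commute)
      then obtain u v where uv: "x = int p * u" "y = int p * v" by (auto elim!: dvdE)
      define n' where "n' = nat (u^2 + v^2)"
      have n': "int n' = u^2 + v^2" by (simp add: n'_def)
      have "int n = int (p^2 * n')" using xy uv n' by (simp add: power2_eq_square algebra_simps)
      hence n: "n = p^2 * n'" by (simp only: of_nat_eq_iff)
      have n'0: "n' > 0" using n less.prems by (cases n') auto
      have "p^2 > 1" using one_less_power[OF prime_gt_1_nat[OF p(1)], of 2] by simp
      hence "n' < n" using n n'0 by simp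
      moreover have "sum_two_squares n'" using n' unfolding sum_two_squares_def by blast
      ultimately obtain a m where am: "no3 a" "only3 m" "n' = a * m^2" using less.IH n'0 by blast
      have "only3 (p * m)" using am(2) p unfolding only3_def
        by (auto simp: prime_gt_0_nat prime_dvd_mult_iff dest: primes_dvd_imp_eq)
      moreover have "n = a * (p * m)^2" using n am by (simp add: power_mult_distrib algebra_simps)
      ultimately show ?thesis using am(1) by blast
    qed
  qed
qed

text \<open>At a prime 3 modulo 4 the multiplicity of the product is twice that of the
  \<open>only3\<close> part, and no other prime divides this part. So all multiplicities of
  \<open>m\<close> and \<open>n\<close> agree.\<close>

lemma no3_only3_unique:
  assumes "no3 a" "only3 m" "no3 b" "only3 n" "a * m^2 = b * n^2"
  shows "a = b \<and> m = n"
proof -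
  have pos: "a > 0" "m > 0" "b > 0" "n > 0" using assms by (auto simp: no3_def only3_def)
  have "multiplicity p m = multiplicity p n" if p: "prime p" for p
  proof (cases "p mod 4 = 3")
    case True
    have "\<not> p dvd a" "\<not> p dvd b" using assms p True by (auto simp: no3_def)
    hence "multiplicity p a = 0" "multiplicity p b = 0" by (auto simp: not_dvd_imp_multiplicity_0)
    hence "multiplicity p (a * m^2) = 2 * multiplicity p m" "multiplicity p (b * n^2) = 2 * multiplicity p n"
      using p pos by (auto simp: prime_elem_multiplicity_mult_distrib prime_elem_multiplicity_power_distrib)
    thus ?thesis using assms(5) by simp
  next
    case False
    have "\<not> p dvd m" "\<not> p dvd n" using assms p False by (auto simp: only3_def)
    thus ?thesis by (simp add: not_dvd_imp_multiplicity_0)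
  qed
  from multiplicity_eq_nat[OF pos(2,4) this] have mn: "m = n" .
  hence "a * n^2 = b * n^2" using assms(5) by (simp only:)
  thus ?thesis using mn pos(4) by (simp only: mult_cancel2) simp
qed

section \<open>The character modulo 4 and the factorisation of the series of sums of two
  squares\<close>

definition chi4 :: "nat \<Rightarrow> complex" where
  "chi4 n = (if n mod 4 = 1 then 1 else if n mod 4 = 3 then -1 else 0)"

lemma chi4_mult: "chi4 (a * b) = chi4 a * chi4 b"
proof -
  define h :: "nat \<Rightarrow> complex" where "h x = (if x = 1 then 1 else if x = 3 then -1 else 0)" for x
  have h: "chi4 n = h (n mod 4)" for n by (simp add: chi4_def h_def)
  define x y where "x = a mod 4" and "y = b mod 4"
  have "x < 4" "y < 4" by (auto simp: x_def y_def)
  hence "x \<in> {0,1,2,3}" "y \<in> {0,1,2,3}" by auto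
  hence "h ((x * y) mod 4) = h x * h y" unfolding h_def by auto
  moreover have "(a * b) mod 4 = (x * y) mod 4" unfolding x_def y_def by (rule mod_mult_eq[symmetric])
  ultimately show ?thesis unfolding h x_def y_def by (simp only:)
qed

lemma norm_chi4: "norm (chi4 n) \<le> 1" by (simp add: chi4_def)

lemma no3_mult: "no3 (a * b) \<longleftrightarrow> no3 a \<and> no3 b"
  unfolding no3_def by (auto simp: prime_dvd_mult_iff)

lemma only3_mult: "only3 (a * b) \<longleftrightarrow> only3 a \<and> only3 b"
  unfolding only3_def by (auto simp: prime_dvd_mult_iff)

lemma only3_1: "only3 1" unfolding only3_def using not_prime_1 by auto
lemma no3_1: "no3 1" unfolding no3_def using not_prime_1 by auto

lemma no3_prime: "prime p \<Longrightarrow> no3 p \<longleftrightarrow> p mod 4 \<noteq> 3"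
  by (auto simp: no3_def prime_gt_0_nat dest: primes_dvd_imp_eq)

lemma only3_prime: "prime p \<Longrightarrow> only3 p \<longleftrightarrow> p mod 4 = 3"
  by (auto simp: only3_def prime_gt_0_nat dest: primes_dvd_imp_eq)

lemma suminf_if_eq_infsum:
  fixes f :: "nat \<Rightarrow> complex"
  assumes "(\<lambda>n. norm (f n)) summable_on UNIV"
  shows "(\<Sum>n. if P n then f n else 0) = infsum f {n. P n}"
proof -
  have "infsum f {n. P n} = infsum (\<lambda>n. if P n then f n else 0) UNIV"
    by (rule infsum_cong_neutral) auto
  moreover have s: "(\<lambda>n. if P n then f n else 0) summable_on UNIV"
  proof -
    have "f summable_on {n. P n}" using assms abs_summable_summable summable_on_subset_banach by blast
    thus ?thesis by (rule summable_on_cong_neutral[THEN iffD1, rotated -1]) auto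
  qed
  ultimately show ?thesis using has_sum_imp_sums[OF has_sum_infsum[OF s]] by (simp add: sums_iff)
qed

text \<open>The positive sums of two squares are the values \<open>a * m^2\<close>, each attained
  once with \<open>no3 a\<close> and \<open>only3 m\<close>. Absolute convergence lets the sum be
  reindexed by these pairs and factored.\<close>

lemma indE_product:
  assumes cm: "cmul F" and sum: "summable (\<lambda>n. norm (F n))"
  shows "(\<Sum>n. of_real (indE n) * F n) = (\<Sum>n. if no3 n then F n else 0) * (\<Sum>n. if only3 n then F n ^ 2 else 0)"
proof -
  define \<phi> where "\<phi> = (\<lambda>(a::nat, m::nat). a * m^2)"
  define UV where "UV = {n. no3 n} \<times> {n. only3 n}"
  have ab: "(\<lambda>n. norm (F n)) summable_on UNIV"
    using sum by (subst summable_on_UNIV_nonneg_real_iff) auto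
  have sq: "(\<lambda>n. norm (F n ^ 2)) summable_on UNIV"
  proof -
    have "(\<lambda>n. norm (F n)) summable_on range (\<lambda>n::nat. n^2)" using ab summable_on_subset_banach by blast
    hence "((\<lambda>n. norm (F n)) \<circ> (\<lambda>n::nat. n^2)) summable_on UNIV"
      by (subst (asm) summable_on_reindex) (auto simp: inj_on_def)
    thus ?thesis using cm by (simp add: o_def cmul_power)
  qed
  have inj: "inj_on \<phi> UV" unfolding inj_on_def UV_def \<phi>_def using no3_only3_unique by auto
  have img: "\<phi> ` UV = {n. n > 0 \<and> sum_two_squares n}"
  proof (rule Set.set_eqI, rule iffI)
    fix n assume "n \<in> \<phi> ` UV"
    then obtain a m where am: "no3 a" "only3 m" "n = a * m^2" by (auto simp: \<phi>_def UV_def)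
    hence "n > 0" by (auto simp: no3_def only3_def)
    thus "n \<in> {n. n > 0 \<and> sum_two_squares n}" using am sum_two_squares_iff by auto
  next
    fix n assume "n \<in> {n. n > 0 \<and> sum_two_squares n}"
    then obtain a m where "no3 a" "only3 m" "n = a * m^2" using sum_two_squares_iff by auto
    thus "n \<in> \<phi> ` UV" by (auto simp: \<phi>_def UV_def image_iff)
  qed
  \<comment> \<open>\<open>indE 0\<close> is 1 because \<open>0 = 0^2 + 0^2\<close>; the term is
    harmless only because \<open>cmul\<close> forces \<open>F 0 = 0\<close>.\<close>
  have "(\<Sum>n. of_real (indE n) * F n) = (\<Sum>n. if n > 0 \<and> sum_two_squares n then F n else 0)"
    using cm by (intro suminf_cong) (auto simp: indE_def cmul_def)
  also have "\<dots> = infsum F (\<phi> ` UV)" unfolding img by (rule suminf_if_eq_infsum[OF ab])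
  also have "\<dots> = infsum (F \<circ> \<phi>) UV" by (rule infsum_reindex[OF inj])
  also have "F \<circ> \<phi> = (\<lambda>(a, m). F a * F m ^ 2)"
    using cm by (auto simp: \<phi>_def cmul_mult cmul_power)
  also have "infsum \<dots> UV = infsum (\<lambda>a. infsum (\<lambda>m. F a * F m ^ 2) {n. only3 n}) {n. no3 n}"
  proof -
    have "(\<lambda>n. norm (F n)) summable_on \<phi> ` UV" using ab summable_on_subset_banach by blast
    hence "((\<lambda>n. norm (F n)) \<circ> \<phi>) summable_on UV" by (subst (asm) summable_on_reindex[OF inj])
    hence "(\<lambda>x. norm ((F \<circ> \<phi>) x)) summable_on UV" by (simp add: o_def)
    hence "(F \<circ> \<phi>) summable_on UV" by (rule abs_summable_summable)
    hence "(\<lambda>(a, m). F a * F m ^ 2) summable_on UV"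
      using cm by (simp add: \<phi>_def cmul_mult cmul_power o_def case_prod_unfold)
    thus ?thesis unfolding UV_def by (simp add: infsum_Sigma'_banach)
  qed
  also have "\<dots> = infsum F {n. no3 n} * infsum (\<lambda>m. F m ^ 2) {n. only3 n}"
    by (simp add: infsum_cmult_right' infsum_cmult_left')
  also have "infsum F {n. no3 n} = (\<Sum>n. if no3 n then F n else 0)" by (rule suminf_if_eq_infsum[OF ab, symmetric])
  also have "infsum (\<lambda>m. F m ^ 2) {n. only3 n} = (\<Sum>n. if only3 n then F n ^ 2 else 0)"
    by (rule suminf_if_eq_infsum[OF sq, symmetric])
  finally show ?thesis .
qed

lemma cmul_chi4: "cmul F \<Longrightarrow> cmul (\<lambda>n. chi4 n * F n)"
  by (simp add: cmul_def chi4_mult chi4_def[of "Suc 0"])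

lemma cmul_no3: "cmul F \<Longrightarrow> cmul (\<lambda>n. if no3 n then F n else 0)"
  using no3_1 by (simp add: cmul_def no3_mult)

lemma cmul_only3_sq: "cmul F \<Longrightarrow> cmul (\<lambda>n. if only3 n then F n ^ 2 else 0)"
  using only3_1 by (simp add: cmul_def only3_mult power_mult_distrib)

lemma summable_norm_mult_le_1:
  fixes F :: "nat \<Rightarrow> complex"
  assumes "summable (\<lambda>n. norm (F n))" "\<And>n. norm (G n) \<le> norm (F n)"
  shows "summable (\<lambda>n. norm (G n :: complex))"
  by (rule summable_comparison_test'[OF assms(1)]) (simp add: assms(2))

text \<open>If \<open>norm (F n) > 1\<close>, the values along the powers of \<open>n\<close> stay
  at least 1 and contradict summability. Consequently \<open>F n ^ 2\<close> is dominated by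
  \<open>F n\<close>.\<close>

lemma cmul_norm_le_1:
  assumes "cmul F" "summable (\<lambda>n. norm (F n))"
  shows "norm (F n) \<le> 1"
proof (cases "n = 0")
  case True thus ?thesis using assms by (simp add: cmul_def)
next
  case False
  show ?thesis
  proof (cases "n = 1")
    case True thus ?thesis using assms by (simp add: cmul_def)
  next
    case n1: False
    show ?thesis
    proof (rule ccontr)
      assume "\<not> norm (F n) \<le> 1"
      hence ge: "norm (F (n ^ k)) \<ge> 1" for k
        using assms(1) by (simp add: cmul_power norm_power one_le_power)
      have "strict_mono (\<lambda>k. n ^ k)" using False n1 by (simp add: strict_mono_def)
      moreover have "(\<lambda>n. norm (F n)) \<longlonglongrightarrow> 0" using assms(2) summable_LIMSEQ_zero by blast
      ultimately have "(\<lambda>k. norm (F (n ^ k))) \<longlonglongrightarrow> 0"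
        using LIMSEQ_subseq_LIMSEQ by (fastforce simp: o_def)
      hence "0 \<ge> (1::real)"
        using ge by (intro LIMSEQ_le_const[where X = "\<lambda>k. norm (F (n ^ k))"]) auto
      thus False by simp
    qed
  qed
qed

text \<open>Comparison of Euler factors. For \<open>p\<close> equal to 1 modulo 4 both sides are
  \<open>(1 - F p)^2\<close>; for 3 modulo 4 they are \<open>(1 - F p ^ 2)^2\<close>, split as
  \<open>(1 - F p) (1 + F p) (1 - F p ^ 2)\<close>. At 2, where \<open>chi4\<close> vanishes, the
  square has one factor \<open>1 - F 2\<close> more than the right side, and this is the correction
  in the statement.\<close>

lemma indE_square:
  assumes cm: "cmul F" and sum: "summable (\<lambda>n. norm (F n))"
  shows "(\<Sum>n. of_real (indE n) * F n) ^ 2 * (1 - F 2) =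
     suminf F * (\<Sum>n. chi4 n * F n) * (\<Sum>n. if only3 n then F n ^ 2 else 0)"
proof -
  let ?P = "\<lambda>f N. \<Prod>p | prime p \<and> p \<le> N. 1 - f p"
  define G where "G n = chi4 n * F n" for n
  define A where "A n = (if no3 n then F n else 0)" for n
  define B where "B n = (if only3 n then F n ^ 2 else 0)" for n
  have cms: "cmul G" "cmul A" "cmul B"
    unfolding G_def A_def B_def using cm cmul_chi4 cmul_no3 cmul_only3_sq by auto
  have "norm (G n) \<le> norm (F n)" for n
    unfolding G_def norm_mult using mult_right_mono[OF norm_chi4, of "norm (F n)"] by simp
  hence sG: "summable (\<lambda>n. norm (G n))" using summable_norm_mult_le_1[OF sum] by blast
  have sA: "summable (\<lambda>n. norm (A n))" by (rule summable_norm_mult_le_1[OF sum]) (simp add: A_def)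
  have sB: "summable (\<lambda>n. norm (B n))"
    by (rule summable_norm_mult_le_1[OF sum])
       (use cmul_norm_le_1[OF cm sum] in \<open>auto simp: B_def power2_eq_square norm_mult mult_left_le\<close>)
  have lim1: "(\<lambda>N. (?P A N * ?P B N) ^ 2) \<longlonglongrightarrow> (1 / suminf A * (1 / suminf B)) ^ 2"
    by (intro tendsto_intros euler_product cms sA sB)
  have lim2: "(\<lambda>N. ?P F N * ?P G N * ?P B N * (1 - F 2)) \<longlonglongrightarrow> 1 / suminf F * (1 / suminf G) * (1 / suminf B) * (1 - F 2)"
    by (intro tendsto_intros euler_product cms cm sum sG sB)
  have eq: "(?P A N * ?P B N) ^ 2 = ?P F N * ?P G N * ?P B N * (1 - F 2)" if "N \<ge> 2" for N
  proof -
    have fin: "finite {p. prime p \<and> p \<le> N}" by simp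
    have two: "2 \<in> {p. prime p \<and> p \<le> N}" using that by simp
    have "(?P A N * ?P B N) ^ 2 = (\<Prod>p | prime p \<and> p \<le> N. ((1 - A p) * (1 - B p)) ^ 2)"
      by (simp only: prod.distrib[symmetric] prod_power_distrib)
    also have "\<dots> = (\<Prod>p | prime p \<and> p \<le> N. (1 - F p) * (1 - G p) * (1 - B p) * (if p = 2 then 1 - F 2 else 1))"
    proof (rule prod.cong[OF refl])
      fix p assume "p \<in> {p. prime p \<and> p \<le> N}"
      hence p: "prime p" by simp
      show "((1 - A p) * (1 - B p)) ^ 2 = (1 - F p) * (1 - G p) * (1 - B p) * (if p = 2 then 1 - F 2 else 1)"
      proof (cases "p = 2")
        case True
        thus ?thesis using no3_prime[OF p] only3_prime[OF p]
          by (simp add: A_def B_def G_def chi4_def power2_eq_square)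
      next
        case False
        hence "odd p" using p primes_dvd_imp_eq two_is_prime_nat by blast
        hence "p mod 4 = 1 \<or> p mod 4 = 3" by presburger
        thus ?thesis using no3_prime[OF p] only3_prime[OF p] False
          by (auto simp: A_def B_def G_def chi4_def power2_eq_square algebra_simps)
      qed
    qed
    also have "\<dots> = ?P F N * ?P G N * ?P B N * (\<Prod>p | prime p \<and> p \<le> N. if p = 2 then 1 - F 2 else 1)"
      by (simp add: prod.distrib)
    also have "(\<Prod>p | prime p \<and> p \<le> N. if p = 2 then 1 - F 2 else 1) = 1 - F 2"
      using prod.delta[OF fin, of 2 "\<lambda>_. 1 - F 2"] two by simp
    finally show ?thesis .
  qed
  have "(1 / suminf A * (1 / suminf B)) ^ 2 = 1 / suminf F * (1 / suminf G) * (1 / suminf B) * (1 - F 2)"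
  proof (rule LIMSEQ_unique[OF lim1])
    show "(\<lambda>N. (?P A N * ?P B N) ^ 2) \<longlonglongrightarrow> 1 / suminf F * (1 / suminf G) * (1 / suminf B) * (1 - F 2)"
      by (rule Lim_transform_eventually[OF lim2]) (use eq in \<open>auto intro!: eventually_sequentiallyI[of 2]\<close>)
  qed
  moreover have "suminf A \<noteq> 0" "suminf B \<noteq> 0" "suminf F \<noteq> 0" "suminf G \<noteq> 0"
    using euler_product_nonzero cms cm sum sA sB sG by auto
  ultimately have fin: "(suminf A * suminf B) ^ 2 * (1 - F 2) = suminf F * suminf G * suminf B"
    by (simp add: divide_simps power2_eq_square) algebra
  have e: "(\<Sum>n. of_real (indE n) * F n) = suminf A * suminf B"
    unfolding A_def B_def by (rule indE_product[OF cm sum])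
  have "(\<Sum>n. of_real (indE n) * F n) ^ 2 * (1 - F 2) = suminf F * suminf G * suminf B"
    unfolding e by (rule fin)
  thus ?thesis unfolding G_def[abs_def] B_def[abs_def] .
qed

section \<open>Continuation of Dirichlet series with periodic coefficients\<close>

lemma le_interpolate:
  fixes x a b t :: real
  assumes "0 \<le> x" "x \<le> a" "x \<le> b" "0 \<le> t" "t \<le> 1"
  shows "x \<le> a powr (1 - t) * b powr t"
proof (cases "x = 0")
  case False
  have "x = x powr (1 - t) * x powr t" using assms False by (simp flip: powr_add)
  also have "\<dots> \<le> a powr (1 - t) * b powr t" using assms by (intro mult_mono powr_mono2) auto
  finally show ?thesis .
qed simp

text \<open>The \<open>n\<close>-th term of \<open>(s - 1) \<Sum> (m n + r)\<^sup>-\<^sup>s\<close> minus the integral it approximates; the sum of these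
  differences converges for \<open>Re s > 0\<close>.\<close>

definition cterm :: "real \<Rightarrow> real \<Rightarrow> complex \<Rightarrow> complex" where
  "cterm m a s = (s - 1) * of_real a powr (- s) +
     (of_real (a + m) powr (1 - s) - of_real a powr (1 - s)) / of_real m"

lemma norm_real_powr: "a \<ge> 0 \<Longrightarrow> norm (of_real a powr s :: complex) = a powr Re s"
  by (subst norm_powr_real_powr) auto

lemma powr_diff_bound:
  assumes a: "0 < a" "a \<le> u" and s: "Re s > 0"
  shows "norm (of_real u powr (- s) - of_real a powr (- s) :: complex) \<le> norm s * a powr (- Re s - 1) * (u - a)"
proof -
  have "norm (of_real u powr (- s) - of_real a powr (- s) :: complex) \<le> (norm s * a powr (- Re s - 1)) * norm (of_real u - of_real a :: complex)"
  proof (rule field_differentiable_bound[where S = "closed_segment (of_real a) (of_real u)"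
         and f' = "\<lambda>z. - s * z powr (- s - 1)"])
    fix z :: complex assume "z \<in> closed_segment (of_real a) (of_real u)"
    then obtain v where v: "z = of_real v" "a \<le> v" "v \<le> u"
      using a by (auto simp: closed_segment_of_real closed_segment_eq_real_ivl)
    have "z \<notin> \<real>\<^sub>\<le>\<^sub>0" using v a by (auto simp: complex_nonpos_Reals_iff)
    thus "((\<lambda>z. z powr (- s)) has_field_derivative - s * z powr (- s - 1)) (at z within closed_segment (of_real a) (of_real u))"
      by (auto intro!: derivative_eq_intros)
    have "norm (- s * z powr (- s - 1)) = norm s * v powr (- Re s - 1)"
      using v a by (simp add: norm_mult norm_real_powr)
    also have "\<dots> \<le> norm s * a powr (- Re s - 1)"
      using v a s by (intro mult_left_mono powr_mono2') auto
    finally show "norm (- s * z powr (- s - 1)) \<le> norm s * a powr (- Re s - 1)" .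
  qed auto
  also have "norm (of_real u - of_real a :: complex) = u - a"
    using a by (metis abs_of_nonneg diff_ge_0_iff_ge norm_of_real of_real_diff)
  finally show ?thesis .
qed

text \<open>The term is the increment over \<open>[a, a + m]\<close> of a primitive of
  \<open>(1 - s) / m * (u powr (- s) - a powr (- s))\<close>. Hence any bound for the bracket on
  that interval, times \<open>norm (s - 1)\<close>, bounds the term.\<close>

lemma cterm_bound_aux:
  assumes a: "0 < a" and m: "0 < m" and D: "\<And>u. a \<le> u \<Longrightarrow> u \<le> a + m \<Longrightarrow> norm (of_real u powr (- s) - of_real a powr (- s) :: complex) \<le> D"
  shows "norm (cterm m a s) \<le> norm (s - 1) * D"
proof -
  define \<phi> :: "complex \<Rightarrow> complex" where "\<phi> z = z powr (1 - s) / of_real m + (s - 1) * z / of_real m * of_real a powr (- s)" for z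
  have eq: "cterm m a s = \<phi> (of_real (a + m)) - \<phi> (of_real a)"
    unfolding cterm_def \<phi>_def using m by (simp add: field_simps)
  have "norm (\<phi> (of_real (a + m)) - \<phi> (of_real a)) \<le> (norm (s - 1) / m * D) * norm (of_real (a + m) - of_real a :: complex)"
  proof (rule field_differentiable_bound[where S = "closed_segment (of_real a) (of_real (a + m))"
         and f' = "\<lambda>z. (1 - s) / of_real m * (z powr (- s) - of_real a powr (- s))"])
    fix z :: complex assume "z \<in> closed_segment (of_real a) (of_real (a + m))"
    then obtain v where v: "z = of_real v" "a \<le> v" "v \<le> a + m"
      using a m unfolding closed_segment_of_real closed_segment_eq_real_ivl by auto
    have z: "z \<notin> \<real>\<^sub>\<le>\<^sub>0" using v a by (auto simp: complex_nonpos_Reals_iff)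
    show "(\<phi> has_field_derivative (1 - s) / of_real m * (z powr (- s) - of_real a powr (- s))) (at z within closed_segment (of_real a) (of_real (a + m)))"
      unfolding \<phi>_def using z m by (auto intro!: derivative_eq_intros simp: field_simps)
    have "norm ((1 - s) / of_real m * (z powr (- s) - of_real a powr (- s))) = norm (s - 1) / m * norm (z powr (- s) - of_real a powr (- s))"
      using m by (simp add: norm_mult norm_divide norm_minus_commute)
    also have "\<dots> \<le> norm (s - 1) / m * D"
      using m D[of v] v by (intro mult_left_mono) auto
    finally show "norm ((1 - s) / of_real m * (z powr (- s) - of_real a powr (- s))) \<le> norm (s - 1) / m * D" .
  qed auto
  also have "\<dots> = norm (s - 1) * D" using m by simp
  finally show ?thesis unfolding eq .
qed

text \<open>Interpolation between the trivial bound \<open>2 a^(-Re s)\<close> and the derivative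
  bound \<open>m |s| a^(-Re s - 1)\<close>. The parameter \<open>t\<close> trades a growth
  \<open>|s|^t\<close> for an extra decay \<open>a^(-t)\<close>; small \<open>t\<close> leads to
  subpolynomial growth next to the line \<open>Re s = 1\<close>.\<close>

lemma cterm_bound:
  assumes a: "0 < a" and m: "0 < m" and s: "Re s > 0" and t: "0 \<le> t" "t \<le> 1"
  shows "norm (cterm m a s) \<le> norm (s - 1) * (2 * (m * norm s) powr t * a powr (- Re s - t))"
proof (rule cterm_bound_aux[OF a m])
  fix u assume u: "a \<le> u" "u \<le> a + m"
  let ?x = "norm (of_real u powr (- s) - of_real a powr (- s) :: complex)"
  have "?x \<le> norm (of_real u powr (- s) :: complex) + norm (of_real a powr (- s) :: complex)"
    by (rule norm_triangle_ineq4)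
  also have "\<dots> = u powr (- Re s) + a powr (- Re s)" using a u by (simp add: norm_real_powr)
  also have "\<dots> \<le> 2 * a powr (- Re s)" using powr_mono2'[of "- Re s" a u] a u s by auto
  finally have 1: "?x \<le> 2 * a powr (- Re s)" .
  have "?x \<le> norm s * a powr (- Re s - 1) * (u - a)" by (rule powr_diff_bound) (use a u s in auto)
  also have "\<dots> \<le> norm s * a powr (- Re s - 1) * m" using u by (intro mult_left_mono) auto
  finally have 2: "?x \<le> (m * norm s) * a powr (- Re s - 1)" by (simp add: algebra_simps)
  have "?x \<le> (2 * a powr (- Re s)) powr (1 - t) * ((m * norm s) * a powr (- Re s - 1)) powr t"
    by (rule le_interpolate) (use 1 2 t in auto)
  also have "\<dots> = 2 powr (1 - t) * (m * norm s) powr t * (a powr (- Re s * (1 - t)) * a powr ((- Re s - 1) * t))"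
    using m by (simp add: powr_mult powr_powr)
  also have "a powr (- Re s * (1 - t)) * a powr ((- Re s - 1) * t) = a powr (- Re s - t)"
    by (simp add: powr_add[symmetric] algebra_simps)
  also have "2 powr (1 - t) * (m * norm s) powr t * a powr (- Re s - t) \<le> 2 * (m * norm s) powr t * a powr (- Re s - t)"
    using t powr_mono[of "1 - t" 1 "2::real"] by (intro mult_right_mono) auto
  finally show "?x \<le> 2 * (m * norm s) powr t * a powr (- Re s - t)" .
qed

lemma cterm_holomorphic: "a > 0 \<Longrightarrow> m > 0 \<Longrightarrow> cterm m a holomorphic_on A"
  unfolding cterm_def by (auto intro!: holomorphic_intros)

lemma cterm_at_1: "a > 0 \<Longrightarrow> m > 0 \<Longrightarrow> cterm m a 1 = 0"
  unfolding cterm_def by (simp add: complex_eq_iff)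

text \<open>For \<open>Re s > 1\<close> the integral corrections inside \<open>cterm\<close>
  telescope to \<open>- r^(1 - s) / m\<close>. The leading summand cancels this, so that the whole
  is \<open>(s - 1)\<close> times the series over the progression.\<close>

definition cY :: "nat \<Rightarrow> nat \<Rightarrow> complex \<Rightarrow> complex" where
  "cY m r s = of_nat r powr (1 - s) / of_nat m + (\<Sum>n. cterm (real m) (real (m * n + r)) s)"

lemma of_nat_prog_pos: "r > 0 \<Longrightarrow> real (m * n + r) > 0"
  by (rule of_nat_0_less_iff[THEN iffD2]) simp

lemma cterm_seq_bound:
  assumes m: "m > 0" and r: "r > 0" and t: "0 \<le> t" "t \<le> 1" and b: "0 < b" "b \<le> Re s"
  shows "norm (cterm (real m) (real (m * n + r)) s) \<le> norm (s - 1) * (2 * (real m * norm s) powr t) * real (Suc n) powr (- (b + t))"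
proof -
  have a: "real (m * n + r) \<ge> real (Suc n)"
  proof -
    have "n + 1 \<le> m * n + r" using m r by (intro add_mono) auto
    thus ?thesis by (metis Suc_eq_plus1 of_nat_le_iff)
  qed
  have "norm (cterm (real m) (real (m * n + r)) s) \<le> norm (s - 1) * (2 * (real m * norm s) powr t * real (m * n + r) powr (- Re s - t))"
    by (rule cterm_bound[OF of_nat_prog_pos[OF r]]) (use m t b in auto)
  also have "real (m * n + r) powr (- Re s - t) \<le> real (Suc n) powr (- Re s - t)"
    using a b t by (intro powr_mono2') auto
  also have "real (Suc n) powr (- Re s - t) \<le> real (Suc n) powr (- (b + t))"
    using b by (intro powr_mono) auto
  finally show ?thesis by (simp add: mult_left_mono mult.assoc)
qed

lemma summable_Suc_powr: "b > 1 \<Longrightarrow> summable (\<lambda>n. real (Suc n) powr (- b))"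
  by (subst summable_Suc_iff) (simp add: summable_real_powr_iff)

lemma cY_holomorphic:
  assumes m: "m > 0" and r: "r > 0"
  shows "cY m r holomorphic_on {s. Re s > 0}"
proof -
  define S where "S = {s. Re s > 0}"
  have S: "open S" unfolding S_def by (rule open_halfspace_Re_gt)
  define f where "f n = cterm (real m) (real (m * n + r))" for n
  have hol: "f n holomorphic_on UNIV" for n unfolding f_def using m by (intro cterm_holomorphic of_nat_prog_pos[OF r]) auto
  have "\<exists>g g'. \<forall>x \<in> S. ((\<lambda>n. f n x) sums g x) \<and> ((\<lambda>n. deriv (f n) x) sums g' x) \<and> (g has_field_derivative g' x) (at x)"
  proof (rule series_and_derivative_comparison_local[OF S])
    fix n x show "(f n has_field_derivative deriv (f n) x) (at x)"
      using holomorphic_derivI[OF hol] by blast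
  next
    fix x assume x: "x \<in> S"
    define d where "d = Re x / 2"
    have d: "d > 0" using x by (simp add: d_def S_def)
    \<comment> \<open>Holomorphy takes the full decay, \<open>t = 1\<close>, so the majorant has
      exponent \<open>d + 1 > 1\<close> for every positive real part; growth in \<open>s\<close> is
      irrelevant locally.\<close>
    define h where "h n = (norm x + d + 1) * (2 * (real m * (norm x + d)) powr 1) * real (Suc n) powr (- (d + 1))" for n
    show "\<exists>d h. 0 < d \<and> summable h \<and> (\<forall>\<^sub>F n in sequentially. \<forall>y\<in>ball x d \<inter> S. norm (f n y) \<le> h n)"
    proof (intro exI conjI)
      show "summable h" unfolding h_def using d by (intro summable_mult summable_Suc_powr) auto
      show "\<forall>\<^sub>F n in sequentially. \<forall>y\<in>ball x d \<inter> S. norm (f n y) \<le> h n"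
      proof (intro always_eventually allI ballI)
        fix n y assume y: "y \<in> ball x d \<inter> S"
        have "\<bar>Re x - Re y\<bar> \<le> norm (x - y)" using abs_Re_le_cmod[of "x - y"] by simp
        hence Rey: "Re y \<ge> d" using y by (auto simp: dist_norm d_def)
        have ny: "norm y \<le> norm x + d" using y norm_triangle_ineq2[of y x] by (auto simp: dist_norm norm_minus_commute)
        have ny1: "norm (y - 1) \<le> norm x + d + 1" using ny norm_triangle_ineq4[of y 1] by simp
        have "norm (f n y) \<le> norm (y - 1) * (2 * (real m * norm y) powr 1) * real (Suc n) powr (- (d + 1))"
          unfolding f_def by (rule cterm_seq_bound) (use m r d Rey in auto)
        also have "(real m * norm y) powr 1 \<le> (real m * (norm x + d)) powr 1"
          using ny by (intro powr_mono2 mult_left_mono) auto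
        also have "norm (y - 1) * (2 * (real m * (norm x + d)) powr 1) * real (Suc n) powr (- (d + 1)) \<le> h n"
          unfolding h_def using ny1 by (intro mult_right_mono) auto
        finally show "norm (f n y) \<le> h n" by (simp add: mult_left_mono mult_right_mono)
      qed
    qed (rule d)
  qed
  then obtain g g' where g: "\<And>x. x \<in> S \<Longrightarrow> (\<lambda>n. f n x) sums g x"
    "\<And>x. x \<in> S \<Longrightarrow> (g has_field_derivative g' x) (at x)" by metis
  have "g holomorphic_on S" using g(2) holomorphic_on_open[OF S] by blast
  hence "(\<lambda>s. of_nat r powr (1 - s) / of_nat m + g s) holomorphic_on S"
    using m by (intro holomorphic_intros) auto
  moreover have "of_nat r powr (1 - s) / of_nat m + g s = cY m r s" if "s \<in> S" for s
    using g(1)[OF that] unfolding cY_def f_def by (simp add: sums_iff)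
  ultimately show ?thesis unfolding S_def[symmetric] by (rule holomorphic_transform)
qed

text \<open>On \<open>Re s \<ge> 1 - t/2\<close> the interpolated terms decay with exponent at least
  \<open>1 + t/2\<close>, so the series converges uniformly. A narrower strip thus pays for a
  smaller power of \<open>norm s\<close>.\<close>

lemma cY_bound:
  assumes m: "m > 0" and r: "r > 0" "r \<le> m" and t: "0 < t" "t \<le> 1"
  shows "\<exists>C\<ge>0. \<forall>s. Re s \<ge> 1 - t/2 \<longrightarrow> norm (cY m r s) \<le> C * ((1 + norm (s - 1)) * (1 + norm s) powr t)"
proof -
  define K where "K = (\<Sum>n. real (Suc n) powr (- (1 + t/2)))"
  have sK: "summable (\<lambda>n. real (Suc n) powr (- (1 + t/2)))" using t by (intro summable_Suc_powr) auto
  have K0: "K \<ge> 0" unfolding K_def using sK by (intro suminf_nonneg) auto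
  show ?thesis
  proof (intro exI[of _ "1 + 2 * real m powr t * K"] conjI allI impI)
    show "0 \<le> 1 + 2 * real m powr t * K" using K0 by simp
    fix s assume s: "Re s \<ge> 1 - t/2"
    define X where "X = norm (s - 1) * (2 * (real m * norm s) powr t)"
    have X0: "X \<ge> 0" unfolding X_def by simp
    have b: "norm (cterm (real m) (real (m * n + r)) s) \<le> X * real (Suc n) powr (- (1 + t/2))" for n
    proof -
      have "norm (cterm (real m) (real (m * n + r)) s) \<le> X * real (Suc n) powr (- (1 - t/2 + t))"
        unfolding X_def by (rule cterm_seq_bound) (use m r t s in auto)
      moreover have "1 - t/2 + t = 1 + t/2" by simp
      ultimately show ?thesis by simp
    qed
    have "norm (\<Sum>n. cterm (real m) (real (m * n + r)) s) \<le> (\<Sum>n. X * real (Suc n) powr (- (1 + t/2)))"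
      by (rule norm_suminf_le[OF b summable_mult[OF sK]])
    also have "\<dots> = X * K" unfolding K_def using sK by (simp add: suminf_mult)
    finally have 1: "norm (\<Sum>n. cterm (real m) (real (m * n + r)) s) \<le> X * K" .
    have "real r powr (1 - Re s) \<le> real r powr 1" using r s t by (intro powr_mono) auto
    hence rr: "real r powr (1 - Re s) \<le> real m" using r by simp
    have 2: "norm (of_nat r powr (1 - s) / of_nat m :: complex) \<le> 1"
    proof -
      have "norm (of_nat r powr (1 - s) / of_nat m :: complex) = real r powr (1 - Re s) / real m"
        using r norm_real_powr[of "real r" "1 - s"] by (simp add: norm_divide)
      also have "\<dots> \<le> 1" using rr m by simp
      finally show ?thesis .
    qed
    define W where "W = (1 + norm s) powr t"
    have W1: "W \<ge> 1" unfolding W_def using t by (simp add: ge_one_powr_ge_zero)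
    have "X \<le> norm (s - 1) * (2 * (real m powr t * W))"
      unfolding X_def W_def using m t by (auto simp: powr_mult intro!: mult_left_mono powr_mono2)
    hence "X * K \<le> (norm (s - 1) * (2 * (real m powr t * W))) * K" using K0 by (intro mult_right_mono)
    also have "\<dots> = (2 * real m powr t * K) * (norm (s - 1) * W)" by simp
    also have "\<dots> \<le> (2 * real m powr t * K) * ((1 + norm (s - 1)) * W)"
      using K0 W1 by (intro mult_left_mono mult_right_mono) auto
    finally have 3: "X * K \<le> (2 * real m powr t * K) * ((1 + norm (s - 1)) * W)" .
    have "1 * 1 \<le> (1 + norm (s - 1)) * W" using W1 by (intro mult_mono) auto
    hence "norm (cY m r s) \<le> (1 + norm (s - 1)) * W + (2 * real m powr t * K) * ((1 + norm (s - 1)) * W)"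
      unfolding cY_def using 1 2 3 norm_triangle_ineq[of "of_nat r powr (1 - s) / of_nat m :: complex"] by (smt (verit))
    thus "norm (cY m r s) \<le> (1 + 2 * real m powr t * K) * ((1 + norm (s - 1)) * (1 + norm s) powr t)"
      unfolding W_def by (simp add: algebra_simps)
  qed
qed

lemma cY_at_1: "m > 0 \<Longrightarrow> r > 0 \<Longrightarrow> cY m r 1 = 1 / of_nat m"
  unfolding cY_def cterm_at_1[OF of_nat_prog_pos of_nat_0_less_iff[THEN iffD2]] by simp

lemma cY_eq:
  assumes m: "m > 0" and r: "r > 0" and s: "Re s > 1"
  shows "summable (\<lambda>n. of_nat (m * n + r) powr (- s) :: complex)"
    and "cY m r s = (s - 1) * (\<Sum>n. of_nat (m * n + r) powr (- s))"
proof -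
  have a: "real (m * n + r) \<ge> real (Suc n)" for n
  proof -
    have "n + 1 \<le> m * n + r" using m r by (intro add_mono) auto
    thus ?thesis by (metis Suc_eq_plus1 of_nat_le_iff)
  qed
  show sm: "summable (\<lambda>n. of_nat (m * n + r) powr (- s) :: complex)"
  proof (rule summable_comparison_test'[OF summable_Suc_powr[OF s]])
    fix n :: nat
    have "norm (of_nat (m * n + r) powr (- s) :: complex) = real (m * n + r) powr (- Re s)"
      by (rule norm_nat_powr)
    also have "\<dots> \<le> real (Suc n) powr (- Re s)" using a s by (intro powr_mono2') auto
    finally show "norm (of_nat (m * n + r) powr (- s) :: complex) \<le> real (Suc n) powr (- Re s)" .
  qed
  define b where "b n = (of_nat (m * n + r) powr (1 - s) :: complex)" for n
  have "b \<longlonglongrightarrow> 0"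
  proof (rule Lim_null_comparison)
    show "\<forall>\<^sub>F n in sequentially. norm (b n) \<le> real (Suc n) powr (- (Re s - 1))"
    proof (intro always_eventually allI)
      fix n
      have "norm (b n) = real (m * n + r) powr (- (Re s - 1))" unfolding b_def
        using norm_nat_powr[of "m * n + r" "s - 1"] by simp
      also have "\<dots> \<le> real (Suc n) powr (- (Re s - 1))" using a s by (intro powr_mono2') auto
      finally show "norm (b n) \<le> real (Suc n) powr (- (Re s - 1))" .
    qed
    have "(\<lambda>n. real n powr (- (Re s - 1))) \<longlonglongrightarrow> 0"
      using s by (intro tendsto_neg_powr filterlim_real_sequentially) auto
    thus "(\<lambda>n. real (Suc n) powr (- (Re s - 1))) \<longlonglongrightarrow> 0" using LIMSEQ_Suc by blast
  qed
  hence "(\<lambda>n. b (Suc n) - b n) sums (0 - b 0)" by (rule telescope_sums)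
  hence 1: "(\<lambda>n. (b (Suc n) - b n) / of_nat m) sums ((0 - b 0) / of_nat m)" by (rule sums_divide)
  have 2: "(\<lambda>n. (s - 1) * of_nat (m * n + r) powr (- s)) sums ((s - 1) * (\<Sum>n. of_nat (m * n + r) powr (- s)))"
    using sm by (intro sums_mult summable_sums)
  have "cterm (real m) (real (m * n + r)) s = (s - 1) * of_nat (m * n + r) powr (- s) + (b (Suc n) - b n) / of_nat m" for n
  proof -
    have "complex_of_real (real (m * n + r) + real m) = of_nat (m * Suc n + r)" by simp
    thus ?thesis unfolding cterm_def b_def by (simp only: of_real_of_nat_eq)
  qed
  hence "(\<lambda>n. cterm (real m) (real (m * n + r)) s) sums ((s - 1) * (\<Sum>n. of_nat (m * n + r) powr (- s)) + (0 - b 0) / of_nat m)"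
    using sums_add[OF 2 1] by simp
  thus "cY m r s = (s - 1) * (\<Sum>n. of_nat (m * n + r) powr (- s))"
    unfolding cY_def b_def by (simp add: sums_iff)
qed

text \<open>The continuation of \<open>(s - 1) \<Sum> g(n) n\<^sup>-\<^sup>s\<close> for \<open>g\<close> of period \<open>m\<close>.\<close>

definition cont :: "(nat \<Rightarrow> complex) \<Rightarrow> nat \<Rightarrow> complex \<Rightarrow> complex" where
  "cont g m s = (\<Sum>r=1..m. g r * cY m r s)"

lemma cont_holomorphic: "m > 0 \<Longrightarrow> cont g m holomorphic_on {s. Re s > 0}"
  unfolding cont_def by (intro holomorphic_intros cY_holomorphic) auto

lemma cont_at_1: "m > 0 \<Longrightarrow> cont g m 1 = (\<Sum>r=1..m. g r) / of_nat m"
  unfolding cont_def by (simp add: cY_at_1 sum_divide_distrib)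

lemma cont_bound:
  assumes m: "m > 0" and g: "\<And>n. norm (g n) \<le> 1" and t: "0 < t" "t \<le> 1"
  shows "\<exists>C\<ge>0. \<forall>s. Re s \<ge> 1 - t/2 \<longrightarrow> norm (cont g m s) \<le> C * ((1 + norm (s - 1)) * (1 + norm s) powr t)"
proof -
  have "\<forall>r\<in>{1..m}. \<exists>C\<ge>0. \<forall>s. Re s \<ge> 1 - t/2 \<longrightarrow> norm (cY m r s) \<le> C * ((1 + norm (s - 1)) * (1 + norm s) powr t)"
    using cY_bound[OF m _ _ t] by auto
  then obtain C where C: "\<And>r. r \<in> {1..m} \<Longrightarrow> C r \<ge> 0"
    "\<And>r s. r \<in> {1..m} \<Longrightarrow> Re s \<ge> 1 - t/2 \<Longrightarrow> norm (cY m r s) \<le> C r * ((1 + norm (s - 1)) * (1 + norm s) powr t)"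
    by metis
  show ?thesis
  proof (intro exI[of _ "\<Sum>r=1..m. C r"] conjI allI impI)
    show "0 \<le> (\<Sum>r=1..m. C r)" using C by (intro sum_nonneg) auto
    fix s assume s: "Re s \<ge> 1 - t/2"
    have "norm (cont g m s) \<le> (\<Sum>r=1..m. norm (g r * cY m r s))" unfolding cont_def by (rule norm_sum)
    also have "\<dots> \<le> (\<Sum>r=1..m. C r * ((1 + norm (s - 1)) * (1 + norm s) powr t))"
    proof (rule sum_mono)
      fix r assume r: "r \<in> {1..m}"
      have "norm (g r * cY m r s) \<le> 1 * norm (cY m r s)" unfolding norm_mult by (intro mult_right_mono g) auto
      thus "norm (g r * cY m r s) \<le> C r * ((1 + norm (s - 1)) * (1 + norm s) powr t)" using C(2)[OF r s] by linarith
    qed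
    finally show "norm (cont g m s) \<le> (\<Sum>r=1..m. C r) * ((1 + norm (s - 1)) * (1 + norm s) powr t)"
      by (simp add: sum_distrib_right)
  qed
qed

lemma cont_eq:
  assumes m: "m > 0" and g: "\<And>n. norm (g n) \<le> 1" and per: "\<And>n. g (n + m) = g n" and s: "Re s > 1"
  shows "cont g m s = (s - 1) * dser g s"
proof -
  define f where "f n = g n * of_nat n powr (- s)" for n
  have "summable f" unfolding f_def
    by (rule summable_norm_cancel[OF tame_summable[OF tame_bounded[OF g] s]])
  hence "f sums dser g s" unfolding dser_def f_def by (rule summable_sums)
  \<comment> \<open>Dropping the vanishing term at 0 makes a block of \<open>m\<close> consecutive
    terms run over the representatives 1 to \<open>m\<close>.\<close>
  moreover have "f 0 = 0" by (simp add: f_def)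
  ultimately have "(\<lambda>n. f (Suc n)) sums dser g s" by (simp add: sums_Suc_iff)
  from sums_group[OF this m]
  have grp: "(\<lambda>n. \<Sum>i = n * m..<n * m + m. f (Suc i)) sums dser g s" .
  have gper: "g (m * n + r) = g r" for n r
  proof (induction n)
    case (Suc n)
    have "m * Suc n + r = (m * n + r) + m" by simp
    thus ?case using Suc per by metis
  qed simp
  have blk: "(\<Sum>i = n * m..<n * m + m. f (Suc i)) = (\<Sum>r=1..m. g r * of_nat (m * n + r) powr (- s))" for n
  proof -
    have "(\<Sum>i = n * m..<n * m + m. f (Suc i)) = (\<Sum>r=1..m. f (m * n + r))"
      by (rule sum.reindex_bij_witness[of _ "\<lambda>r. m * n + r - 1" "\<lambda>i. Suc i - m * n"]) (auto simp: mult.commute)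
    also have "\<dots> = (\<Sum>r=1..m. g r * of_nat (m * n + r) powr (- s))"
      unfolding f_def gper by simp
    finally show ?thesis .
  qed
  have "(\<lambda>n. \<Sum>r=1..m. g r * of_nat (m * n + r) powr (- s)) sums (\<Sum>r=1..m. g r * (\<Sum>n. of_nat (m * n + r) powr (- s)))"
    by (intro sums_sum sums_mult summable_sums cY_eq(1)) (use m s in auto)
  hence "dser g s = (\<Sum>r=1..m. g r * (\<Sum>n. of_nat (m * n + r) powr (- s)))"
    using grp unfolding blk by (rule sums_unique2[symmetric])
  thus ?thesis unfolding cont_def using m s by (simp add: cY_eq(2) sum_distrib_left algebra_simps)
qed

text \<open>The strip stops at 3 so that \<open>norm s\<close> and \<open>1 + |Im s|\<close> are
  comparable. The line \<open>Re s = 1\<close> is left out, but bounds over this set do not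
  degenerate towards it; the disc around the possible pole is removed.\<close>

definition farstrip :: "real \<Rightarrow> complex set" where
  "farstrip d = {s. 1 < Re s \<and> Re s < 3 \<and> d < norm (s - 1)}"

lemma farstrip_open: "open (farstrip d)"
  unfolding farstrip_def by (intro open_Collect_conj open_Collect_less continuous_intros)

text \<open>Dividing the continuation by \<open>s - 1\<close> cancels its linear growth and leaves
  \<open>|s|^t\<close>. The Cauchy radius is at most \<open>t/2\<close>, to stay in the half-plane
  of \<open>cont_bound\<close>, and at most \<open>d/2\<close>, to stay away from 1.\<close>

lemma dser_slow:
  assumes m: "m > 0" and g: "\<And>n. norm (g n) \<le> 1" and per: "\<And>n. g (n + m) = g n" and d: "d > 0"
  shows "slow (farstrip d) (dser g)"
proof (rule slow_cong[OF farstrip_open])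
  show "dser g s = cont g m s / (s - 1)" if "s \<in> farstrip d" for s
    using that d cont_eq[where g = g and m = m and s = s, OF m g per] by (auto simp: farstrip_def)
  show "slow (farstrip d) (\<lambda>s. cont g m s / (s - 1))"
  proof (rule slow_Cauchy[where T = "{s. Re s > 0} - {1}"])
    show "(\<lambda>s. cont g m s / (s - 1)) holomorphic_on {s. Re s > 0} - {1}"
      by (intro holomorphic_intros holomorphic_on_subset[OF cont_holomorphic[OF m]]) auto
    show "open (farstrip d)" by (rule farstrip_open)
    show "farstrip d \<subseteq> {s. Re s > 0} - {1}" using d by (auto simp: farstrip_def)
    fix e :: real assume e: "e > 0"
    define t where "t = min e 1"
    have t: "0 < t" "t \<le> 1" "t \<le> e" using e by (auto simp: t_def)
    obtain C where C: "C \<ge> 0" "\<And>s. Re s \<ge> 1 - t/2 \<Longrightarrow> norm (cont g m s) \<le> C * ((1 + norm (s - 1)) * (1 + norm s) powr t)"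
      using cont_bound[where g = g, OF m g t(1,2)] by (elim exE conjE) metis
    define r where "r = min (t/2) (d/2)"
    have r: "r > 0" "r \<le> t/2" "r \<le> d/2" using t d by (auto simp: r_def)
    define C' where "C' = C * (2/d + 1) * 5"
    have C'0: "C' \<ge> 0" using C d by (simp add: C'_def)
    show "\<exists>r>0. \<exists>C. \<forall>s\<in>farstrip d. cball s r \<subseteq> {s. Re s > 0} - {1} \<and> (\<forall>z\<in>cball s r. norm (cont g m z / (z - 1)) \<le> C * (1 + \<bar>Im s\<bar>) powr e)"
    proof (rule exI[of _ r], rule conjI[OF r(1)], rule exI[of _ C'], rule ballI)
      fix s assume s: "s \<in> farstrip d"
      have 1: "Re z \<ge> 1 - t/2" "norm (z - 1) \<ge> d/2" "norm z \<le> 4 + \<bar>Im s\<bar>" if z: "z \<in> cball s r" for z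
      proof -
        have zr: "norm (s - z) \<le> r" using z by (simp add: dist_norm)
        have "\<bar>Re s - Re z\<bar> \<le> norm (s - z)" using abs_Re_le_cmod[of "s - z"] by simp
        thus "Re z \<ge> 1 - t/2" using zr r s by (auto simp: farstrip_def)
        have "norm (s - 1) \<le> norm (s - z) + norm (z - 1)" using norm_triangle_ineq[of "s - z" "z - 1"] by simp
        thus "norm (z - 1) \<ge> d/2" using zr r s by (auto simp: farstrip_def)
        have "norm s \<le> 3 + \<bar>Im s\<bar>" using cmod_le[of s] s by (auto simp: farstrip_def)
        moreover have "norm z \<le> norm s + norm (s - z)" using norm_triangle_ineq4[of s "s - z"] by simp
        ultimately show "norm z \<le> 4 + \<bar>Im s\<bar>" using zr r t by linarith
      qed
      show "cball s r \<subseteq> {s. Re s > 0} - {1} \<and> (\<forall>z\<in>cball s r. norm (cont g m z / (z - 1)) \<le> C' * (1 + \<bar>Im s\<bar>) powr e)"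
      proof (intro conjI ballI subsetI)
        fix z assume z: "z \<in> cball s r"
        show "z \<in> {s. Re s > 0} - {1}" using 1[OF z] t d by auto
        have nz: "norm (z - 1) > 0" using 1(2)[OF z] d by linarith
        have "norm (cont g m z / (z - 1)) \<le> C * ((1 + norm (z - 1)) * (1 + norm z) powr t) / norm (z - 1)"
          unfolding norm_divide using C(2)[OF 1(1)[OF z]] by (intro divide_right_mono) auto
        also have "\<dots> = C * (1 / norm (z - 1) + 1) * (1 + norm z) powr t"
          using nz by (simp add: field_simps)
        also have "\<dots> \<le> C * (2/d + 1) * (5 * (1 + \<bar>Im s\<bar>)) powr t"
        proof (intro mult_mono mult_left_mono add_mono powr_mono2 C)
          show "1 / norm (z - 1) \<le> 2 / d" using 1(2)[OF z] nz d by (simp add: field_simps)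
        qed (use 1(3)[OF z] t C d nz in auto)
        also have "\<dots> \<le> C * (2/d + 1) * (5 * (1 + \<bar>Im s\<bar>) powr e)"
        proof (rule mult_left_mono)
          have "(5 * (1 + \<bar>Im s\<bar>)) powr t = 5 powr t * (1 + \<bar>Im s\<bar>) powr t" by (rule powr_mult)
          also have "\<dots> \<le> 5 * (1 + \<bar>Im s\<bar>) powr e"
          proof (rule mult_mono)
            show "5 powr t \<le> (5::real)" using powr_mono[of t 1 "5::real"] t by simp
            show "(1 + \<bar>Im s\<bar>) powr t \<le> (1 + \<bar>Im s\<bar>) powr e" using t by (intro powr_mono) auto
          qed auto
          finally show "(5 * (1 + \<bar>Im s\<bar>)) powr t \<le> 5 * (1 + \<bar>Im s\<bar>) powr e" .
          show "0 \<le> C * (2/d + 1)" using C(1) d by simp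
        qed
        also have "\<dots> = C' * (1 + \<bar>Im s\<bar>) powr e" unfolding C'_def by (simp only: mult.assoc)
        finally show "norm (cont g m z / (z - 1)) \<le> C' * (1 + \<bar>Im s\<bar>) powr e" .
      qed
    qed
  qed
qed

section \<open>Dirichlet characters and nonvanishing on the line Re s = 1\<close>

definition dchar :: "nat \<Rightarrow> (nat \<Rightarrow> complex) \<Rightarrow> bool" where
  "dchar m g \<longleftrightarrow> m > 0 \<and> g 1 = 1 \<and> (\<forall>a b. g (a * b) = g a * g b) \<and> (\<forall>n. g (n + m) = g n) \<and>
     (\<forall>n. norm (g n) \<le> 1) \<and> (\<forall>n. \<not> coprime n m \<longrightarrow> g n = 0)"

lemma dcharD:
  assumes "dchar m g"
  shows "m > 0" "g 1 = 1" "g (a * b) = g a * g b" "g (n + m) = g n" "norm (g n) \<le> 1" "\<not> coprime n m \<Longrightarrow> g n = 0"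
  using assms by (auto simp: dchar_def)

lemma dchar_one: "dchar 1 (\<lambda>_. 1)"
  by (simp add: dchar_def)

lemma dchar_square: "dchar m g \<Longrightarrow> dchar m (\<lambda>n. g n ^ 2)"
  by (auto simp: dchar_def power_mult_distrib norm_power power_le_one)

lemma of_nat_mult_powr: "(of_nat (a * b) powr z :: complex) = of_nat a powr z * of_nat b powr z"
  by (simp add: powr_times_real)

lemma cmul_dser_term:
  assumes "g 1 = 1" "\<And>a b. g (a * b) = g a * g b"
  shows "cmul (\<lambda>n. g n * of_nat n powr (- s))"
  unfolding cmul_def using assms by (auto simp: of_nat_mult_powr simp del: of_nat_mult)

lemma dchar_summable: "dchar m g \<Longrightarrow> Re s > 1 \<Longrightarrow> summable (\<lambda>n. norm (g n * of_nat n powr (- s)))"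
  by (intro tame_summable tame_bounded[of _ 1]) (auto simp: dchar_def)

text \<open>The three points are \<open>\<sigma>\<close>, \<open>\<sigma> + i t\<close> and
  \<open>\<sigma> + 2 i t\<close>, the last written as \<open>2 * s - Re s\<close>. With
  \<open>r = p^(-\<sigma>)\<close> and \<open>z = g p * p^(-i t)\<close> the terms at
  \<open>p\<close> are \<open>r\<close>, \<open>r z\<close> and \<open>r z^2\<close>.\<close>

lemma dchar_three_four_one:
  assumes g: "dchar m g" and s: "Re s > 1"
  shows "norm (dser (\<lambda>_. 1) (of_real (Re s))) ^ 3 * norm (dser g s) ^ 4 * norm (dser (\<lambda>n. g n ^ 2) (2 * s - of_real (Re s))) \<ge> 1"
  unfolding dser_def
proof (rule three_four_one)
  note g2 = dchar_square[OF g]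
  show "cmul (\<lambda>n. 1 * of_nat n powr - complex_of_real (Re s))" by (rule cmul_dser_term) auto
  show "cmul (\<lambda>n. g n * of_nat n powr - s)" by (rule cmul_dser_term) (use dcharD(2,3)[OF g] in auto)
  show "cmul (\<lambda>n. g n ^ 2 * of_nat n powr - (2 * s - complex_of_real (Re s)))" by (rule cmul_dser_term) (use dcharD(2,3)[OF g2] in auto)
  show "summable (\<lambda>n. norm (1 * of_nat n powr - complex_of_real (Re s)))" by (rule dchar_summable[OF dchar_one]) (use s in auto)
  show "summable (\<lambda>n. norm (g n * of_nat n powr - s))" by (rule dchar_summable[OF g s])
  show "summable (\<lambda>n. norm (g n ^ 2 * of_nat n powr - (2 * s - complex_of_real (Re s))))"
    by (rule dchar_summable[OF g2]) (use s in auto)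
  fix p :: nat assume p: "prime p"
  define r where "r = real p powr (- Re s)"
  define z where "z = g p * of_nat p powr (- (\<i> * of_real (Im s)))"
  have p1: "real p > 1" using prime_gt_1_nat[OF p] by simp
  have r: "0 \<le> r" "r < 1" unfolding r_def using p1 s by (auto intro!: powr_less_one)
  have rr: "complex_of_real r = of_nat p powr (- of_real (Re s))"
    unfolding r_def by (subst powr_of_real[symmetric]) auto
  have "norm (of_nat p powr (- (\<i> * of_real (Im s))) :: complex) = 1"
    using p1 by (subst norm_powr_real_powr) auto
  hence "norm z \<le> 1" unfolding z_def norm_mult using dcharD(5)[OF g] by simp
  have e1: "- s = - of_real (Re s) + (- (\<i> * of_real (Im s)))" by (simp add: complex_eq_iff)
  have e2: "- (2 * s - of_real (Re s)) = - of_real (Re s) + (- (\<i> * of_real (Im s)) + - (\<i> * of_real (Im s)))"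
    by (simp add: complex_eq_iff)
  have "g p * of_nat p powr - s = of_real r * z"
    unfolding rr z_def e1 by (simp only: powr_add) simp
  moreover have "g p ^ 2 * of_nat p powr - (2 * s - complex_of_real (Re s)) = of_real r * z\<^sup>2"
    unfolding rr z_def e2 by (simp only: powr_add) (simp add: power2_eq_square)
  ultimately show "\<exists>r z. 0 \<le> r \<and> r < 1 \<and> norm z \<le> 1 \<and> 1 * of_nat p powr - complex_of_real (Re s) = complex_of_real r \<and>
       g p * of_nat p powr - s = complex_of_real r * z \<and> g p ^ 2 * of_nat p powr - (2 * s - complex_of_real (Re s)) = complex_of_real r * z\<^sup>2"
    using r \<open>norm z \<le> 1\<close> rr by (intro exI[of _ r] exI[of _ z]) auto
qed

lemma slowD: "slow S f \<Longrightarrow> e > 0 \<Longrightarrow> \<exists>C. \<forall>s\<in>S. norm ((deriv ^^ j) f s) \<le> C * (1 + \<bar>Im s\<bar>) powr e"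
  unfolding slow_def slow_upto_def by blast

lemma dchar_slow: "dchar m g \<Longrightarrow> d > 0 \<Longrightarrow> slow (farstrip d) (dser g)"
  by (rule dser_slow[where m = m]) (auto simp: dchar_def)

lemma zeta_upper_bound:
  "\<exists>A. \<forall>\<sigma>. 1 < \<sigma> \<and> \<sigma> < 3 \<longrightarrow> norm (dser (\<lambda>_. 1) (of_real \<sigma>)) \<le> A / (\<sigma> - 1)"
proof -
  obtain C where C: "C \<ge> 0" "\<And>s. Re s \<ge> 1 - 1/2 \<Longrightarrow> norm (cont (\<lambda>_. 1) 1 s) \<le> C * ((1 + norm (s - 1)) * (1 + norm s) powr 1)"
    using cont_bound[of 1 "\<lambda>_. 1" 1] by (auto simp del: One_nat_def)
  show ?thesis
  proof (intro exI[of _ "C * (3 * 4)"] allI impI)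
    fix \<sigma> :: real assume s: "1 < \<sigma> \<and> \<sigma> < 3"
    have eq: "cont (\<lambda>_. 1) 1 (of_real \<sigma>) = (of_real \<sigma> - 1) * dser (\<lambda>_. 1) (of_real \<sigma>)"
      using s by (intro cont_eq) auto
    have n1: "norm (complex_of_real \<sigma> - 1) = \<sigma> - 1"
      using s by (metis abs_of_nonneg diff_ge_0_iff_ge less_imp_le norm_of_real of_real_1 of_real_diff)
    have "(\<sigma> - 1) * norm (dser (\<lambda>_. 1) (of_real \<sigma>)) = norm (cont (\<lambda>_. 1) 1 (of_real \<sigma>))"
      unfolding eq norm_mult n1 ..
    also have "\<dots> \<le> C * ((1 + norm (complex_of_real \<sigma> - 1)) * (1 + norm (complex_of_real \<sigma>)) powr 1)"
      by (rule C(2)) (use s in auto)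
    also have "\<dots> \<le> C * (3 * 4)" unfolding n1 using s C(1) by (intro mult_left_mono mult_mono) auto
    finally show "norm (dser (\<lambda>_. 1) (of_real \<sigma>)) \<le> C * (3 * 4) / (\<sigma> - 1)"
      using s by (simp add: field_simps)
  qed
qed

text \<open>At distance at least \<open>\<eta>\<close> from the line the 3-4-1 inequality gives the
  lower bound \<open>2 \<eta> A X\<close>. A point closer to the line is compared with the point at
  \<open>1 + \<eta>\<close> of the same height: the derivative is at most \<open>A X\<close>, so the
  move costs at most \<open>\<eta> A X\<close> and half of the bound survives. No zero-free region
  is involved.\<close>

lemma dser_lower_bound:
  assumes g: "dchar m g" and d: "d > 0" and e: "e > 0"
  shows "\<exists>c>0. \<forall>s\<in>farstrip d. norm (dser g s) \<ge> c * (1 + \<bar>Im s\<bar>) powr (- e)"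
proof -
  define \<epsilon> where "\<epsilon> = e / 4"
  have eps: "\<epsilon> > 0" using e by (simp add: \<epsilon>_def)
  have sl: "slow (farstrip d) (dser g)" by (rule dchar_slow[OF g d])
  obtain C1 where C1: "\<And>s. s \<in> farstrip d \<Longrightarrow> norm (deriv (dser g) s) \<le> C1 * (1 + \<bar>Im s\<bar>) powr \<epsilon>"
    using slowD[OF sl eps, of 1] by auto
  obtain C2 where C2: "\<And>s. s \<in> farstrip d \<Longrightarrow> norm (dser (\<lambda>n. g n ^ 2) s) \<le> C2 * (1 + \<bar>Im s\<bar>) powr \<epsilon>"
    using slowD[OF dchar_slow[OF dchar_square[OF g] d] eps, of 0] by auto
  obtain C3 where C3: "\<And>\<sigma>. 1 < \<sigma> \<Longrightarrow> \<sigma> < 3 \<Longrightarrow> norm (dser (\<lambda>_. 1) (of_real \<sigma>)) \<le> C3 / (\<sigma> - 1)"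
    using zeta_upper_bound by blast
  \<comment> \<open>One constant for the derivative, the squared character and the zeta bound;
    \<open>2 powr \<epsilon>\<close> pays for doubling the imaginary part.\<close>
  define A where "A = max 1 (max C1 (max (C2 * 2 powr \<epsilon>) C3))"
  have A: "A \<ge> 1" "A \<ge> C1" "A \<ge> C2 * 2 powr \<epsilon>" "A \<ge> C3" unfolding A_def by auto
  define X where "X s = (1 + \<bar>Im s\<bar>) powr \<epsilon>" for s
  have X1: "X s \<ge> 1" for s unfolding X_def using eps by (simp add: ge_one_powr_ge_zero)
  \<comment> \<open>Solves \<open>(2 \<eta> A X)^4 * (A^4 X / \<eta>^3) = 1\<close>, the equality
    case of the 3-4-1 inequality. Then \<open>\<eta> A X = 1 / (16 A^7 X^4)\<close>, and
    \<open>X^4 = (1 + |Im s|)^e\<close> explains the choice of \<open>e / 4\<close>.\<close>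
  define \<eta> where "\<eta> s = 1 / (16 * A ^ 8 * X s ^ 5)" for s
  have AX: "A ^ 8 * X s ^ 5 \<ge> 1" for s
    using mult_mono[of 1 "A ^ 8" 1 "X s ^ 5"] A(1) X1[of s] by (simp add: one_le_power)
  have eta: "0 < \<eta> s" "\<eta> s < 1" for s using AX[of s] unfolding \<eta>_def by (auto simp: field_simps)
  have far: "norm (dser g s) \<ge> 2 * \<eta> s * A * X s" if s: "s \<in> farstrip d" and re: "Re s - 1 \<ge> \<eta> s" for s
  proof -
    have res: "1 < Re s" "Re s < 3" "d < norm (s - 1)" using s by (auto simp: farstrip_def)
    define s2 where "s2 = 2 * s - complex_of_real (Re s)"
    have s2: "Re s2 = Re s" "Im s2 = 2 * Im s" unfolding s2_def by auto
    have "norm (s - 1) \<le> norm (s2 - 1)"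
      unfolding cmod_def by (rule real_sqrt_le_mono) (simp add: s2 power_mult_distrib)
    hence s2f: "s2 \<in> farstrip d" using res s2 by (auto simp: farstrip_def)
    have "(1 + \<bar>Im s2\<bar>) powr \<epsilon> > 0" by simp
    hence C20: "C2 \<ge> 0" using order_trans[OF norm_ge_zero C2[OF s2f]]
      by (simp only: zero_le_mult_iff) linarith
    have "norm (dser (\<lambda>n. g n ^ 2) s2) \<le> C2 * (1 + \<bar>2 * Im s\<bar>) powr \<epsilon>" using C2[OF s2f] s2 by simp
    also have "\<dots> \<le> C2 * (2 * (1 + \<bar>Im s\<bar>)) powr \<epsilon>"
      using eps C20 by (intro mult_left_mono powr_mono2) auto
    also have "(2 * (1 + \<bar>Im s\<bar>)) powr \<epsilon> = 2 powr \<epsilon> * X s" unfolding X_def by (rule powr_mult)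
    also have "C2 * (2 powr \<epsilon> * X s) = (C2 * 2 powr \<epsilon>) * X s" by simp
    also have "\<dots> \<le> A * X s" using A(3) X1[of s] by (intro mult_right_mono) auto
    finally have b2: "norm (dser (\<lambda>n. g n ^ 2) s2) \<le> A * X s" .
    have "norm (dser (\<lambda>_. 1) (of_real (Re s))) \<le> C3 / (Re s - 1)" using C3 res by blast
    also have "\<dots> \<le> A / \<eta> s" using A(1,4) res re eta[of s]
      by (intro frac_le) auto
    finally have b1: "norm (dser (\<lambda>_. 1) (of_real (Re s))) \<le> A / \<eta> s" .
    define Z where "Z = norm (dser g s)"
    have "1 \<le> norm (dser (\<lambda>_. 1) (of_real (Re s))) ^ 3 * Z ^ 4 * norm (dser (\<lambda>n. g n ^ 2) s2)"
      using dchar_three_four_one[OF g res(1)] unfolding s2_def Z_def .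
    also have "\<dots> \<le> (A / \<eta> s) ^ 3 * Z ^ 4 * (A * X s)"
      using b1 b2 A(1) eta[of s] unfolding Z_def by (intro mult_mono power_mono) auto
    also have "\<dots> = Z ^ 4 * (A ^ 4 * X s / \<eta> s ^ 3)" by (simp add: power_divide field_simps power_numeral_reduce)
    finally have 1: "1 \<le> Z ^ 4 * (A ^ 4 * X s / \<eta> s ^ 3)" .
    have 2: "(2 * \<eta> s * A * X s) ^ 4 * (A ^ 4 * X s / \<eta> s ^ 3) = 1"
    proof -
      have "(2 * \<eta> s * A * X s) ^ 4 * (A ^ 4 * X s / \<eta> s ^ 3) = \<eta> s * (16 * A ^ 8 * X s ^ 5)"
        using eta[of s] by (simp add: field_simps power_numeral_reduce)
      also have "\<dots> = 1" using AX[of s] unfolding \<eta>_def by auto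
      finally show ?thesis .
    qed
    have pos: "A ^ 4 * X s / \<eta> s ^ 3 > 0" using A(1) X1[of s] eta[of s] by simp
    have "(2 * \<eta> s * A * X s) ^ 4 \<le> Z ^ 4"
      using 1 2 pos by (metis mult_le_cancel_right_pos)
    thus ?thesis unfolding Z_def by (rule power_le_imp_le_base[of _ 3, simplified]) simp
  qed
  have main: "norm (dser g s) \<ge> \<eta> s * A * X s" if s: "s \<in> farstrip d" for s
  proof (cases "Re s - 1 \<ge> \<eta> s")
    case True
    have "\<eta> s * A * X s \<ge> 0" using eta[of s] A(1) X1[of s] by simp
    thus ?thesis using far[OF s True] by linarith
  next
    case False
    have res: "1 < Re s" "Re s < 3" "d < norm (s - 1)" using s by (auto simp: farstrip_def)
    define s1 where "s1 = Complex (1 + \<eta> s) (Im s)"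
    \<comment> \<open>Moving right at constant height increases the distance to 1, so the segment
      does not enter the removed disc.\<close>
    have inf: "z \<in> farstrip d" if z: "Re z \<ge> Re s" "Re z \<le> 1 + \<eta> s" "Im z = Im s" for z
    proof -
      have "norm (s - 1) \<le> norm (z - 1)" unfolding cmod_def
        using z res by (intro real_sqrt_le_mono add_mono) (auto intro!: power_mono)
      thus ?thesis using z res eta[of s] by (auto simp: farstrip_def)
    qed
    have s1f: "s1 \<in> farstrip d" using False by (intro inf) (auto simp: s1_def)
    have Xe: "X s1 = X s" "\<eta> s1 = \<eta> s" by (auto simp: X_def \<eta>_def s1_def)
    have "norm (dser g s1) \<ge> 2 * \<eta> s * A * X s" using far[OF s1f] Xe by (simp add: s1_def)
    moreover have "norm (dser g s1 - dser g s) \<le> (A * X s) * norm (s1 - s)"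
    proof (rule field_differentiable_bound[where S = "closed_segment s s1" and f' = "deriv (dser g)"])
      fix z assume "z \<in> closed_segment s s1"
      then obtain u where u: "0 \<le> u" "u \<le> 1" "z = (1 - u) *\<^sub>R s + u *\<^sub>R s1" by (auto simp: in_segment)
      have zr: "Re z = Re s + u * (1 + \<eta> s - Re s)" "Im z = Im s"
        unfolding u(3) by (auto simp: s1_def algebra_simps)
      have k: "0 \<le> 1 + \<eta> s - Re s" using False by simp
      have "u * (1 + \<eta> s - Re s) \<le> 1 * (1 + \<eta> s - Re s)" using u k by (intro mult_right_mono) auto
      moreover have "0 \<le> u * (1 + \<eta> s - Re s)" using u k by simp
      ultimately have zf: "z \<in> farstrip d" using zr by (intro inf) auto
      have "dser g holomorphic_on farstrip d" using sl by (auto simp: slow_def slow_upto_def)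
      thus "(dser g has_field_derivative deriv (dser g) z) (at z within closed_segment s s1)"
        using zf farstrip_open holomorphic_derivI has_field_derivative_at_within by blast
      have "norm (deriv (dser g) z) \<le> C1 * X s" using C1[OF zf] zr unfolding X_def by simp
      also have "\<dots> \<le> A * X s" using A X1[of s] by (intro mult_right_mono) auto
      finally show "norm (deriv (dser g) z) \<le> A * X s" .
    qed auto
    moreover have "norm (s1 - s) \<le> \<eta> s"
    proof -
      have "s1 - s = of_real (1 + \<eta> s - Re s)" by (simp add: s1_def complex_eq_iff)
      hence "norm (s1 - s) = \<bar>1 + \<eta> s - Re s\<bar>" by (simp only: norm_of_real)
      thus ?thesis using False res by auto
    qed
    moreover have "(A * X s) * norm (s1 - s) \<le> (A * X s) * \<eta> s"
      using A(1) X1[of s] calculation(3) by (intro mult_left_mono) auto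
    moreover have "norm (dser g s1) \<le> norm (dser g s) + norm (dser g s1 - dser g s)"
      using norm_triangle_ineq[of "dser g s" "dser g s1 - dser g s"] by simp
    ultimately show ?thesis by (simp add: algebra_simps)
  qed
  show ?thesis
  proof (intro exI[of _ "1 / (16 * A ^ 7)"] conjI ballI)
    show "1 / (16 * A ^ 7) > 0" using A(1) by simp
    fix s assume s: "s \<in> farstrip d"
    have "X s ^ 4 = (1 + \<bar>Im s\<bar>) powr e"
      unfolding X_def \<epsilon>_def by (simp add: powr_powr flip: powr_realpow)
    hence "1 / (16 * A ^ 7) * (1 + \<bar>Im s\<bar>) powr (- e) = 1 / (16 * A ^ 7) / X s ^ 4"
      by (simp add: powr_minus field_simps)
    also have "\<dots> = \<eta> s * A * X s"
      unfolding \<eta>_def using A(1) X1[of s] by (simp add: field_simps power_numeral_reduce)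
    finally show "norm (dser g s) \<ge> 1 / (16 * A ^ 7) * (1 + \<bar>Im s\<bar>) powr (- e)" using main[OF s] by simp
  qed
qed

lemma dser_nonzero:
  assumes "dchar m g" "Re s > 1" shows "dser g s \<noteq> 0"
  unfolding dser_def
  by (rule euler_product_nonzero[OF cmul_dser_term dchar_summable[OF assms]]) (use dcharD(2,3)[OF assms(1)] in auto)

lemma dser_inverse_slow:
  assumes g: "dchar m g" and d: "d > 0"
  shows "slow (farstrip d) (\<lambda>s. inverse (dser g s))"
proof (rule slow_inverse[OF farstrip_open dchar_slow[OF g d]])
  show "dser g s \<noteq> 0" if "s \<in> farstrip d" for s
    using dser_nonzero[OF g] that by (auto simp: farstrip_def)
  fix e :: real assume "e > 0"
  then obtain c where c: "c > 0" "\<And>s. s \<in> farstrip d \<Longrightarrow> norm (dser g s) \<ge> c * (1 + \<bar>Im s\<bar>) powr (- e)"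
    using dser_lower_bound[OF g d] by blast
  show "\<exists>C. \<forall>s\<in>farstrip d. norm (inverse (dser g s)) \<le> C * (1 + \<bar>Im s\<bar>) powr e"
  proof (intro exI[of _ "1/c"] ballI)
    fix s assume s: "s \<in> farstrip d"
    have p: "c * (1 + \<bar>Im s\<bar>) powr (- e) > 0" using c by simp
    have "norm (inverse (dser g s)) = inverse (norm (dser g s))" by (rule norm_inverse)
    also have "\<dots> \<le> inverse (c * (1 + \<bar>Im s\<bar>) powr (- e))" by (rule le_imp_inverse_le[OF c(2)[OF s] p])
    also have "\<dots> = 1/c * (1 + \<bar>Im s\<bar>) powr e" by (simp add: powr_minus inverse_eq_divide)
    finally show "norm (inverse (dser g s)) \<le> 1/c * (1 + \<bar>Im s\<bar>) powr e" .
  qed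
qed

section \<open>Nonvanishing of L-functions at s = 1\<close>

lemma abel_summation_bound:
  fixes g :: "nat \<Rightarrow> complex" and b :: "nat \<Rightarrow> real"
  assumes S: "\<And>K. norm (\<Sum>n<K. g n) \<le> B" and mono: "\<And>n. n \<ge> M \<Longrightarrow> b (Suc n) \<le> b n"
    and nonneg: "\<And>n. n \<ge> M \<Longrightarrow> 0 \<le> b n" and MN: "M \<le> N"
  shows "norm (\<Sum>n=M..<N. g n * of_real (b n)) \<le> 2 * B * b M"
proof -
  define S where "S K = (\<Sum>n<K. g n)" for K
  have SB: "norm (S K) \<le> B" for K unfolding S_def by (rule assms(1))
  have B0: "B \<ge> 0" using SB[of 0] norm_ge_zero order_trans by blast
  have id: "(\<Sum>n=M..<N. g n * of_real (b n)) = S N * of_real (b N) - S M * of_real (b M)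
      + (\<Sum>n=M..<N. S (Suc n) * of_real (b n - b (Suc n)))"
    using MN
  proof (induction N rule: dec_induct)
    case (step N)
    define Y where "Y = (\<Sum>n=M..<N. S (Suc n) * of_real (b n - b (Suc n)))"
    have gN: "g N * of_real (b N) = (S (Suc N) - S N) * of_real (b N)" unfolding S_def by simp
    show ?case
      unfolding sum.atLeastLessThan_Suc[OF step.hyps(1)] step.IH gN Y_def[symmetric]
      by (simp add: algebra_simps)
  qed simp
  have 1: "norm (\<Sum>n=M..<N. S (Suc n) * of_real (b n - b (Suc n))) \<le> B * (b M - b N)"
  proof -
    have "norm (\<Sum>n=M..<N. S (Suc n) * of_real (b n - b (Suc n))) \<le> (\<Sum>n=M..<N. norm (S (Suc n) * of_real (b n - b (Suc n))))"
      by (rule norm_sum)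
    also have "\<dots> \<le> (\<Sum>n=M..<N. B * (b n - b (Suc n)))"
    proof (rule sum_mono)
      fix n assume n: "n \<in> {M..<N}"
      hence "norm (S (Suc n) * of_real (b n - b (Suc n))) = norm (S (Suc n)) * (b n - b (Suc n))"
        using mono[of n] unfolding norm_mult norm_of_real by simp
      also have "\<dots> \<le> B * (b n - b (Suc n))" using mono[of n] n SB by (intro mult_right_mono) auto
      finally show "norm (S (Suc n) * of_real (b n - b (Suc n))) \<le> B * (b n - b (Suc n))" .
    qed
    also have "\<dots> = B * (\<Sum>n=M..<N. b n - b (Suc n))" by (simp add: sum_distrib_left)
    also have "(\<Sum>n=M..<N. b n - b (Suc n)) = b M - b N"
      using sum_Suc_diff'[OF MN, of "\<lambda>n. - b n"] by simp
    finally show ?thesis .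
  qed
  have 2: "norm (S N * of_real (b N)) \<le> B * b N"
    using nonneg[OF MN] SB unfolding norm_mult norm_of_real by (intro mult_mono) (auto simp: B0)
  have 3: "norm (S M * of_real (b M)) \<le> B * b M"
    using nonneg[of M] SB unfolding norm_mult norm_of_real by (intro mult_mono) (auto simp: B0)
  show ?thesis unfolding id
    using 1 2 3 norm_triangle_ineq[of "S N * of_real (b N) - S M * of_real (b M)" "\<Sum>n=M..<N. S (Suc n) * of_real (b n - b (Suc n))"]
      norm_triangle_ineq4[of "S N * of_real (b N)" "S M * of_real (b M)"]
    by (simp add: algebra_simps)
qed

lemma dchar_sum_period:
  assumes g: "dchar m g"
  shows "(\<Sum>n<m. g n) = (\<Sum>r=1..m. g r)"
proof -
  have m: "m > 0" using dcharD(1)[OF g] .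
  have g0: "g 0 = g m" using dcharD(4)[OF g, of 0] by simp
  have "{..<m} = insert 0 {1..<m}" using m by auto
  hence "(\<Sum>n<m. g n) = g 0 + (\<Sum>n\<in>{1..<m}. g n)" by simp
  moreover have "{1..m} = insert m {1..<m}" using m by auto
  hence "(\<Sum>n=1..m. g n) = g m + (\<Sum>n\<in>{1..<m}. g n)" by simp
  ultimately show ?thesis using g0 by simp
qed

lemma dchar_partial_sum_bound:
  assumes g: "dchar m g" and zero: "(\<Sum>r=1..m. g r) = 0"
  shows "norm (\<Sum>n<K. g n) \<le> real m"
proof (induction K rule: less_induct)
  case (less K)
  have m: "m > 0" using dcharD(1)[OF g] .
  show ?case
  proof (cases "K < m")
    case True
    have "norm (\<Sum>n<K. g n) \<le> (\<Sum>n<K. norm (g n))" by (rule norm_sum)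
    also have "\<dots> \<le> (\<Sum>n<K. 1)" using dcharD(5)[OF g] by (intro sum_mono) auto
    also have "\<dots> \<le> real m" using True by simp
    finally show ?thesis .
  next
    case False
    define k where "k = K - m"
    have K: "K = k + m" using False by (simp add: k_def)
    have "(\<Sum>n<K. g n) = (\<Sum>n\<in>{0..<m}. g n) + (\<Sum>n\<in>{m..<K}. g n)"
      using sum.atLeastLessThan_concat[of 0 m K g] False by (simp add: lessThan_atLeast0)
    also have "(\<Sum>n\<in>{0..<m}. g n) = 0" using dchar_sum_period[OF g] zero by (simp add: lessThan_atLeast0)
    also have "(\<Sum>n\<in>{m..<K}. g n) = (\<Sum>n\<in>{0..<k}. g (n + m))"
      using sum.shift_bounds_nat_ivl[of g 0 m k] K by simp
    also have "\<dots> = (\<Sum>n<k. g n)" using dcharD(4)[OF g] by (simp add: lessThan_atLeast0)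
    finally show ?thesis using less[of k] K m by simp
  qed
qed

text \<open>Multiplication by \<open>c\<close> permutes the residues modulo \<open>m\<close>, so the
  period sum equals \<open>g c\<close> times itself.\<close>

lemma dchar_sum_zero:
  assumes g: "dchar m g" and c: "coprime c m" "g c \<noteq> 1"
  shows "(\<Sum>r=1..m. g r) = 0"
proof -
  have m: "m > 0" using dcharD(1)[OF g] .
  have gmod: "g (n mod m) = g n" for n
  proof (induction n rule: less_induct)
    case (less n)
    show ?case
    proof (cases "n < m")
      case False
      have "g (n mod m) = g ((n - m) mod m)" using False by (simp add: le_mod_geq)
      also have "\<dots> = g (n - m)" using less m False by simp
      also have "\<dots> = g n" using dcharD(4)[OF g, of "n - m"] False by simp
      finally show ?thesis .
    qed simp
  qed
  define f where "f r = (r * c) mod m" for r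
  have inj: "inj_on f {..<m}"
  proof (rule inj_onI)
    fix x y assume xy: "x \<in> {..<m}" "y \<in> {..<m}" "f x = f y"
    hence "[x * c = y * c] (mod m)" by (simp add: f_def cong_def)
    hence "[x = y] (mod m)" using c(1) by (simp add: cong_mult_rcancel_nat)
    thus "x = y" using xy by (simp add: cong_def)
  qed
  have "f ` {..<m} \<subseteq> {..<m}" using m by (auto simp: f_def)
  hence img: "f ` {..<m} = {..<m}" using inj by (intro endo_inj_surj) auto
  have "(\<Sum>n<m. g n) = (\<Sum>n\<in>f ` {..<m}. g n)" using img by simp
  also have "\<dots> = (\<Sum>n<m. g (f n))" by (subst sum.reindex[OF inj]) simp
  also have "\<dots> = (\<Sum>n<m. g n) * g c" unfolding f_def gmod dcharD(3)[OF g] by (simp add: sum_distrib_right)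
  finally have "(\<Sum>n<m. g n) * (1 - g c) = 0" by (simp add: right_diff_distrib)
  hence "(\<Sum>n<m. g n) = 0" using c(2) by simp
  thus ?thesis using dchar_sum_period[OF g] by simp
qed

text \<open>This is \<open>L(s, g)\<close> only when the period sum of \<open>g\<close> is zero; otherwise the pole has been subtracted.\<close>

definition Lfun :: "(nat \<Rightarrow> complex) \<Rightarrow> nat \<Rightarrow> complex \<Rightarrow> complex" where
  "Lfun g m s = (if s = 1 then deriv (cont g m) 1 else (cont g m s - cont g m 1) / (s - 1))"

lemma Lfun_holomorphic: "m > 0 \<Longrightarrow> Lfun g m holomorphic_on {s. Re s > 0}"
  unfolding Lfun_def[abs_def] by (intro pole_lemma_open cont_holomorphic open_halfspace_Re_gt)

lemma Lfun_eq_dser: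
  assumes g: "dchar m g" and zero: "(\<Sum>r=1..m. g r) = 0" and s: "Re s > 1"
  shows "Lfun g m s = dser g s"
proof -
  have m: "m > 0" using dcharD(1)[OF g] .
  have "cont g m s = (s - 1) * dser g s"
    by (rule cont_eq) (use m s dcharD(4,5)[OF g] in auto)
  moreover have "cont g m 1 = 0" using cont_at_1[OF m, of g] zero by simp
  ultimately show ?thesis using s by (auto simp: Lfun_def)
qed

lemma real_at_right_1_tendsto:
  fixes f :: "complex \<Rightarrow> complex"
  assumes "f holomorphic_on {s. Re s > 0}"
  shows "((\<lambda>\<sigma>. f (of_real \<sigma>)) \<longlongrightarrow> f 1) (at_right 1)"
proof -
  have "continuous_on {s. Re s > 0} f" using assms holomorphic_on_imp_continuous_on by blast
  hence "isCont f 1" using open_halfspace_Re_gt[of 0] by (simp add: continuous_on_eq_continuous_at)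
  moreover have "((\<lambda>\<sigma>::real. complex_of_real \<sigma>) \<longlongrightarrow> of_real 1) (at_right 1)"
    by (intro tendsto_intros)
  ultimately show ?thesis using isCont_tendsto_compose[of 1 f "\<lambda>\<sigma>::real. complex_of_real \<sigma>" "at_right 1"] by simp
qed

lemma dser_tendsto_Lfun:
  assumes g: "dchar m g" and zero: "(\<Sum>r=1..m. g r) = 0"
  shows "((\<lambda>\<sigma>. dser g (of_real \<sigma>)) \<longlongrightarrow> Lfun g m 1) (at_right 1)"
proof (rule Lim_transform_eventually[OF real_at_right_1_tendsto[OF Lfun_holomorphic[OF dcharD(1)[OF g]]]])
  show "\<forall>\<^sub>F \<sigma> in at_right 1. Lfun g m (of_real \<sigma>) = dser g (of_real \<sigma>)"
    using eventually_at_right_less[of "1::real"] by eventually_elim (use Lfun_eq_dser[OF g zero] in auto)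
qed

text \<open>For \<open>\<sigma> > 1\<close> Abel summation bounds the tail beyond \<open>N\<close>
  by \<open>2 m N^(-\<sigma>)\<close>, hence by \<open>2 m / N\<close> uniformly in
  \<open>\<sigma>\<close>. Letting \<open>\<sigma>\<close> tend to 1 carries the bound over to the
  conditionally convergent series.\<close>

lemma partial_sum_Lfun_1:
  assumes g: "dchar m g" and zero: "(\<Sum>r=1..m. g r) = 0" and N: "N \<ge> 1"
  shows "norm (Lfun g m 1 - (\<Sum>n<N. g n * of_real (real n powr (-1)))) \<le> 2 * real m * real N powr (-1)"
proof -
  have bd: "norm (dser g (of_real \<sigma>) - (\<Sum>n<N. g n * of_real (real n powr (- \<sigma>)))) \<le> 2 * real m * real N powr (-1)"
    if s: "\<sigma> > 1" for \<sigma> :: real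
  proof -
    define f where "f n = g n * of_real (real n powr (- \<sigma>))" for n
    have feq: "g n * of_nat n powr (- of_real \<sigma>) = f n" for n
      unfolding f_def using powr_of_real[of "real n" "- \<sigma>"] by simp
    have "summable (\<lambda>n. g n * of_nat n powr (- of_real \<sigma>))"
      by (rule summable_norm_cancel[OF dchar_summable[OF g]]) (use s in simp)
    hence "f sums dser g (of_real \<sigma>)" unfolding dser_def feq by (rule summable_sums)
    hence lim: "(\<lambda>K. (\<Sum>n<K. f n)) \<longlonglongrightarrow> dser g (of_real \<sigma>)" unfolding sums_def .
    hence "(\<lambda>K. norm ((\<Sum>n<K. f n) - (\<Sum>n<N. f n))) \<longlonglongrightarrow> norm (dser g (of_real \<sigma>) - (\<Sum>n<N. f n))"
      by (intro tendsto_intros)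
    moreover have "norm ((\<Sum>n<K. f n) - (\<Sum>n<N. f n)) \<le> 2 * real m * real N powr (-1)" if K: "K \<ge> N" for K
    proof -
      have "(\<Sum>n<K. f n) - (\<Sum>n<N. f n) = (\<Sum>n=N..<K. f n)"
        using sum.atLeastLessThan_concat[of 0 N K f] K by (simp add: lessThan_atLeast0 algebra_simps)
      also have "norm \<dots> \<le> 2 * real m * real N powr (- \<sigma>)"
        unfolding f_def
      proof (rule abel_summation_bound[OF dchar_partial_sum_bound[OF g zero] _ _ K])
        show "real (Suc n) powr (- \<sigma>) \<le> real n powr (- \<sigma>)" if "n \<ge> N" for n
          using that N s by (intro powr_mono2') auto
      qed auto
      also have "\<dots> \<le> 2 * real m * real N powr (-1)"
        using N s by (intro mult_left_mono powr_mono) auto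
      finally show ?thesis .
    qed
    ultimately have "norm (dser g (of_real \<sigma>) - (\<Sum>n<N. f n)) \<le> 2 * real m * real N powr (-1)"
      by (intro LIMSEQ_le_const2) auto
    thus ?thesis unfolding f_def .
  qed
  have pw: "((\<lambda>\<sigma>. real n powr (- \<sigma>)) \<longlongrightarrow> real n powr (-1)) (at_right 1)" for n
  proof (cases "n = 0")
    case False
    thus ?thesis by (intro tendsto_powr tendsto_const tendsto_minus tendsto_ident_at) auto
  qed simp
  have "((\<lambda>\<sigma>. norm (dser g (of_real \<sigma>) - (\<Sum>n<N. g n * of_real (real n powr (- \<sigma>))))) \<longlongrightarrow>
        norm (Lfun g m 1 - (\<Sum>n<N. g n * of_real (real n powr (-1))))) (at_right 1)"
    by (intro tendsto_norm tendsto_diff tendsto_sum tendsto_mult tendsto_const tendsto_of_real pw dser_tendsto_Lfun[OF g zero])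
  moreover have "\<forall>\<^sub>F \<sigma> in at_right 1. norm (dser g (of_real \<sigma>) - (\<Sum>n<N. g n * of_real (real n powr (- \<sigma>)))) \<le> 2 * real m * real N powr (-1)"
    using eventually_at_right_less[of "1::real"] by eventually_elim (rule bd)
  ultimately show ?thesis by (rule tendsto_upperbound) simp
qed

lemma partial_sums_tendsto_Lfun_1:
  assumes g: "dchar m g" and zero: "(\<Sum>r=1..m. g r) = 0"
  shows "(\<lambda>N. \<Sum>n<N. g n * of_real (real n powr (-1))) \<longlonglongrightarrow> Lfun g m 1"
proof -
  have "(\<lambda>N. 2 * real m * real N powr (-1)) \<longlonglongrightarrow> 2 * real m * 0"
    by (intro tendsto_intros tendsto_neg_powr filterlim_real_sequentially) auto
  hence lim: "(\<lambda>N. 2 * real m * real N powr (-1)) \<longlonglongrightarrow> 0" by (simp only: mult_zero_right)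
  have ev: "\<forall>\<^sub>F N in sequentially. norm (Lfun g m 1 - (\<Sum>n<N. g n * of_real (real n powr (-1)))) \<le> 2 * real m * real N powr (-1)"
    by (intro eventually_sequentiallyI[of 1] partial_sum_Lfun_1 g zero)
  have "(\<lambda>N. Lfun g m 1 - (\<Sum>n<N. g n * of_real (real n powr (-1)))) \<longlonglongrightarrow> 0"
    by (rule Lim_null_comparison[OF ev lim])
  hence "(\<lambda>N. Lfun g m 1 - (Lfun g m 1 - (\<Sum>n<N. g n * of_real (real n powr (-1))))) \<longlonglongrightarrow> Lfun g m 1 - 0"
    by (intro tendsto_diff tendsto_const)
  thus ?thesis by simp
qed

text \<open>On the real axis a zero of \<open>L(s, g)\<close> at 1 enters the 3-4-1 product with
  multiplicity at least 4, against the triple pole of the cubed zeta function; the series of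
  \<open>g^2\<close> stays bounded. The product would tend to 0 although it is at least 1.\<close>

lemma Lfun_1_nonzero_complex:
  assumes g: "dchar m g" and zero: "(\<Sum>r=1..m. g r) = 0" and zero2: "(\<Sum>r=1..m. g r ^ 2) = 0"
  shows "Lfun g m 1 \<noteq> 0"
proof
  assume L0: "Lfun g m 1 = 0"
  have m: "m > 0" using dcharD(1)[OF g] .
  note g2 = dchar_square[OF g]
  define q where "q = Lfun g m"
  define q2 where "q2 = Lfun (\<lambda>n. g n ^ 2) m"
  have 1: "((\<lambda>\<sigma>. cont (\<lambda>_. 1) 1 (of_real \<sigma>)) \<longlongrightarrow> cont (\<lambda>_. 1) 1 1) (at_right 1)"
    by (intro real_at_right_1_tendsto cont_holomorphic) auto
  have 2: "((\<lambda>\<sigma>. q2 (of_real \<sigma>)) \<longlongrightarrow> q2 1) (at_right 1)"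
    unfolding q2_def by (intro real_at_right_1_tendsto Lfun_holomorphic m)
  \<comment> \<open>The assumed zero is divided out: \<open>Q\<close> extends holomorphically to 1,
    and one factor \<open>\<sigma> - 1\<close> is left over in the product.\<close>
  define Q where "Q s = (if s = 1 then deriv q 1 else (q s - q 1) / (s - 1))" for s
  have "Q holomorphic_on {s. Re s > 0}"
    unfolding Q_def[abs_def] q_def by (intro pole_lemma_open Lfun_holomorphic m open_halfspace_Re_gt)
  hence 3: "((\<lambda>\<sigma>. Q (of_real \<sigma>)) \<longlongrightarrow> Q 1) (at_right 1)" by (rule real_at_right_1_tendsto)
  have "((\<lambda>\<sigma>::real. norm (cont (\<lambda>_. 1) 1 (of_real \<sigma>)) ^ 3 * norm (Q (of_real \<sigma>)) ^ 4 * norm (q2 (of_real \<sigma>)) * (\<sigma> - 1))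
      \<longlongrightarrow> norm (cont (\<lambda>_. 1) 1 1) ^ 3 * norm (Q 1) ^ 4 * norm (q2 1) * (1 - 1)) (at_right 1)"
    by (intro tendsto_intros 1 2 3)
  moreover have "\<forall>\<^sub>F \<sigma> in at_right 1. 1 \<le> norm (cont (\<lambda>_. 1) 1 (of_real \<sigma>)) ^ 3 * norm (Q (of_real \<sigma>)) ^ 4 * norm (q2 (of_real \<sigma>)) * (\<sigma> - 1)"
    using eventually_at_right_less[of "1::real"]
  proof eventually_elim
    case (elim \<sigma>)
    have n1: "norm (complex_of_real \<sigma> - 1) = \<sigma> - 1"
      using elim by (metis abs_of_nonneg diff_ge_0_iff_ge less_imp_le norm_of_real of_real_1 of_real_diff)
    have c: "cont (\<lambda>_. 1) 1 (of_real \<sigma>) = (of_real \<sigma> - 1) * dser (\<lambda>_. 1) (of_real \<sigma>)"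
      using elim by (intro cont_eq) auto
    have nc: "norm (cont (\<lambda>_. 1) 1 (of_real \<sigma>)) = (\<sigma> - 1) * norm (dser (\<lambda>_. 1) (of_real \<sigma>))"
      unfolding c norm_mult n1 ..
    have "Q (of_real \<sigma>) = dser g (of_real \<sigma>) / (of_real \<sigma> - 1)"
      using elim Lfun_eq_dser[OF g zero, of "of_real \<sigma>"] L0 unfolding Q_def q_def by auto
    hence nQ: "norm (Q (of_real \<sigma>)) = norm (dser g (of_real \<sigma>)) / (\<sigma> - 1)" by (simp add: norm_divide n1)
    have nq2: "q2 (of_real \<sigma>) = dser (\<lambda>n. g n ^ 2) (of_real \<sigma>)"
      unfolding q2_def by (rule Lfun_eq_dser[OF g2 zero2]) (use elim in auto)
    have "1 \<le> norm (dser (\<lambda>_. 1) (of_real \<sigma>)) ^ 3 * norm (dser g (of_real \<sigma>)) ^ 4 * norm (dser (\<lambda>n. g n ^ 2) (of_real \<sigma>))"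
      using dchar_three_four_one[OF g, of "of_real \<sigma>"] elim by simp
    also have "\<dots> = norm (cont (\<lambda>_. 1) 1 (of_real \<sigma>)) ^ 3 * norm (Q (of_real \<sigma>)) ^ 4 * norm (q2 (of_real \<sigma>)) * (\<sigma> - 1)"
    proof -
      have "z ^ 3 * G ^ 4 * W = (t * z) ^ 3 * (G / t) ^ 4 * W * t" if "t \<noteq> 0" for z G W t :: real
        using that by (simp add: field_simps power_numeral_reduce)
      moreover have "\<sigma> - 1 \<noteq> 0" using elim by simp
      ultimately show ?thesis unfolding nc nQ nq2 by blast
    qed
    finally show ?case .
  qed
  ultimately have "1 \<le> norm (cont (\<lambda>_. 1) 1 1) ^ 3 * norm (Q 1) ^ 4 * norm (q2 1) * (1 - 1::real)"
    by (rule tendsto_lowerbound) simp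
  thus False by simp
qed

lemma divisors_prime_power_times:
  fixes p M :: nat
  assumes p: "prime p" "\<not> p dvd M" "M > 0"
  shows "bij_betw (\<lambda>(i, d). p ^ i * d) ({..k} \<times> {d. d dvd M}) {d. d dvd p ^ k * M}"
proof (rule bij_betwI')
  have nd: "\<not> p dvd d" if "d dvd M" for d using p that dvd_trans by blast
  fix x y assume xy: "x \<in> {..k} \<times> {d. d dvd M}" "y \<in> {..k} \<times> {d. d dvd M}"
  obtain i d j e where e: "x = (i, d)" "y = (j, e)" by (metis surj_pair)
  have "i = j \<and> d = e" if eq: "p ^ i * d = p ^ j * e"
  proof -
    have d0: "d > 0" "e > 0" using xy e p(3) by (auto intro: Nat.gr0I)
    have "multiplicity p (p ^ i * d) = i" "multiplicity p (p ^ j * e) = j"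
      using p(1) nd xy e d0 by (auto simp: prime_elem_multiplicity_mult_distrib not_dvd_imp_multiplicity_0)
    hence "i = j" using eq by simp
    thus ?thesis using eq p(1) by auto
  qed
  thus "((case x of (i, d) \<Rightarrow> p ^ i * d) = (case y of (i, d) \<Rightarrow> p ^ i * d)) = (x = y)"
    unfolding e by auto
next
  fix x assume "x \<in> {..k} \<times> {d. d dvd M}"
  thus "(case x of (i, d) \<Rightarrow> p ^ i * d) \<in> {d. d dvd p ^ k * M}"
    by (auto intro!: mult_dvd_mono le_imp_power_dvd)
next
  fix y assume y: "y \<in> {d. d dvd p ^ k * M}"
  have "y > 0" using y p by (auto intro!: Nat.gr0I simp: prime_gt_0_nat)
  define i where "i = multiplicity p y"
  obtain d where d: "y = p ^ i * d" "\<not> p dvd d"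
    unfolding i_def using multiplicity_decompose'[of y p] \<open>y > 0\<close> p(1)
    by (metis not_prime_unit gr_implies_not0)
  have "p ^ i dvd p ^ k * M" using y d by (auto intro: dvd_mult_left)
  moreover have "coprime (p ^ i) M" using p by (simp add: prime_imp_coprime)
  ultimately have "p ^ i dvd p ^ k" by (simp add: coprime_dvd_mult_left_iff)
  hence "i \<le> k" using p(1) prime_gt_1_nat by (simp add: power_dvd_imp_le)
  moreover have "d dvd p ^ k * M" using y d by (auto intro: dvd_mult_right)
  hence "d dvd M" using d(2) p(1) prime_imp_coprime[of p d]
    by (simp add: coprime_dvd_mult_right_iff coprime_commute)
  ultimately show "\<exists>x\<in>{..k} \<times> {d. d dvd M}. y = (case x of (i, d) \<Rightarrow> p ^ i * d)" using d by force
qed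

text \<open>Monsky's elementary argument: if \<open>\<Sum> h(n)/n = 0\<close>, the Lambert series \<open>\<Sum> h(n) x\<^sup>n / (1 - x\<^sup>n)\<close> stays
  bounded as \<open>x \<rightarrow> 1\<close>, yet its coefficients are nonnegative and at least 1 at the squares.\<close>

locale real_char =
  fixes h :: "nat \<Rightarrow> real"
  assumes h1: "h 1 = 1" and hmult: "\<And>a b. h (a * b) = h a * h b" and hval: "\<And>n. h n \<in> {-1, 0, 1}"
begin

definition rsum :: "nat \<Rightarrow> real" where "rsum N = (\<Sum>d | d dvd N. h d)"

lemma h_power: "h (a ^ k) = h a ^ k"
  by (induction k) (auto simp: hmult, use h1 in auto)

lemma rsum_prime_power:
  assumes "prime p" "\<not> p dvd M" "M > 0"
  shows "rsum (p ^ k * M) = (\<Sum>i\<le>k. h p ^ i) * rsum M"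
proof -
  have "rsum (p ^ k * M) = (\<Sum>x\<in>{..k} \<times> {d. d dvd M}. h (case x of (i, d) \<Rightarrow> p ^ i * d))"
    unfolding rsum_def using sum.reindex_bij_betw[OF divisors_prime_power_times[OF assms, of k], of h] by simp
  also have "\<dots> = (\<Sum>x\<in>{..k} \<times> {d. d dvd M}. case x of (i, d) \<Rightarrow> h p ^ i * h d)"
    by (intro sum.cong) (auto simp: hmult h_power)
  also have "\<dots> = (\<Sum>i\<le>k. h p ^ i) * rsum M"
    unfolding rsum_def by (simp add: sum_product sum.cartesian_product)
  finally show ?thesis .
qed

text \<open>For \<open>h p\<close> equal to 1, 0 or -1 the sum is \<open>k + 1\<close>, 1 (from
  \<open>0 ^ 0\<close>), or an alternating sum that is 1 for even \<open>k\<close> and 0 for odd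
  \<open>k\<close>.\<close>

lemma geo_nonneg: "(\<Sum>i\<le>k. h p ^ i) \<ge> 0" and geo_even: "even k \<Longrightarrow> (\<Sum>i\<le>k. h p ^ i) \<ge> 1"
proof -
  have m: "(\<Sum>i\<le>k. (-1::real) ^ i) = (if even k then 1 else 0)" for k by (induction k) auto
  have z: "(\<Sum>i\<le>k. (0::real) ^ i) = 1" by (induction k) auto
  show "(\<Sum>i\<le>k. h p ^ i) \<ge> 0" using hval[of p] m z by auto
  show "(\<Sum>i\<le>k. h p ^ i) \<ge> 1" if "even k" using hval[of p] m z that by auto
qed

lemma prime_decompose:
  assumes "n > (1::nat)"
  obtains p k M where "prime p" "\<not> p dvd M" "M > 0" "n = p ^ k * M" "M < n"
proof -
  obtain p where p: "prime p" "p dvd n" using prime_factor_nat[of n] assms by auto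
  define k where "k = multiplicity p n"
  obtain M where M: "n = p ^ k * M" "\<not> p dvd M"
    unfolding k_def using multiplicity_decompose'[of n p] assms p(1) by (metis not_prime_unit not_less0 neq0_conv)
  have M0: "M > 0" using M assms by (auto intro!: Nat.gr0I)
  have "M \<noteq> n" using M(2) p(2) by auto
  moreover have "M \<le> n" using M(1) prime_gt_0_nat[OF p(1)] by simp
  ultimately show ?thesis using that p M M0 by auto
qed

lemma rsum_1: "rsum 1 = 1"
  using h1 by (simp add: rsum_def)

lemma rsum_nonneg: "n > 0 \<Longrightarrow> rsum n \<ge> 0"
proof (induction n rule: less_induct)
  case (less n)
  show ?case
  proof (cases "n = 1")
    case True thus ?thesis using rsum_1 by simp
  next
    case False
    hence "n > 1" using less.prems by simp
    then obtain p k M where "prime p" "\<not> p dvd M" "M > 0" "n = p ^ k * M" "M < n"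
      by (rule prime_decompose)
    thus ?thesis using rsum_prime_power geo_nonneg less.IH by simp
  qed
qed

lemma rsum_square: "n > 0 \<Longrightarrow> rsum (n ^ 2) \<ge> 1"
proof (induction n rule: less_induct)
  case (less n)
  show ?case
  proof (cases "n = 1")
    case True thus ?thesis using rsum_1 by simp
  next
    case False
    hence "n > 1" using less.prems by simp
    then obtain p k M where pM: "prime p" "\<not> p dvd M" "M > 0" "n = p ^ k * M" "M < n"
      by (rule prime_decompose)
    have "n ^ 2 = p ^ (2 * k) * M ^ 2" unfolding pM(4) by (simp add: power_mult_distrib power_mult[symmetric] mult.commute)
    moreover have "\<not> p dvd M ^ 2" using pM prime_dvd_power by blast
    ultimately have "rsum (n ^ 2) = (\<Sum>i\<le>2 * k. h p ^ i) * rsum (M ^ 2)"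
      using rsum_prime_power[of p "M ^ 2" "2 * k"] pM by simp
    moreover have "rsum (M ^ 2) \<ge> 1" using less.IH pM by blast
    moreover have "(\<Sum>i\<le>2 * k. h p ^ i) \<ge> 1" by (rule geo_even) simp
    ultimately show ?thesis using mult_mono[of 1 "\<Sum>i\<le>2 * k. h p ^ i" 1 "rsum (M ^ 2)"] by simp
  qed
qed

text \<open>Writing \<open>N = d k\<close>, the cutoff \<open>N \<le> T\<close> becomes
  \<open>k \<le> T div d\<close>. Working with finite sums avoids rearranging double series; the
  price is that the inner geometric sums are incomplete.\<close>

lemma lambert_finite:
  "(\<Sum>N=1..T. rsum N * x ^ N) = (\<Sum>d=1..T. h d * (\<Sum>k=1..T div d. (x ^ d) ^ k))"
proof -
  have "(\<Sum>N=1..T. rsum N * x ^ N) = (\<Sum>N=1..T. \<Sum>d | d dvd N. h d * x ^ N)"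
    unfolding rsum_def by (simp add: sum_distrib_right)
  also have "\<dots> = (\<Sum>(N, d)\<in>(SIGMA N:{1..T}. {d. d dvd N}). h d * x ^ N)"
    by (subst sum.Sigma) auto
  also have "\<dots> = (\<Sum>(d, k)\<in>(SIGMA d:{1..T}. {1..T div d}). h d * (x ^ d) ^ k)"
  proof (rule sum.reindex_bij_witness[where i = "\<lambda>(d, k). (d * k, d)" and j = "\<lambda>(N, d). (d, N div d)"], goal_cases)
    case (2 a)
    then obtain N d where "a = (N, d)" "1 \<le> N" "N \<le> T" "d dvd N" by auto
    moreover from this have "d \<ge> 1" "d \<le> N" by (auto intro: dvd_imp_le simp: Suc_le_eq intro!: Nat.gr0I)
    moreover from calculation have "N div d \<ge> 1" by (simp add: Suc_le_eq div_greater_zero_iff)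
    ultimately show ?case by (auto intro: div_le_mono)
  next
    case (4 b)
    then obtain d k where "b = (d, k)" "1 \<le> d" "1 \<le> k" "k \<le> T div d" by auto
    moreover from this have "d * k \<le> T" by (metis div_mult_self1_is_m le_trans mult.commute mult_le_mono1 times_div_less_eq_dividend)
    ultimately show ?case by auto
  qed (auto simp: power_mult)
  also have "\<dots> = (\<Sum>d=1..T. \<Sum>k=1..T div d. h d * (x ^ d) ^ k)"
    by (subst sum.Sigma) auto
  finally show ?thesis by (simp add: sum_distrib_left)
qed

end

text \<open>The terms with indices \<open>i\<close> and \<open>n - 1 - i\<close> are paired; by the
  inequality of arithmetic and geometric means each pair is at least
  \<open>2 y ^ (n - 1)\<close>.\<close>

lemma geometric_lower_bound:
  fixes y :: real
  assumes "0 \<le> y"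
  shows "real n * y ^ (n - 1) \<le> (\<Sum>i<n. (y\<^sup>2) ^ i)"
proof -
  have "2 * (\<Sum>i<n. (y\<^sup>2) ^ i) = (\<Sum>i<n. (y\<^sup>2) ^ i) + (\<Sum>i<n. (y\<^sup>2) ^ (n - Suc i))"
    unfolding sum.nat_diff_reindex by simp
  also have "\<dots> = (\<Sum>i<n. (y\<^sup>2) ^ i + (y\<^sup>2) ^ (n - Suc i))" by (simp add: sum.distrib)
  also have "\<dots> \<ge> (\<Sum>i<n. 2 * y ^ (n - 1))"
  proof (rule sum_mono)
    fix i assume "i \<in> {..<n}"
    hence "y ^ (n - 1) = y ^ i * y ^ (n - Suc i)" by (simp flip: power_add)
    moreover have "(y\<^sup>2) ^ i + (y\<^sup>2) ^ (n - Suc i) = (y ^ i)\<^sup>2 + (y ^ (n - Suc i))\<^sup>2"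
      by (simp add: power_mult[symmetric] mult.commute)
    ultimately show "2 * y ^ (n - 1) \<le> (y\<^sup>2) ^ i + (y\<^sup>2) ^ (n - Suc i)"
      using sum_squares_bound[of "y ^ i" "y ^ (n - Suc i)"] by simp
  qed
  finally show ?thesis by simp
qed

context real_char
begin

context
  fixes x :: real
  assumes x: "0 < x" "x < 1"
begin

definition G :: "nat \<Rightarrow> real" where "G n = (\<Sum>i<n. x ^ i)"

text \<open>For \<open>n \<ge> 1\<close> this is \<open>1 / (n (1 - x)) - x^n / (1 - x^n)\<close>,
  the gap between a harmonic term and a Lambert term. Dividing by \<open>G n\<close> in place of
  \<open>1 - x ^ n\<close> pulls the common factor \<open>1 - x\<close> out.\<close>

definition b :: "nat \<Rightarrow> real" where "b n = (1 / real n - x ^ n / G n) / (1 - x)"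

lemma G_pos: "n \<ge> 1 \<Longrightarrow> G n > 0"
  unfolding G_def using x by (intro sum_pos) (auto simp: lessThan_empty_iff)

lemma one_minus_power: "1 - x ^ n = (1 - x) * G n"
  unfolding G_def by (rule one_diff_power_eq)

lemma b_nonneg: assumes "n \<ge> 1" shows "b n \<ge> 0"
proof -
  have "real n * x ^ n = (\<Sum>i<n. x ^ n)" by simp
  also have "\<dots> \<le> G n" unfolding G_def using x by (intro sum_mono power_decreasing) auto
  finally have "x ^ n / G n \<le> 1 / real n" using G_pos[OF assms] assms by (simp add: field_simps)
  thus ?thesis unfolding b_def using x by simp
qed

text \<open>The decrease amounts to \<open>x^n / (G n * G (n + 1)) \<le> 1 / (n (n + 1))\<close>,
  which follows from two instances of \<open>geometric_lower_bound\<close> at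
  \<open>y = sqrt x\<close>.\<close>

lemma b_antimono: assumes "n \<ge> 1" shows "b (Suc n) \<le> b n"
proof -
  define y where "y = sqrt x"
  have y: "0 \<le> y" "y \<le> 1" "y\<^sup>2 = x" unfolding y_def using x by auto
  have G1: "G (Suc n) = 1 + x * G n"
    unfolding G_def by (subst sum.lessThan_Suc_shift) (simp add: sum_distrib_left)
  have "real n * y ^ (n - 1) * (real (Suc n) * y ^ n) \<le> G n * G (Suc n)"
    using geometric_lower_bound[OF y(1), of n] geometric_lower_bound[OF y(1), of "Suc n"] y
    unfolding G_def by (intro mult_mono) (auto simp: sum_nonneg)
  moreover have "real n * real (Suc n) * x ^ n \<le> real n * y ^ (n - 1) * (real (Suc n) * y ^ n)"
  proof -
    have "x ^ n = y ^ n * y ^ n" unfolding y(3)[symmetric] by (simp add: power2_eq_square power_mult_distrib)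
    also have "\<dots> \<le> y ^ (n - 1) * y ^ n" using y by (intro mult_right_mono power_decreasing) auto
    finally have "real n * real (Suc n) * x ^ n \<le> real n * real (Suc n) * (y ^ (n - 1) * y ^ n)" by (intro mult_left_mono) auto
    thus ?thesis by (simp add: algebra_simps)
  qed
  ultimately have ge: "real n * real (Suc n) * x ^ n \<le> G n * G (Suc n)" by linarith
  have Gp: "G n > 0" "G (Suc n) > 0" using G_pos assms by auto
  have "x ^ n / G n - x ^ Suc n / G (Suc n) = x ^ n * (G (Suc n) - x * G n) / (G n * G (Suc n))"
    using Gp by (simp add: field_simps)
  also have "\<dots> = x ^ n / (G n * G (Suc n))" unfolding G1 by simp
  also have "\<dots> \<le> 1 / (real n * real (Suc n))"
  proof -
    have pn: "real n * real (Suc n) > 0" using assms by simp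
    have "x ^ n \<le> (G n * G (Suc n)) / (real n * real (Suc n))"
      by (rule mult_imp_le_div_pos[OF pn]) (use ge in \<open>simp only: mult.commute[of "x ^ n"]\<close>)
    hence "x ^ n / (G n * G (Suc n)) \<le> (G n * G (Suc n)) / (real n * real (Suc n)) / (G n * G (Suc n))"
      using Gp by (intro divide_right_mono) auto
    thus ?thesis using Gp by simp
  qed
  also have "\<dots> = 1 / real n - 1 / real (Suc n)" using assms by (simp add: field_simps)
  finally have "1 / real (Suc n) - x ^ Suc n / G (Suc n) \<le> 1 / real n - x ^ n / G n" by linarith
  thus ?thesis unfolding b_def using x by (intro divide_right_mono) auto
qed

lemma b_1: "b 1 = 1"
  unfolding b_def G_def using x by simp

lemma norm_h_le: "\<bar>h n\<bar> \<le> 1" using hval[of n] by auto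

text \<open>Each Lambert term is replaced by \<open>1 / (d (1 - x)) - b d\<close>. This leaves the
  harmonic sum, an Abel sum bounded by \<open>2 C\<close> because \<open>b\<close> decreases from
  \<open>b 1 = 1\<close>, and the missing ends of the geometric sums.\<close>

lemma lambert_upper:
  assumes C: "\<And>K. \<bar>\<Sum>n<K. h n\<bar> \<le> C"
  shows "(\<Sum>N=1..T. rsum N * x ^ N) \<le> \<bar>\<Sum>n=1..T. h n / real n\<bar> / (1 - x) + 2 * C + real T * x ^ T / (1 - x)"
proof -
  have "(\<Sum>N=1..T. rsum N * x ^ N) = (\<Sum>d=1..T. h d / real d / (1 - x) - h d * b d - h d * (x ^ (d * (T div d + 1)) / (1 - x ^ d)))"
    unfolding lambert_finite
  proof (rule sum.cong[OF refl])
    fix d assume d: "d \<in> {1..T}"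
    define y where "y = x ^ d"
    define K where "K = T div d"
    have y1: "y < 1" unfolding y_def using power_strict_decreasing[of 0 d x] x d by simp
    have "(\<Sum>k=1..K. y ^ k) = (\<Sum>k<Suc K. y ^ k) - 1"
      by (simp add: lessThan_Suc_atMost atMost_atLeast0 sum.atLeast_Suc_atMost)
    also have "\<dots> = (y - y ^ (K + 1)) / (1 - y)"
      using one_diff_power_eq[of y "Suc K"] y1 by (simp add: field_simps)
    finally have 1: "(\<Sum>k=1..K. y ^ k) = y / (1 - y) - y ^ (K + 1) / (1 - y)" by (simp add: diff_divide_distrib)
    have 2: "y / (1 - y) = 1 / real d / (1 - x) - b d"
      unfolding y_def one_minus_power b_def by (simp add: diff_divide_distrib mult.commute)
    have e: "y ^ (K + 1) = x ^ (d * (T div d + 1))" unfolding y_def K_def by (simp only: power_mult)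
    have s: "(\<Sum>k=1..T div d. (x ^ d) ^ k) = 1 / real d / (1 - x) - b d - x ^ (d * (T div d + 1)) / (1 - x ^ d)"
      using 1[unfolded 2 e] unfolding K_def y_def .
    show "h d * (\<Sum>k=1..T div d. (x ^ d) ^ k) = h d / real d / (1 - x) - h d * b d - h d * (x ^ (d * (T div d + 1)) / (1 - x ^ d))"
      unfolding s by (simp only: right_diff_distrib times_divide_eq_right mult_1_right)
  qed
  also have "\<dots> = (\<Sum>d=1..T. h d / real d) / (1 - x) - (\<Sum>d=1..T. h d * b d) - (\<Sum>d=1..T. h d * (x ^ (d * (T div d + 1)) / (1 - x ^ d)))"
    by (simp add: sum_subtractf sum_divide_distrib)
  also have "\<dots> \<le> \<bar>\<Sum>n=1..T. h n / real n\<bar> / (1 - x) + 2 * C + real T * x ^ T / (1 - x)"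
  proof -
    have 1: "(\<Sum>d=1..T. h d / real d) / (1 - x) \<le> \<bar>\<Sum>n=1..T. h n / real n\<bar> / (1 - x)"
      using x by (intro divide_right_mono) auto
    have "norm (\<Sum>n=1..<Suc T. complex_of_real (h n) * of_real (b n)) \<le> 2 * C * b 1"
    proof (rule abel_summation_bound)
      fix K show "norm (\<Sum>n<K. complex_of_real (h n)) \<le> C"
        using C[of K] by (metis norm_of_real of_real_sum)
    qed (auto simp: b_antimono b_nonneg)
    moreover have "(\<Sum>n=1..<Suc T. complex_of_real (h n) * of_real (b n)) = of_real (\<Sum>n=1..T. h n * b n)"
      by (simp add: atLeastLessThanSuc_atLeastAtMost)
    ultimately have 2: "\<bar>\<Sum>n=1..T. h n * b n\<bar> \<le> 2 * C" unfolding b_1 by (simp only: norm_of_real mult_1_right)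
    have "\<bar>\<Sum>d=1..T. h d * (x ^ (d * (T div d + 1)) / (1 - x ^ d))\<bar> \<le> (\<Sum>d=1..T. x ^ T / (1 - x))"
    proof (rule order_trans[OF sum_abs], rule sum_mono)
      fix d assume d: "d \<in> {1..T}"
      have "x ^ d \<le> x ^ 1" using d x by (intro power_decreasing) auto
      hence xd: "1 - x \<le> 1 - x ^ d" by simp
      \<comment> \<open>The first exponent missing from an incomplete geometric sum lies beyond the
        cutoff.\<close>
      have "T < d * (T div d + 1)" using d dividend_less_times_div[of d T] by simp
      hence "x ^ (d * (T div d + 1)) \<le> x ^ T" using x by (intro power_decreasing) auto
      hence "x ^ (d * (T div d + 1)) / (1 - x ^ d) \<le> x ^ T / (1 - x)" using xd x by (intro frac_le) auto
      moreover have "\<bar>h d * (x ^ (d * (T div d + 1)) / (1 - x ^ d))\<bar> \<le> 1 * (x ^ (d * (T div d + 1)) / (1 - x ^ d))"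
        unfolding abs_mult using norm_h_le[of d] x xd by (intro mult_mono) auto
      ultimately show "\<bar>h d * (x ^ (d * (T div d + 1)) / (1 - x ^ d))\<bar> \<le> x ^ T / (1 - x)" by linarith
    qed
    hence 3: "\<bar>\<Sum>d=1..T. h d * (x ^ (d * (T div d + 1)) / (1 - x ^ d))\<bar> \<le> real T * x ^ T / (1 - x)" by simp
    show ?thesis using 1 2 3 by linarith
  qed
  finally show ?thesis .
qed

lemma lambert_lower:
  assumes "M\<^sup>2 \<le> T"
  shows "(\<Sum>j=1..M. x ^ (j\<^sup>2)) \<le> (\<Sum>N=1..T. rsum N * x ^ N)"
proof -
  have inj: "inj_on (\<lambda>j::nat. j\<^sup>2) {1..M}" by (auto simp: inj_on_def)
  have "(\<Sum>j=1..M. x ^ (j\<^sup>2)) \<le> (\<Sum>j=1..M. rsum (j\<^sup>2) * x ^ (j\<^sup>2))"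
    using rsum_square x by (intro sum_mono) (auto simp: mult_le_cancel_right1)
  also have "\<dots> = (\<Sum>N\<in>(\<lambda>j. j\<^sup>2) ` {1..M}. rsum N * x ^ N)" by (subst sum.reindex[OF inj]) simp
  also have "\<dots> \<le> (\<Sum>N=1..T. rsum N * x ^ N)"
  proof (rule sum_mono2)
    show "(\<lambda>j. j\<^sup>2) ` {1..M} \<subseteq> {1..T}"
    proof
      fix n assume "n \<in> (\<lambda>j. j\<^sup>2) ` {1..M}"
      then obtain j where j: "n = j\<^sup>2" "1 \<le> j" "j \<le> M" by auto
      have "j\<^sup>2 \<le> T" by (rule order_trans[OF power_mono assms]) (use j in auto)
      thus "n \<in> {1..T}" using j assms by (auto simp: Suc_le_eq)
    qed
  qed (use rsum_nonneg x in auto)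
  finally show ?thesis .
qed

lemma squares_bound:
  assumes C: "\<And>K. \<bar>\<Sum>n<K. h n\<bar> \<le> C" and lim: "(\<lambda>T. \<Sum>n=1..T. h n / real n) \<longlonglongrightarrow> 0"
  shows "(\<Sum>j=1..M. x ^ (j\<^sup>2)) \<le> 2 * C"
proof -
  have "(\<lambda>T. real T * x ^ T) \<longlonglongrightarrow> 0" using powser_times_n_limit_0[of x] x by simp
  hence "(\<lambda>T. \<bar>\<Sum>n=1..T. h n / real n\<bar> / (1 - x) + 2 * C + real T * x ^ T / (1 - x)) \<longlonglongrightarrow> \<bar>0\<bar> / (1 - x) + 2 * C + 0 / (1 - x)"
    using x by (intro tendsto_intros lim) auto
  moreover have "(\<Sum>j=1..M. x ^ (j\<^sup>2)) \<le> \<bar>\<Sum>n=1..T. h n / real n\<bar> / (1 - x) + 2 * C + real T * x ^ T / (1 - x)" if "T \<ge> M\<^sup>2" for T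
    using lambert_lower[OF that] lambert_upper[OF C, of T] by linarith
  ultimately have "(\<Sum>j=1..M. x ^ (j\<^sup>2)) \<le> \<bar>0\<bar> / (1 - x) + 2 * C + 0 / (1 - x)"
    by (intro LIMSEQ_le_const) auto
  thus ?thesis by simp
qed

end

text \<open>For fixed \<open>x\<close> the cutoff has already gone to infinity in
  \<open>squares_bound\<close>, which removed the harmonic sum and the truncation term. Letting
  \<open>x\<close> tend to 1 now gives \<open>M \<le> 2 C\<close> for every
  \<open>M\<close>.\<close>

lemma harmonic_sum_not_zero:
  assumes C: "\<And>K. \<bar>\<Sum>n<K. h n\<bar> \<le> C" and lim: "(\<lambda>T. \<Sum>n=1..T. h n / real n) \<longlonglongrightarrow> 0"
  shows False
proof -
  have "real M \<le> 2 * C" for M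
  proof -
    have "((\<lambda>x::real. \<Sum>j=1..M. x ^ (j\<^sup>2)) \<longlongrightarrow> (\<Sum>j=1..M. 1 ^ (j\<^sup>2))) (at_left 1)"
      by (intro tendsto_intros)
    moreover have "\<forall>\<^sub>F x in at_left (1::real). (\<Sum>j=1..M. x ^ (j\<^sup>2)) \<le> 2 * C"
      using eventually_at_left_real[of 0 1] by (rule eventually_mono) (use squares_bound[OF _ _ C lim] in auto)
    ultimately have "(\<Sum>j=1..M. (1::real) ^ (j\<^sup>2)) \<le> 2 * C" by (rule tendsto_upperbound) simp
    thus ?thesis by simp
  qed
  thus False using reals_Archimedean2[of "2 * C"] by (meson not_less)
qed

end

text \<open>If \<open>g^2\<close> differs from 1 at some unit, its period sum vanishes and the 3-4-1
  argument applies. Otherwise \<open>g\<close> takes only the values 0, 1 and -1, and the Lambert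
  series argument takes over.\<close>

theorem Lfun_1_nonzero:
  assumes g: "dchar m g" and zero: "(\<Sum>r=1..m. g r) = 0"
  shows "Lfun g m 1 \<noteq> 0"
proof (cases "\<exists>c. coprime c m \<and> g c ^ 2 \<noteq> 1")
  case True
  then obtain c where "coprime c m" "g c ^ 2 \<noteq> 1" by blast
  hence "(\<Sum>r=1..m. g r ^ 2) = 0" by (rule dchar_sum_zero[OF dchar_square[OF g]])
  thus ?thesis by (rule Lfun_1_nonzero_complex[OF g zero])
next
  case False
  define h where "h n = Re (g n)" for n
  have gv: "g n = 0 \<or> g n = 1 \<or> g n = -1" for n
  proof (cases "coprime n m")
    case True
    hence "g n ^ 2 = 1" using False by blast
    thus ?thesis by (simp add: power2_eq_1_iff)
  qed (use dcharD(6)[OF g] in auto)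
  have gh: "g n = of_real (h n)" for n using gv[of n] by (auto simp: h_def)
  interpret real_char h
  proof
    show "h 1 = 1" using dcharD(2)[OF g] by (simp add: h_def)
    show "h (a * b) = h a * h b" for a b
      using dcharD(3)[OF g, of a b] unfolding gh by (metis of_real_eq_iff of_real_mult)
    show "h n \<in> {-1, 0, 1}" for n using gv[of n] by (auto simp: h_def)
  qed
  show ?thesis
  proof
    assume L0: "Lfun g m 1 = 0"
    have C: "\<bar>\<Sum>n<K. h n\<bar> \<le> real m" for K
      using dchar_partial_sum_bound[OF g zero, of K] unfolding gh by (metis norm_of_real of_real_sum)
    have "(\<lambda>N. \<Sum>n<N. g n * of_real (real n powr (-1))) \<longlonglongrightarrow> 0"
      using partial_sums_tendsto_Lfun_1[OF g zero] L0 by simp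
    moreover have "(\<Sum>n<N. g n * of_real (real n powr (-1))) = of_real (\<Sum>n<N. h n / real n)" for N
      unfolding gh of_real_sum by (intro sum.cong refl) (simp add: powr_minus_divide)
    ultimately have "(\<lambda>N. complex_of_real (\<Sum>n<N. h n / real n)) \<longlonglongrightarrow> of_real 0" by simp
    hence "(\<lambda>N. \<Sum>n<N. h n / real n) \<longlonglongrightarrow> 0" by (simp only: tendsto_of_real_iff)
    hence "(\<lambda>N. \<Sum>n<Suc N. h n / real n) \<longlonglongrightarrow> 0" by (rule LIMSEQ_Suc)
    moreover have "(\<Sum>n<Suc N. h n / real n) = (\<Sum>n=1..N. h n / real n)" for N
      by (simp add: lessThan_Suc_atMost atMost_atLeast0 sum.atLeast_Suc_atMost)
    ultimately have "(\<lambda>N. \<Sum>n=1..N. h n / real n) \<longlonglongrightarrow> 0" by simp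
    from harmonic_sum_not_zero[OF C this] show False .
  qed
qed

section \<open>The Dirichlet series of sums of two squares\<close>

lemma coprime_4_imp_odd: "coprime n (4::nat) \<longleftrightarrow> odd n"
  using coprime_power_right_iff[of n 2 2] by (simp add: coprime_right_2_iff_odd)

lemma dchar_chi4_mult:
  assumes g: "dchar m g" shows "dchar (4 * m) (\<lambda>n. chi4 n * g n)"
  unfolding dchar_def
proof (intro conjI allI impI)
  have m: "m > 0" using dcharD(1)[OF g] .
  show "4 * m > 0" using m by simp
  show "chi4 1 * g 1 = 1" using dcharD(2)[OF g] by (simp add: chi4_def)
  show "chi4 (a * b) * g (a * b) = chi4 a * g a * (chi4 b * g b)" for a b
    using chi4_mult dcharD(3)[OF g] by simp
  show "norm (chi4 n * g n) \<le> 1" for n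
    unfolding norm_mult using norm_chi4 dcharD(5)[OF g] by (simp add: mult_le_one)
  show "chi4 (n + 4 * m) * g (n + 4 * m) = chi4 n * g n" for n
  proof -
    have "g (n + k * m) = g n" for k
    proof (induction k)
      case (Suc k)
      thus ?case using dcharD(4)[OF g, of "n + k * m"] by (simp add: algebra_simps)
    qed simp
    moreover have "chi4 (n + 4 * m) = chi4 n" by (simp add: chi4_def)
    ultimately show ?thesis by simp
  qed
  show "chi4 n * g n = 0" if "\<not> coprime n (4 * m)" for n
  proof (cases "coprime n m")
    case True
    hence "\<not> coprime n 4" using that by simp
    hence "even n" using coprime_4_imp_odd by blast
    hence "n mod 4 \<noteq> 1" "n mod 4 \<noteq> 3" by presburger+
    hence "chi4 n = 0" unfolding chi4_def by simp
    thus ?thesis by simp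
  qed (use dcharD(6)[OF g] in auto)
qed

definition Aser :: "(nat \<Rightarrow> complex) \<Rightarrow> complex \<Rightarrow> complex" where
  "Aser g = dser (\<lambda>n. g n * of_real (indE n))"

text \<open>As an Euler product this is the product of \<open>1 / (1 - g(p)^2 p^(-2 s))\<close> over
  the primes 3 modulo 4. It converges absolutely for \<open>Re s > 1/2\<close>; the abscissa 3/4
  used below keeps the terms under \<open>n^(-3/2)\<close>.\<close>

definition Vser :: "(nat \<Rightarrow> complex) \<Rightarrow> complex \<Rightarrow> complex" where
  "Vser g s = dser (\<lambda>n. if only3 n then g n ^ 2 else 0) (2 * s)"

definition Hser :: "(nat \<Rightarrow> complex) \<Rightarrow> complex \<Rightarrow> complex" where
  "Hser g s = Vser g s / (1 - g 2 * 2 powr (- s))"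

lemma norm_indE: "0 \<le> indE n" "indE n \<le> 1" by (auto simp: indE_def)

lemma Aser_tame: "dchar m g \<Longrightarrow> tame (\<lambda>n. g n * of_real (indE n))"
  by (rule tame_bounded[of _ 1]) (auto simp: norm_mult indE_def dchar_def)

lemma norm_2_powr_lt: "Re s > 3/4 \<Longrightarrow> norm ((2::complex) powr (- s)) \<le> 2 powr (- (3/4))"
  using norm_nat_powr[of 2 s] by (simp add: powr_mono)

lemma two_powr_lt_1: "(2::real) powr (- (3/4)) < 1"
  by (rule powr_less_one) auto

text \<open>The sum of \<open>n^(-3/2)\<close> bounds the series from above; through the Euler
  product, the exponential of minus that sum bounds it from below.\<close>

lemma Vser_facts:
  assumes g: "dchar m g"
  shows "Vser g holomorphic_on {s. Re s > 3/4}"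
    and "\<exists>K. \<forall>s. Re s > 3/4 \<longrightarrow> norm (Vser g s) \<le> K \<and> norm (inverse (Vser g s)) \<le> K \<and> Vser g s \<noteq> 0"
proof -
  define c where "c n = (if only3 n then g n ^ 2 else 0)" for n
  have cn: "norm (c n) \<le> 1" for n unfolding c_def using dcharD(5)[OF g] by (simp add: norm_power power_le_one)
  have ct: "tame c" by (rule tame_bounded[OF cn])
  have V: "Vser g s = dser c (2 * s)" for s by (simp add: Vser_def c_def[abs_def])
  show "Vser g holomorphic_on {s. Re s > 3/4}"
  proof -
    have "(dser c \<circ> (\<lambda>s. 2 * s)) holomorphic_on {s. Re s > 3/4}"
      by (rule holomorphic_on_compose_gen[OF _ dser_holomorphic[OF ct]]) (auto intro!: holomorphic_intros)
    thus ?thesis by (simp add: o_def V[abs_def])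
  qed
  define K0 where "K0 = (\<Sum>n. real n powr (- (3/2)))"
  have sK: "summable (\<lambda>n. real n powr (- (3/2)))" by (simp add: summable_real_powr_iff)
  show "\<exists>K. \<forall>s. Re s > 3/4 \<longrightarrow> norm (Vser g s) \<le> K \<and> norm (inverse (Vser g s)) \<le> K \<and> Vser g s \<noteq> 0"
  proof (intro exI[of _ "max K0 (exp K0)"] allI impI)
    fix s :: complex assume s: "Re s > 3/4"
    define F where "F n = c n * of_nat n powr (- (2 * s))" for n
    have Fn: "norm (F n) \<le> real n powr (- (3/2))" for n
    proof -
      have "norm (F n) = norm (c n) * real n powr (- (2 * Re s))"
        unfolding F_def norm_mult using norm_nat_powr[of n "2 * s"] by simp
      also have "\<dots> \<le> 1 * real n powr (- (3/2))"
      proof (rule mult_mono[OF cn])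
        show "real n powr (- (2 * Re s)) \<le> real n powr (- (3/2))"
          using s by (cases "n = 0") (auto intro!: powr_mono)
      qed auto
      finally show ?thesis by simp
    qed
    have sF: "summable (\<lambda>n. norm (F n))" by (rule summable_comparison_test'[OF sK]) (use Fn in simp)
    have cmF: "cmul F" unfolding F_def[abs_def]
    proof (rule cmul_dser_term)
      show "c 1 = 1" unfolding c_def using only3_1 dcharD(2)[OF g] by simp
      show "c (a * b) = c a * c b" for a b
        unfolding c_def using only3_mult[of a b] dcharD(3)[OF g] by (simp add: power_mult_distrib)
    qed
    have Vs: "Vser g s = suminf F" by (simp only: V dser_def F_def[abs_def])
    have le: "(\<Sum>n. norm (F n)) \<le> K0" unfolding K0_def by (rule suminf_le) (use Fn sF sK in auto)
    have u: "norm (Vser g s) \<le> K0" unfolding Vs using summable_norm[OF sF] le by linarith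
    have l: "exp (- K0) \<le> norm (Vser g s)" 
    proof -
      have "exp (- K0) \<le> exp (- (\<Sum>n. norm (F n)))" using le by simp
      thus ?thesis unfolding Vs using euler_product_lower_bound[OF cmF sF] by linarith
    qed
    have nz: "Vser g s \<noteq> 0" unfolding Vs by (rule euler_product_nonzero[OF cmF sF])
    have "norm (inverse (Vser g s)) = inverse (norm (Vser g s))" by (rule norm_inverse)
    also have "\<dots> \<le> inverse (exp (- K0))" by (rule le_imp_inverse_le[OF l]) simp
    also have "\<dots> = exp K0" by (simp add: exp_minus)
    finally show "norm (Vser g s) \<le> max K0 (exp K0) \<and> norm (inverse (Vser g s)) \<le> max K0 (exp K0) \<and> Vser g s \<noteq> 0"
      using u nz by auto
  qed
qed

lemma two_factor:
  assumes g: "dchar m g" and s: "Re s > 3/4"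
  shows "norm (1 - g 2 * 2 powr (- s)) \<le> 2" "norm (1 - g 2 * 2 powr (- s)) \<ge> 1 - 2 powr (- (3/4))"
    "1 - g 2 * 2 powr (- s) \<noteq> 0"
proof -
  have "norm (g 2 * 2 powr (- s)) \<le> 1 * 2 powr (- (3/4))"
    unfolding norm_mult using dcharD(5)[OF g] norm_2_powr_lt[OF s] by (intro mult_mono) auto
  hence b: "norm (g 2 * 2 powr (- s)) \<le> 2 powr (- (3/4))" by simp
  show "norm (1 - g 2 * 2 powr (- s)) \<le> 2"
    using b two_powr_lt_1 norm_triangle_ineq4[of 1 "g 2 * 2 powr (- s)"] by simp
  show l: "norm (1 - g 2 * 2 powr (- s)) \<ge> 1 - 2 powr (- (3/4))"
    using b norm_triangle_ineq2[of 1 "g 2 * 2 powr (- s)"] by simp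
  show "1 - g 2 * 2 powr (- s) \<noteq> 0" using l two_powr_lt_1 by auto
qed

lemma Hser_facts:
  assumes g: "dchar m g"
  shows "Hser g holomorphic_on {s. Re s > 3/4}"
    and "\<exists>K. \<forall>s. Re s > 3/4 \<longrightarrow> norm (Hser g s) \<le> K \<and> norm (inverse (Hser g s)) \<le> K \<and> Hser g s \<noteq> 0"
proof -
  show "Hser g holomorphic_on {s. Re s > 3/4}"
    unfolding Hser_def[abs_def] using two_factor(3)[OF g] by (intro holomorphic_intros Vser_facts(1)[OF g]) auto
  obtain K where K: "\<And>s. Re s > 3/4 \<Longrightarrow> norm (Vser g s) \<le> K" "\<And>s. Re s > 3/4 \<Longrightarrow> norm (inverse (Vser g s)) \<le> K"
    "\<And>s. Re s > 3/4 \<Longrightarrow> Vser g s \<noteq> 0" using Vser_facts(2)[OF g] by metis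
  define a where "a = 1 - (2::real) powr (- (3/4))"
  have a: "a > 0" unfolding a_def using two_powr_lt_1 by simp
  show "\<exists>K. \<forall>s. Re s > 3/4 \<longrightarrow> norm (Hser g s) \<le> K \<and> norm (inverse (Hser g s)) \<le> K \<and> Hser g s \<noteq> 0"
  proof (intro exI[of _ "max (K / a) (K * 2)"] allI impI)
    fix s :: complex assume s: "Re s > 3/4"
    note tf = two_factor[OF g s]
    have K0: "K \<ge> 0" using K(1)[OF s] norm_ge_zero order_trans by blast
    have "norm (Hser g s) \<le> K / a" unfolding Hser_def norm_divide
      using tf K(1)[OF s] a K0 unfolding a_def by (intro frac_le) auto
    moreover have "norm (inverse (Hser g s)) \<le> K * 2"
    proof -
      have "inverse (Hser g s) = inverse (Vser g s) * (1 - g 2 * 2 powr (- s))" unfolding Hser_def by (simp add: divide_inverse)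
      thus ?thesis unfolding norm_mult using tf(1) K(2)[OF s] K0 by (simp only: norm_mult) (intro mult_mono, auto)
    qed
    moreover have "Hser g s \<noteq> 0" unfolding Hser_def using tf K(3)[OF s] by simp
    ultimately show "norm (Hser g s) \<le> max (K / a) (K * 2) \<and> norm (inverse (Hser g s)) \<le> max (K / a) (K * 2) \<and> Hser g s \<noteq> 0" by auto
  qed
qed

lemma Aser_square:
  assumes g: "dchar m g" and s: "Re s > 1"
  shows "Aser g s ^ 2 = dser g s * dser (\<lambda>n. chi4 n * g n) s * Hser g s"
proof -
  define F where "F n = g n * of_nat n powr (- s)" for n
  have cm: "cmul F" unfolding F_def by (rule cmul_dser_term) (use dcharD(2,3)[OF g] in auto)
  have sm: "summable (\<lambda>n. norm (F n))" unfolding F_def by (rule dchar_summable[OF g s])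
  have 1: "(\<Sum>n. of_real (indE n) * F n) = Aser g s" unfolding Aser_def dser_def F_def by (simp add: algebra_simps)
  have 2: "suminf F = dser g s" unfolding dser_def F_def ..
  have 3: "(\<Sum>n. chi4 n * F n) = dser (\<lambda>n. chi4 n * g n) s" unfolding dser_def F_def by (simp add: algebra_simps)
  have sq: "of_nat n powr (- (2 * s)) = (of_nat n powr (- s) :: complex) ^ 2" for n :: nat
  proof -
    have "- (2 * s) = - s + - s" by simp
    thus ?thesis by (simp only: powr_add power2_eq_square)
  qed
  have 4: "(\<Sum>n. if only3 n then F n ^ 2 else 0) = Vser g s"
    unfolding Vser_def dser_def F_def sq by (intro suminf_cong) (simp add: power_mult_distrib)
  have F2: "F 2 = g 2 * 2 powr (- s)" unfolding F_def by simp
  have "Aser g s ^ 2 * (1 - g 2 * 2 powr (- s)) = dser g s * dser (\<lambda>n. chi4 n * g n) s * Vser g s"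
    using indE_square[OF cm sm] unfolding 1 2 3 4 F2 .
  moreover have "1 - g 2 * 2 powr (- s) \<noteq> 0" using two_factor(3)[OF g] s by simp
  ultimately show ?thesis unfolding Hser_def by (simp add: field_simps)
qed

lemma slow_of_bounded:
  assumes hol: "f holomorphic_on {s. Re s > 3/4}" and b: "\<And>s. Re s > 3/4 \<Longrightarrow> norm (f s) \<le> K"
  shows "slow (farstrip d) f"
proof (rule slow_Cauchy[OF hol farstrip_open])
  show "farstrip d \<subseteq> {s. Re s > 3/4}" by (auto simp: farstrip_def)
  fix e :: real assume e: "e > 0"
  show "\<exists>r>0. \<exists>C. \<forall>s\<in>farstrip d. cball s r \<subseteq> {s. Re s > 3/4} \<and> (\<forall>z\<in>cball s r. norm (f z) \<le> C * (1 + \<bar>Im s\<bar>) powr e)"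
  proof (rule exI[of _ "1/8"], rule conjI, simp, rule exI[of _ "K"], rule ballI)
    fix s assume s: "s \<in> farstrip d"
    have sub: "Re z > 3/4" if "z \<in> cball s (1/8)" for z
      using that s abs_Re_le_cmod[of "s - z"] by (auto simp: farstrip_def dist_norm)
    show "cball s (1/8) \<subseteq> {s. Re s > 3/4} \<and> (\<forall>z\<in>cball s (1/8). norm (f z) \<le> K * (1 + \<bar>Im s\<bar>) powr e)"
    proof (intro conjI ballI subsetI)
      fix z assume z: "z \<in> cball s (1/8)"
      show "z \<in> {s. Re s > 3/4}" using sub[OF z] by simp
      have K0: "K \<ge> 0" using b[OF sub[OF z]] norm_ge_zero order_trans by blast
      have "(1 + \<bar>Im s\<bar>) powr e \<ge> 1" using e by (simp add: ge_one_powr_ge_zero)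
      hence "K * 1 \<le> K * (1 + \<bar>Im s\<bar>) powr e" using K0 by (intro mult_left_mono) auto
      thus "norm (f z) \<le> K * (1 + \<bar>Im s\<bar>) powr e" using b[OF sub[OF z]] by linarith
    qed
  qed
qed

lemma Aser_holomorphic: "dchar m g \<Longrightarrow> Aser g holomorphic_on {s. Re s > 1}"
  unfolding Aser_def by (intro dser_holomorphic Aser_tame)

text \<open>Only \<open>B = A^2\<close> is accessible. Its size bounds that of \<open>A\<close>, and
  differentiating gives \<open>A' = A * B' / (2 B)\<close>, where \<open>B\<close>, its derivative
  and its inverse are all of subpolynomial growth.\<close>

lemma Aser_slow:
  assumes g: "dchar m g" and d: "d > 0"
  shows "slow (farstrip d) (Aser g)"
proof -
  note g4 = dchar_chi4_mult[OF g]
  define L where "L = dser (\<lambda>n. chi4 n * g n)"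
  obtain K where K: "\<And>s. Re s > 3/4 \<Longrightarrow> norm (Hser g s) \<le> K" "\<And>s. Re s > 3/4 \<Longrightarrow> norm (inverse (Hser g s)) \<le> K"
    "\<And>s. Re s > 3/4 \<Longrightarrow> Hser g s \<noteq> 0" using Hser_facts(2)[OF g] by metis
  have H: "slow (farstrip d) (Hser g)" by (rule slow_of_bounded[OF Hser_facts(1)[OF g] K(1)])
  have Hi: "slow (farstrip d) (\<lambda>s. inverse (Hser g s))"
    by (rule slow_of_bounded[OF _ K(2)]) (intro holomorphic_on_inverse Hser_facts(1)[OF g], use K(3) in auto)
  define B where "B s = dser g s * L s * Hser g s" for s
  have B: "slow (farstrip d) B" unfolding B_def[abs_def] L_def
    by (intro slow_mult farstrip_open H dchar_slow[OF g d] dchar_slow[OF g4 d])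
  have Bi: "slow (farstrip d) (\<lambda>s. inverse (dser g s) * inverse (L s) * inverse (Hser g s))"
    unfolding L_def by (intro slow_mult farstrip_open Hi dser_inverse_slow[OF g d] dser_inverse_slow[OF g4 d])
  define \<psi> where "\<psi> s = (1/2) * (deriv B s * (inverse (dser g s) * inverse (L s) * inverse (Hser g s)))" for s
  have psi: "slow (farstrip d) \<psi>" unfolding \<psi>_def[abs_def]
    by (intro slow_mult farstrip_open slow_const slow_deriv B Bi)
  have hol: "Aser g holomorphic_on farstrip d"
    by (rule holomorphic_on_subset[OF Aser_holomorphic[OF g]]) (auto simp: farstrip_def)
  have AB: "Aser g s ^ 2 = B s" if "s \<in> farstrip d" for s
    unfolding B_def L_def using that by (intro Aser_square[OF g]) (auto simp: farstrip_def)
  have 0: "slow_upto 0 (farstrip d) (Aser g)"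
    unfolding slow_upto_def
  proof (intro conjI hol allI impI)
    fix j :: nat and e :: real assume j: "j \<le> 0" and e: "e > 0"
    obtain C where C: "\<And>s. s \<in> farstrip d \<Longrightarrow> norm (B s) \<le> C * (1 + \<bar>Im s\<bar>) powr (2 * e)"
      using slowD[OF B, of "2 * e" 0] e by auto
    show "\<exists>C. \<forall>s\<in>farstrip d. norm ((deriv ^^ j) (Aser g) s) \<le> C * (1 + \<bar>Im s\<bar>) powr e"
    proof (intro exI[of _ "sqrt C"] ballI)
      fix s assume s: "s \<in> farstrip d"
      have "norm (Aser g s) ^ 2 \<le> C * (1 + \<bar>Im s\<bar>) powr (2 * e)"
        using C[OF s] AB[OF s] by (metis norm_power)
      hence "norm (Aser g s) \<le> sqrt (C * (1 + \<bar>Im s\<bar>) powr (2 * e))" by (rule real_le_rsqrt)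
      also have "\<dots> = sqrt C * sqrt (((1 + \<bar>Im s\<bar>) powr e) ^ 2)"
        by (simp add: real_sqrt_mult power2_eq_square flip: powr_add)
      also have "sqrt (((1 + \<bar>Im s\<bar>) powr e) ^ 2) = (1 + \<bar>Im s\<bar>) powr e" by simp
      finally show "norm ((deriv ^^ j) (Aser g) s) \<le> sqrt C * (1 + \<bar>Im s\<bar>) powr e" using j by simp
    qed
  qed
  show ?thesis
  proof (rule slow_of_logderiv[OF farstrip_open hol 0 psi])
    fix s assume s: "s \<in> farstrip d"
    have re: "Re s > 1" using s by (simp add: farstrip_def)
    have dA: "(Aser g has_field_derivative deriv (Aser g) s) (at s)"
      by (rule holomorphic_derivI[OF hol farstrip_open s])
    hence "((\<lambda>s. Aser g s ^ 2) has_field_derivative 2 * Aser g s * deriv (Aser g) s) (at s)"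
      by (auto intro!: derivative_eq_intros)
    hence "(B has_field_derivative 2 * Aser g s * deriv (Aser g) s) (at s)"
      by (rule has_field_derivative_transform_within_open[OF _ farstrip_open s]) (rule AB)
    hence dB: "deriv B s = 2 * Aser g s * deriv (Aser g) s" by (rule DERIV_imp_deriv)
    have nz: "dser g s \<noteq> 0" "L s \<noteq> 0" "Hser g s \<noteq> 0"
      unfolding L_def using dser_nonzero[OF g re] dser_nonzero[OF g4 re] K(3)[of s] re by auto
    have A2: "Aser g s * Aser g s = dser g s * L s * Hser g s"
      using AB[OF s] unfolding B_def by (simp add: power2_eq_square)
    have "Aser g s * \<psi> s = deriv (Aser g) s * (Aser g s * Aser g s) * (inverse (dser g s) * inverse (L s) * inverse (Hser g s))"
      unfolding \<psi>_def dB by (simp add: algebra_simps)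
    also have "\<dots> = deriv (Aser g) s" unfolding A2 using nz by (simp add: field_simps)
    finally show "deriv (Aser g) s = Aser g s * \<psi> s" by simp
  qed
qed

section \<open>Behaviour of the series next to s = 1\<close>

lemma same_square_sign:
  fixes f P :: "complex \<Rightarrow> complex"
  assumes S: "connected S" and f: "continuous_on S f" and P: "continuous_on S P"
    and nz: "\<And>s. s \<in> S \<Longrightarrow> P s \<noteq> 0" and sq: "\<And>s. s \<in> S \<Longrightarrow> f s ^ 2 = P s ^ 2"
  shows "(\<forall>s\<in>S. f s = P s) \<or> (\<forall>s\<in>S. f s = - P s)"
proof -
  define h where "h s = f s / P s" for s
  have "continuous_on S h" unfolding h_def using nz by (intro continuous_intros f P) auto
  moreover have "h ` S \<subseteq> {1, -1}"
  proof
    fix y assume "y \<in> h ` S"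
    then obtain s where s: "s \<in> S" "y = f s / P s" by (auto simp: h_def)
    have "y ^ 2 = 1" unfolding s(2) power_divide using sq[OF s(1)] nz[OF s(1)] by simp
    thus "y \<in> {1, -1}" by (simp add: power2_eq_1_iff)
  qed
  ultimately have "h constant_on S"
    using S continuous_finite_range_constant finite_subset by (metis finite.emptyI finite.insertI)
  then obtain c where c: "\<And>s. s \<in> S \<Longrightarrow> h s = c" unfolding constant_on_def by blast
  show ?thesis
  proof (cases "S = {}")
    case False
    then obtain s0 where "s0 \<in> S" by blast
    hence "c = 1 \<or> c = -1" using c \<open>h ` S \<subseteq> {1, -1}\<close> by (metis image_subset_iff insertE singletonD)
    moreover have "f s = c * P s" if "s \<in> S" for s using c[OF that] nz[OF that] by (simp add: h_def field_simps)
    ultimately show ?thesis by auto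
  qed simp
qed

text \<open>\<open>B\<close> has no zero on a small disc, so it has a holomorphic root there. On the
  convex right part of the disc this root agrees with \<open>f\<close> up to one sign, and adjusting
  the sign continues \<open>f\<close> across the line.\<close>

lemma local_sqrt:
  fixes B f :: "complex \<Rightarrow> complex"
  assumes R: "open R" "1 \<in> R" and B: "B holomorphic_on R" "B 1 \<noteq> 0"
    and f: "continuous_on {s. Re s > 1} f" and sq: "\<And>s. Re s > 1 \<Longrightarrow> f s ^ 2 = B s"
  shows "\<exists>\<epsilon> Q. \<epsilon> > 0 \<and> Q holomorphic_on ball 1 \<epsilon> \<and> (\<forall>s\<in>ball 1 \<epsilon> \<inter> {s. Re s > 1}. f s = Q s) \<and> Q 1 ^ 2 = B 1"
proof -
  have "open (R \<inter> B -` (- {0}))"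
    using B(1) by (intro continuous_open_preimage holomorphic_on_imp_continuous_on R) auto
  moreover have "1 \<in> R \<inter> B -` (- {0})" using R B by auto
  ultimately obtain \<epsilon> where e: "\<epsilon> > 0" "ball 1 \<epsilon> \<subseteq> R \<inter> B -` (- {0})" by (meson openE)
  have hb: "B holomorphic_on ball 1 \<epsilon>" using B(1) e(2) holomorphic_on_subset by blast
  have nzB: "B z \<noteq> 0" if "z \<in> ball 1 \<epsilon>" for z using e(2) that by auto
  obtain P where P: "P holomorphic_on ball 1 \<epsilon>" "\<And>z. z \<in> ball 1 \<epsilon> \<Longrightarrow> B z = P z ^ 2"
    using contractible_imp_holomorphic_sqrt[OF hb convex_imp_contractible[OF convex_ball] nzB] by metis
  define S where "S = ball 1 \<epsilon> \<inter> {s. Re s > 1}"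
  have "connected S" unfolding S_def by (intro convex_connected convex_Int convex_ball convex_halfspace_Re_gt)
  moreover have "continuous_on S f" by (rule continuous_on_subset[OF f]) (auto simp: S_def)
  moreover have "continuous_on S P"
    by (rule continuous_on_subset[OF holomorphic_on_imp_continuous_on[OF P(1)]]) (auto simp: S_def)
  moreover have "P s \<noteq> 0" if "s \<in> S" for s
  proof
    assume "P s = 0"
    hence "B s = 0" using P(2)[of s] that by (simp add: S_def)
    thus False using that e(2) by (auto simp: S_def)
  qed
  moreover have "f s ^ 2 = P s ^ 2" if "s \<in> S" for s using sq[of s] P(2)[of s] that by (simp add: S_def)
  ultimately have sgn: "(\<forall>s\<in>S. f s = P s) \<or> (\<forall>s\<in>S. f s = - P s)" by (rule same_square_sign)
  have "1 \<in> ball 1 \<epsilon>" using e by simp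
  from sgn show ?thesis
  proof
    assume "\<forall>s\<in>S. f s = P s"
    thus ?thesis using e(1) P \<open>1 \<in> ball 1 \<epsilon>\<close> unfolding S_def by (intro exI[of _ \<epsilon>] exI[of _ P]) auto
  next
    assume "\<forall>s\<in>S. f s = - P s"
    moreover have "(\<lambda>s. - P s) holomorphic_on ball 1 \<epsilon>" using P(1) by (intro holomorphic_intros)
    ultimately show ?thesis using e(1) P(2) \<open>1 \<in> ball 1 \<epsilon>\<close> unfolding S_def
      by (intro exI[of _ \<epsilon>] exI[of _ "\<lambda>s. - P s"]) auto
  qed
qed

lemma holomorphic_bounded_on_cball:
  fixes Q :: "complex \<Rightarrow> complex"
  assumes "Q holomorphic_on ball 1 \<epsilon>" "\<epsilon> > 0"
  shows "\<exists>K\<ge>0. \<forall>s. norm (s - 1) \<le> \<epsilon> / 2 \<longrightarrow> norm (Q s) \<le> K"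
proof -
  have "continuous_on (cball 1 (\<epsilon> / 2)) Q"
    using holomorphic_on_imp_continuous_on[OF assms(1)] by (rule continuous_on_subset) (use assms in auto)
  hence "bounded (Q ` cball 1 (\<epsilon> / 2))" by (intro compact_imp_bounded compact_continuous_image) auto
  then obtain K where "K > 0" "\<And>y. y \<in> Q ` cball 1 (\<epsilon> / 2) \<Longrightarrow> norm y \<le> K" by (auto simp: bounded_pos)
  thus ?thesis by (intro exI[of _ K]) (auto simp: dist_norm norm_minus_commute)
qed

lemma quadratic_nonzero:
  assumes "Re s > 0" shows "s * (s + 1) \<noteq> (0::complex)"
proof -
  have "Re (s + 1) > 0" using assms by simp
  hence "s + 1 \<noteq> 0" by (metis less_irrefl zero_complex.sel(1))
  moreover have "s \<noteq> 0" using assms by auto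
  ultimately show ?thesis by simp
qed

text \<open>An integrable majorant in \<open>t = Im s\<close> that is uniform in \<open>Re s > 1\<close>.\<close>

definition Gmaj :: "real \<Rightarrow> real" where "Gmaj t = \<bar>t\<bar> powr (- 1/2) / (1 + \<bar>t\<bar>)"

lemma Gmaj_lower:
  assumes "t \<noteq> 0" shows "(1 + \<bar>t\<bar>) powr (- 3/2) \<le> Gmaj t"
proof -
  have "(- 3/2 :: real) = - 1/2 + (-1)" by simp
  hence "(1 + \<bar>t\<bar>) powr (- 3/2) = (1 + \<bar>t\<bar>) powr (- 1/2) * (1 + \<bar>t\<bar>) powr (-1)"
    by (simp only: powr_add)
  also have "\<dots> = (1 + \<bar>t\<bar>) powr (- 1/2) / (1 + \<bar>t\<bar>)" by (simp add: powr_minus_divide)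
  also have "\<dots> \<le> Gmaj t" unfolding Gmaj_def using assms by (intro divide_right_mono powr_mono2') auto
  finally show ?thesis .
qed

text \<open>Decay of order -3/2 away from 1 and a singularity of order 1/2 at 1 both lie below a
  multiple of \<open>Gmaj\<close>, uniformly in the real part since
  \<open>|Im s| \<le> norm (s - 1)\<close>. Points with \<open>Im s = 0\<close> are excluded because
  \<open>Gmaj 0 = 0\<close> by the convention for \<open>powr\<close>.\<close>

lemma strip_bound_combine:
  assumes e: "\<epsilon> > 0" and far: "\<And>s. s \<in> farstrip (\<epsilon> / 2) \<Longrightarrow> norm (f s) \<le> C1 * (1 + \<bar>Im s\<bar>) powr (- 3/2)"
    and near: "\<And>s. 1 < Re s \<Longrightarrow> norm (s - 1) \<le> \<epsilon> / 2 \<Longrightarrow> norm (f s) \<le> C2 * norm (s - 1) powr (- 1/2)"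
    and C: "C1 \<ge> 0" "C2 \<ge> 0"
  shows "\<exists>C\<ge>0. \<forall>s. 1 < Re s \<and> Re s < 3 \<and> Im s \<noteq> 0 \<longrightarrow> norm (f s :: complex) \<le> C * Gmaj (Im s)"
proof (intro exI[of _ "C1 + C2 * (1 + \<epsilon> / 2)"] conjI allI impI)
  show "0 \<le> C1 + C2 * (1 + \<epsilon> / 2)" using C e by simp
  fix s assume s: "1 < Re s \<and> Re s < 3 \<and> Im s \<noteq> 0"
  have G0: "Gmaj (Im s) \<ge> 0" unfolding Gmaj_def by simp
  have C2e: "C2 * (1 + \<epsilon> / 2) \<ge> 0" using C e by simp
  show "norm (f s) \<le> (C1 + C2 * (1 + \<epsilon> / 2)) * Gmaj (Im s)"
  proof (cases "norm (s - 1) \<le> \<epsilon> / 2")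
    case True
    have "\<bar>Im s\<bar> \<le> norm (s - 1)" using abs_Im_le_cmod[of "s - 1"] by simp
    hence "norm (s - 1) powr (- 1/2) \<le> \<bar>Im s\<bar> powr (- 1/2)" using s by (intro powr_mono2') auto
    moreover have "\<bar>Im s\<bar> powr (- 1/2) = (1 + \<bar>Im s\<bar>) * Gmaj (Im s)" unfolding Gmaj_def by simp
    moreover have "(1 + \<bar>Im s\<bar>) * Gmaj (Im s) \<le> (1 + \<epsilon> / 2) * Gmaj (Im s)"
      using \<open>\<bar>Im s\<bar> \<le> norm (s - 1)\<close> True G0 by (intro mult_right_mono) auto
    ultimately have "norm (s - 1) powr (- 1/2) \<le> (1 + \<epsilon> / 2) * Gmaj (Im s)" by linarith
    hence "C2 * norm (s - 1) powr (- 1/2) \<le> C2 * ((1 + \<epsilon> / 2) * Gmaj (Im s))" using C by (intro mult_left_mono)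
    hence "norm (f s) \<le> C2 * (1 + \<epsilon> / 2) * Gmaj (Im s)" using near[OF _ True] s by (simp add: mult.assoc)
    moreover have "0 \<le> C1 * Gmaj (Im s)" using C G0 by simp
    ultimately show ?thesis unfolding distrib_right by linarith
  next
    case False
    hence "s \<in> farstrip (\<epsilon> / 2)" using s by (simp add: farstrip_def)
    hence "norm (f s) \<le> C1 * (1 + \<bar>Im s\<bar>) powr (- 3/2)" by (rule far)
    also have "\<dots> \<le> C1 * Gmaj (Im s)" using s C Gmaj_lower by (intro mult_left_mono) auto
    finally have "norm (f s) \<le> C1 * Gmaj (Im s)" .
    moreover have "0 \<le> C2 * (1 + \<epsilon> / 2) * Gmaj (Im s)" by (rule mult_nonneg_nonneg[OF C2e G0])
    ultimately show ?thesis unfolding distrib_right by linarith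
  qed
qed

text \<open>This is the Laplace transform of the smoothed sum of the coefficients;
  \<open>1 / (s (s + 1))\<close> comes from the weight \<open>1 - n / x\<close>.\<close>

definition Ar :: "(nat \<Rightarrow> complex) \<Rightarrow> complex \<Rightarrow> complex" where
  "Ar g s = Aser g s * inverse (s * (s + 1))"

lemma Ar_holomorphic: "dchar m g \<Longrightarrow> Ar g holomorphic_on {s. Re s > 1}"
  unfolding Ar_def[abs_def]
  by (intro holomorphic_intros Aser_holomorphic quadratic_nonzero) auto

lemma inverse_quadratic_deriv_bound:
  assumes s: "Re s > 1"
  shows "norm ((deriv ^^ j) (\<lambda>s. inverse (s * (s + 1))) s) \<le> fact j * 16 * 2 ^ j * (1 + \<bar>Im s\<bar>) powr (-2)"
proof -
  have zb: "norm z \<ge> (1 + \<bar>Im s\<bar>) / 4 \<and> norm (z + 1) \<ge> (1 + \<bar>Im s\<bar>) / 4 \<and> Re z \<ge> 1/2" if z: "norm (s - z) \<le> 1/2" for z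
  proof -
    have "\<bar>Re s - Re z\<bar> \<le> 1/2" using abs_Re_le_cmod[of "s - z"] z by simp
    hence re: "Re z \<ge> 1/2" using s by linarith
    have im: "\<bar>Im s - Im z\<bar> \<le> 1/2" using abs_Im_le_cmod[of "s - z"] z by simp
    have i2: "\<bar>Im s\<bar> \<le> \<bar>Im z\<bar> + 1/2" using im by linarith
    have nb: "norm z \<ge> Re z" "norm z \<ge> \<bar>Im z\<bar>" "norm (z + 1) \<ge> Re z" "norm (z + 1) \<ge> \<bar>Im z\<bar>"
      using abs_Re_le_cmod[of z] abs_Im_le_cmod[of z] abs_Re_le_cmod[of "z + 1"] abs_Im_le_cmod[of "z + 1"] by auto
    have "norm z \<ge> (1 + \<bar>Im s\<bar>) / 4" using nb(1,2) re i2 by (simp add: field_simps)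
    moreover have "norm (z + 1) \<ge> (1 + \<bar>Im s\<bar>) / 4" using nb(3,4) re i2 by (simp add: field_simps)
    ultimately show ?thesis using re by blast
  qed
  have nz: "z \<noteq> 0 \<and> z + 1 \<noteq> 0" if "norm (s - z) \<le> 1/2" for z
    using zb[OF that] by auto
  have hol: "(\<lambda>s. inverse (s * (s + 1))) holomorphic_on cball s (1/2)"
    using nz by (intro holomorphic_intros) (auto simp: dist_norm)
  have "norm ((deriv ^^ j) (\<lambda>s. inverse (s * (s + 1))) s) \<le> fact j * (16 * (1 + \<bar>Im s\<bar>) powr (-2)) / (1/2) ^ j"
  proof (rule Cauchy_inequality)
    show "(\<lambda>s. inverse (s * (s + 1))) holomorphic_on ball s (1/2)" by (rule holomorphic_on_subset[OF hol]) auto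
    show "continuous_on (cball s (1/2)) (\<lambda>s. inverse (s * (s + 1)))" by (rule holomorphic_on_imp_continuous_on[OF hol])
    fix z assume "norm (s - z) = 1/2"
    hence z: "norm z \<ge> (1 + \<bar>Im s\<bar>) / 4" "norm (z + 1) \<ge> (1 + \<bar>Im s\<bar>) / 4" using zb[of z] by auto
    have "((1 + \<bar>Im s\<bar>) / 4) * ((1 + \<bar>Im s\<bar>) / 4) \<le> norm (z * (z + 1))" unfolding norm_mult using z by (intro mult_mono) auto
    hence "inverse (norm (z * (z + 1))) \<le> inverse (((1 + \<bar>Im s\<bar>) / 4) * ((1 + \<bar>Im s\<bar>) / 4))"
      by (intro le_imp_inverse_le) auto
    also have "\<dots> = 16 * (1 + \<bar>Im s\<bar>) powr (-2)"
    proof -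
      have "(1 + \<bar>Im s\<bar>) powr (-2) = inverse ((1 + \<bar>Im s\<bar>) * (1 + \<bar>Im s\<bar>))"
        by (simp add: powr_minus powr_numeral power2_eq_square)
      thus ?thesis by (simp add: field_simps)
    qed
    finally show "norm (inverse (z * (z + 1))) \<le> 16 * (1 + \<bar>Im s\<bar>) powr (-2)" unfolding norm_inverse .
  qed simp
  thus ?thesis by (simp add: power_one_over field_simps)
qed

text \<open>In Leibniz's rule the derivatives of \<open>Aser\<close> are allowed growth 1/2 and
  those of \<open>1 / (s (s + 1))\<close> decay with order 2.\<close>

lemma Ar_far_bound:
  assumes g: "dchar m g" and d: "d > 0"
  shows "\<exists>C\<ge>0. \<forall>s\<in>farstrip d. norm ((deriv ^^ k) (Ar g) s) \<le> C * (1 + \<bar>Im s\<bar>) powr (- 3/2)"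
proof -
  have "\<forall>i. \<exists>C. \<forall>s\<in>farstrip d. norm ((deriv ^^ i) (Aser g) s) \<le> C * (1 + \<bar>Im s\<bar>) powr (1/2)"
    using slowD[OF Aser_slow[OF g d], of "1/2"] by simp
  then obtain A where A: "\<And>i s. s \<in> farstrip d \<Longrightarrow> norm ((deriv ^^ i) (Aser g) s) \<le> A i * (1 + \<bar>Im s\<bar>) powr (1/2)" by metis
  define C where "C = (\<Sum>i = 0..k. real (k choose i) * \<bar>A i\<bar> * (fact (k - i) * 16 * 2 ^ (k - i)))"
  show ?thesis
  proof (intro exI[of _ C] conjI ballI)
    show "0 \<le> C" unfolding C_def by (intro sum_nonneg) auto
    fix s assume s: "s \<in> farstrip d"
    have re: "Re s > 1" using s by (simp add: farstrip_def)
    let ?r = "\<lambda>s::complex. inverse (s * (s + 1))"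
    have h1: "Aser g holomorphic_on {s. Re s > 1}" by (rule Aser_holomorphic[OF g])
    have h2: "?r holomorphic_on {s. Re s > 1}" by (intro holomorphic_intros quadratic_nonzero) auto
    define X where "X = 1 + \<bar>Im s\<bar>"
    have X: "X powr (1/2) * X powr (-2) = X powr (- 3/2)" by (simp flip: powr_add)
    have "norm ((deriv ^^ k) (Ar g) s) = norm (\<Sum>i = 0..k. of_nat (k choose i) * (deriv ^^ i) (Aser g) s * (deriv ^^ (k - i)) ?r s)"
      unfolding Ar_def[abs_def] using re by (subst higher_deriv_mult[OF h1 h2 open_halfspace_Re_gt]) auto
    also have "\<dots> \<le> (\<Sum>i = 0..k. norm (of_nat (k choose i) * (deriv ^^ i) (Aser g) s * (deriv ^^ (k - i)) ?r s))" by (rule norm_sum)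
    also have "\<dots> \<le> (\<Sum>i = 0..k. (real (k choose i) * \<bar>A i\<bar> * (fact (k - i) * 16 * 2 ^ (k - i))) * X powr (- 3/2))"
    proof (rule sum_mono)
      fix i
      have "norm ((deriv ^^ i) (Aser g) s) \<le> A i * X powr (1/2)" using A[OF s] unfolding X_def .
      also have "\<dots> \<le> \<bar>A i\<bar> * X powr (1/2)" by (intro mult_right_mono) auto
      finally have a: "norm ((deriv ^^ i) (Aser g) s) \<le> \<bar>A i\<bar> * X powr (1/2)" .
      have b: "norm ((deriv ^^ (k - i)) ?r s) \<le> (fact (k - i) * 16 * 2 ^ (k - i)) * X powr (-2)"
        unfolding X_def by (rule inverse_quadratic_deriv_bound[OF re])
      have "norm ((deriv ^^ i) (Aser g) s) * norm ((deriv ^^ (k - i)) ?r s) \<le>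
          (\<bar>A i\<bar> * X powr (1/2)) * ((fact (k - i) * 16 * 2 ^ (k - i)) * X powr (-2))"
        by (intro mult_mono a b) auto
      also have "\<dots> = \<bar>A i\<bar> * (fact (k - i) * 16 * 2 ^ (k - i)) * (X powr (1/2) * X powr (-2))" by (simp only: ac_simps)
      finally have "real (k choose i) * (norm ((deriv ^^ i) (Aser g) s) * norm ((deriv ^^ (k - i)) ?r s)) \<le>
         real (k choose i) * (\<bar>A i\<bar> * (fact (k - i) * 16 * 2 ^ (k - i)) * X powr (- 3/2))"
        unfolding X by (intro mult_left_mono) auto
      thus "norm (of_nat (k choose i) * (deriv ^^ i) (Aser g) s * (deriv ^^ (k - i)) ?r s) \<le>
         (real (k choose i) * \<bar>A i\<bar> * (fact (k - i) * 16 * 2 ^ (k - i))) * X powr (- 3/2)"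
        unfolding norm_mult norm_of_nat by (simp only: mult.assoc)
    qed
    also have "\<dots> = C * X powr (- 3/2)" unfolding C_def by (simp add: sum_distrib_right)
    finally show "norm ((deriv ^^ k) (Ar g) s) \<le> C * (1 + \<bar>Im s\<bar>) powr (- 3/2)" unfolding X_def .
  qed
qed

text \<open>Neither L-function has a pole or a zero at 1, so \<open>Ar g\<close> continues
  holomorphically to a disc there and its derivatives are bounded. No main term has to be
  subtracted.\<close>

lemma Ar_deriv_bound_nonprincipal:
  assumes g: "dchar m g" and z1: "(\<Sum>r=1..m. g r) = 0" and z2: "(\<Sum>r=1..4 * m. chi4 r * g r) = 0"
  shows "\<exists>C\<ge>0. \<forall>s. 1 < Re s \<and> Re s < 3 \<and> Im s \<noteq> 0 \<longrightarrow> norm ((deriv ^^ k) (Ar g) s) \<le> C * Gmaj (Im s)"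
proof -
  note g4 = dchar_chi4_mult[OF g]
  have m: "m > 0" "4 * m > 0" using dcharD(1)[OF g] by auto
  define R where "R = {s. Re s > 3/4}"
  define B where "B s = Lfun g m s * Lfun (\<lambda>n. chi4 n * g n) (4 * m) s * Hser g s * (inverse (s * (s + 1))) ^ 2" for s
  have R1: "open R" unfolding R_def by (rule open_halfspace_Re_gt)
  have R2: "1 \<in> R" unfolding R_def by simp
  note R = R1 R2
  have Rs: "R \<subseteq> {s. Re s > 0}" unfolding R_def by auto
  have nzR: "s * (s + 1) \<noteq> 0" if "s \<in> R" for s using that by (intro quadratic_nonzero) (auto simp: R_def)
  have Bh: "B holomorphic_on R" unfolding B_def[abs_def]
    by (intro holomorphic_intros holomorphic_on_subset[OF Lfun_holomorphic[OF m(1)]]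
        holomorphic_on_subset[OF Lfun_holomorphic[OF m(2)]] Hser_facts(1)[OF g, folded R_def] Rs nzR)
  have "Hser g 1 \<noteq> 0" using Hser_facts(2)[OF g] by (auto dest: spec[of _ 1])
  hence B1: "B 1 \<noteq> 0" unfolding B_def using Lfun_1_nonzero[OF g z1] Lfun_1_nonzero[OF g4 z2] by simp
  have sq: "Ar g s ^ 2 = B s" if "Re s > 1" for s
    unfolding B_def Ar_def power_mult_distrib[of "Aser g s"] Aser_square[OF g that] Lfun_eq_dser[OF g z1 that] Lfun_eq_dser[OF g4 z2 that] ..
  obtain \<epsilon> Q where Q: "\<epsilon> > 0" "Q holomorphic_on ball 1 \<epsilon>" "\<And>s. s \<in> ball 1 \<epsilon> \<inter> {s. Re s > 1} \<Longrightarrow> Ar g s = Q s"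
    using local_sqrt[OF R Bh B1 holomorphic_on_imp_continuous_on[OF Ar_holomorphic[OF g]] sq] by auto
  define S where "S = ball 1 \<epsilon> \<inter> {s. Re s > 1}"
  have S: "open S" unfolding S_def by (intro open_Int open_ball open_halfspace_Re_gt)
  have eq: "(deriv ^^ k) (Ar g) s = (deriv ^^ k) Q s" if "s \<in> S" for s
  proof (rule higher_deriv_transform_within_open[OF _ _ S that])
    show "Ar g holomorphic_on S" by (rule holomorphic_on_subset[OF Ar_holomorphic[OF g]]) (auto simp: S_def)
    show "Q holomorphic_on S" by (rule holomorphic_on_subset[OF Q(2)]) (auto simp: S_def)
  qed (use Q(3) in \<open>auto simp: S_def\<close>)
  have "(deriv ^^ k) Q holomorphic_on ball 1 \<epsilon>" by (intro holomorphic_higher_deriv Q(2) open_ball)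
  then obtain K where K: "K \<ge> 0" "\<And>s. norm (s - 1) \<le> \<epsilon> / 2 \<Longrightarrow> norm ((deriv ^^ k) Q s) \<le> K"
    using holomorphic_bounded_on_cball Q(1) by blast
  have "\<epsilon> / 2 > 0" using Q(1) by simp
  from Ar_far_bound[OF g this, of k]
  obtain C1 where C1: "C1 \<ge> 0" "\<And>s. s \<in> farstrip (\<epsilon> / 2) \<Longrightarrow> norm ((deriv ^^ k) (Ar g) s) \<le> C1 * (1 + \<bar>Im s\<bar>) powr (- 3/2)" by auto
  show ?thesis
  proof (rule strip_bound_combine[OF Q(1) C1(2) _ C1(1), where ?C2.0 = "K * (\<epsilon> / 2) powr (1/2)"])
    fix s assume s: "1 < Re s" "norm (s - 1) \<le> \<epsilon> / 2"
    hence "s \<in> S" using Q(1) by (auto simp: S_def dist_norm norm_minus_commute)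
    hence "norm ((deriv ^^ k) (Ar g) s) \<le> K" using eq K(2)[OF s(2)] by simp
    also have "K = K * 1" by simp
    also have "K * 1 \<le> K * ((\<epsilon> / 2) powr (1/2) * norm (s - 1) powr (- 1/2))"
    proof (rule mult_left_mono[OF _ K(1)])
      have n0: "norm (s - 1) > 0" using s by auto
      have "(1::real) = norm (s - 1) powr (1/2) * norm (s - 1) powr (- 1/2)" using n0 by (simp flip: powr_add)
      also have "\<dots> \<le> (\<epsilon> / 2) powr (1/2) * norm (s - 1) powr (- 1/2)"
        using s by (intro mult_right_mono powr_mono2) auto
      finally show "1 \<le> (\<epsilon> / 2) powr (1/2) * norm (s - 1) powr (- 1/2)" .
    qed
    finally show "norm ((deriv ^^ k) (Ar g) s) \<le> K * (\<epsilon> / 2) powr (1/2) * norm (s - 1) powr (- 1/2)" by (simp only: mult.assoc)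
  qed (use K in auto)
qed

text \<open>Differentiating \<open>(s - 1)^a Q\<close> gives \<open>(s - 1)^(a - 1)\<close> times
  \<open>a Q + (s - 1) Q'\<close>. The value of the cofactor at 1 is multiplied by \<open>a\<close>
  each time, which produces the product of the exponents.\<close>

lemma powr_deriv_iterate:
  assumes Q: "Q holomorphic_on ball 1 \<epsilon>" and S: "S = ball 1 \<epsilon> \<inter> {s. Re s > 1}"
    and A: "\<And>s. s \<in> S \<Longrightarrow> A s = (s - 1) powr (- 1/2) * Q s"
  shows "\<exists>Qk. Qk holomorphic_on ball 1 \<epsilon> \<and> Qk 1 = (\<Prod>i<k. - 1/2 - of_nat i) * Q 1 \<and>
     (\<forall>s\<in>S. (deriv ^^ k) A s = (s - 1) powr (- 1/2 - of_nat k) * Qk s)"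
proof (induction k)
  case 0
  show ?case using Q A by (intro exI[of _ Q]) auto
next
  case (Suc k)
  then obtain Qk where Qk: "Qk holomorphic_on ball 1 \<epsilon>" "Qk 1 = (\<Prod>i<k. - 1/2 - of_nat i) * Q 1"
     "\<And>s. s \<in> S \<Longrightarrow> (deriv ^^ k) A s = (s - 1) powr (- 1/2 - of_nat k) * Qk s" by blast
  have So: "open S" unfolding S by (intro open_Int open_ball open_halfspace_Re_gt)
  define a :: complex where "a = - 1/2 - of_nat k"
  define R where "R s = a * Qk s + (s - 1) * deriv Qk s" for s
  show ?case
  proof (intro exI[of _ R] conjI ballI)
    show "R holomorphic_on ball 1 \<epsilon>" unfolding R_def[abs_def] by (intro holomorphic_intros Qk(1) open_ball)
    show "R 1 = (\<Prod>i<Suc k. - 1/2 - of_nat i) * Q 1" unfolding R_def a_def using Qk(2) by simp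
    fix s assume s: "s \<in> S"
    have nz: "s - 1 \<noteq> 0" and np: "s - 1 \<notin> \<real>\<^sub>\<le>\<^sub>0" using s by (auto simp: S complex_nonpos_Reals_iff)
    have dQ: "(Qk has_field_derivative deriv Qk s) (at s)"
      using holomorphic_derivI[OF Qk(1) open_ball, of s] s by (simp add: S)
    have dp: "((\<lambda>s. (s - 1) powr a) has_field_derivative a * (s - 1) powr (a - 1)) (at s)"
      using np by (auto intro!: derivative_eq_intros)
    have "((\<lambda>s. (s - 1) powr a * Qk s) has_field_derivative (a * (s - 1) powr (a - 1)) * Qk s + deriv Qk s * (s - 1) powr a) (at s)"
      by (rule DERIV_mult[OF dp dQ])
    also have "(a * (s - 1) powr (a - 1)) * Qk s + deriv Qk s * (s - 1) powr a = (s - 1) powr (a - 1) * R s"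
    proof -
      have "(s - 1) powr a = (s - 1) powr (a - 1) * (s - 1)"
        using nz powr_add[of "s - 1" "a - 1" 1] by simp
      thus ?thesis unfolding R_def by (simp only: distrib_left) (simp only: ac_simps)
    qed
    finally have "((deriv ^^ k) A has_field_derivative (s - 1) powr (a - 1) * R s) (at s)"
      by (rule has_field_derivative_transform_within_open[OF _ So s]) (use Qk(3) in \<open>simp add: a_def\<close>)
    hence "deriv ((deriv ^^ k) A) s = (s - 1) powr (a - 1) * R s" by (rule DERIV_imp_deriv)
    moreover have "a - 1 = - 1/2 - of_nat (Suc k)" unfolding a_def by simp
    ultimately show "(deriv ^^ Suc k) A s = (s - 1) powr (- 1/2 - of_nat (Suc k)) * R s" by simp
  qed
qed

lemma Taylor_bound_at_1:
  fixes Q :: "complex \<Rightarrow> complex"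
  assumes Q: "Q holomorphic_on ball 1 \<epsilon>" and e: "\<epsilon> > 0"
  shows "\<exists>K\<ge>0. \<forall>s. norm (s - 1) \<le> \<epsilon> / 2 \<longrightarrow>
    norm (Q s - (\<Sum>j\<le>k. (deriv ^^ j) Q 1 / fact j * (s - 1) ^ j)) \<le> K * norm (s - 1) ^ Suc k"
proof -
  have "(deriv ^^ Suc k) Q holomorphic_on ball 1 \<epsilon>" by (intro holomorphic_higher_deriv Q open_ball)
  then obtain K where K: "K \<ge> 0" "\<And>s. norm (s - 1) \<le> \<epsilon> / 2 \<Longrightarrow> norm ((deriv ^^ Suc k) Q s) \<le> K"
    using holomorphic_bounded_on_cball e by blast
  show ?thesis
  proof (intro exI[of _ "K / fact k"] conjI allI impI)
    show "0 \<le> K / fact k" using K by simp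
    fix s :: complex assume s: "norm (s - 1) \<le> \<epsilon> / 2"
    have "norm ((deriv ^^ 0) Q s - (\<Sum>j\<le>k. (deriv ^^ j) Q 1 * (s - 1) ^ j / fact j)) \<le> K * norm (s - 1) ^ Suc k / fact k"
    proof (rule complex_Taylor[where S = "cball 1 (\<epsilon> / 2)"])
      fix i x assume x: "x \<in> cball (1::complex) (\<epsilon> / 2)" "i \<le> k"
      have "x \<in> ball 1 \<epsilon>" using x e by auto
      hence "((deriv ^^ i) Q has_field_derivative deriv ((deriv ^^ i) Q) x) (at x)"
        by (intro holomorphic_derivI[OF holomorphic_higher_deriv[OF Q open_ball] open_ball])
      thus "((deriv ^^ i) Q has_field_derivative (deriv ^^ Suc i) Q x) (at x within cball 1 (\<epsilon> / 2))"
        by (simp add: has_field_derivative_at_within)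
    qed (use K s e in \<open>auto simp: dist_norm norm_minus_commute\<close>)
    thus "norm (Q s - (\<Sum>j\<le>k. (deriv ^^ j) Q 1 / fact j * (s - 1) ^ j)) \<le> K / fact k * norm (s - 1) ^ Suc k"
      by (simp add: mult.commute)
  qed
qed

lemma dchar_chi4: "dchar 4 chi4"
  using dchar_chi4_mult[OF dchar_one] by (simp only: mult_1_right)

lemma chi4_sum: "(\<Sum>r=1..4. chi4 r) = 0"
proof -
  have "{1..4} = {1, 2, 3, 4 :: nat}" by auto
  thus ?thesis by (simp add: chi4_def)
qed

text \<open>Near 1 the \<open>k\<close>-th derivative is \<open>(s - 1)^(-1/2 - k)\<close> times a
  holomorphic function. Removing the Taylor polynomial of degree \<open>k - 1\<close> of the latter
  gains \<open>|s - 1|^k\<close> and leaves \<open>|s - 1|^(-1/2)\<close>. The value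
  \<open>p0\<close> is recorded up to its square and its sign, which together determine it.\<close>

lemma Ar_one_expansion:
  assumes k: "k > 0"
  shows "\<exists>e p0 C. p0 ^ 2 = Lfun chi4 4 1 * Hser (\<lambda>_. 1) 1 \<and> p0 \<in> \<real>\<^sub>\<ge>\<^sub>0 \<and> e 0 = (\<Prod>i<k. - 1/2 - of_nat i) * (p0 / 2) \<and> C \<ge> 0 \<and>
    (\<forall>s. 1 < Re s \<and> Re s < 3 \<and> Im s \<noteq> 0 \<longrightarrow>
      norm ((deriv ^^ k) (Ar (\<lambda>_. 1)) s - (\<Sum>j<k. e j * (s - 1) powr (of_nat j - of_nat k - 1/2))) \<le> C * Gmaj (Im s))"
proof -
  define g :: "nat \<Rightarrow> complex" where "g = (\<lambda>_. 1)"
  have g: "dchar 1 g" unfolding g_def by (rule dchar_one)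
  define A where "A = Aser g"
  define R where "R = {s. Re s > 3/4}"
  define B where "B s = cont g 1 s * Lfun chi4 4 s * Hser g s" for s
  have R1: "open R" unfolding R_def by (rule open_halfspace_Re_gt)
  have R2: "1 \<in> R" unfolding R_def by simp
  note R = R1 R2
  have Rs: "R \<subseteq> {s. Re s > 0}" unfolding R_def by auto
  have Bh: "B holomorphic_on R" unfolding B_def[abs_def]
    by (intro holomorphic_intros holomorphic_on_subset[OF cont_holomorphic _ ] 
        holomorphic_on_subset[OF Lfun_holomorphic] Hser_facts(1)[OF g, folded R_def]) (use Rs in auto)
  have c1: "cont g 1 1 = 1" using cont_at_1[of 1 g] by (simp add: g_def)
  have B1v: "B 1 = Lfun chi4 4 1 * Hser g 1" unfolding B_def c1 by simp
  have "Hser g 1 \<noteq> 0" using Hser_facts(2)[OF g] by (auto dest: spec[of _ 1])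
  hence B1: "B 1 \<noteq> 0" unfolding B1v using Lfun_1_nonzero[OF dchar_chi4 chi4_sum] by simp
  \<comment> \<open>The extra half power makes \<open>f^2\<close> equal to
    \<open>(s - 1) A^2\<close>, where the simple pole of zeta is cancelled by passing to
    \<open>cont g 1\<close>.\<close>
  define f where "f s = (s - 1) powr (1/2) * A s" for s
  have Ah: "A holomorphic_on {s. Re s > 1}" unfolding A_def by (rule Aser_holomorphic[OF g])
  have np: "s - 1 \<notin> \<real>\<^sub>\<le>\<^sub>0" if "Re s > 1" for s using that by (auto simp: complex_nonpos_Reals_iff)
  have "f holomorphic_on {s. Re s > 1}" unfolding f_def[abs_def] using np by (intro holomorphic_intros Ah) auto
  hence fc: "continuous_on {s. Re s > 1} f" by (rule holomorphic_on_imp_continuous_on)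
  have sq: "f s ^ 2 = B s" if s: "Re s > 1" for s
  proof -
    have nz: "s - 1 \<noteq> 0" using s by auto
    have "((s - 1) powr (1/2)) ^ 2 = s - 1"
      using nz powr_add[of "s - 1" "1/2" "1/2"] by (simp add: power2_eq_square)
    hence "f s ^ 2 = (s - 1) * A s ^ 2" unfolding f_def by (simp add: power_mult_distrib)
    also have "A s ^ 2 = dser g s * dser chi4 s * Hser g s"
      unfolding A_def using Aser_square[OF g s] by (simp add: g_def)
    also have "(s - 1) * \<dots> = ((s - 1) * dser g s) * dser chi4 s * Hser g s" by simp
    also have "(s - 1) * dser g s = cont g 1 s"
      using cont_eq[of 1 g s] s by (simp add: g_def)
    also have "dser chi4 s = Lfun chi4 4 s" by (rule Lfun_eq_dser[OF dchar_chi4 chi4_sum s, symmetric])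
    finally show ?thesis unfolding B_def .
  qed
  obtain \<epsilon> Q where Q: "\<epsilon> > 0" "Q holomorphic_on ball 1 \<epsilon>" "\<And>s. s \<in> ball 1 \<epsilon> \<inter> {s. Re s > 1} \<Longrightarrow> f s = Q s" "Q 1 ^ 2 = B 1"
    using local_sqrt[OF R Bh B1 fc sq] by auto
  define S where "S = ball 1 \<epsilon> \<inter> {s. Re s > 1}"
  have AQ: "A s = (s - 1) powr (- 1/2) * Q s" if s: "s \<in> S" for s
  proof -
    have nz: "s - 1 \<noteq> 0" using s by (auto simp: S_def)
    have "(s - 1) powr (- 1/2) * (s - 1) powr (1/2) = 1"
      using nz powr_add[of "s - 1" "- 1/2" "1/2"] by simp
    hence "(s - 1) powr (- 1/2) * f s = A s" unfolding f_def by (simp add: mult.assoc[symmetric])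
    thus ?thesis using Q(3)[of s] s by (simp add: S_def)
  qed
  define Q' where "Q' s = Q s * inverse (s * (s + 1))" for s
  define \<delta> where "\<delta> = min \<epsilon> 1"
  have d0: "\<delta> > 0" using Q(1) by (simp add: \<delta>_def)
  define S' where "S' = ball 1 \<delta> \<inter> {s. Re s > 1}"
  have nzb: "s * (s + 1) \<noteq> 0" if "s \<in> ball 1 \<delta>" for s :: complex
  proof -
    have "norm (1 - s) < 1" using that by (simp add: dist_norm \<delta>_def)
    hence "Re s > 0" using abs_Re_le_cmod[of "1 - s"] by auto
    thus ?thesis by (rule quadratic_nonzero)
  qed
  have Q'h: "Q' holomorphic_on ball 1 \<delta>"
    unfolding Q'_def[abs_def] using nzb
    by (intro holomorphic_intros holomorphic_on_subset[OF Q(2)]) (auto simp: \<delta>_def)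
  have AQ': "Ar g s = (s - 1) powr (- 1/2) * Q' s" if "s \<in> S'" for s
    unfolding Ar_def Q'_def using AQ[of s] that unfolding A_def S_def S'_def by (auto simp: \<delta>_def)
  obtain Qk where Qk: "Qk holomorphic_on ball 1 \<delta>" "Qk 1 = (\<Prod>i<k. - 1/2 - of_nat i) * Q' 1"
     "\<And>s. s \<in> S' \<Longrightarrow> (deriv ^^ k) (Ar g) s = (s - 1) powr (- 1/2 - of_nat k) * Qk s"
    using powr_deriv_iterate[OF Q'h S'_def AQ', of k] by blast
  define e where "e j = (deriv ^^ j) Qk 1 / fact j" for j
  have kk: "{..k - 1} = {..<k}" "Suc (k - 1) = k" using k by auto
  obtain K where K: "K \<ge> 0" "\<And>s. norm (s - 1) \<le> \<delta> / 2 \<Longrightarrow> norm (Qk s - (\<Sum>j<k. e j * (s - 1) ^ j)) \<le> K * norm (s - 1) ^ k"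
    using Taylor_bound_at_1[OF Qk(1) d0, of "k - 1"] unfolding e_def kk by blast
  have d2: "\<delta> / 2 > 0" using d0 by simp
  from Ar_far_bound[OF g d2, of k]
  obtain C1 where C1: "C1 \<ge> 0" "\<And>s. s \<in> farstrip (\<delta> / 2) \<Longrightarrow> norm ((deriv ^^ k) (Ar g) s) \<le> C1 * (1 + \<bar>Im s\<bar>) powr (- 3/2)" by auto
  define sing where "sing s = (\<Sum>j<k. e j * (s - 1) powr (of_nat j - of_nat k - 1/2))" for s
  have npw: "norm ((s - 1) powr (of_nat j - of_nat k - 1/2)) = norm (s - 1) powr (real j - real k - 1/2)" for s :: complex and j
  proof -
    have "of_nat j - of_nat k - 1/2 = complex_of_real (real j - real k - 1/2)" by simp
    thus ?thesis using norm_powr_real_powr'[of "complex_of_real (real j - real k - 1/2)" "s - 1"] by (simp only: Reals_of_real Re_complex_of_real)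
  qed
  \<comment> \<open>Outside the disc of radius \<open>\<delta> / 2\<close> both 1 and
    \<open>|Im s|\<close> are bounded by multiples of \<open>norm (s - 1)\<close>;
    \<open>\<eta>\<close> is the resulting comparison constant.\<close>
  define \<eta> where "\<eta> = 1 / (1 + 2 / \<delta>)"
  have eta: "\<eta> > 0" unfolding \<eta>_def using d0 by (simp add: add_pos_pos)
  define C3 where "C3 = (\<Sum>j<k. norm (e j) * \<eta> powr (real j - real k - 1/2))"
  have C30: "C3 \<ge> 0" unfolding C3_def by (intro sum_nonneg) auto
  have C3: "norm (sing s) \<le> C3 * (1 + \<bar>Im s\<bar>) powr (- 3/2)" if s: "norm (s - 1) > \<delta> / 2" for s
  proof -
    have "\<bar>Im s\<bar> \<le> norm (s - 1)" using abs_Im_le_cmod[of "s - 1"] by simp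
    moreover have "1 \<le> norm (s - 1) * (2 / \<delta>)" using s d0 by (simp add: field_simps)
    ultimately have "1 + \<bar>Im s\<bar> \<le> norm (s - 1) * (1 + 2 / \<delta>)" by (simp add: distrib_left)
    hence low: "\<eta> * (1 + \<bar>Im s\<bar>) \<le> norm (s - 1)"
      unfolding \<eta>_def using d0 by (simp add: divide_le_eq add_pos_pos)
    have "norm (sing s) \<le> (\<Sum>j<k. norm (e j * (s - 1) powr (of_nat j - of_nat k - 1/2)))" unfolding sing_def by (rule norm_sum)
    also have "\<dots> \<le> (\<Sum>j<k. norm (e j) * (\<eta> powr (real j - real k - 1/2) * (1 + \<bar>Im s\<bar>) powr (- 3/2)))"
      unfolding norm_mult npw
    proof (intro sum_mono mult_left_mono)
      fix j assume j: "j \<in> {..<k}"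
      \<comment> \<open>The exponents \<open>j - k - 1/2\<close> are therefore at most -3/2, so the
        subtracted powers themselves satisfy the decay required away from 1.\<close>
      have jk: "real j + 1 \<le> real k" using j by auto
      have "norm (s - 1) powr (real j - real k - 1/2) \<le> (\<eta> * (1 + \<bar>Im s\<bar>)) powr (real j - real k - 1/2)"
        using low eta jk by (intro powr_mono2') auto
      also have "\<dots> = \<eta> powr (real j - real k - 1/2) * (1 + \<bar>Im s\<bar>) powr (real j - real k - 1/2)" by (rule powr_mult)
      also have "\<dots> \<le> \<eta> powr (real j - real k - 1/2) * (1 + \<bar>Im s\<bar>) powr (- 3/2)"
        using jk by (intro mult_left_mono powr_mono) auto
      finally show "norm (s - 1) powr (real j - real k - 1/2) \<le> \<eta> powr (real j - real k - 1/2) * (1 + \<bar>Im s\<bar>) powr (- 3/2)" .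
    qed auto
    also have "\<dots> = C3 * (1 + \<bar>Im s\<bar>) powr (- 3/2)" unfolding C3_def by (simp add: sum_distrib_right mult.assoc)
    finally show ?thesis .
  qed
  have "\<exists>C\<ge>0. \<forall>s. 1 < Re s \<and> Re s < 3 \<and> Im s \<noteq> 0 \<longrightarrow> norm ((deriv ^^ k) (Ar g) s - sing s) \<le> C * Gmaj (Im s)"
  proof (rule strip_bound_combine[OF d0, where ?C1.0 = "C1 + C3" and ?C2.0 = K])
    fix s assume s: "s \<in> farstrip (\<delta> / 2)"
    have "norm ((deriv ^^ k) (Ar g) s - sing s) \<le> norm ((deriv ^^ k) (Ar g) s) + norm (sing s)" by (rule norm_triangle_ineq4)
    also have "\<dots> \<le> C1 * (1 + \<bar>Im s\<bar>) powr (- 3/2) + C3 * (1 + \<bar>Im s\<bar>) powr (- 3/2)"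
      using C1(2)[OF s] C3[of s] s by (auto simp: farstrip_def)
    finally show "norm ((deriv ^^ k) (Ar g) s - sing s) \<le> (C1 + C3) * (1 + \<bar>Im s\<bar>) powr (- 3/2)" by (simp add: distrib_right)
  next
    fix s assume s: "1 < Re s" "norm (s - 1) \<le> \<delta> / 2"
    have sS: "s \<in> S'" using s d0 by (auto simp: S'_def dist_norm norm_minus_commute)
    have nz: "s - 1 \<noteq> 0" using s by auto
    have "(s - 1) powr (- 1/2 - of_nat k) * (s - 1) ^ j = (s - 1) powr (of_nat j - of_nat k - 1/2)" for j
    proof -
      have "(s - 1) powr (- 1/2 - of_nat k) * (s - 1) powr (of_nat j) = (s - 1) powr (- 1/2 - of_nat k + of_nat j)"
        by (rule powr_add[symmetric])
      thus ?thesis using nz by (simp add: algebra_simps)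
    qed
    hence "sing s = (s - 1) powr (- 1/2 - of_nat k) * (\<Sum>j<k. e j * (s - 1) ^ j)"
      unfolding sing_def sum_distrib_left by (intro sum.cong refl) (simp add: algebra_simps)
    hence df: "(deriv ^^ k) (Ar g) s - sing s = (s - 1) powr (- 1/2 - of_nat k) * (Qk s - (\<Sum>j<k. e j * (s - 1) ^ j))"
      unfolding Qk(3)[OF sS] by (simp add: right_diff_distrib)
    have "of_nat 0 - of_nat k - 1/2 = (- 1/2 - of_nat k :: complex)" "real 0 - real k - 1/2 = - 1/2 - real k" by auto
    hence np0: "norm ((s - 1) powr (- 1/2 - of_nat k)) = norm (s - 1) powr (- 1/2 - real k)"
      using npw[of s 0] by (simp only:)
    have "norm ((deriv ^^ k) (Ar g) s - sing s) = norm (s - 1) powr (- 1/2 - real k) * norm (Qk s - (\<Sum>j<k. e j * (s - 1) ^ j))"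
      unfolding df norm_mult np0 ..
    also have "\<dots> \<le> norm (s - 1) powr (- 1/2 - real k) * (K * norm (s - 1) ^ k)"
      by (intro mult_left_mono K(2) s) auto
    also have "\<dots> = K * (norm (s - 1) powr (- 1/2 - real k) * norm (s - 1) powr (real k))"
      using nz by (subst powr_realpow) auto
    also have "\<dots> = K * norm (s - 1) powr (- 1/2)" by (simp flip: powr_add)
    finally show "norm ((deriv ^^ k) (Ar g) s - sing s) \<le> K * norm (s - 1) powr (- 1/2)" .
  qed (use K C1 C30 in auto)
  then obtain C where C0: "C \<ge> 0" and C: "\<forall>s. 1 < Re s \<and> Re s < 3 \<and> Im s \<noteq> 0 \<longrightarrow> norm ((deriv ^^ k) (Ar g) s - sing s) \<le> C * Gmaj (Im s)" by blast
  \<comment> \<open>The sign of the root is fixed on the real axis: \<open>Q 1\<close> is the limit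
    of \<open>(\<sigma> - 1)^(1/2) A(\<sigma>)\<close>, and the coefficients of \<open>A\<close> are
    nonnegative.\<close>
  have "Q 1 \<in> \<real>\<^sub>\<ge>\<^sub>0"
  proof (rule Lim_in_closed_set[OF closed_nonneg_Reals_complex])
    have "isCont Q 1" using holomorphic_on_imp_continuous_on[OF Q(2)] Q(1) by (simp add: continuous_on_eq_continuous_at)
    moreover have "((\<lambda>\<sigma>::real. complex_of_real \<sigma>) \<longlongrightarrow> of_real 1) (at_right 1)" by (intro tendsto_intros)
    ultimately show "((\<lambda>\<sigma>. Q (of_real \<sigma>)) \<longlongrightarrow> Q 1) (at_right (1::real))"
      using isCont_tendsto_compose[of 1 Q "\<lambda>\<sigma>::real. complex_of_real \<sigma>" "at_right 1"] by simp
    have "\<forall>\<^sub>F \<sigma> in at_right (1::real). \<sigma> \<in> {1<..<1 + \<epsilon>}" using Q(1) by (intro eventually_at_right_real) auto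
    thus "\<forall>\<^sub>F \<sigma> in at_right 1. Q (complex_of_real \<sigma>) \<in> \<real>\<^sub>\<ge>\<^sub>0"
    proof eventually_elim
      case (elim \<sigma>)
      have "norm (complex_of_real \<sigma> - 1) = \<sigma> - 1"
        using elim by (metis abs_of_nonneg diff_ge_0_iff_ge greaterThanLessThan_iff less_imp_le norm_of_real of_real_1 of_real_diff)
      hence "f (of_real \<sigma>) = Q (of_real \<sigma>)" using elim by (intro Q(3)) (auto simp: dist_norm norm_minus_commute)
      moreover have "A (of_real \<sigma>) = of_real (\<Sum>n. indE n * real n powr (- \<sigma>))"
      proof -
        have "summable (\<lambda>n. norm (g n * of_real (indE n)) * real n powr (- \<sigma>))"
          using elim by (intro tame_summable_real Aser_tame[OF g]) auto
        hence sm: "summable (\<lambda>n. indE n * real n powr (- \<sigma>))" by (simp add: g_def norm_indE)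
        have "A (of_real \<sigma>) = (\<Sum>n. of_real (indE n * real n powr (- \<sigma>)))"
          unfolding A_def Aser_def dser_def g_def
        proof (rule suminf_cong)
          fix n show "1 * complex_of_real (indE n) * of_nat n powr - complex_of_real \<sigma> = of_real (indE n * real n powr (- \<sigma>))"
            using powr_of_real[of "real n" "- \<sigma>"] by simp
        qed
        thus ?thesis by (simp only: suminf_of_real[OF sm])
      qed
      moreover have "(\<Sum>n. indE n * real n powr (- \<sigma>)) \<ge> 0"
      proof (rule suminf_nonneg)
        have "summable (\<lambda>n. norm (g n * of_real (indE n)) * real n powr (- \<sigma>))"
          using elim by (intro tame_summable_real Aser_tame[OF g]) auto
        thus "summable (\<lambda>n. indE n * real n powr (- \<sigma>))" by (simp add: g_def norm_indE)
      qed (simp add: norm_indE)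
      moreover have "(complex_of_real \<sigma> - 1) powr (1/2) = of_real ((\<sigma> - 1) powr (1/2))"
        using elim powr_of_real[of "\<sigma> - 1" "1/2"] by simp
      ultimately have "Q (of_real \<sigma>) = of_real ((\<sigma> - 1) powr (1/2) * (\<Sum>n. indE n * real n powr (- \<sigma>)))"
        unfolding f_def by simp
      moreover have "(\<sigma> - 1) powr (1/2) * (\<Sum>n. indE n * real n powr (- \<sigma>)) \<ge> 0"
        using \<open>(\<Sum>n. indE n * real n powr (- \<sigma>)) \<ge> 0\<close> by simp
      ultimately show ?case by (simp only: nonneg_Reals_of_real_iff)
    qed
  qed simp
  \<comment> \<open>The 2 is the value of \<open>s (s + 1)\<close> at 1.\<close>
  moreover have "e 0 = (\<Prod>i<k. - 1/2 - of_nat i) * (Q 1 / 2)" unfolding e_def using Qk(2) by (simp add: Q'_def)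
  ultimately show ?thesis
    using C C0 Q(4) unfolding B1v g_def sing_def
    by (intro exI[of _ e] exI[of _ "Q 1"] exI[of _ C]) simp
qed

text \<open>Along even cutoffs the partial sums are those of the Leibniz series for
  \<open>pi / 4\<close>.\<close>

lemma Lfun_chi4_1: "Lfun chi4 4 1 = of_real (pi / 4)"
proof -
  have lim: "(\<lambda>N. \<Sum>n<N. chi4 n * of_real (real n powr (-1))) \<longlonglongrightarrow> Lfun chi4 4 1"
    by (rule partial_sums_tendsto_Lfun_1[OF dchar_chi4 chi4_sum])
  have "strict_mono (\<lambda>K::nat. 2 * K)" by (simp add: strict_mono_def)
  from LIMSEQ_subseq_LIMSEQ[OF lim this]
  have lim1: "(\<lambda>K. \<Sum>n<2 * K. chi4 n * of_real (real n powr (-1))) \<longlonglongrightarrow> Lfun chi4 4 1" by (simp add: o_def)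
  have eq: "(\<Sum>n<2 * K. chi4 n * of_real (real n powr (-1))) = of_real (\<Sum>k<K. (-1) ^ k * (1 / real (k * 2 + 1)))" for K
  proof (induction K)
    case (Suc K)
    have "chi4 (2 * K) = 0"
    proof -
      have "(2 * K) mod 4 \<noteq> 1" "(2 * K) mod 4 \<noteq> 3" by presburger+
      thus ?thesis by (simp add: chi4_def)
    qed
    moreover have "chi4 (2 * K + 1) = (-1) ^ K"
    proof (cases "even K")
      case True
      then obtain j where "K = 2 * j" by (elim evenE)
      thus ?thesis by (simp add: chi4_def)
    next
      case False
      then obtain j where "K = 2 * j + 1" by (elim oddE)
      moreover have "(2 * (2 * j + 1) + 1) mod 4 = 3" by presburger
      ultimately show ?thesis by (simp add: chi4_def)
    qed
    moreover have "real (2 * K + 1) powr (-1) = 1 / real (K * 2 + 1)" by (subst powr_minus_divide) (simp add: mult.commute)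
    ultimately show ?case using Suc by simp
  qed simp
  have "summable (\<lambda>k. (-1) ^ k * (1 / real (k * 2 + 1) * (1::real) ^ (k * 2 + 1)))"
    by (rule summable_arctan_series) simp
  hence "(\<lambda>k. (-1) ^ k * (1 / real (k * 2 + 1))) sums (pi / 4)"
    using pi_series by (simp add: sums_iff)
  hence "(\<lambda>K. \<Sum>k<K. (-1) ^ k * (1 / real (k * 2 + 1))) \<longlonglongrightarrow> pi / 4" unfolding sums_def .
  hence "(\<lambda>K. complex_of_real (\<Sum>k<K. (-1) ^ k * (1 / real (k * 2 + 1)))) \<longlonglongrightarrow> of_real (pi / 4)"
    by (rule tendsto_of_real)
  thus ?thesis using lim1 unfolding eq by (rule LIMSEQ_unique[symmetric])
qed

section \<open>Laplace transforms and Fourier inversion\<close>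

definition adm :: "real \<Rightarrow> (real \<Rightarrow> complex) \<Rightarrow> bool" where
  "adm a0 f \<longleftrightarrow> f \<in> borel_measurable borel \<and> (\<forall>u<0. f u = 0) \<and>
     (\<forall>a>a0. integrable lborel (\<lambda>u. exp (- (a * u)) * norm (f u)))"

definition lap :: "(real \<Rightarrow> complex) \<Rightarrow> complex \<Rightarrow> complex" where
  "lap f w = (LINT u|lborel. exp (- (w * of_real u)) * f u)"

lemma adm_mult:
  assumes f: "adm a0 f"
  shows "adm a0 (\<lambda>u. - of_real u * f u)"
  unfolding adm_def
proof (intro conjI allI impI)
  have m: "f \<in> borel_measurable borel" and neg: "\<And>u. u < 0 \<Longrightarrow> f u = 0"
    and int: "\<And>a. a > a0 \<Longrightarrow> integrable lborel (\<lambda>u. exp (- (a * u)) * norm (f u))"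
    using f by (auto simp: adm_def)
  show "(\<lambda>u. - of_real u * f u) \<in> borel_measurable borel" using m by measurable
  show "- of_real u * f u = 0" if "u < 0" for u using neg[OF that] by simp
  fix a :: real assume a: "a > a0"
  define d where "d = (a - a0) / 2"
  have d: "d > 0" using a by (simp add: d_def)
  have "integrable lborel (\<lambda>u. (1/d) * (exp (- ((a - d) * u)) * norm (f u)))"
    using a by (intro integrable_mult_right int) (auto simp: d_def field_simps)
  thus "integrable lborel (\<lambda>u. exp (- (a * u)) * norm (- of_real u * f u))"
  proof (rule Bochner_Integration.integrable_bound)
    show "(\<lambda>u. exp (- (a * u)) * norm (- of_real u * f u)) \<in> borel_measurable lborel" using m by measurable
    show "AE u in lborel. norm (exp (- (a * u)) * norm (- of_real u * f u)) \<le> norm ((1/d) * (exp (- ((a - d) * u)) * norm (f u)))"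
    proof (intro AE_I2)
      fix u :: real
      show "norm (exp (- (a * u)) * norm (- of_real u * f u)) \<le> norm ((1/d) * (exp (- ((a - d) * u)) * norm (f u)))"
      proof (cases "u < 0")
        case False
        have "d * u \<le> exp (d * u)" using exp_ge_add_one_self[of "d * u"] by linarith
        hence "u \<le> (1/d) * exp (d * u)" using d by (simp add: field_simps)
        hence "exp (- (a * u)) * norm (f u) * u \<le> exp (- (a * u)) * norm (f u) * ((1/d) * exp (d * u))"
          by (intro mult_left_mono) auto
        also have "\<dots> = (1/d) * ((exp (- (a * u)) * exp (d * u)) * norm (f u))" by simp
        also have "exp (- (a * u)) * exp (d * u) = exp (- ((a - d) * u))"
          by (simp add: exp_add[symmetric] algebra_simps)
        finally show ?thesis using False d by (simp add: norm_mult abs_mult algebra_simps)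
      qed (simp add: neg)
    qed
  qed
qed

lemma lap_integrable:
  assumes f: "adm a0 f" and w: "Re w > a0"
  shows "integrable lborel (\<lambda>u. exp (- (w * of_real u)) * f u)"
proof -
  have m: "f \<in> borel_measurable borel" using f by (auto simp: adm_def)
  have "integrable lborel (\<lambda>u. exp (- (Re w * u)) * norm (f u))" using f w by (auto simp: adm_def)
  thus ?thesis
    by (rule Bochner_Integration.integrable_bound) (use m in \<open>measurable, auto simp: norm_mult intro!: AE_I2\<close>)
qed

text \<open>The second-order remainder of the exponential is dominated by \<open>|h|^2\<close> times
  an integrable function: half of the distance of \<open>Re w\<close> from the abscissa absorbs
  \<open>exp (d u)\<close>, and the factor \<open>u^2\<close> sits in \<open>f2\<close>. The
  difference quotient is thus estimated directly.\<close>

lemma lap_has_field_derivative: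
  assumes f: "adm a0 f" and w: "Re w > a0"
  shows "(lap f has_field_derivative lap (\<lambda>u. - of_real u * f u) w) (at w)"
proof -
  define f1 where "f1 u = - of_real u * f u" for u
  define f2 where "f2 u = - of_real u * f1 u" for u
  have f1: "adm a0 f1" unfolding f1_def[abs_def] by (rule adm_mult[OF f])
  have f2: "adm a0 f2" unfolding f2_def[abs_def] by (rule adm_mult[OF f1])
  have neg: "\<And>u. u < 0 \<Longrightarrow> f u = 0" using f by (auto simp: adm_def)
  define d where "d = (Re w - a0) / 2"
  have d: "d > 0" using w by (simp add: d_def)
  define C where "C = (LINT u|lborel. exp (- ((Re w - d) * u)) * norm (f2 u))"
  have intC: "integrable lborel (\<lambda>u. exp (- ((Re w - d) * u)) * norm (f2 u))"
  proof -
    have "Re w - d > a0" using w by (simp add: d_def field_simps)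
    thus ?thesis using f2 unfolding adm_def by blast
  qed
  have bound: "norm (lap f (w + h) - lap f w - h * lap f1 w) \<le> norm h ^ 2 * C" if h: "norm h < d" for h
  proof -
    have rh: "Re (w + h) > a0" using h d abs_Re_le_cmod[of h] by (simp add: d_def)
    have i1: "integrable lborel (\<lambda>u. exp (- ((w + h) * of_real u)) * f u)" by (rule lap_integrable[OF f rh])
    have i2: "integrable lborel (\<lambda>u. exp (- (w * of_real u)) * f u)" by (rule lap_integrable[OF f w])
    have i3: "integrable lborel (\<lambda>u. h * (exp (- (w * of_real u)) * f1 u))"
      by (intro integrable_mult_right lap_integrable[OF f1 w])
    have "lap f (w + h) - lap f w - h * lap f1 w =
       (LINT u|lborel. exp (- ((w + h) * of_real u)) * f u - exp (- (w * of_real u)) * f u - h * (exp (- (w * of_real u)) * f1 u))"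
      unfolding lap_def using i1 i2 i3 by (subst Bochner_Integration.integral_diff integral_mult_right; (intro Bochner_Integration.integrable_diff)?; assumption?)+ auto
    also have "norm \<dots> \<le> (LINT u|lborel. norm h ^ 2 * (exp (- ((Re w - d) * u)) * norm (f2 u)))"
    proof (rule order_trans[OF integral_norm_bound], rule integral_mono)
      show "integrable lborel (\<lambda>u. norm (exp (- ((w + h) * of_real u)) * f u - exp (- (w * of_real u)) * f u - h * (exp (- (w * of_real u)) * f1 u)))"
        by (intro integrable_norm Bochner_Integration.integrable_diff i1 i2 i3)
      show "integrable lborel (\<lambda>u. norm h ^ 2 * (exp (- ((Re w - d) * u)) * norm (f2 u)))" by (intro integrable_mult_right intC)
      fix u :: real
      show "norm (exp (- ((w + h) * of_real u)) * f u - exp (- (w * of_real u)) * f u - h * (exp (- (w * of_real u)) * f1 u))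
          \<le> norm h ^ 2 * (exp (- ((Re w - d) * u)) * norm (f2 u))"
      proof (cases "u < 0")
        case True thus ?thesis by (simp add: neg f1_def f2_def)
      next
        case False
        define z where "z = - (h * of_real u)"
        have e: "exp (- ((w + h) * of_real u)) = exp (- (w * of_real u)) * exp z"
          unfolding z_def by (simp add: exp_add[symmetric] algebra_simps)
        have "exp (- ((w + h) * of_real u)) * f u - exp (- (w * of_real u)) * f u - h * (exp (- (w * of_real u)) * f1 u)
           = exp (- (w * of_real u)) * (exp z - (1 + z)) * f u"
          unfolding e f1_def z_def by (simp add: algebra_simps)
        hence "norm (exp (- ((w + h) * of_real u)) * f u - exp (- (w * of_real u)) * f u - h * (exp (- (w * of_real u)) * f1 u))
           = exp (- (Re w * u)) * norm (exp z - (1 + z)) * norm (f u)" by (simp add: norm_mult)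
        also have "norm (exp z - (1 + z)) \<le> exp (d * u) * norm z ^ 2"
        proof -
          have "norm (exp z - (\<Sum>i\<le>1. z ^ i / fact i)) \<le> exp \<bar>Re z\<bar> * norm z ^ Suc 1 / fact 1" by (rule Taylor_exp)
          moreover have "(\<Sum>i\<le>1. z ^ i / fact i) = 1 + z" by simp
          ultimately have 1: "norm (exp z - (1 + z)) \<le> exp \<bar>Re z\<bar> * norm z ^ 2" by (simp add: power2_eq_square)
          have "\<bar>Re z\<bar> \<le> norm z" by (rule abs_Re_le_cmod)
          also have "norm z = norm h * u" unfolding z_def using False by (simp add: norm_mult)
          also have "\<dots> \<le> d * u" using h False by (intro mult_right_mono) auto
          finally have "exp \<bar>Re z\<bar> * norm z ^ 2 \<le> exp (d * u) * norm z ^ 2" by (intro mult_right_mono) auto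
          thus ?thesis using 1 by linarith
        qed
        also have "exp (- (Re w * u)) * (exp (d * u) * norm z ^ 2) * norm (f u) = norm h ^ 2 * (exp (- ((Re w - d) * u)) * norm (f2 u))"
        proof -
          have "exp (- (Re w * u)) * exp (d * u) = exp (- ((Re w - d) * u))" by (simp add: exp_add[symmetric] algebra_simps)
          moreover have "norm z ^ 2 * norm (f u) = norm h ^ 2 * norm (f2 u)"
            unfolding z_def f2_def f1_def using False by (simp add: norm_mult power2_eq_square)
          ultimately show ?thesis by (metis (no_types, lifting) mult.assoc mult.commute)
        qed
        finally show ?thesis by (simp add: mult_left_mono mult_right_mono)
      qed
    qed
    also have "\<dots> = norm h ^ 2 * C" unfolding C_def by simp
    finally show ?thesis .
  qed
  have C0: "C \<ge> 0" unfolding C_def by (intro Bochner_Integration.integral_nonneg) auto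
  have "((\<lambda>h. (lap f (w + h) - lap f w) / h) \<longlongrightarrow> lap f1 w) (at 0)"
  proof (rule Lim_transform_eventually[OF _ always_eventually], rule LIM_zero_cancel, rule Lim_null_comparison)
    show "\<forall>\<^sub>F h in at 0. norm ((lap f (w + h) - lap f w) / h - lap f1 w) \<le> norm h * C"
      unfolding eventually_at
    proof (intro exI[of _ d] conjI ballI impI d)
      fix h :: complex assume "h \<noteq> 0 \<and> dist h 0 < d"
      hence h: "h \<noteq> 0" "norm h < d" by auto
      have "(lap f (w + h) - lap f w) / h - lap f1 w = (lap f (w + h) - lap f w - h * lap f1 w) / h"
        using h by (simp add: field_simps)
      hence "norm ((lap f (w + h) - lap f w) / h - lap f1 w) = norm (lap f (w + h) - lap f w - h * lap f1 w) / norm h"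
        by (simp add: norm_divide)
      also have "\<dots> \<le> norm h ^ 2 * C / norm h" by (intro divide_right_mono bound h) auto
      also have "\<dots> = norm h * C" using h by (simp add: power2_eq_square)
      finally show "norm ((lap f (w + h) - lap f w) / h - lap f1 w) \<le> norm h * C" .
    qed
    have "((\<lambda>h::complex. norm h * C) \<longlongrightarrow> norm (0::complex) * C) (at 0)" by (intro tendsto_intros)
    thus "((\<lambda>h::complex. norm h * C) \<longlongrightarrow> 0) (at 0)" by simp
  qed simp
  thus ?thesis unfolding f1_def[abs_def] DERIV_def .
qed

lemma adm_power: "adm a0 f \<Longrightarrow> adm a0 (\<lambda>u. (- of_real u) ^ k * f u)"
proof (induction k)
  case (Suc k)
  from adm_mult[OF Suc.IH[OF Suc.prems]] show ?case by (simp add: mult.assoc)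
qed simp

lemma lap_higher_deriv:
  assumes f: "adm a0 f" and "Re w > a0"
  shows "(deriv ^^ k) (lap f) w = lap (\<lambda>u. (- of_real u) ^ k * f u) w"
  using assms(2)
proof (induction k arbitrary: w)
  case (Suc k)
  let ?f = "\<lambda>k u. (- of_real u) ^ k * f u"
  have "(deriv ^^ Suc k) (lap f) w = deriv ((deriv ^^ k) (lap f)) w" by simp
  also have "\<dots> = deriv (lap (?f k)) w"
  proof (rule deriv_cong_ev[OF _ refl])
    have "\<forall>\<^sub>F x in nhds w. x \<in> {s. Re s > a0}"
      using Suc.prems open_halfspace_Re_gt by (intro eventually_nhds_in_open) auto
    thus "\<forall>\<^sub>F x in nhds w. (deriv ^^ k) (lap f) x = lap (?f k) x"
      by (rule eventually_mono) (use Suc.IH in auto)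
  qed
  also have "\<dots> = lap (?f (Suc k)) w"
    using lap_has_field_derivative[OF adm_power[OF f] Suc.prems, of k]
    by (simp add: DERIV_imp_deriv mult.assoc)
  finally show ?case .
qed simp

lemma lap_holomorphic: "adm a0 f \<Longrightarrow> lap f holomorphic_on {s. Re s > a0}"
  unfolding holomorphic_on_open[OF open_halfspace_Re_gt]
  using lap_has_field_derivative by blast

section \<open>Transforms of powers and Fourier inversion\<close>

definition pw :: "real \<Rightarrow> real \<Rightarrow> real" where
  "pw \<alpha> u = indicator {0..} u * u powr (\<alpha> - 1)"

lemma pw_measurable [measurable]: "pw \<alpha> \<in> borel_measurable borel"
  unfolding pw_def[abs_def] by measurable

lemma pw_nonneg: "pw \<alpha> u \<ge> 0" by (simp add: pw_def indicator_def)

lemma has_bochner_integral_pw: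
  assumes al: "\<alpha> > 0" and a: "a > 0"
  shows "has_bochner_integral lborel (\<lambda>u. pw \<alpha> u * exp (- (a * u))) (Gamma \<alpha> * a powr (- \<alpha>))"
proof -
  have eq: "pw \<alpha> u * exp (- u) = indicator {0..} u * u powr (\<alpha> - 1) / exp u" for u
    by (simp add: pw_def exp_minus field_simps)
  have h1: "has_bochner_integral lborel (\<lambda>u. pw \<alpha> u * exp (- u)) (Gamma \<alpha>)"
  proof (rule has_bochner_integral_nn_integral)
    show "(\<lambda>u. pw \<alpha> u * exp (- u)) \<in> borel_measurable lborel" by measurable
    show "AE u in lborel. 0 \<le> pw \<alpha> u * exp (- u)" by (simp add: pw_nonneg)
    show "(\<integral>\<^sup>+ u. ennreal (pw \<alpha> u * exp (- u)) \<partial>lborel) = ennreal (Gamma \<alpha>)"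
      unfolding eq using Gamma_conv_nn_integral_real[OF al] by simp
    show "0 \<le> Gamma \<alpha>" using Gamma_real_pos[OF al] by simp
  qed
  from lborel_has_bochner_integral_real_affine_iff[of a "\<lambda>u. pw \<alpha> u * exp (- u)" "Gamma \<alpha>" 0] h1 a
  have "has_bochner_integral lborel (\<lambda>u. pw \<alpha> (a * u) * exp (- (a * u))) (Gamma \<alpha> / a)" by (simp add: field_simps)
  hence "has_bochner_integral lborel (\<lambda>u. a powr (1 - \<alpha>) * (pw \<alpha> (a * u) * exp (- (a * u)))) (a powr (1 - \<alpha>) * (Gamma \<alpha> / a))"
    by (rule has_bochner_integral_mult_right)
  moreover have "a powr (1 - \<alpha>) * (pw \<alpha> (a * u) * exp (- (a * u))) = pw \<alpha> u * exp (- (a * u))" for u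
  proof (cases "u \<ge> 0")
    case True
    have "a powr (1 - \<alpha>) * (a * u) powr (\<alpha> - 1) = (a powr (1 - \<alpha>) * a powr (\<alpha> - 1)) * u powr (\<alpha> - 1)"
      using a True by (simp add: powr_mult)
    also have "a powr (1 - \<alpha>) * a powr (\<alpha> - 1) = 1" using a by (simp flip: powr_add)
    finally show ?thesis using a True by (simp add: pw_def)
  next
    case False
    hence "\<not> 0 \<le> a * u" using a by (simp add: zero_le_mult_iff)
    thus ?thesis using False by (simp add: pw_def)
  qed
  moreover have "a powr (1 - \<alpha>) * (Gamma \<alpha> / a) = Gamma \<alpha> * a powr (- \<alpha>)"
    using a by (simp add: powr_diff powr_minus field_simps)
  ultimately show ?thesis by simp
qed

lemma adm_pw: "\<alpha> > 0 \<Longrightarrow> adm 0 (\<lambda>u. of_real (pw \<alpha> u))"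
  unfolding adm_def
proof (intro conjI allI impI)
  fix a :: real assume "\<alpha> > 0" "a > 0"
  from has_bochner_integral_pw[OF this]
  show "integrable lborel (\<lambda>u. exp (- (a * u)) * norm (complex_of_real (pw \<alpha> u)))"
    by (simp add: has_bochner_integral_iff pw_nonneg mult.commute)
qed (auto simp: pw_def)

text \<open>For real \<open>w\<close> this is the Gamma integral after scaling. Both sides are
  holomorphic in the right half-plane, so they agree there by the identity theorem.\<close>

lemma lap_pw:
  assumes al: "\<alpha> > 0" and w: "Re w > 0"
  shows "lap (\<lambda>u. of_real (pw \<alpha> u)) w = of_real (Gamma \<alpha>) * w powr (- of_real \<alpha>)"
proof -
  define S where "S = {s::complex. Re s > 0}"
  define F where "F w = lap (\<lambda>u. of_real (pw \<alpha> u)) w - of_real (Gamma \<alpha>) * w powr (- of_real \<alpha>)" for w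
  have real: "F (of_real x) = 0" if x: "x > 0" for x
  proof -
    have "lap (\<lambda>u. of_real (pw \<alpha> u)) (of_real x) = (LINT u|lborel. complex_of_real (pw \<alpha> u * exp (- (x * u))))"
      unfolding lap_def by (intro Bochner_Integration.integral_cong refl) (simp add: exp_of_real[symmetric])
    also have "\<dots> = of_real (Gamma \<alpha> * x powr (- \<alpha>))"
      using has_bochner_integral_pw[OF al x] by (simp only: integral_complex_of_real has_bochner_integral_iff)
    also have "\<dots> = of_real (Gamma \<alpha>) * of_real x powr (- of_real \<alpha>)"
      using powr_of_real[of x "- \<alpha>"] x by simp
    finally show ?thesis unfolding F_def by simp
  qed
  have hol: "F holomorphic_on S" unfolding F_def[abs_def] S_def
    by (intro holomorphic_intros lap_holomorphic[OF adm_pw[OF al]]) (auto simp: complex_nonpos_Reals_iff)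
  have "F w = 0"
  proof (rule analytic_continuation[OF hol])
    show "open S" unfolding S_def by (rule open_halfspace_Re_gt)
    show "connected S" unfolding S_def by (intro convex_connected convex_halfspace_Re_gt)
    show "complex_of_real ` {0<..} \<subseteq> S" by (auto simp: S_def)
    show "1 \<in> S" by (simp add: S_def)
    show "1 islimpt complex_of_real ` {0<..}"
      unfolding islimpt_approachable
    proof (intro allI impI)
      fix e :: real assume e: "e > 0"
      have "dist (complex_of_real (1 + e / 2)) 1 = e / 2"
        using e by (metis abs_of_nonneg add_diff_cancel_left' dist_norm half_gt_zero less_imp_le norm_of_real of_real_1 of_real_diff)
      moreover have "complex_of_real (1 + e / 2) \<noteq> 1" using e by (simp add: complex_eq_iff)
      moreover have "complex_of_real (1 + e / 2) \<in> complex_of_real ` {0<..}" using e by (intro imageI) simp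
      ultimately show "\<exists>x'\<in>complex_of_real ` {0<..}. x' \<noteq> 1 \<and> dist x' 1 < e" using e by (intro bexI[of _ "complex_of_real (1 + e / 2)"]) auto
    qed
    show "F z = 0" if "z \<in> complex_of_real ` {0<..}" for z using that real by auto
    show "w \<in> S" using w by (simp add: S_def)
  qed
  thus ?thesis unfolding F_def by simp
qed

text \<open>The Gaussian factor makes the double integral absolutely convergent, so the integrations
  can be exchanged. The inner one is then the characteristic function of the normal distribution,
  and \<open>v = u - \<epsilon> w\<close> concentrates the result at \<open>u\<close>.\<close>

lemma fourier_gauss_identity:
  fixes k :: "real \<Rightarrow> complex" and u \<epsilon> :: real
  assumes m [measurable]: "k \<in> borel_measurable borel" and int: "integrable lborel k" and eps: "\<epsilon> > 0"
  defines "K \<equiv> (\<lambda>t. LINT v|lborel. iexp (- (t * v)) * k v)"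
  shows "(LINT t|lborel. K t * iexp (t * u) * of_real (std_normal_density (\<epsilon> * t))) =
         (LINT w|lborel. k (u - \<epsilon> * w) * of_real (exp (- (w\<^sup>2) / 2)))"
proof -
  define N where "N = std_normal_distribution"
  interpret N: prob_space N unfolding N_def by (rule real_distribution.axioms(1)[OF real_dist_normal_dist])
  have [measurable_cong]: "sets N = sets borel" unfolding N_def by simp
  interpret P: pair_sigma_finite N lborel ..
  have "(LINT t|lborel. K t * iexp (t * u) * of_real (std_normal_density (\<epsilon> * t)))
      = \<bar>1/\<epsilon>\<bar> *\<^sub>R (LINT x|lborel. K (0 + 1/\<epsilon> * x) * iexp ((0 + 1/\<epsilon> * x) * u) * of_real (std_normal_density (\<epsilon> * (0 + 1/\<epsilon> * x))))"
    using eps by (intro lborel_integral_real_affine) simp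
  also have "\<dots> = (1/\<epsilon>) *\<^sub>R (LINT x|lborel. std_normal_density x *\<^sub>R (K (x / \<epsilon>) * iexp (x / \<epsilon> * u)))"
    using eps by (simp add: scaleR_conv_of_real mult.commute)
  also have "(LINT x|lborel. std_normal_density x *\<^sub>R (K (x / \<epsilon>) * iexp (x / \<epsilon> * u))) = (LINT x|N. K (x / \<epsilon>) * iexp (x / \<epsilon> * u))"
    unfolding N_def
  proof (rule integral_density[symmetric])
    show "(\<lambda>x. K (x / \<epsilon>) * iexp (x / \<epsilon> * u)) \<in> borel_measurable lborel" unfolding K_def by measurable
  qed (auto simp: normal_density_nonneg)
  also have "(\<lambda>x. K (x / \<epsilon>) * iexp (x / \<epsilon> * u)) = (\<lambda>x. LINT v|lborel. k v * iexp (x * ((u - v) / \<epsilon>)))"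
  proof
    fix x
    have "K (x / \<epsilon>) * iexp (x / \<epsilon> * u) = (LINT v|lborel. (iexp (- (x / \<epsilon> * v)) * k v) * iexp (x / \<epsilon> * u))"
      unfolding K_def by simp
    also have "\<dots> = (LINT v|lborel. k v * iexp (x * ((u - v) / \<epsilon>)))"
    proof (rule Bochner_Integration.integral_cong[OF refl])
      fix v
      have "iexp (- (x / \<epsilon> * v)) * iexp (x / \<epsilon> * u) = iexp (x * ((u - v) / \<epsilon>))"
        unfolding exp_add[symmetric] using eps by (simp add: field_simps)
      thus "iexp (- (x / \<epsilon> * v)) * k v * iexp (x / \<epsilon> * u) = k v * iexp (x * ((u - v) / \<epsilon>))"
        by (metis mult.commute mult.left_commute)
    qed
    finally show "K (x / \<epsilon>) * iexp (x / \<epsilon> * u) = (LINT v|lborel. k v * iexp (x * ((u - v) / \<epsilon>)))" .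
  qed
  also have "(LINT x|N. LINT v|lborel. k v * iexp (x * ((u - v) / \<epsilon>))) = (LINT v|lborel. LINT x|N. k v * iexp (x * ((u - v) / \<epsilon>)))"
  proof (rule P.Fubini_integral[symmetric])
    show "integrable (N \<Otimes>\<^sub>M lborel) (\<lambda>(x, v). k v * iexp (x * ((u - v) / \<epsilon>)))"
    proof (rule P.Fubini_integrable)
      show "(\<lambda>(x, v). k v * iexp (x * ((u - v) / \<epsilon>))) \<in> borel_measurable (N \<Otimes>\<^sub>M lborel)" by measurable
      show "integrable N (\<lambda>x. LINT v|lborel. norm (case (x, v) of (x, v) \<Rightarrow> k v * iexp (x * ((u - v) / \<epsilon>))))"
        by (simp add: norm_mult)
      show "AE x in N. integrable lborel (\<lambda>v. case (x, v) of (x, v) \<Rightarrow> k v * iexp (x * ((u - v) / \<epsilon>)))"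
      proof (intro AE_I2)
        fix x
        have "integrable lborel (\<lambda>v. k v * iexp (x * ((u - v) / \<epsilon>)))"
          by (rule Bochner_Integration.integrable_bound[OF int]) (auto simp: norm_mult)
        thus "integrable lborel (\<lambda>v. case (x, v) of (x, v) \<Rightarrow> k v * iexp (x * ((u - v) / \<epsilon>)))" by simp
      qed
    qed
  qed
  also have "(\<lambda>v. LINT x|N. k v * iexp (x * ((u - v) / \<epsilon>))) = (\<lambda>v. k v * of_real (exp (- (((u - v) / \<epsilon>)\<^sup>2) / 2)))"
  proof
    fix v
    have "(LINT x|N. k v * iexp (x * ((u - v) / \<epsilon>))) = k v * (LINT x|N. iexp (((u - v) / \<epsilon>) * x))"
      by (simp add: mult.commute)
    also have "(LINT x|N. iexp (((u - v) / \<epsilon>) * x)) = char N ((u - v) / \<epsilon>)"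
      unfolding char_def by (simp add: complex_eq_iff)
    also have "\<dots> = of_real (exp (- (((u - v) / \<epsilon>)\<^sup>2) / 2))" unfolding N_def char_std_normal_distribution ..
    finally show "(LINT x|N. k v * iexp (x * ((u - v) / \<epsilon>))) = k v * of_real (exp (- (((u - v) / \<epsilon>)\<^sup>2) / 2))" .
  qed
  also have "(LINT v|lborel. k v * of_real (exp (- (((u - v) / \<epsilon>)\<^sup>2) / 2))) =
     \<bar>- \<epsilon>\<bar> *\<^sub>R (LINT w|lborel. k (u + - \<epsilon> * w) * of_real (exp (- (((u - (u + - \<epsilon> * w)) / \<epsilon>)\<^sup>2) / 2)))"
    using eps by (intro lborel_integral_real_affine) simp
  also have "(1/\<epsilon>) *\<^sub>R \<dots> = (LINT w|lborel. k (u - \<epsilon> * w) * of_real (exp (- (w\<^sup>2) / 2)))"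
    using eps by simp
  finally show ?thesis .
qed

lemma gauss_integral: "integrable lborel (\<lambda>w::real. exp (- (w\<^sup>2) / 2))" "(LINT w|lborel. exp (- (w\<^sup>2) / 2 :: real)) = sqrt (2 * pi)"
proof -
  have "has_bochner_integral lborel (\<lambda>x. std_normal_density x * x ^ (2 * 0)) (fact (2 * 0) / (2 ^ 0 * fact 0))"
    by (rule std_normal_moment_even)
  hence h: "has_bochner_integral lborel std_normal_density 1" by simp
  have e: "std_normal_density = (\<lambda>w. 1 / sqrt (2 * pi) * exp (- (w\<^sup>2) / 2))"
    by (simp add: std_normal_density_def fun_eq_iff)
  have "has_bochner_integral lborel (\<lambda>w. sqrt (2 * pi) * (1 / sqrt (2 * pi) * exp (- (w\<^sup>2) / 2))) (sqrt (2 * pi) * 1)"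
    using h unfolding e by (rule has_bochner_integral_mult_right)
  hence "has_bochner_integral lborel (\<lambda>w::real. exp (- (w\<^sup>2) / 2)) (sqrt (2 * pi))" by simp
  thus "integrable lborel (\<lambda>w::real. exp (- (w\<^sup>2) / 2))" "(LINT w|lborel. exp (- (w\<^sup>2) / 2 :: real)) = sqrt (2 * pi)"
    by (auto simp: has_bochner_integral_iff)
qed

text \<open>Let the Gaussian width tend to its limit: on one side the density becomes its value
  \<open>1 / sqrt (2 pi)\<close> at 0, dominated by \<open>K\<close>; on the other \<open>k\<close>
  tends to \<open>k u\<close> against a Gaussian of mass \<open>sqrt (2 pi)\<close>, dominated
  because \<open>k\<close> is bounded.\<close>

theorem fourier_inversion:
  fixes k :: "real \<Rightarrow> complex" and u M :: real
  assumes m [measurable]: "k \<in> borel_measurable borel" and int: "integrable lborel k"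
    and M: "\<And>v. norm (k v) \<le> M" and cont: "isCont k u"
  defines "K \<equiv> (\<lambda>t. LINT v|lborel. iexp (- (t * v)) * k v)"
  assumes Kint: "integrable lborel K"
  shows "(LINT t|lborel. K t * iexp (t * u)) = of_real (2 * pi) * k u"
proof -
  define e where "e n = 1 / real (Suc n)" for n
  have e0: "e n > 0" for n by (simp add: e_def)
  have elim: "e \<longlonglongrightarrow> 0" unfolding e_def using LIMSEQ_inverse_real_of_nat by (simp add: inverse_eq_divide)
  have [measurable]: "K \<in> borel_measurable borel" using Kint by (simp add: borel_measurable_integrable)
  have dens: "0 \<le> std_normal_density x" "std_normal_density x \<le> 1" for x
  proof -
    have "sqrt (2 * pi) \<ge> sqrt 1" using pi_gt3 by (intro real_sqrt_le_mono) auto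
    hence s: "sqrt (2 * pi) \<ge> 1" by simp
    have "1 / sqrt (2 * pi) * exp (- x\<^sup>2 / 2) \<le> 1 * 1" using s by (intro mult_mono) auto
    thus "std_normal_density x \<le> 1" unfolding std_normal_density_def by simp
  qed (rule normal_density_nonneg)
  have 1: "(\<lambda>n. LINT t|lborel. K t * iexp (t * u) * of_real (std_normal_density (e n * t)))
     \<longlonglongrightarrow> (LINT t|lborel. K t * iexp (t * u) * of_real (std_normal_density 0))"
  proof (rule integral_dominated_convergence[where w = "\<lambda>t. norm (K t)"])
    show "integrable lborel (\<lambda>t. norm (K t))" using Kint by (rule integrable_norm)
    show "AE t in lborel. (\<lambda>n. K t * iexp (t * u) * of_real (std_normal_density (e n * t))) \<longlonglongrightarrow> K t * iexp (t * u) * of_real (std_normal_density 0)"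
    proof (intro AE_I2 tendsto_mult tendsto_const tendsto_of_real)
      fix t :: real
      have "(\<lambda>n. 1 / sqrt (2 * pi) * exp (- (e n * t)\<^sup>2 / 2)) \<longlonglongrightarrow> 1 / sqrt (2 * pi) * exp (- (0 * t)\<^sup>2 / 2)"
        by (intro tendsto_intros elim) auto
      thus "(\<lambda>n. std_normal_density (e n * t)) \<longlonglongrightarrow> std_normal_density 0" by (simp add: std_normal_density_def)
    qed
    show "AE t in lborel. norm (K t * iexp (t * u) * of_real (std_normal_density (e n * t))) \<le> norm (K t)" for n
      using dens by (intro AE_I2) (simp add: norm_mult mult_left_le)
  qed measurable
  have 2: "(\<lambda>n. LINT w|lborel. k (u - e n * w) * of_real (exp (- (w\<^sup>2) / 2)))
     \<longlonglongrightarrow> (LINT w|lborel. k u * of_real (exp (- (w\<^sup>2) / 2)))"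
  proof (rule integral_dominated_convergence[where w = "\<lambda>w. M * exp (- (w\<^sup>2) / 2)"])
    show "integrable lborel (\<lambda>w. M * exp (- (w\<^sup>2) / 2))" by (intro integrable_mult_right gauss_integral)
    show "AE w in lborel. (\<lambda>n. k (u - e n * w) * of_real (exp (- (w\<^sup>2) / 2))) \<longlonglongrightarrow> k u * of_real (exp (- (w\<^sup>2) / 2))"
    proof (intro AE_I2 tendsto_mult tendsto_const)
      fix w :: real
      have "(\<lambda>n. u - e n * w) \<longlonglongrightarrow> u - 0 * w" by (intro tendsto_intros elim)
      thus "(\<lambda>n. k (u - e n * w)) \<longlonglongrightarrow> k u" using isCont_tendsto_compose[OF cont] by simp
    qed
    show "AE w in lborel. norm (k (u - e n * w) * of_real (exp (- (w\<^sup>2) / 2))) \<le> M * exp (- (w\<^sup>2) / 2)" for n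
      using M by (intro AE_I2) (simp add: norm_mult mult_right_mono)
  qed measurable
  have a: "(LINT t|lborel. K t * iexp (t * u) * of_real (std_normal_density 0)) = (LINT w|lborel. k u * of_real (exp (- (w\<^sup>2) / 2)))"
    using 1 2 unfolding K_def fourier_gauss_identity[OF m int e0] by (rule LIMSEQ_unique)
  have b: "(LINT w|lborel. k u * complex_of_real (exp (- (w\<^sup>2) / 2))) = k u * of_real (sqrt (2 * pi))"
    using gauss_integral(2) by (simp only: integral_mult_right_zero integral_complex_of_real)
  have c: "(LINT t|lborel. K t * iexp (t * u) * of_real (std_normal_density 0)) = (LINT t|lborel. K t * iexp (t * u)) * of_real (1 / sqrt (2 * pi))"
    by (simp add: std_normal_density_def)
  have "(LINT t|lborel. K t * iexp (t * u)) * of_real (1 / sqrt (2 * pi)) = k u * of_real (sqrt (2 * pi))"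
    by (rule trans[OF c[symmetric] trans[OF a b]])
  hence "(LINT t|lborel. K t * iexp (t * u)) * of_real (1 / sqrt (2 * pi) * sqrt (2 * pi)) = k u * of_real (sqrt (2 * pi) * sqrt (2 * pi))"
    by (simp only: of_real_mult mult.assoc[symmetric])
  thus ?thesis by (simp add: mult.commute)
qed

corollary fourier_bound:
  fixes k :: "real \<Rightarrow> complex" and u M :: real
  assumes m [measurable]: "k \<in> borel_measurable borel" and int: "integrable lborel k"
    and M: "\<And>v. norm (k v) \<le> M" and cont: "isCont k u" and H: "integrable lborel H"
    and le: "\<And>t. t \<noteq> 0 \<Longrightarrow> norm (LINT v|lborel. iexp (- (t * v)) * k v) \<le> H t"
  shows "norm (k u) \<le> (LINT t|lborel. H t) / (2 * pi)"
proof -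
  define K where "K = (\<lambda>t. LINT v|lborel. iexp (- (t * v)) * k v)"
  have [measurable]: "K \<in> borel_measurable borel" unfolding K_def by measurable
  have ae: "AE t in lborel. norm (K t) \<le> H t"
    \<comment> \<open>The point 0 is a null set. It must be skipped, since the majorant
      \<open>Gmaj\<close> used later vanishes there by convention.\<close>
    using AE_lborel_singleton[of "0::real"] unfolding K_def by eventually_elim (rule le)
  have Kint: "integrable lborel K"
  proof (rule Bochner_Integration.integrable_bound[OF H])
    show "AE t in lborel. norm (K t) \<le> norm (H t)" using ae by eventually_elim simp
    show "K \<in> borel_measurable lborel" by measurable
  qed
  have "of_real (2 * pi) * k u = (LINT t|lborel. K t * iexp (t * u))"
    using fourier_inversion[OF m int M cont] Kint unfolding K_def by (simp only:)
  moreover have "norm (of_real (2 * pi) * k u) = 2 * pi * norm (k u)" by (simp add: norm_mult)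
  ultimately have "2 * pi * norm (k u) = norm (LINT t|lborel. K t * iexp (t * u))" by (simp only:)
  also have "\<dots> \<le> (LINT t|lborel. norm (K t * iexp (t * u)))" by (rule integral_norm_bound)
  also have "\<dots> = (LINT t|lborel. norm (K t))" by (simp add: norm_mult)
  also have "\<dots> \<le> (LINT t|lborel. H t)" by (rule integral_mono_AE[OF integrable_norm[OF Kint] H ae])
  finally show ?thesis by (simp add: field_simps)
qed

lemma integrable_powr_pieces:
  "integrable lborel (\<lambda>t::real. indicator {0..1} t * t powr (- 1/2))"
  "integrable lborel (\<lambda>t::real. indicator {1..} t * t powr (- 3/2))"
proof -
  have "has_bochner_integral lborel (\<lambda>t::real. indicator {0..1} t * t powr (- 1/2)) (1 powr (- 1/2 + 1) / (- 1/2 + 1))"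
  proof (rule has_bochner_integral_nn_integral)
    show "(\<integral>\<^sup>+ t. ennreal (indicator {0..1} t * t powr (- 1/2)) \<partial>lborel) = ennreal (1 powr (- 1/2 + 1) / (- 1/2 + 1))"
      by (rule nn_integral_has_integral_lebesgue[OF _ has_integral_powr_from_0]) auto
  qed auto
  thus "integrable lborel (\<lambda>t::real. indicator {0..1} t * t powr (- 1/2))" by (simp only: has_bochner_integral_iff)
  have "has_bochner_integral lborel (\<lambda>t::real. indicator {1..} t * t powr (- 3/2)) (- (1 powr (- 3/2 + 1)) / (- 3/2 + 1))"
  proof (rule has_bochner_integral_nn_integral)
    show "(\<integral>\<^sup>+ t. ennreal (indicator {1..} t * t powr (- 3/2)) \<partial>lborel) = ennreal (- (1 powr (- 3/2 + 1)) / (- 3/2 + 1))"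
      by (rule nn_integral_has_integral_lebesgue[OF _ has_integral_powr_to_inf]) auto
  qed auto
  thus "integrable lborel (\<lambda>t::real. indicator {1..} t * t powr (- 3/2))" by (simp only: has_bochner_integral_iff)
qed

lemma Gmaj_integrable: "integrable lborel Gmaj"
proof -
  define g :: "real \<Rightarrow> real" where "g t = indicator {0..1} t * t powr (- 1/2) + indicator {1..} t * t powr (- 3/2)" for t
  have g: "integrable lborel g" unfolding g_def[abs_def] by (intro Bochner_Integration.integrable_add integrable_powr_pieces)
  have "integrable lborel (\<lambda>t. g (0 + (-1) * t))" by (rule lborel_integrable_real_affine[OF g]) simp
  hence "integrable lborel (\<lambda>t. g t + g (0 + (-1) * t))" using g by (rule_tac Bochner_Integration.integrable_add)
  thus ?thesis
  proof (rule Bochner_Integration.integrable_bound)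
    show "Gmaj \<in> borel_measurable lborel" unfolding Gmaj_def[abs_def] by measurable
    have gn: "g t \<ge> 0" for t unfolding g_def by simp
    have le: "Gmaj t \<le> g t" if t: "t \<ge> 0" for t
    proof (cases "t \<le> 1")
      case True
      have "Gmaj t \<le> t powr (- 1/2) / 1" unfolding Gmaj_def using t by (intro frac_le) auto
      also have "\<dots> \<le> g t" unfolding g_def using True t by simp
      finally show ?thesis .
    next
      case False
      have "(- 3/2::real) = - 1/2 + (-1)" by simp
      hence "t powr (- 3/2) = t powr (- 1/2) * t powr (-1)" by (simp only: powr_add)
      hence e: "t powr (- 3/2) = t powr (- 1/2) / t" using False by (simp add: powr_minus_divide)
      have "Gmaj t \<le> t powr (- 1/2) / t" unfolding Gmaj_def using False by (intro frac_le) auto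
      also have "\<dots> \<le> g t" unfolding g_def e using False by simp
      finally show ?thesis .
    qed
    show "AE t in lborel. norm (Gmaj t) \<le> norm (g t + g (0 + (-1) * t))"
    proof (intro AE_I2)
      fix t :: real
      have G0: "Gmaj t \<ge> 0" unfolding Gmaj_def by simp
      have sym: "Gmaj (- t) = Gmaj t" unfolding Gmaj_def by simp
      show "norm (Gmaj t) \<le> norm (g t + g (0 + (-1) * t))"
        using le[of t] le[of "- t"] gn[of t] gn[of "- t"] G0 sym by (cases "t \<ge> 0") auto
    qed
  qed
qed

section \<open>A Tauberian theorem\<close>

text \<open>At \<open>X = log x\<close> this is the Riesz mean, the sum of
  \<open>a n * (1 - n / x)\<close> over \<open>n \<le> x\<close>. Multiplied by \<open>x\<close> it
  becomes the integral of the summatory function when \<open>a 0 = 0\<close>, and it is continuous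
  in \<open>X\<close>.\<close>

definition \<Psi> :: "(nat \<Rightarrow> complex) \<Rightarrow> real \<Rightarrow> complex" where
  "\<Psi> a X = (\<Sum>n. a n * of_real (max 0 (1 - real n * exp (- X))))"

lemma psi_term_zero: "real n \<ge> exp X \<Longrightarrow> max 0 (1 - real n * exp (- X)) = 0"
  by (simp add: exp_minus field_simps)

lemma psi_eq_sum:
  assumes "real N \<ge> exp X"
  shows "\<Psi> a X = (\<Sum>n<N. a n * of_real (max 0 (1 - real n * exp (- X))))"
  unfolding \<Psi>_def
proof (rule suminf_finite)
  fix n assume "n \<notin> {..<N}"
  hence "real n \<ge> exp X" using assms by auto
  thus "a n * of_real (max 0 (1 - real n * exp (- X))) = 0" by (simp add: psi_term_zero)
qed simp

lemma psi_isCont: "isCont (\<Psi> a) X"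
proof -
  obtain N where N: "exp (X + 1) \<le> real N" using real_arch_simple by blast
  have "isCont (\<lambda>Y. \<Sum>n<N. a n * of_real (max 0 (1 - real n * exp (- Y)))) X"
    by (intro continuous_intros)
  moreover have "\<forall>\<^sub>F Y in nhds X. \<Psi> a Y = (\<Sum>n<N. a n * of_real (max 0 (1 - real n * exp (- Y))))"
  proof -
    have "\<forall>\<^sub>F Y in nhds X. Y \<in> {..<X + 1}" by (intro eventually_nhds_in_open) auto
    thus ?thesis
    proof (rule eventually_mono)
      fix Y assume "Y \<in> {..<X + 1}"
      hence "exp Y \<le> real N" using N by (metis exp_le_cancel_iff lessThan_iff less_imp_le order_trans)
      thus "\<Psi> a Y = (\<Sum>n<N. a n * of_real (max 0 (1 - real n * exp (- Y))))" by (rule psi_eq_sum)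
    qed
  qed
  ultimately show ?thesis by (subst isCont_cong)
qed

lemma psi_measurable [measurable]: "\<Psi> a \<in> borel_measurable borel"
  by (intro borel_measurable_continuous_onI continuous_at_imp_continuous_on ballI psi_isCont)

text \<open>Shifting \<open>u\<close> by \<open>log n\<close> turns the kernel into
  \<open>1 - exp (- y)\<close> on \<open>y > 0\<close>, whose transform is
  \<open>1 / s - 1 / (s + 1)\<close>; the shift contributes \<open>n^(-s)\<close>.\<close>

lemma laplace_kernel:
  assumes n: "n > 0" and s: "Re s > 0"
  shows "integrable lborel (\<lambda>u. exp (- (s * of_real u)) * of_real (max 0 (1 - real n * exp (- u))))"
    and "(LINT u|lborel. exp (- (s * of_real u)) * of_real (max 0 (1 - real n * exp (- u)))) = of_nat n powr (- s) * inverse (s * (s + 1))"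
proof -
  define f where "f u = exp (- (s * of_real u)) * complex_of_real (max 0 (1 - real n * exp (- u)))" for u
  define p where "p u = complex_of_real (pw 1 u)" for u
  have adm: "adm 0 p" unfolding p_def[abs_def] by (rule adm_pw) simp
  have s1: "Re (s + 1) > 0" using s by simp
  have nz: "s \<noteq> 0" "s + 1 \<noteq> 0" using quadratic_nonzero[OF s] by auto
  define f0 where "f0 y = exp (- (s * of_real y)) * p y - exp (- ((s + 1) * of_real y)) * p y" for y
  have i0: "integrable lborel f0" unfolding f0_def[abs_def]
    by (intro Bochner_Integration.integrable_diff lap_integrable[OF adm s] lap_integrable[OF adm s1])
  have v0: "(LINT y|lborel. f0 y) = inverse (s * (s + 1))"
  proof -
    have "(LINT y|lborel. f0 y) = lap p s - lap p (s + 1)" unfolding f0_def lap_def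
      by (intro Bochner_Integration.integral_diff lap_integrable[OF adm s] lap_integrable[OF adm s1])
    also have "\<dots> = inverse s - inverse (s + 1)"
      unfolding p_def[abs_def] using lap_pw[of 1 s] lap_pw[of 1 "s + 1"] s s1 nz by (simp add: powr_minus)
    also have "\<dots> = inverse (s * (s + 1))" using nz by (simp add: field_simps)
    finally show ?thesis .
  qed
  have shift: "f (ln (real n) + 1 * y) = of_nat n powr (- s) * f0 y" for y
  proof -
    have e1: "real n * exp (- (ln (real n) + y)) = exp (- y)" using n by (simp add: exp_add exp_diff exp_minus field_simps)
    have e2: "exp (- (s * of_real (ln (real n) + y))) = of_nat n powr (- s) * exp (- (s * of_real y))"
      using n by (simp add: powr_def exp_add[symmetric] Ln_of_nat algebra_simps)
    have e3: "exp (- (s * of_real y)) * of_real (max 0 (1 - exp (- y))) = f0 y"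
    proof (cases "y > 0")
      case True
      hence py: "p y = 1" by (simp add: p_def pw_def)
      have mx: "max 0 (1 - exp (- y)) = 1 - exp (- y)" using True by simp
      have ex: "exp (- ((s + 1) * of_real y)) = exp (- (s * of_real y)) * of_real (exp (- y))"
        by (simp add: exp_add[symmetric] exp_of_real[symmetric] algebra_simps)
      show ?thesis unfolding f0_def py mx ex by (simp only: of_real_diff of_real_1 right_diff_distrib mult_1_right)
    next
      case False
      hence "max 0 (1 - exp (- y)) = 0" by simp
      moreover have "p y = 0" using False by (cases "y = 0") (auto simp: p_def pw_def)
      ultimately show ?thesis unfolding f0_def by simp
    qed
    have "f (ln (real n) + 1 * y) = of_nat n powr (- s) * (exp (- (s * of_real y)) * of_real (max 0 (1 - exp (- y))))"
      unfolding f_def using e1 e2 by (simp add: mult.assoc)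
    thus ?thesis unfolding e3 .
  qed
  have "integrable lborel (\<lambda>y. f (ln (real n) + 1 * y))" unfolding shift by (intro integrable_mult_right i0)
  thus "integrable lborel (\<lambda>u. exp (- (s * of_real u)) * of_real (max 0 (1 - real n * exp (- u))))"
    using lborel_integrable_real_affine_iff[of 1 f "ln (real n)"] unfolding f_def[abs_def] by simp
  have "(LINT u|lborel. f u) = \<bar>1\<bar> *\<^sub>R (LINT y|lborel. f (ln (real n) + 1 * y))"
    by (rule lborel_integral_real_affine) simp
  also have "\<dots> = of_nat n powr (- s) * inverse (s * (s + 1))" unfolding shift v0[symmetric] by simp
  finally show "(LINT u|lborel. exp (- (s * of_real u)) * of_real (max 0 (1 - real n * exp (- u)))) = of_nat n powr (- s) * inverse (s * (s + 1))"
    unfolding f_def .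
qed

lemma powr_le_exp:
  fixes \<beta> \<delta> :: real
  assumes "\<beta> > 0" "\<delta> > 0"
  shows "\<exists>M\<ge>0. \<forall>v\<ge>0. v powr \<beta> * exp (- (\<delta> * v)) \<le> M"
proof (intro exI[of _ "(\<beta> / \<delta>) powr \<beta>"] conjI allI impI)
  fix v :: real assume v: "v \<ge> 0"
  define \<eta> where "\<eta> = \<delta> / \<beta>"
  have eta: "\<eta> > 0" using assms by (simp add: \<eta>_def)
  have "\<eta> * v \<le> exp (\<eta> * v)" using exp_ge_add_one_self[of "\<eta> * v"] by linarith
  hence "v \<le> 1 / \<eta> * exp (\<eta> * v)" using eta by (simp add: field_simps)
  hence "v powr \<beta> \<le> (1 / \<eta> * exp (\<eta> * v)) powr \<beta>" using v assms by (intro powr_mono2) auto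
  also have "\<dots> = (1 / \<eta>) powr \<beta> * exp (\<eta> * v) powr \<beta>" by (rule powr_mult)
  also have "exp (\<eta> * v) powr \<beta> = exp (\<delta> * v)" using assms by (simp add: powr_def \<eta>_def)
  also have "1 / \<eta> = \<beta> / \<delta>" by (simp add: \<eta>_def)
  finally have "v powr \<beta> * exp (- (\<delta> * v)) \<le> (\<beta> / \<delta>) powr \<beta> * exp (\<delta> * v) * exp (- (\<delta> * v))" by (intro mult_right_mono) auto
  thus "v powr \<beta> * exp (- (\<delta> * v)) \<le> (\<beta> / \<delta>) powr \<beta>" by (simp add: mult.assoc exp_add[symmetric])
qed simp

lemma adm_shift:
  assumes "\<alpha> > 0"
  shows "adm 1 (\<lambda>u. of_real (pw \<alpha> u * exp u))"
  unfolding adm_def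
proof (intro conjI allI impI)
  fix b :: real assume b: "b > 1"
  have "integrable lborel (\<lambda>u. pw \<alpha> u * exp (- ((b - 1) * u)))"
    using has_bochner_integral_pw[of \<alpha> "b - 1"] b assms by (simp add: has_bochner_integral_iff)
  moreover have "exp (- (b * u)) * norm (complex_of_real (pw \<alpha> u * exp u)) = pw \<alpha> u * exp (- ((b - 1) * u))" for u
  proof -
    have "norm (complex_of_real (pw \<alpha> u * exp u)) = pw \<alpha> u * exp u"
      using pw_nonneg[of \<alpha> u] by (simp only: norm_of_real abs_mult abs_of_nonneg abs_exp_cancel)
    moreover have "exp (- (b * u)) * exp u = exp (- ((b - 1) * u))" by (simp add: exp_add[symmetric] algebra_simps)
    ultimately show ?thesis by (metis mult.commute mult.left_commute)
  qed
  ultimately show "integrable lborel (\<lambda>u. exp (- (b * u)) * norm (complex_of_real (pw \<alpha> u * exp u)))" by simp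
qed (auto simp: pw_def)

lemma lap_shift:
  assumes "\<alpha> > 0" "Re s > 1"
  shows "lap (\<lambda>u. of_real (pw \<alpha> u * exp u)) s = of_real (Gamma \<alpha>) * (s - 1) powr (- of_real \<alpha>)"
proof -
  have "lap (\<lambda>u. of_real (pw \<alpha> u * exp u)) s = lap (\<lambda>u. of_real (pw \<alpha> u)) (s - 1)"
    unfolding lap_def
  proof (rule Bochner_Integration.integral_cong[OF refl])
    fix u
    have "exp (- ((s - 1) * of_real u)) = exp (- (s * of_real u)) * of_real (exp u)"
      by (simp add: exp_add[symmetric] exp_of_real[symmetric] algebra_simps)
    thus "exp (- (s * of_real u)) * of_real (pw \<alpha> u * exp u) = exp (- ((s - 1) * of_real u)) * of_real (pw \<alpha> u)" by simp
  qed
  also have "\<dots> = of_real (Gamma \<alpha>) * (s - 1) powr (- of_real \<alpha>)" using assms by (intro lap_pw) auto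
  finally show ?thesis .
qed

context
  fixes a :: "nat \<Rightarrow> complex"
  assumes a0: "a 0 = 0" and a1: "\<And>n. norm (a n) \<le> 1"
begin

lemma psi_neg: assumes "X < 0" shows "\<Psi> a X = 0"
proof -
  have "exp X \<le> real 1" using assms by simp
  from psi_eq_sum[OF this] show ?thesis by (simp add: a0)
qed

lemma psi_bound: "norm (\<Psi> a X) \<le> exp X"
proof -
  define N where "N = nat \<lceil>exp X\<rceil>"
  have N: "exp X \<le> real N" "real N \<le> exp X + 1" unfolding N_def by (auto simp: of_nat_nat)
  have "N > 0" using N(1) exp_gt_zero[of X] by (metis gr0I not_le of_nat_0)
  have "norm (\<Psi> a X) \<le> (\<Sum>n<N. norm (a n * of_real (max 0 (1 - real n * exp (- X)))))"
    unfolding psi_eq_sum[OF N(1)] by (rule norm_sum)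
  also have "\<dots> \<le> (\<Sum>n<N. if n = 0 then 0 else 1)"
  proof (rule sum_mono)
    fix n
    have "norm (a n * of_real (max 0 (1 - real n * exp (- X)))) \<le> norm (a n) * 1"
      unfolding norm_mult by (intro mult_left_mono) auto
    thus "norm (a n * of_real (max 0 (1 - real n * exp (- X)))) \<le> (if n = 0 then 0 else 1)"
      using a0 a1[of n] by auto
  qed
  also have "\<dots> = real N - 1"
  proof -
    have "{..<N} = insert 0 {1..<N}" using \<open>N > 0\<close> by auto
    hence "(\<Sum>n<N. if n = 0 then 0 else 1 :: real) = (\<Sum>n\<in>{1..<N}. if n = 0 then 0 else 1)" by simp
    also have "\<dots> = (\<Sum>n\<in>{1..<N}. 1)" by (intro sum.cong) auto
    finally show ?thesis using \<open>N > 0\<close> by (simp add: of_nat_diff)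
  qed
  also have "\<dots> \<le> exp X" using N by simp
  finally show ?thesis .
qed

lemma adm_psi: "adm 1 (\<Psi> a)"
  unfolding adm_def
proof (intro conjI allI impI)
  show "\<Psi> a \<in> borel_measurable borel" by measurable
  show "\<Psi> a u = 0" if "u < 0" for u by (rule psi_neg[OF that])
  fix b :: real assume b: "b > 1"
  have "integrable lborel (\<lambda>u. pw 1 u * exp (- ((b - 1) * u)))"
    using has_bochner_integral_pw[of 1 "b - 1"] b by (simp add: has_bochner_integral_iff)
  thus "integrable lborel (\<lambda>u. exp (- (b * u)) * norm (\<Psi> a u))"
  proof (rule Bochner_Integration.integrable_bound)
    show "(\<lambda>u. exp (- (b * u)) * norm (\<Psi> a u)) \<in> borel_measurable lborel" by measurable
    have "AE u in lborel. u \<noteq> 0" by (rule AE_lborel_singleton)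
    thus "AE u in lborel. norm (exp (- (b * u)) * norm (\<Psi> a u)) \<le> norm (pw 1 u * exp (- ((b - 1) * u)))"
    proof eventually_elim
      case (elim u)
      show ?case
      proof (cases "u < 0")
        case False
        hence u: "u > 0" using elim by simp
        have "exp (- (b * u)) * norm (\<Psi> a u) \<le> exp (- (b * u)) * exp u" using psi_bound by (intro mult_left_mono) auto
        also have "\<dots> = exp (- ((b - 1) * u))" by (simp add: exp_add[symmetric] algebra_simps)
        finally show ?thesis using u by (simp add: pw_def)
      qed (simp add: psi_neg)
    qed
  qed
qed

lemma lap_psi:
  assumes s: "Re s > 1"
  shows "lap (\<Psi> a) s = dser a s * inverse (s * (s + 1))"
proof -
  define f where "f n u = a n * (exp (- (s * of_real u)) * of_real (max 0 (1 - real n * exp (- u))))" for n u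
  have s0: "Re s > 0" using s by simp
  have rs: "Re (complex_of_real (Re s)) > 0" using s0 by simp
  have int: "integrable lborel (f n)" for n
  proof (cases "n = 0")
    case False
    thus ?thesis unfolding f_def[abs_def] using laplace_kernel(1)[OF _ s0] by (intro integrable_mult_right) auto
  qed (simp add: f_def[abs_def] a0)
  have val: "(LINT u|lborel. f n u) = a n * of_nat n powr (- s) * inverse (s * (s + 1))" for n
  proof (cases "n = 0")
    case False
    thus ?thesis unfolding f_def using laplace_kernel(2)[OF _ s0, of n] by simp
  qed (simp add: f_def a0)
  \<comment> \<open>The kernel is nonnegative, so these norms are values of the same transform at
    the real point \<open>Re s\<close>.\<close>
  have nrm: "(LINT u|lborel. norm (f n u)) = norm (a n) * real n powr (- Re s) * (1 / (Re s * (Re s + 1)))" for n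
  proof (cases "n = 0")
    case False
    have "complex_of_real (LINT u|lborel. exp (- (Re s * u)) * max 0 (1 - real n * exp (- u)))
        = (LINT u|lborel. complex_of_real (exp (- (Re s * u)) * max 0 (1 - real n * exp (- u))))" by (simp only: integral_complex_of_real)
    also have "\<dots> = (LINT u|lborel. exp (- (complex_of_real (Re s) * of_real u)) * of_real (max 0 (1 - real n * exp (- u))))"
      by (intro Bochner_Integration.integral_cong refl) (simp add: exp_of_real[symmetric])
    also have "\<dots> = of_nat n powr (- complex_of_real (Re s)) * inverse (complex_of_real (Re s) * (complex_of_real (Re s) + 1))"
      using False by (intro laplace_kernel(2) rs) simp
    also have "\<dots> = of_real (real n powr (- Re s) * (1 / (Re s * (Re s + 1))))"
      using powr_of_real[of "real n" "- Re s"] by (simp add: divide_inverse)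
    finally have "(LINT u|lborel. exp (- (Re s * u)) * max 0 (1 - real n * exp (- u))) = real n powr (- Re s) * (1 / (Re s * (Re s + 1)))"
      by (simp only: of_real_eq_iff)
    moreover have "norm (f n u) = norm (a n) * (exp (- (Re s * u)) * max 0 (1 - real n * exp (- u)))" for u
      unfolding f_def by (simp add: norm_mult)
    ultimately show ?thesis by simp
  qed (simp add: f_def a0)
  have smr: "summable (\<lambda>n. norm (a n) * real n powr (- Re s))" by (rule tame_summable_real[OF tame_bounded[OF a1] s])
  have "(LINT u|lborel. (\<Sum>n. f n u)) = (\<Sum>n. LINT u|lborel. f n u)"
  proof (rule integral_suminf[OF int])
    show "AE u in lborel. summable (\<lambda>n. norm (f n u))"
    proof (intro AE_I2)
      fix u
      obtain N where N: "exp u \<le> real N" using real_arch_simple by blast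
      have "f n u = 0" if "n \<notin> {..<N}" for n
        unfolding f_def using psi_term_zero[of u n] that N by auto
      thus "summable (\<lambda>n. norm (f n u))" by (intro summable_finite[of "{..<N}"]) auto
    qed
    show "summable (\<lambda>n. LINT u|lborel. norm (f n u))" unfolding nrm by (intro summable_mult2 smr)
  qed
  also have "(\<lambda>u. \<Sum>n. f n u) = (\<lambda>u. exp (- (s * of_real u)) * \<Psi> a u)"
  proof
    fix u
    obtain N where N: "exp u \<le> real N" using real_arch_simple by blast
    have "(\<Sum>n. f n u) = (\<Sum>n<N. f n u)"
      by (rule suminf_finite) (use psi_term_zero[of u] N in \<open>auto simp: f_def\<close>)
    also have "\<dots> = exp (- (s * of_real u)) * \<Psi> a u"
      unfolding psi_eq_sum[OF N] f_def by (simp add: sum_distrib_left algebra_simps)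
    finally show "(\<Sum>n. f n u) = exp (- (s * of_real u)) * \<Psi> a u" .
  qed
  also have "(\<Sum>n. LINT u|lborel. f n u) = dser a s * inverse (s * (s + 1))"
  proof -
    have "summable (\<lambda>n. a n * of_nat n powr (- s))"
      by (rule summable_norm_cancel[OF tame_summable[OF tame_bounded[OF a1] s]])
    thus ?thesis unfolding val dser_def by (rule suminf_mult2[symmetric])
  qed
  finally show ?thesis unfolding lap_def .
qed

text \<open>Up to sign, \<open>k\<close> derivatives of the transform belong to
  \<open>v^k * \<Psi> a v\<close>, and the powers of \<open>s - 1\<close> belong to
  \<open>v^(k - 1/2 - j) * exp v\<close>. The difference has a transform below
  \<open>C * Gmaj\<close> on every vertical line, so inversion bounds it pointwise; dividing by
  \<open>X^k\<close> gives the claim.\<close>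

theorem smoothed_asymptotics:
  fixes d :: "nat \<Rightarrow> complex" and C :: real
  assumes k: "k > 0" and C: "C \<ge> 0"
    and bnd: "\<And>s. 1 < Re s \<Longrightarrow> Re s < 3 \<Longrightarrow> Im s \<noteq> 0 \<Longrightarrow>
      norm ((-1) ^ k * (deriv ^^ k) (\<lambda>s. dser a s * inverse (s * (s + 1))) s -
        (\<Sum>j<k. d j * (of_real (Gamma (real k + 1/2 - real j)) * (s - 1) powr (- of_real (real k + 1/2 - real j))))) \<le> C * Gmaj (Im s)"
  shows "\<exists>C'\<ge>0. \<forall>X\<ge>1. norm (\<Psi> a X - of_real (exp X) * (\<Sum>j<k. d j * of_real (X powr (- 1/2 - real j)))) \<le> C' * (exp X * X powr (- real k))"
proof -
  define \<alpha> where "\<alpha> j = real k + 1/2 - real j" for j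
  have al: "\<alpha> j > 1" if "j < k" for j using that unfolding \<alpha>_def by auto
  define f where "f v = of_real v ^ k * \<Psi> a v - (\<Sum>j<k. d j * of_real (pw (\<alpha> j) v * exp v))" for v
  have fm [measurable]: "f \<in> borel_measurable borel" unfolding f_def[abs_def] by measurable
  define C1 where "C1 = (LINT t|lborel. C * Gmaj t) / (2 * pi)"
  have C10: "C1 \<ge> 0" unfolding C1_def using C by (intro divide_nonneg_pos Bochner_Integration.integral_nonneg) (auto simp: Gmaj_def)
  have main: "norm (f X) \<le> C1 * exp (\<sigma> * X)" if X: "X \<ge> 1" and s: "1 < \<sigma>" "\<sigma> < 3" for X \<sigma>
  proof -
    define \<kappa> where "\<kappa> v = of_real (exp (- (\<sigma> * v))) * f v" for v
    have [measurable]: "\<kappa> \<in> borel_measurable borel" unfolding \<kappa>_def[abs_def] by measurable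
    have i1: "integrable lborel (\<lambda>v. exp (- (w * of_real v)) * (of_real v ^ k * \<Psi> a v))" if "Re w > 1" for w
    proof -
      have "integrable lborel (\<lambda>v. (-1) ^ k * (exp (- (w * of_real v)) * ((- of_real v) ^ k * \<Psi> a v)))"
        by (intro integrable_mult_right lap_integrable[OF adm_power[OF adm_psi] that])
      moreover have "(-1) ^ k * (exp (- (w * of_real v)) * ((- of_real v) ^ k * \<Psi> a v)) = exp (- (w * of_real v)) * (of_real v ^ k * \<Psi> a v)" for v
      proof -
        have "(-1) ^ k * (- complex_of_real v) ^ k = of_real v ^ k" by (simp add: power_mult_distrib[symmetric])
        thus ?thesis by (metis mult.assoc mult.left_commute)
      qed
      ultimately show ?thesis by simp
    qed
    have i2: "integrable lborel (\<lambda>v. d j * (exp (- (w * of_real v)) * of_real (pw (\<alpha> j) v * exp v)))" if "Re w > 1" "j < k" for w j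
      using al[OF that(2)] by (intro integrable_mult_right lap_integrable[OF adm_shift that(1)]) simp
    have split: "exp (- (w * of_real v)) * f v = exp (- (w * of_real v)) * (of_real v ^ k * \<Psi> a v) -
        (\<Sum>j<k. d j * (exp (- (w * of_real v)) * of_real (pw (\<alpha> j) v * exp v)))" for w v
      unfolding f_def by (simp add: right_diff_distrib sum_distrib_left mult.left_commute)
    have i3: "integrable lborel (\<lambda>v. \<Sum>j<k. d j * (exp (- (w * of_real v)) * of_real (pw (\<alpha> j) v * exp v)))" if "Re w > 1" for w
      using i2[OF that] by (intro Bochner_Integration.integrable_sum) auto
    have lapf: "(LINT v|lborel. exp (- (w * of_real v)) * f v) = (-1) ^ k * (deriv ^^ k) (\<lambda>s. dser a s * inverse (s * (s + 1))) w -
        (\<Sum>j<k. d j * (of_real (Gamma (\<alpha> j)) * (w - 1) powr (- of_real (\<alpha> j))))" if w: "Re w > 1" for w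
    proof -
      have "(LINT v|lborel. exp (- (w * of_real v)) * f v) = (LINT v|lborel. exp (- (w * of_real v)) * (of_real v ^ k * \<Psi> a v)) -
          (LINT v|lborel. (\<Sum>j<k. d j * (exp (- (w * of_real v)) * of_real (pw (\<alpha> j) v * exp v))))"
        unfolding split by (rule Bochner_Integration.integral_diff[OF i1[OF w] i3[OF w]])
      also have "(LINT v|lborel. (\<Sum>j<k. d j * (exp (- (w * of_real v)) * of_real (pw (\<alpha> j) v * exp v)))) =
          (\<Sum>j<k. LINT v|lborel. d j * (exp (- (w * of_real v)) * of_real (pw (\<alpha> j) v * exp v)))"
        using i2[OF w] by (intro Bochner_Integration.integral_sum) auto
      also have "\<dots> = (\<Sum>j<k. d j * (of_real (Gamma (\<alpha> j)) * (w - 1) powr (- of_real (\<alpha> j))))"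
      proof (rule sum.cong[OF refl])
        fix j assume "j \<in> {..<k}"
        hence "\<alpha> j > 0" using al[of j] by simp
        from lap_shift[OF this w]
        show "(LINT v|lborel. d j * (exp (- (w * of_real v)) * of_real (pw (\<alpha> j) v * exp v))) = d j * (of_real (Gamma (\<alpha> j)) * (w - 1) powr (- of_real (\<alpha> j)))"
          unfolding lap_def by (simp only: integral_mult_right_zero)
      qed
      also have "(LINT v|lborel. exp (- (w * of_real v)) * (of_real v ^ k * \<Psi> a v)) = (-1) ^ k * (deriv ^^ k) (\<lambda>s. dser a s * inverse (s * (s + 1))) w"
      proof -
        have "(deriv ^^ k) (\<lambda>s. dser a s * inverse (s * (s + 1))) w = (deriv ^^ k) (lap (\<Psi> a)) w"
        proof (rule higher_deriv_transform_within_open[OF _ _ open_halfspace_Re_gt])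
          show "lap (\<Psi> a) holomorphic_on {s. Re s > 1}" by (rule lap_holomorphic[OF adm_psi])
          show "(\<lambda>s. dser a s * inverse (s * (s + 1))) holomorphic_on {s. Re s > 1}"
            by (intro holomorphic_intros dser_holomorphic tame_bounded[OF a1] quadratic_nonzero) auto
        qed (use w lap_psi in auto)
        also have "\<dots> = lap (\<lambda>u. (- of_real u) ^ k * \<Psi> a u) w" by (rule lap_higher_deriv[OF adm_psi w])
        finally have "(-1) ^ k * (deriv ^^ k) (\<lambda>s. dser a s * inverse (s * (s + 1))) w = (LINT v|lborel. (-1) ^ k * (exp (- (w * of_real v)) * ((- of_real v) ^ k * \<Psi> a v)))"
          unfolding lap_def by (simp only: integral_mult_right_zero)
        also have "\<dots> = (LINT v|lborel. exp (- (w * of_real v)) * (of_real v ^ k * \<Psi> a v))"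
        proof (rule Bochner_Integration.integral_cong[OF refl])
          fix v
          have "(-1) ^ k * (- complex_of_real v) ^ k = of_real v ^ k" by (simp add: power_mult_distrib[symmetric])
          thus "(-1) ^ k * (exp (- (w * of_real v)) * ((- of_real v) ^ k * \<Psi> a v)) = exp (- (w * of_real v)) * (of_real v ^ k * \<Psi> a v)"
            by (metis mult.assoc mult.left_commute)
        qed
        finally show ?thesis by simp
      qed
      finally show ?thesis .
    qed
    have kap: "\<kappa> v = exp (- (of_real \<sigma> * of_real v)) * f v" for v unfolding \<kappa>_def by (simp add: exp_of_real[symmetric])
    have intk: "integrable lborel \<kappa>"
      unfolding kap[abs_def] split using s by (intro Bochner_Integration.integrable_diff i1 i3) auto
    have le: "norm (LINT v|lborel. iexp (- (t * v)) * \<kappa> v) \<le> C * Gmaj t" if t: "t \<noteq> 0" for t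
    proof -
      define w where "w = Complex \<sigma> t"
      have w: "Re w > 1" "Re w < 3" "Im w = t" using s by (auto simp: w_def)
      have "iexp (- (t * v)) * \<kappa> v = exp (- (w * of_real v)) * f v" for v
      proof -
        have "iexp (- (t * v)) * exp (- (of_real \<sigma> * of_real v)) = exp (- (w * of_real v))"
          unfolding exp_add[symmetric] w_def by (intro arg_cong[of _ _ exp]) (simp add: complex_eq_iff)
        thus ?thesis unfolding kap by (simp only: mult.assoc[symmetric])
      qed
      hence "(LINT v|lborel. iexp (- (t * v)) * \<kappa> v) = (LINT v|lborel. exp (- (w * of_real v)) * f v)" by simp
      also have "norm \<dots> \<le> C * Gmaj (Im w)" unfolding lapf[OF w(1)] \<alpha>_def using w t by (intro bnd) auto
      finally show ?thesis unfolding w(3) .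
    qed
    \<comment> \<open>Only the existence of a bound is needed to justify inversion. \<open>M\<close>
      depends on \<open>\<sigma>\<close>, whereas the resulting constant \<open>C1\<close> does
      not.\<close>
    have "\<exists>M. \<forall>v. norm (\<kappa> v) \<le> M"
    proof -
      have dl: "\<sigma> - 1 > 0" using s by simp
      obtain M0 where M0: "M0 \<ge> 0" "\<And>v. v \<ge> 0 \<Longrightarrow> v powr real k * exp (- ((\<sigma> - 1) * v)) \<le> M0"
        using powr_le_exp[of "real k" "\<sigma> - 1"] dl k by auto
      have "\<forall>j\<in>{..<k}. \<exists>M\<ge>0. \<forall>v\<ge>0. v powr (\<alpha> j - 1) * exp (- ((\<sigma> - 1) * v)) \<le> M"
        using powr_le_exp[OF _ dl] al by (simp add: lessThan_iff)
      then obtain M where M: "\<And>j v. j < k \<Longrightarrow> v \<ge> 0 \<Longrightarrow> v powr (\<alpha> j - 1) * exp (- ((\<sigma> - 1) * v)) \<le> M j"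
        by (metis lessThan_iff)
      show ?thesis
      proof (intro exI allI)
        fix v
        show "norm (\<kappa> v) \<le> M0 + (\<Sum>j<k. norm (d j) * \<bar>M j\<bar>)"
        proof (cases "v < 0")
          case True
          hence "\<kappa> v = 0" unfolding \<kappa>_def f_def by (simp add: psi_neg pw_def)
          thus ?thesis using M0 by (simp add: sum_nonneg)
        next
          case False
          hence v: "v \<ge> 0" by simp
          have ee: "exp (- (\<sigma> * v)) * exp v = exp (- ((\<sigma> - 1) * v))" by (simp add: exp_add[symmetric] algebra_simps)
          have "norm (f v) \<le> v ^ k * norm (\<Psi> a v) + (\<Sum>j<k. norm (d j) * (pw (\<alpha> j) v * exp v))"
          proof -
            have "norm (f v) \<le> norm (of_real v ^ k * \<Psi> a v) + norm (\<Sum>j<k. d j * of_real (pw (\<alpha> j) v * exp v))"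
              unfolding f_def by (rule norm_triangle_ineq4)
            also have "norm (\<Sum>j<k. d j * complex_of_real (pw (\<alpha> j) v * exp v)) \<le> (\<Sum>j<k. norm (d j * of_real (pw (\<alpha> j) v * exp v)))"
              by (rule norm_sum)
            also have "\<dots> = (\<Sum>j<k. norm (d j) * (pw (\<alpha> j) v * exp v))"
              by (intro sum.cong refl) (simp add: norm_mult pw_nonneg)
            also have "norm (complex_of_real v ^ k * \<Psi> a v) = v ^ k * norm (\<Psi> a v)" using v by (simp add: norm_mult norm_power)
            finally show ?thesis by simp
          qed
          also have "\<dots> \<le> v ^ k * exp v + (\<Sum>j<k. norm (d j) * (pw (\<alpha> j) v * exp v))"
            using v psi_bound by (intro add_right_mono mult_left_mono) auto
          finally have "exp (- (\<sigma> * v)) * norm (f v) \<le> exp (- (\<sigma> * v)) * (v ^ k * exp v + (\<Sum>j<k. norm (d j) * (pw (\<alpha> j) v * exp v)))"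
            by (intro mult_left_mono) auto
          also have "\<dots> = v ^ k * exp (- ((\<sigma> - 1) * v)) + (\<Sum>j<k. norm (d j) * (pw (\<alpha> j) v * exp (- ((\<sigma> - 1) * v))))"
            unfolding ee[symmetric] by (simp add: distrib_left sum_distrib_left algebra_simps)
          also have "\<dots> \<le> M0 + (\<Sum>j<k. norm (d j) * \<bar>M j\<bar>)"
          proof (intro add_mono sum_mono mult_left_mono)
            have "v ^ k \<le> v powr real k" using v k by (cases "v = 0") (auto simp: powr_realpow zero_power)
            hence "v ^ k * exp (- ((\<sigma> - 1) * v)) \<le> v powr real k * exp (- ((\<sigma> - 1) * v))" by (intro mult_right_mono) auto
            thus "v ^ k * exp (- ((\<sigma> - 1) * v)) \<le> M0" using M0(2)[OF v] by linarith
            fix j assume "j \<in> {..<k}"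
            thus "pw (\<alpha> j) v * exp (- ((\<sigma> - 1) * v)) \<le> \<bar>M j\<bar>" using M[of j v] v by (simp add: pw_def)
          qed auto
          finally show ?thesis unfolding \<kappa>_def by (simp add: norm_mult)
        qed
      qed
    qed
    then obtain M where M: "\<And>v. norm (\<kappa> v) \<le> M" by blast
    have ck: "isCont \<kappa> X"
    proof -
      have "isCont (\<lambda>v. of_real (exp (- (\<sigma> * v))) * (of_real v ^ k * \<Psi> a v - (\<Sum>j<k. d j * of_real (v powr (\<alpha> j - 1) * exp v)))) X"
        using X by (intro continuous_intros psi_isCont) auto
      moreover have "\<forall>\<^sub>F v in nhds X. \<kappa> v = of_real (exp (- (\<sigma> * v))) * (of_real v ^ k * \<Psi> a v - (\<Sum>j<k. d j * of_real (v powr (\<alpha> j - 1) * exp v)))"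
      proof -
        have "\<forall>\<^sub>F v in nhds X. v \<in> {0<..}" using X by (intro eventually_nhds_in_open) auto
        thus ?thesis by (rule eventually_mono) (simp add: \<kappa>_def f_def pw_def)
      qed
      ultimately show ?thesis by (subst isCont_cong)
    qed
    have "norm (\<kappa> X) \<le> C1" unfolding C1_def
    proof (rule fourier_bound[OF _ intk M ck])
      show "\<kappa> \<in> borel_measurable borel" by measurable
      show "integrable lborel (\<lambda>t. C * Gmaj t)" by (intro integrable_mult_right Gmaj_integrable)
    qed (rule le)
    moreover have "norm (\<kappa> X) = exp (- (\<sigma> * X)) * norm (f X)" unfolding \<kappa>_def by (simp add: norm_mult)
    ultimately have "exp (\<sigma> * X) * (exp (- (\<sigma> * X)) * norm (f X)) \<le> exp (\<sigma> * X) * C1" by (intro mult_left_mono) auto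
    moreover have "exp (\<sigma> * X) * (exp (- (\<sigma> * X)) * norm (f X)) = norm (f X)"
      unfolding mult.assoc[symmetric] exp_add[symmetric] by simp
    ultimately show ?thesis by (simp only: mult.commute)
  qed
  show ?thesis
  proof (intro exI[of _ "C1 * exp 1"] conjI allI impI)
    show "0 \<le> C1 * exp 1" using C10 by simp
    fix X :: real assume X: "X \<ge> 1"
    \<comment> \<open>The line is chosen at distance \<open>1 / X\<close> from
      \<open>Re s = 1\<close>, which costs just a factor \<open>exp 1\<close>;
      \<open>X \<ge> 1\<close> keeps it to the left of 3.\<close>
    have "norm (f X) \<le> C1 * exp ((1 + 1 / X) * X)" using X by (intro main) (auto simp: field_simps)
    also have "(1 + 1 / X) * X = 1 + X" using X by (simp add: field_simps)
    finally have b: "norm (f X) \<le> C1 * exp 1 * exp X" by (simp add: exp_add mult.assoc)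
    have "f X = of_real (X ^ k) * (\<Psi> a X - of_real (exp X) * (\<Sum>j<k. d j * of_real (X powr (- 1/2 - real j))))"
    proof -
      have "of_real (pw (\<alpha> j) X * exp X) = complex_of_real (X ^ k) * (of_real (exp X) * of_real (X powr (- 1/2 - real j)))" for j
      proof -
        have "X powr (\<alpha> j - 1) = X powr (real k + (- 1/2 - real j))" by (simp add: \<alpha>_def algebra_simps)
        also have "\<dots> = X ^ k * X powr (- 1/2 - real j)" using X by (simp add: powr_add powr_realpow)
        finally have "pw (\<alpha> j) X * exp X = X ^ k * (exp X * X powr (- 1/2 - real j))" using X by (simp add: pw_def)
        thus ?thesis by (simp only: of_real_mult)
      qed
      thus ?thesis unfolding f_def by (simp add: right_diff_distrib sum_distrib_left algebra_simps)
    qed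
    hence "norm (f X) = X ^ k * norm (\<Psi> a X - of_real (exp X) * (\<Sum>j<k. d j * of_real (X powr (- 1/2 - real j))))"
      using X by (simp add: norm_mult norm_power)
    hence "X ^ k * norm (\<Psi> a X - of_real (exp X) * (\<Sum>j<k. d j * of_real (X powr (- 1/2 - real j)))) \<le> C1 * exp 1 * exp X" using b by simp
    hence "norm (\<Psi> a X - of_real (exp X) * (\<Sum>j<k. d j * of_real (X powr (- 1/2 - real j)))) \<le> C1 * exp 1 * exp X / X ^ k"
      using X by (simp add: field_simps)
    also have "\<dots> = C1 * exp 1 * (exp X * X powr (- real k))" using X by (simp add: powr_minus powr_realpow divide_inverse)
    finally show "norm (\<Psi> a X - of_real (exp X) * (\<Sum>j<k. d j * of_real (X powr (- 1/2 - real j)))) \<le> C1 * exp 1 * (exp X * X powr (- real k))" .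
  qed
qed

end

section \<open>Removing the smoothing\<close>

definition mlog :: "real \<Rightarrow> real \<Rightarrow> real" where "mlog \<beta> x = x\<^sup>2 * ln x powr \<beta>"
text \<open>While \<open>mlog \<beta>\<close> is a main term of \<open>x * \<Psi> a (ln x)\<close>,
  this derivative is the corresponding main term of the unsmoothed sum.\<close>

definition mlog' :: "real \<Rightarrow> real \<Rightarrow> real" where "mlog' \<beta> x = 2 * x * ln x powr \<beta> + \<beta> * x * ln x powr (\<beta> - 1)"
definition mlog'' :: "real \<Rightarrow> real \<Rightarrow> real" where
  "mlog'' \<beta> x = 2 * ln x powr \<beta> + 3 * \<beta> * ln x powr (\<beta> - 1) + \<beta> * (\<beta> - 1) * ln x powr (\<beta> - 2)"

lemma ln_powr_deriv: "x > 1 \<Longrightarrow> ((\<lambda>x. ln x powr \<beta>) has_real_derivative \<beta> * ln x powr (\<beta> - 1) / x) (at x)"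
  by (auto intro!: derivative_eq_intros simp: ln_gt_zero powr_diff field_simps)

lemma mlog_deriv: assumes "x > 1" shows "(mlog \<beta> has_real_derivative mlog' \<beta> x) (at x)"
proof -
  have "((\<lambda>x. x\<^sup>2 * ln x powr \<beta>) has_real_derivative (2 * x) * ln x powr \<beta> + (\<beta> * ln x powr (\<beta> - 1) / x) * x\<^sup>2) (at x)"
    by (rule DERIV_mult[OF _ ln_powr_deriv[OF assms]]) (auto intro!: derivative_eq_intros)
  moreover have "(\<beta> * ln x powr (\<beta> - 1) / x) * x\<^sup>2 = \<beta> * x * ln x powr (\<beta> - 1)" using assms by (simp add: power2_eq_square)
  ultimately show ?thesis unfolding mlog_def[abs_def] mlog'_def by simp
qed

lemma mlog'_deriv: assumes "x > 1" shows "(mlog' \<beta> has_real_derivative mlog'' \<beta> x) (at x)"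
proof -
  have 1: "((\<lambda>x. 2 * x * ln x powr \<beta>) has_real_derivative 2 * ln x powr \<beta> + (\<beta> * ln x powr (\<beta> - 1) / x) * (2 * x)) (at x)"
    by (rule DERIV_mult[OF _ ln_powr_deriv[OF assms]]) (auto intro!: derivative_eq_intros)
  have 2: "((\<lambda>x. \<beta> * x * ln x powr (\<beta> - 1)) has_real_derivative \<beta> * ln x powr (\<beta> - 1) + ((\<beta> - 1) * ln x powr (\<beta> - 1 - 1) / x) * (\<beta> * x)) (at x)"
    by (rule DERIV_mult[OF _ ln_powr_deriv[OF assms]]) (auto intro!: derivative_eq_intros)
  have "(2 * ln x powr \<beta> + (\<beta> * ln x powr (\<beta> - 1) / x) * (2 * x)) + (\<beta> * ln x powr (\<beta> - 1) + ((\<beta> - 1) * ln x powr (\<beta> - 1 - 1) / x) * (\<beta> * x)) = mlog'' \<beta> x"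
    unfolding mlog''_def using assms by (simp add: field_simps)
  thus ?thesis using DERIV_add[OF 1 2] unfolding mlog'_def[abs_def] by simp
qed

lemma ln_ge_1: "x \<ge> exp 1 \<Longrightarrow> ln x \<ge> (1::real)"
  using ln_mono[of "exp 1" x] by (smt (verit) exp_gt_zero ln_exp)

lemma powr_nonpos_le_1: "(L::real) \<ge> 1 \<Longrightarrow> b \<le> 0 \<Longrightarrow> L powr b \<le> 1"
  using powr_mono[of b 0 L] by simp

lemma mlog_Taylor:
  assumes b: "\<beta> \<le> 0" and x: "x \<ge> exp 1" and h: "h > 0"
  shows "\<bar>mlog \<beta> (x + h) - mlog \<beta> x - h * mlog' \<beta> x\<bar> \<le> (2 + 3 * \<bar>\<beta>\<bar> + \<bar>\<beta> * (\<beta> - 1)\<bar>) * h\<^sup>2"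
proof -
  define B where "B = 2 + 3 * \<bar>\<beta>\<bar> + \<bar>\<beta> * (\<beta> - 1)\<bar>"
  have "exp 1 > (1::real)" by simp
  hence x1: "x > 1" using x by linarith
  have bb: "\<bar>mlog'' \<beta> y\<bar> \<le> B" if "y \<ge> x" for y
  proof -
    have L: "ln y \<ge> 1" using ln_ge_1 x that by simp
    have l: "ln y powr \<beta> \<le> 1" "ln y powr (\<beta> - 1) \<le> 1" "ln y powr (\<beta> - 2) \<le> 1"
      using L b by (auto intro!: powr_nonpos_le_1)
    have "\<bar>mlog'' \<beta> y\<bar> \<le> \<bar>2 * ln y powr \<beta>\<bar> + \<bar>3 * \<beta> * ln y powr (\<beta> - 1)\<bar> + \<bar>\<beta> * (\<beta> - 1) * ln y powr (\<beta> - 2)\<bar>"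
      unfolding mlog''_def by (intro order_trans[OF abs_triangle_ineq] add_mono abs_triangle_ineq order_refl)
    also have "\<bar>2 * ln y powr \<beta>\<bar> \<le> 2 * 1" using l by simp
    also have "\<bar>3 * \<beta> * ln y powr (\<beta> - 1)\<bar> \<le> 3 * \<bar>\<beta>\<bar> * 1"
      unfolding abs_mult using l by (intro mult_mono) auto
    also have "\<bar>\<beta> * (\<beta> - 1) * ln y powr (\<beta> - 2)\<bar> \<le> \<bar>\<beta> * (\<beta> - 1)\<bar> * 1"
      unfolding abs_mult[of "\<beta> * (\<beta> - 1)"] using l by (intro mult_mono) auto
    finally show ?thesis unfolding B_def by simp
  qed
  obtain z where z: "x < z" "z < x + h" "mlog \<beta> (x + h) - mlog \<beta> x = (x + h - x) * mlog' \<beta> z"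
    using MVT2[of x "x + h" "mlog \<beta>" "mlog' \<beta>"] h x1 mlog_deriv by auto
  obtain y where y: "x < y" "y < z" "mlog' \<beta> z - mlog' \<beta> x = (z - x) * mlog'' \<beta> y"
    using MVT2[of x z "mlog' \<beta>" "mlog'' \<beta>"] z x1 mlog'_deriv by auto
  have "mlog \<beta> (x + h) - mlog \<beta> x - h * mlog' \<beta> x = h * (mlog' \<beta> z - mlog' \<beta> x)"
    using z(3) by (simp add: algebra_simps)
  hence "\<bar>mlog \<beta> (x + h) - mlog \<beta> x - h * mlog' \<beta> x\<bar> = h * ((z - x) * \<bar>mlog'' \<beta> y\<bar>)"
    unfolding y(3) using h z by (simp add: abs_mult)
  also have "\<dots> \<le> h * (h * B)" using bb[of y] y z h by (intro mult_left_mono mult_mono) auto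
  finally show ?thesis unfolding B_def by (simp add: power2_eq_square algebra_simps)
qed

text \<open>\<open>y * \<Psi> a (ln y)\<close> is the sum of \<open>a n * max 0 (y - n)\<close>.
  Passing from \<open>x\<close> to \<open>x + h\<close> adds exactly \<open>h\<close> to each term
  with \<open>n \<le> x\<close>; the at most \<open>h + 1\<close> integers in
  \<open>(x, x + h]\<close> contribute at most \<open>h\<close> each.\<close>

lemma smoothed_sum_difference:
  fixes a :: "nat \<Rightarrow> complex"
  assumes a1: "\<And>n. norm (a n) \<le> 1" and x: "x > 0" and h: "h > 0"
  shows "norm (of_real (x + h) * \<Psi> a (ln (x + h)) - of_real x * \<Psi> a (ln x) - of_real h * (\<Sum>n\<le>nat \<lfloor>x\<rfloor>. a n)) \<le> h * (h + 1)"
proof -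
  define N where "N = nat \<lceil>x + h\<rceil>"
  have N: "x + h \<le> real N" unfolding N_def using x h by (simp add: of_nat_nat)
  define t where "t y n = max 0 (y - real n)" for y n
  have F: "of_real y * \<Psi> a (ln y) = (\<Sum>n<N. a n * of_real (t y n))" if y: "y > 0" "y \<le> x + h" for y
  proof -
    have "exp (ln y) \<le> real N" using y N by simp
    hence "of_real y * \<Psi> a (ln y) = (\<Sum>n<N. a n * of_real (y * max 0 (1 - real n * exp (- ln y))))"
      unfolding psi_eq_sum by (subst psi_eq_sum[of "ln y" N]) (auto simp: sum_distrib_left algebra_simps)
    moreover have "y * max 0 (1 - real n * exp (- ln y)) = t y n" for n
      unfolding t_def using y by (simp add: exp_minus max_def field_simps)
    ultimately show ?thesis by simp
  qed
  define e where "e n = t (x + h) n - t x n - (if real n \<le> x then h else 0)" for n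
  have sub: "{..nat \<lfloor>x\<rfloor>} = {n. real n \<le> x}"
    using x by (auto simp: le_nat_iff le_floor_iff)
  have sumN: "(\<Sum>n\<le>nat \<lfloor>x\<rfloor>. a n) = (\<Sum>n<N. if real n \<le> x then a n else 0)"
  proof -
    have "{n. real n \<le> x} \<subseteq> {..<N}" using N h by auto
    thus ?thesis unfolding sub by (intro sum.mono_neutral_cong_left) auto
  qed
  have "of_real (x + h) * \<Psi> a (ln (x + h)) - of_real x * \<Psi> a (ln x) - of_real h * (\<Sum>n\<le>nat \<lfloor>x\<rfloor>. a n) = (\<Sum>n<N. a n * of_real (e n))"
    unfolding sumN using F[of "x + h"] F[of x] x h
    by (simp add: e_def sum_subtractf[symmetric] sum_distrib_left algebra_simps if_distrib cong: if_cong)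
  also have "norm \<dots> \<le> (\<Sum>n<N. norm (a n * of_real (e n)))" by (rule norm_sum)
  also have "\<dots> \<le> (\<Sum>n<N. if x < real n \<and> real n \<le> x + h then h else 0)"
  proof (rule sum_mono)
    fix n
    have en: "\<bar>e n\<bar> \<le> (if x < real n \<and> real n \<le> x + h then h else 0)"
      unfolding e_def t_def using h by (auto simp: max_def)
    have "norm (a n * of_real (e n)) \<le> 1 * \<bar>e n\<bar>" unfolding norm_mult norm_of_real by (intro mult_right_mono a1) auto
    thus "norm (a n * of_real (e n)) \<le> (if x < real n \<and> real n \<le> x + h then h else 0)" using en by linarith
  qed
  also have "\<dots> = real (card {n\<in>{..<N}. x < real n \<and> real n \<le> x + h}) * h"
    by (simp add: sum.If_cases Int_def conj_commute)
  also have "\<dots> \<le> (h + 1) * h"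
  proof (rule mult_right_mono)
    have "{n\<in>{..<N}. x < real n \<and> real n \<le> x + h} \<subseteq> {nat \<lfloor>x\<rfloor> + 1..nat \<lfloor>x + h\<rfloor>}"
      using x h by (auto simp: le_nat_iff le_floor_iff Suc_le_eq nat_less_iff floor_less_iff)
    hence "card {n\<in>{..<N}. x < real n \<and> real n \<le> x + h} \<le> card {nat \<lfloor>x\<rfloor> + 1..nat \<lfloor>x + h\<rfloor>}" by (intro card_mono) auto
    also have "\<dots> = nat \<lfloor>x + h\<rfloor> - nat \<lfloor>x\<rfloor>" by simp
    finally have c: "card {n\<in>{..<N}. x < real n \<and> real n \<le> x + h} \<le> nat \<lfloor>x + h\<rfloor> - nat \<lfloor>x\<rfloor>" .
    have "\<lfloor>x\<rfloor> \<le> \<lfloor>x + h\<rfloor>" using h by (intro floor_mono) simp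
    hence "real (nat \<lfloor>x + h\<rfloor> - nat \<lfloor>x\<rfloor>) = of_int \<lfloor>x + h\<rfloor> - of_int \<lfloor>x\<rfloor>" using x h by (simp add: of_nat_diff nat_le_eq_zle)
    also have "\<dots> \<le> h + 1" by linarith
    finally show "real (card {n\<in>{..<N}. x < real n \<and> real n \<le> x + h}) \<le> h + 1" using c by (smt (verit) of_nat_le_iff)
  qed (use h in simp)
  finally show ?thesis by (simp add: mult.commute)
qed

text \<open>Difference quotients with step \<open>h\<close>: the smoothed error
  \<open>x^2 (log x)^(-k)\<close> is divided by \<open>h\<close>, while the curvature of the main
  term and the boundary terms cost about \<open>h\<close>.\<close>

theorem sum_asymptotics:
  fixes a :: "nat \<Rightarrow> complex" and d :: "nat \<Rightarrow> complex" and C :: real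
  assumes a0: "a 0 = 0" and a1: "\<And>n. norm (a n) \<le> 1" and k: "k > 0" and C: "C \<ge> 0"
    and bnd: "\<And>s. 1 < Re s \<Longrightarrow> Re s < 3 \<Longrightarrow> Im s \<noteq> 0 \<Longrightarrow>
      norm ((-1) ^ k * (deriv ^^ k) (\<lambda>s. dser a s * inverse (s * (s + 1))) s -
        (\<Sum>j<k. d j * (of_real (Gamma (real k + 1/2 - real j)) * (s - 1) powr (- of_real (real k + 1/2 - real j))))) \<le> C * Gmaj (Im s)"
  shows "\<exists>C'\<ge>0. \<forall>x\<ge>exp 1. norm ((\<Sum>n\<le>nat \<lfloor>x\<rfloor>. a n) - (\<Sum>j<k. d j * of_real (mlog' (- 1/2 - real j) x))) \<le> C' * (x * ln x powr (- real k / 2))"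
proof -
  obtain C1 where C1: "C1 \<ge> 0" "\<And>X. X \<ge> 1 \<Longrightarrow> norm (\<Psi> a X - of_real (exp X) * (\<Sum>j<k. d j * of_real (X powr (- 1/2 - real j)))) \<le> C1 * (exp X * X powr (- real k))"
    using smoothed_asymptotics[OF a0 a1 k C bnd] by blast
  define M where "M x = (\<Sum>j<k. d j * complex_of_real (mlog (- 1/2 - real j) x))" for x
  define M' where "M' x = (\<Sum>j<k. d j * complex_of_real (mlog' (- 1/2 - real j) x))" for x
  define F where "F x = of_real x * \<Psi> a (ln x)" for x
  have FM: "norm (F x - M x) \<le> C1 * (x\<^sup>2 * ln x powr (- real k))" if x: "x \<ge> exp 1" for x
  proof -
    have x0: "x > 0" using x exp_gt_zero[of "1::real"] by linarith
    have "F x - M x = of_real x * (\<Psi> a (ln x) - of_real (exp (ln x)) * (\<Sum>j<k. d j * of_real (ln x powr (- 1/2 - real j))))"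
      unfolding F_def M_def mlog_def using x0 by (simp add: right_diff_distrib sum_distrib_left power2_eq_square algebra_simps)
    hence "norm (F x - M x) = x * norm (\<Psi> a (ln x) - of_real (exp (ln x)) * (\<Sum>j<k. d j * of_real (ln x powr (- 1/2 - real j))))"
      using x0 by (simp only: norm_mult norm_of_real abs_of_pos)
    also have "\<dots> \<le> x * (C1 * (exp (ln x) * ln x powr (- real k)))"
      using x0 by (intro mult_left_mono C1(2) ln_ge_1 x) auto
    also have "\<dots> = C1 * (x\<^sup>2 * ln x powr (- real k))" using x0 by (simp add: power2_eq_square)
    finally show ?thesis .
  qed
  define B where "B = (\<Sum>j<k. norm (d j) * (2 + 3 * \<bar>- 1/2 - real j\<bar> + \<bar>(- 1/2 - real j) * (- 1/2 - real j - 1)\<bar>))"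
  have B0: "B \<ge> 0" unfolding B_def by (intro sum_nonneg) auto
  have MT: "norm (M (x + h) - M x - of_real h * M' x) \<le> B * h\<^sup>2" if x: "x \<ge> exp 1" and h: "h > 0" for x h
  proof -
    have e1: "M (x + h) - M x - of_real h * M' x = (\<Sum>j<k. d j * of_real (mlog (- 1/2 - real j) (x + h) - mlog (- 1/2 - real j) x - h * mlog' (- 1/2 - real j) x))"
      unfolding M_def M'_def sum_distrib_left sum_subtractf[symmetric] by (intro sum.cong refl) (simp add: algebra_simps)
    have "norm (M (x + h) - M x - of_real h * M' x) \<le> (\<Sum>j<k. norm (d j * of_real (mlog (- 1/2 - real j) (x + h) - mlog (- 1/2 - real j) x - h * mlog' (- 1/2 - real j) x)))"
      unfolding e1 by (rule norm_sum)
    also have "\<dots> \<le> (\<Sum>j<k. norm (d j) * ((2 + 3 * \<bar>- 1/2 - real j\<bar> + \<bar>(- 1/2 - real j) * (- 1/2 - real j - 1)\<bar>) * h\<^sup>2))"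
    proof (rule sum_mono)
      fix j :: nat
      have jn: "- 1/2 - real j \<le> 0" by linarith
      have "\<bar>mlog (- 1/2 - real j) (x + h) - mlog (- 1/2 - real j) x - h * mlog' (- 1/2 - real j) x\<bar> \<le>
          (2 + 3 * \<bar>- 1/2 - real j\<bar> + \<bar>(- 1/2 - real j) * (- 1/2 - real j - 1)\<bar>) * h\<^sup>2"
        by (rule mlog_Taylor[OF jn x h])
      thus "norm (d j * of_real (mlog (- 1/2 - real j) (x + h) - mlog (- 1/2 - real j) x - h * mlog' (- 1/2 - real j) x)) \<le>
          norm (d j) * ((2 + 3 * \<bar>- 1/2 - real j\<bar> + \<bar>(- 1/2 - real j) * (- 1/2 - real j - 1)\<bar>) * h\<^sup>2)"
        unfolding norm_mult norm_of_real by (rule mult_left_mono) simp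
    qed
    also have "\<dots> = B * h\<^sup>2" unfolding B_def sum_distrib_right by (simp only: mult.assoc)
    finally show ?thesis .
  qed
  obtain M0 where M0: "M0 \<ge> 0" "\<And>v. v \<ge> 0 \<Longrightarrow> v powr (real k / 2) * exp (- (1 * v)) \<le> M0"
    using powr_le_exp[of "real k / 2" 1] k by auto
  show ?thesis
  proof (intro exI[of _ "8 * C1 + B + 1 + M0"] conjI allI impI)
    show "0 \<le> 8 * C1 + B + 1 + M0" using C1 B0 M0 by simp
    fix x :: real assume x: "x \<ge> exp 1"
    have x0: "x > 0" using x exp_gt_zero[of "1::real"] by linarith
    define L where "L = ln x"
    have L: "L \<ge> 1" unfolding L_def by (rule ln_ge_1[OF x])
    \<comment> \<open>This step balances the two errors, since \<open>x^2 L^(-k) / h = h\<close>.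
      Here half of the saving is lost.\<close>
    define h where "h = x * L powr (- real k / 2)"
    have h: "h > 0" unfolding h_def using x0 L by simp
    have "L powr (- real k / 2) \<le> 1" using L by (intro powr_nonpos_le_1) auto
    hence hx: "h \<le> x" unfolding h_def using x0 by (simp add: mult_left_le)
    define S where "S = (\<Sum>n\<le>nat \<lfloor>x\<rfloor>. a n)"
    have e2: "of_real h * (S - M' x) = (F (x + h) - M (x + h)) - (F x - M x) + (M (x + h) - M x - of_real h * M' x) - (F (x + h) - F x - of_real h * S)"
      by (simp add: algebra_simps)
    have "norm (of_real h * (S - M' x)) \<le> norm (F (x + h) - M (x + h)) + norm (F x - M x) + norm (M (x + h) - M x - of_real h * M' x) + norm (F (x + h) - F x - of_real h * S)"
      unfolding e2 using norm_triangle_ineq4[of "(F (x + h) - M (x + h)) - (F x - M x) + (M (x + h) - M x - of_real h * M' x)" "F (x + h) - F x - of_real h * S"]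
        norm_triangle_ineq[of "(F (x + h) - M (x + h)) - (F x - M x)" "M (x + h) - M x - of_real h * M' x"]
        norm_triangle_ineq4[of "F (x + h) - M (x + h)" "F x - M x"] by linarith
    also have "\<dots> \<le> C1 * (4 * x\<^sup>2 * L powr (- real k)) + C1 * (4 * x\<^sup>2 * L powr (- real k)) + B * h\<^sup>2 + h * (h + 1)"
    proof (intro add_mono)
      have "norm (F (x + h) - M (x + h)) \<le> C1 * ((x + h)\<^sup>2 * ln (x + h) powr (- real k))" using x h by (intro FM) auto
      also have "\<dots> \<le> C1 * (4 * x\<^sup>2 * L powr (- real k))"
      proof (intro mult_left_mono mult_mono C1(1))
        have "(x + h)\<^sup>2 \<le> (2 * x)\<^sup>2" using hx h x0 by (intro power_mono) auto
        thus "(x + h)\<^sup>2 \<le> 4 * x\<^sup>2" by (simp add: power_mult_distrib)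
        have "L \<le> ln (x + h)" unfolding L_def using x0 h by (intro ln_mono) auto
        thus "ln (x + h) powr (- real k) \<le> L powr (- real k)" using L by (intro powr_mono2') auto
      qed auto
      finally show "norm (F (x + h) - M (x + h)) \<le> C1 * (4 * x\<^sup>2 * L powr (- real k))" .
      have "norm (F x - M x) \<le> C1 * (x\<^sup>2 * L powr (- real k))" unfolding L_def by (rule FM[OF x])
      also have "\<dots> \<le> C1 * (4 * x\<^sup>2 * L powr (- real k))" using C1(1) by (intro mult_left_mono mult_right_mono) auto
      finally show "norm (F x - M x) \<le> C1 * (4 * x\<^sup>2 * L powr (- real k))" .
      show "norm (M (x + h) - M x - of_real h * M' x) \<le> B * h\<^sup>2" by (rule MT[OF x h])
      show "norm (F (x + h) - F x - of_real h * S) \<le> h * (h + 1)" unfolding F_def S_def by (rule smoothed_sum_difference[OF a1 x0 h])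
    qed
    also have "x\<^sup>2 * L powr (- real k) = h\<^sup>2"
    proof -
      have "L powr (- real k) = L powr (- real k / 2) * L powr (- real k / 2)" by (simp flip: powr_add)
      thus ?thesis unfolding h_def by (simp add: power2_eq_square)
    qed
    hence "C1 * (4 * x\<^sup>2 * L powr (- real k)) + C1 * (4 * x\<^sup>2 * L powr (- real k)) + B * h\<^sup>2 + h * (h + 1) = h * ((8 * C1 + B + 1) * h + 1)"
      by (simp add: power2_eq_square algebra_simps)
    finally have "h * norm (S - M' x) \<le> h * ((8 * C1 + B + 1) * h + 1)" using h by (simp add: norm_mult)
    hence 1: "norm (S - M' x) \<le> (8 * C1 + B + 1) * h + 1" using h by (simp add: mult_le_cancel_left_pos)
    \<comment> \<open>Powers of \<open>log x\<close> are bounded by multiples of \<open>x\<close>,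
      so \<open>1 \<le> M0 * h\<close> and the stray summand 1 is absorbed.\<close>
    have "L powr (real k / 2) * exp (- (1 * L)) \<le> M0" using L by (intro M0(2)) auto
    hence "L powr (real k / 2) \<le> M0 * x" unfolding L_def using x0 by (simp add: exp_minus field_simps)
    hence "L powr (real k / 2) * L powr (- real k / 2) \<le> M0 * x * L powr (- real k / 2)" by (intro mult_right_mono) auto
    hence 2: "1 \<le> M0 * h" unfolding h_def using L by (simp add: powr_add[symmetric] mult.assoc)
    have "norm (S - M' x) \<le> (8 * C1 + B + 1) * h + M0 * h" using 1 2 by linarith
    thus "norm ((\<Sum>n\<le>nat \<lfloor>x\<rfloor>. a n) - (\<Sum>j<k. d j * of_real (mlog' (- 1/2 - real j) x))) \<le> (8 * C1 + B + 1 + M0) * (x * ln x powr (- real k / 2))"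
      unfolding S_def M'_def h_def L_def by (simp add: algebra_simps)
  qed
qed

section \<open>The Landau-Ramanujan expansion\<close>

text \<open>By the Euler product, \<open>Vser\<close> at 1 is the inverse of the limit
  \<open>w\<close> of the products of \<open>1 - p^(-2)\<close> over primes 3 modulo 4, whereas
  \<open>LR_K\<close> is \<open>w^(-1/2) / sqrt 2\<close>.\<close>

lemma Vser_one_eq_LR_K: "Vser (\<lambda>_. 1) 1 = of_real (2 * LR_K\<^sup>2)" and LR_K_pos: "LR_K > 0"
proof -
  define E :: "nat \<Rightarrow> real" where "E n = (if prime n \<and> n mod 4 = 3 then 1 - 1 / (real n)^2 else 1)" for n
  define c :: "nat \<Rightarrow> complex" where "c n = (if only3 n then 1 else 0)" for n
  define F where "F n = c n * of_nat n powr (- 2)" for n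
  have cn: "norm (c n) \<le> 1" for n by (simp add: c_def)
  have sF: "summable (\<lambda>n. norm (F n))" unfolding F_def
    by (rule tame_summable[OF tame_bounded[OF cn]]) simp
  have cmF: "cmul F" unfolding F_def[abs_def]
  proof (rule cmul_dser_term)
    show "c 1 = 1" unfolding c_def using only3_1 by simp
    show "c (a * b) = c a * c b" for a b unfolding c_def using only3_mult[of a b] by simp
  qed
  have V: "Vser (\<lambda>_. 1) 1 = suminf F" by (simp add: Vser_def dser_def F_def[abs_def] c_def[abs_def] cong: if_cong)
  have nz: "suminf F \<noteq> 0" by (rule euler_product_nonzero[OF cmF sF])
  define P where "P N = (\<Prod>n\<le>N. E n)" for N
  have Epos: "E n > 0" for n
  proof -
    have "1 / (real n)^2 < 1" if "prime n"
    proof -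
      have "real n \<ge> 2" using prime_ge_2_nat[OF that] by simp
      hence "real n ^ 2 > 1" by (intro one_less_power) auto
      thus ?thesis by (simp add: divide_less_eq)
    qed
    thus ?thesis by (auto simp: E_def)
  qed
  have Ppos: "P N > 0" for N unfolding P_def by (rule prod_pos) (use Epos in auto)
  have Fp: "1 - F p = of_real (E p)" if "prime p" for p
  proof -
    have "(of_nat p :: complex) powr (-2) = of_real (1 / (real p)^2)"
      using prime_gt_0_nat[OF that] powr_of_int[of "of_nat p :: complex" "-2"]
      by (simp add: power_int_def field_simps)
    thus ?thesis using only3_prime[OF that] that by (simp add: F_def E_def c_def)
  qed
  have Peq: "(\<Prod>p | prime p \<and> p \<le> N. 1 - F p) = of_real (P N)" for N
  proof -
    have "(\<Prod>p | prime p \<and> p \<le> N. 1 - F p) = (\<Prod>p | prime p \<and> p \<le> N. of_real (E p))"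
      by (rule prod.cong) (auto simp: Fp)
    also have "\<dots> = (\<Prod>p\<le>N. of_real (E p))"
      by (rule prod.mono_neutral_left) (auto simp: E_def)
    finally show ?thesis by (simp add: P_def)
  qed
  have lim: "(\<lambda>N. of_real (P N) :: complex) \<longlonglongrightarrow> 1 / suminf F"
    using euler_product[OF cmF sF] unfolding Peq .
  define w where "w = Re (1 / suminf F)"
  have limR: "P \<longlonglongrightarrow> w" unfolding w_def using tendsto_Re[OF lim] by simp
  have "(\<lambda>N. of_real (P N) :: complex) \<longlonglongrightarrow> of_real w" using limR by (rule tendsto_of_real)
  hence ww: "of_real w = 1 / suminf F" using lim LIMSEQ_unique by blast
  have "w \<ge> 0" by (rule LIMSEQ_le_const[OF limR]) (use Ppos less_imp_le in blast)
  moreover have "w \<noteq> 0" using ww nz by auto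
  ultimately have w: "w > 0" by simp
  have "(\<lambda>N. \<Prod>n\<le>N. E n powr (-1/2)) \<longlonglongrightarrow> w powr (-1/2)"
  proof -
    have "(\<Prod>n\<le>N. E n powr (-1/2)) = P N powr (-1/2)" for N
      unfolding P_def by (rule prod_powr_distrib[symmetric])
    moreover have "(\<lambda>N. P N powr (-1/2)) \<longlonglongrightarrow> w powr (-1/2)"
      by (intro tendsto_intros limR) (use w in auto)
    ultimately show ?thesis by simp
  qed
  hence "(\<Prod>n. E n powr (-1/2)) = w powr (-1/2)" by (rule prodinf_eq_prod_lim) (use w in auto)
  moreover have "E n powr (-1/2) = (if prime n \<and> n mod 4 = 3 then (1 - 1 / (real n)^2) powr (-1/2) else 1)" for n
    by (simp add: E_def)
  ultimately have K: "LR_K = (1 / sqrt 2) * w powr (-1/2)" unfolding LR_K_def by simp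
  show "LR_K > 0" unfolding K using w by simp
  have "(w powr (-1/2))\<^sup>2 = w powr (-1)" using w by (simp only: power2_eq_square powr_add[symmetric]) simp
  also have "\<dots> = 1 / w" using w by (simp add: powr_minus_divide)
  finally have "2 * LR_K\<^sup>2 = 1 / w" unfolding K by (simp add: power_mult_distrib power_divide)
  moreover have "suminf F = of_real (1 / w)" using ww by simp
  ultimately show "Vser (\<lambda>_. 1) 1 = of_real (2 * LR_K\<^sup>2)" unfolding V by simp
qed

text \<open>The coefficients are not normalised: for \<open>countE\<close> the leading one is
  \<open>LR_K\<close>. In this form expansions can be added, scaled and truncated termwise; the
  normalisation \<open>c 0 = 1\<close> is restored at the very end.\<close>

definition log_expansion :: "(real \<Rightarrow> real) \<Rightarrow> (nat \<Rightarrow> real) \<Rightarrow> nat \<Rightarrow> bool" where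
  "log_expansion f c J \<longleftrightarrow>
     (\<lambda>x. f x - x * (\<Sum>j\<le>J. c j * ln x powr (- 1/2 - real j))) \<in> O(\<lambda>x. x * ln x powr (- real J - 3/2))"

lemma log_expansion_add:
  assumes "log_expansion f c J" "log_expansion g d J"
  shows "log_expansion (\<lambda>x. f x + g x) (\<lambda>j. c j + d j) J"
proof -
  have "(\<lambda>x. (f x - x * (\<Sum>j\<le>J. c j * ln x powr (- 1/2 - real j))) + (g x - x * (\<Sum>j\<le>J. d j * ln x powr (- 1/2 - real j))))
      \<in> O(\<lambda>x. x * ln x powr (- real J - 3/2))"
    using assms unfolding log_expansion_def by (rule sum_in_bigo)
  thus ?thesis unfolding log_expansion_def by (simp add: algebra_simps sum.distrib)
qed

lemma log_expansion_cmult: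
  assumes "log_expansion f c J"
  shows "log_expansion (\<lambda>x. k * f x) (\<lambda>j. k * c j) J"
proof -
  have "(\<lambda>x. k * (f x - x * (\<Sum>j\<le>J. c j * ln x powr (- 1/2 - real j)))) \<in> O(\<lambda>x. x * ln x powr (- real J - 3/2))"
    using assms unfolding log_expansion_def by (cases "k = 0") simp_all
  thus ?thesis unfolding log_expansion_def by (simp add: algebra_simps sum_distrib_left)
qed

lemma log_expansion_bigo:
  assumes "f \<in> O(\<lambda>x. x * ln x powr (- real J - 3/2))"
  shows "log_expansion f (\<lambda>_. 0) J"
  using assms unfolding log_expansion_def by simp

lemma log_expansion_sum:
  assumes "\<And>i. i \<in> A \<Longrightarrow> log_expansion (f i) (c i) J"
  shows "log_expansion (\<lambda>x. \<Sum>i\<in>A. f i x) (\<lambda>j. \<Sum>i\<in>A. c i j) J"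
  using assms
proof (induction A rule: infinite_finite_induct)
  case (insert i A)
  have "log_expansion (\<lambda>x. f i x + (\<Sum>i\<in>A. f i x)) (\<lambda>j. c i j + (\<Sum>i\<in>A. c i j)) J"
    by (rule log_expansion_add) (use insert in auto)
  thus ?case using insert by simp
qed (auto intro!: log_expansion_bigo)

lemma log_expansion_cong:
  assumes "log_expansion f c J" "eventually (\<lambda>x. f x = g x) at_top" "\<And>j. j \<le> J \<Longrightarrow> c j = d j"
  shows "log_expansion g d J"
proof -
  have "eventually (\<lambda>x. f x - x * (\<Sum>j\<le>J. c j * ln x powr (- 1/2 - real j)) =
      g x - x * (\<Sum>j\<le>J. d j * ln x powr (- 1/2 - real j))) at_top"
    using assms(2)
  proof eventually_elim
    case (elim x)
    have "(\<Sum>j\<le>J. c j * ln x powr (- 1/2 - real j)) = (\<Sum>j\<le>J. d j * ln x powr (- 1/2 - real j))"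
      by (rule sum.cong) (use assms(3) in auto)
    thus ?case using elim by simp
  qed
  from landau_o.big.in_cong[OF this] show ?thesis using assms(1) unfolding log_expansion_def by simp
qed

lemma eventually_ln_ge: "eventually (\<lambda>x::real. ln x \<ge> a) at_top"
  using ln_at_top by (simp add: filterlim_at_top)

lemma ln_powr_bigo:
  assumes "a \<le> b"
  shows "(\<lambda>x::real. x * ln x powr a) \<in> O(\<lambda>x. x * ln x powr b)"
proof (rule bigoI[of _ 1])
  show "eventually (\<lambda>x::real. norm (x * ln x powr a) \<le> 1 * norm (x * ln x powr b)) at_top"
    using eventually_ln_ge[of 1] eventually_ge_at_top[of 0]
  proof eventually_elim
    case (elim x)
    thus ?case using assms by (auto simp: abs_mult intro!: mult_left_mono powr_mono)
  qed
qed

lemma log_expansion_monomial: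
  "log_expansion (\<lambda>x. x * ln x powr (- 1/2 - real j)) (\<lambda>i. if i = j then 1 else 0) J"
proof (cases "j \<le> J")
  case True
  have "(\<Sum>i\<le>J. (if i = j then 1 else 0) * ln x powr (- 1/2 - real i)) = ln x powr (- 1/2 - real j)" for x
  proof -
    have "(\<Sum>i\<le>J. (if i = j then 1 else 0) * ln x powr (- 1/2 - real i)) =
       (\<Sum>i\<le>J. if i = j then ln x powr (- 1/2 - real i) else 0)" by (rule sum.cong) auto
    thus ?thesis using True by simp
  qed
  thus ?thesis unfolding log_expansion_def by simp
next
  case False
  have "log_expansion (\<lambda>x. x * ln x powr (- 1/2 - real j)) (\<lambda>_. 0) J"
    by (rule log_expansion_bigo, rule ln_powr_bigo) (use False in simp)
  thus ?thesis by (rule log_expansion_cong) (use False in auto)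
qed

lemma log_expansion_truncate:
  assumes "log_expansion f c J" "I \<le> J"
  shows "log_expansion f c I"
proof -
  have "log_expansion (\<lambda>x. \<Sum>j\<le>J. c j * (x * ln x powr (- 1/2 - real j)))
     (\<lambda>i. \<Sum>j\<le>J. c j * (if i = j then 1 else 0)) I"
    by (rule log_expansion_sum, rule log_expansion_cmult, rule log_expansion_monomial)
  moreover have "log_expansion (\<lambda>x. f x - x * (\<Sum>j\<le>J. c j * ln x powr (- 1/2 - real j))) (\<lambda>_. 0) I"
    using assms ln_powr_bigo[of "- real J - 3/2" "- real I - 3/2"]
    by (intro log_expansion_bigo) (auto simp: log_expansion_def intro: landau_o.big_trans)
  ultimately have "log_expansion (\<lambda>x. (\<Sum>j\<le>J. c j * (x * ln x powr (- 1/2 - real j))) +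
        (f x - x * (\<Sum>j\<le>J. c j * ln x powr (- 1/2 - real j))))
      (\<lambda>i. (\<Sum>j\<le>J. c j * (if i = j then 1 else 0)) + 0) I"
    by (rule log_expansion_add)
  thus ?thesis
  proof (rule log_expansion_cong)
    show "(\<Sum>j\<le>J. c j * (if i = j then 1 else 0)) + 0 = c i" if "i \<le> I" for i
    proof -
      have "(\<Sum>j\<le>J. c j * (if i = j then 1 else 0)) = (\<Sum>j\<le>J. if i = j then c j else 0)"
        by (rule sum.cong) auto
      thus ?thesis using that assms(2) by simp
    qed
  qed (auto simp: sum_distrib_left algebra_simps)
qed

text \<open>With equal leading coefficients the difference of the expansions is a multiple of
  \<open>x (log x)^(-3/2)\<close>, which is too large for the error term unless the multiple is
  0.\<close>

lemma log_expansion_unique_1: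
  assumes "log_expansion f c 1" "log_expansion f d 1" "c 0 = d 0"
  shows "c 1 = d 1"
proof (rule ccontr)
  assume ne: "c 1 \<noteq> d 1"
  have "log_expansion (\<lambda>x. f x + (- 1) * f x) (\<lambda>j. c j + (- 1) * d j) 1"
    by (intro log_expansion_add log_expansion_cmult assms)
  hence "(\<lambda>x. (d 1 - c 1) * (x * ln x powr (-3/2))) \<in> O(\<lambda>x. x * ln x powr (-5/2))"
    unfolding log_expansion_def using assms(3) by (simp add: algebra_simps)
  hence "(\<lambda>x::real. x * ln x powr (-3/2)) \<in> O(\<lambda>x. x * ln x powr (-5/2))" using ne by simp
  moreover have "(\<lambda>x::real. x * ln x powr (-5/2)) \<in> o(\<lambda>x. x * ln x powr (-3/2))" by real_asymp
  ultimately have "(\<lambda>x::real. x * ln x powr (-5/2)) \<in> o(\<lambda>x. x * ln x powr (-5/2))"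
    by (rule landau_o.small_big_trans[rotated])
  hence "eventually (\<lambda>x::real. x * ln x powr (-5/2) = 0) at_top" by (simp add: landau_o.small_refl_iff)
  moreover have "eventually (\<lambda>x::real. x * ln x powr (-5/2) \<noteq> 0) at_top"
    using eventually_ln_ge[of 1] eventually_gt_at_top[of 0] by eventually_elim auto
  ultimately have "eventually (\<lambda>x::real. False) at_top" by eventually_elim auto
  thus False by simp
qed

section \<open>Expanding powers of log x - log q\<close>

lemma binomial_remainder:
  "(\<lambda>z::real. (1 + z) powr a - (\<Sum>n\<le>N. (a gchoose n) * z ^ n)) \<in> O[nhds 0](\<lambda>z. z ^ Suc N)"
proof -
  define b where "b n = a gchoose (n + Suc N)" for n
  have s: "summable (\<lambda>n. b n * (1/2) ^ n)"
  proof -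
    have "summable (\<lambda>n. (a gchoose n) * (1/2) ^ n)" using gen_binomial_real[of "1/2" a] by (simp add: sums_iff)
    hence "summable (\<lambda>n. (a gchoose (n + Suc N)) * (1/2) ^ (n + Suc N))" by (rule summable_ignore_initial_segment)
    hence "summable (\<lambda>n. 2 ^ Suc N * ((a gchoose (n + Suc N)) * (1/2) ^ (n + Suc N)))" by (rule summable_mult)
    moreover have "2 ^ Suc N * ((a gchoose (n + Suc N)) * (1/2) ^ (n + Suc N)) = b n * (1/2) ^ n" for n
      unfolding b_def by (simp add: power_add power_divide)
    ultimately show ?thesis by (simp only:)
  qed
  define h where "h z = (\<Sum>n. b n * z ^ n)" for z
  have "isCont h 0" unfolding h_def by (rule isCont_powser[OF s]) simp
  hence "(h \<longlongrightarrow> h 0) (nhds 0)" by (simp add: isCont_def tendsto_nhds_iff)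
  hence h: "h \<in> O[nhds 0](\<lambda>_. 1)" by (intro bigoI_tendsto[of _ _ "h 0"]) auto
  have eq: "(1 + z) powr a - (\<Sum>n\<le>N. (a gchoose n) * z ^ n) = z ^ Suc N * h z" if z: "\<bar>z\<bar> < 1/2" for z
  proof -
    have S: "(\<lambda>n. (a gchoose n) * z ^ n) sums ((1 + z) powr a)" by (rule gen_binomial_real) (use z in simp)
    from sums_split_initial_segment[OF this, of "Suc N"]
    have "(\<lambda>n. z ^ Suc N * (b n * z ^ n)) sums ((1 + z) powr a - (\<Sum>n\<le>N. (a gchoose n) * z ^ n))"
      by (simp add: b_def power_add algebra_simps lessThan_Suc_atMost del: sum.lessThan_Suc)
    moreover have "summable (\<lambda>n. b n * z ^ n)" by (rule powser_inside[OF s]) (use z in simp)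
    hence "(\<lambda>n. z ^ Suc N * (b n * z ^ n)) sums (z ^ Suc N * h z)" unfolding h_def
      by (intro sums_mult summable_sums)
    ultimately show ?thesis by (rule sums_unique2)
  qed
  have "eventually (\<lambda>z::real. \<bar>z\<bar> < 1/2) (nhds 0)"
    by (rule eventually_nhds_in_open[of "{z. \<bar>z\<bar> < 1/2}", simplified]) 
       (auto intro!: open_Collect_less continuous_intros)
  hence ev: "eventually (\<lambda>z. (1 + z) powr a - (\<Sum>n\<le>N. (a gchoose n) * z ^ n) = z ^ Suc N * h z) (nhds 0)"
    by eventually_elim (rule eq)
  have "(\<lambda>z. z ^ Suc N * h z) \<in> O[nhds 0](\<lambda>z. z ^ Suc N * 1)"
    by (rule landau_o.big.mult[OF landau_o.big_refl h])
  thus ?thesis using landau_o.big.in_cong[OF ev] by simp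
qed

text \<open>Write \<open>(ln x - l)^\<beta> = (ln x)^\<beta> * (1 - l / ln x)^\<beta>\<close> and
  cut the binomial series after \<open>J - j\<close> terms; the remainder has exponent
  \<open>\<beta> - (J - j + 1) = - J - 3/2\<close>.\<close>

lemma log_expansion_shifted_monomial:
  assumes "j \<le> J"
  shows "log_expansion (\<lambda>x. x * (ln x - l) powr (- 1/2 - real j))
     (\<lambda>i. if i < j then 0 else ((- 1/2 - real j) gchoose (i - j)) * (- l) ^ (i - j)) J"
proof -
  define \<beta> where "\<beta> = - 1/2 - real j"
  define c where "c i = (if i < j then 0 else (\<beta> gchoose (i - j)) * (- l) ^ (i - j))" for i
  define N where "N = J - j"
  have lim: "filterlim (\<lambda>x::real. - l / ln x) (nhds 0) at_top" by real_asymp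
  have R: "(\<lambda>x. (1 + (- l / ln x)) powr \<beta> - (\<Sum>n\<le>N. (\<beta> gchoose n) * (- l / ln x) ^ n)) \<in> O(\<lambda>x. (- l / ln x) ^ Suc N)"
    by (rule landau_o.big.compose[OF binomial_remainder lim])
  have "(\<lambda>x. (- l / ln x) ^ Suc N) \<in> O(\<lambda>x. ln x powr (- real (Suc N)))"
  proof (rule bigoI[of _ "\<bar>l\<bar> ^ Suc N"])
    show "eventually (\<lambda>x. norm ((- l / ln x) ^ Suc N) \<le> \<bar>l\<bar> ^ Suc N * norm (ln x powr (- real (Suc N)))) at_top"
      using eventually_ln_ge[of 1]
    proof eventually_elim
      case (elim x)
      have "norm ((- l / ln x) ^ Suc N) = \<bar>l\<bar> ^ Suc N / ln x ^ Suc N"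
        using elim by (simp only: norm_power norm_divide power_divide real_norm_def abs_minus_cancel)
          (simp add: power_abs abs_mult)
      also have "\<dots> = \<bar>l\<bar> ^ Suc N * ln x powr (- real (Suc N))"
        using elim powr_realpow[of "ln x" "Suc N"] by (simp only: powr_minus) (simp add: divide_inverse)
      finally show ?case by simp
    qed
  qed
  from landau_o.big_trans[OF R this]
  have R2: "(\<lambda>x. x * ln x powr \<beta> * ((1 + (- l / ln x)) powr \<beta> - (\<Sum>n\<le>N. (\<beta> gchoose n) * (- l / ln x) ^ n)))
     \<in> O(\<lambda>x. x * ln x powr \<beta> * ln x powr (- real (Suc N)))"
    by (rule landau_o.big.mult[OF landau_o.big_refl])
  have e: "ln x powr \<beta> * ln x powr (- real (Suc N)) = ln x powr (- real J - 3/2)" for x :: real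
  proof -
    have "\<beta> + - real (Suc N) = - real J - 3/2" using assms by (simp add: \<beta>_def N_def of_nat_diff)
    thus ?thesis by (simp only: powr_add[symmetric])
  qed
  have "eventually (\<lambda>x. x * ln x powr \<beta> * ((1 + (- l / ln x)) powr \<beta> - (\<Sum>n\<le>N. (\<beta> gchoose n) * (- l / ln x) ^ n))
     = x * (ln x - l) powr \<beta> - x * (\<Sum>i\<le>J. c i * ln x powr (- 1/2 - real i))) at_top"
    using eventually_ln_ge[of 1] eventually_ln_ge[of l]
  proof eventually_elim
    case (elim x)
    have "ln x - l = ln x * (1 + (- l / ln x))" using elim by (simp add: field_simps)
    moreover have "1 + (- l / ln x) \<ge> 0" using elim by (simp add: field_simps)
    ultimately have 1: "(ln x - l) powr \<beta> = ln x powr \<beta> * (1 + (- l / ln x)) powr \<beta>"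
      using elim by (simp add: powr_mult)
    have "(\<Sum>i\<le>J. c i * ln x powr (- 1/2 - real i)) = (\<Sum>i\<in>{j..J}. c i * ln x powr (- 1/2 - real i))"
      by (rule sum.mono_neutral_right) (auto simp: c_def)
    also have "\<dots> = (\<Sum>n\<le>N. c (n + j) * ln x powr (- 1/2 - real (n + j)))"
      by (rule sum.reindex_bij_witness[of _ "\<lambda>n. n + j" "\<lambda>i. i - j"]) (use assms in \<open>auto simp: N_def\<close>)
    also have "\<dots> = (\<Sum>n\<le>N. ln x powr \<beta> * ((\<beta> gchoose n) * (- l / ln x) ^ n))"
    proof (rule sum.cong[OF refl])
      fix n
      have "ln x powr (- 1/2 - real (n + j)) = ln x powr \<beta> * ln x powr (- real n)"
      proof -
        have "- 1/2 - real (n + j) = \<beta> + - real n" by (simp add: \<beta>_def)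
        thus ?thesis by (simp only: powr_add)
      qed
      also have "ln x powr (- real n) = 1 / ln x ^ n"
        using elim by (simp add: powr_minus powr_realpow divide_inverse)
      finally show "c (n + j) * ln x powr (- 1/2 - real (n + j)) = ln x powr \<beta> * ((\<beta> gchoose n) * (- l / ln x) ^ n)"
        unfolding power_divide by (simp add: c_def)
    qed
    finally have 2: "(\<Sum>i\<le>J. c i * ln x powr (- 1/2 - real i)) =
      ln x powr \<beta> * (\<Sum>n\<le>N. (\<beta> gchoose n) * (- l / ln x) ^ n)" by (simp only: sum_distrib_left)
    show ?case unfolding 1 2 by (simp only: right_diff_distrib mult.assoc)
  qed
  from landau_o.big.in_cong[OF this] R2
  have "log_expansion (\<lambda>x. x * (ln x - l) powr \<beta>) c J"
    unfolding log_expansion_def by (simp only: mult.assoc e)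
  thus ?thesis unfolding \<beta>_def c_def .
qed

text \<open>The source of every \<open>log q\<close> in the result: in the second coefficient the
  leading term contributes its first binomial term \<open>(-1/2) * (- ln q)\<close>.\<close>

lemma log_expansion_scale:
  assumes f: "log_expansion f c J" and q: "q \<ge> (1::real)" and J: "J \<ge> 1"
  shows "\<exists>d. log_expansion (\<lambda>x. f (x / q)) d J \<and> d 0 = c 0 / q \<and> d 1 = (c 1 + c 0 * ln q / 2) / q"
proof -
  define b where "b j i = (if i < j then 0 else ((- 1/2 - real j) gchoose (i - j)) * (- ln q) ^ (i - j))" for j i
  define d where "d i = (\<Sum>j\<le>J. (c j / q) * b j i)" for i
  have 1: "log_expansion (\<lambda>x. \<Sum>j\<le>J. (c j / q) * (x * (ln x - ln q) powr (- 1/2 - real j))) d J"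
    unfolding d_def b_def
    by (rule log_expansion_sum, rule log_expansion_cmult, rule log_expansion_shifted_monomial) simp
  have lim: "filterlim (\<lambda>x. x / q) at_top at_top" using q by real_asymp
  have "(\<lambda>x. f (x / q) - x / q * (\<Sum>j\<le>J. c j * ln (x / q) powr (- 1/2 - real j)))
      \<in> O(\<lambda>x. x / q * ln (x / q) powr (- real J - 3/2))"
    using landau_o.big.compose[OF f[unfolded log_expansion_def] lim] .
  also have "(\<lambda>x. x / q * ln (x / q) powr (- real J - 3/2)) \<in> O(\<lambda>x. x * ln x powr (- real J - 3/2))"
  proof (rule bigoI[of _ "(1/2) powr (- real J - 3/2)"])
    show "eventually (\<lambda>x. norm (x / q * ln (x / q) powr (- real J - 3/2))
       \<le> (1/2) powr (- real J - 3/2) * norm (x * ln x powr (- real J - 3/2))) at_top"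
      using eventually_ln_ge[of 1] eventually_ln_ge[of "2 * ln q"] eventually_gt_at_top[of 0]
    proof eventually_elim
      case (elim x)
      have "ln (x / q) \<ge> ln x * (1/2)" using elim q by (simp add: ln_div)
      hence "ln (x / q) powr (- real J - 3/2) \<le> (ln x * (1/2)) powr (- real J - 3/2)"
        by (intro powr_mono2') (use \<open>ln x \<ge> 1\<close> in linarith)+
      also have "\<dots> = (1/2) powr (- real J - 3/2) * ln x powr (- real J - 3/2)"
        using elim by (subst powr_mult) auto
      finally have *: "ln (x / q) powr (- real J - 3/2) \<le> (1/2) powr (- real J - 3/2) * ln x powr (- real J - 3/2)" .
      have "x / q * ln (x / q) powr (- real J - 3/2) \<le> x * ((1/2) powr (- real J - 3/2) * ln x powr (- real J - 3/2))"
        by (rule mult_mono[OF _ *]) (use elim q in \<open>auto simp: field_simps\<close>)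
      thus ?case using elim q by (simp add: abs_mult mult_ac)
    qed
  qed
  finally have 2: "log_expansion (\<lambda>x. f (x / q) - x / q * (\<Sum>j\<le>J. c j * ln (x / q) powr (- 1/2 - real j))) (\<lambda>_. 0) J"
    by (rule log_expansion_bigo)
  have L: "log_expansion (\<lambda>x. f (x / q)) d J"
  proof (rule log_expansion_cong[OF log_expansion_add[OF 1 2]])
    show "eventually (\<lambda>x. (\<Sum>j\<le>J. c j / q * (x * (ln x - ln q) powr (- 1 / 2 - real j))) +
           (f (x / q) - x / q * (\<Sum>j\<le>J. c j * ln (x / q) powr (- 1 / 2 - real j))) = f (x / q)) at_top"
      using eventually_gt_at_top[of 0]
    proof eventually_elim
      case (elim x)
      have "ln (x / q) = ln x - ln q" using elim q by (simp add: ln_div)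
      thus ?case by (simp add: sum_distrib_left mult_ac)
    qed
  qed simp
  have "d 0 = (\<Sum>j\<in>{0}. (c j / q) * b j 0)" unfolding d_def
    by (rule sum.mono_neutral_right) (auto simp: b_def)
  hence d0: "d 0 = c 0 / q" by (simp add: b_def)
  \<comment> \<open>A monomial with index \<open>j\<close> influences only the coefficients from
    \<open>j\<close> on.\<close>
  have "d 1 = (\<Sum>j\<in>{0, 1}. (c j / q) * b j 1)" unfolding d_def
    by (rule sum.mono_neutral_right) (use J in \<open>auto simp: b_def\<close>)
  hence "d 1 = (c 1 + c 0 * ln q / 2) / q" using q by (simp add: b_def field_simps)
  thus ?thesis using L d0 by blast
qed

text \<open>Up to sign, the product comes from differentiating \<open>(s - 1)^(-1/2)\<close>
  \<open>k\<close> times. It cancels the Gamma factor of the Laplace transform at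
  \<open>j = 0\<close> and leaves \<open>1 / sqrt pi\<close>.\<close>

lemma gamma_half_product: "(\<Prod>i<k. 1/2 + real i) = Gamma (real k + 1/2) / sqrt pi"
proof (induction k)
  case 0 show ?case using Gamma_one_half_real by simp
next
  case (Suc k)
  have "real k + 1/2 > 0" by simp
  hence "Gamma (real k + 1/2 + 1) = (real k + 1/2) * Gamma (real k + 1/2)"
    by (intro Gamma_plus1) (auto dest: nonpos_Ints_nonpos)
  thus ?case using Suc by (simp add: add_ac mult_ac)
qed

section \<open>The expansion of the counting function and its first two coefficients\<close>

lemma countE_eq: "countE x = (\<Sum>n\<le>nat \<lfloor>x\<rfloor>. if n = 0 then 0 else indE n)"
proof -
  have "(\<Sum>n\<le>nat \<lfloor>x\<rfloor>. if n = 0 then 0 else indE n) = (\<Sum>n\<in>{1..nat \<lfloor>x\<rfloor>}. if n = 0 then 0 else indE n)"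
    by (rule sum.mono_neutral_right) auto
  thus ?thesis unfolding countE_def by simp
qed

lemma log_expansion_mlog':
  "log_expansion (mlog' (- 1/2 - real j))
     (\<lambda>i. 2 * (if i = j then 1 else 0) + (- 1/2 - real j) * (if i = Suc j then 1 else 0)) J"
proof (rule log_expansion_cong)
  show "log_expansion (\<lambda>x. 2 * (x * ln x powr (- 1/2 - real j)) + (- 1/2 - real j) * (x * ln x powr (- 1/2 - real (Suc j))))
    (\<lambda>i. 2 * (if i = j then 1 else 0) + (- 1/2 - real j) * (if i = Suc j then 1 else 0)) J"
    by (intro log_expansion_add log_expansion_cmult log_expansion_monomial)
  have "- 1/2 - real (Suc j) = - 1/2 - real j - 1" by simp
  thus "eventually (\<lambda>x. 2 * (x * ln x powr (- 1/2 - real j)) + (- 1/2 - real j) * (x * ln x powr (- 1/2 - real (Suc j))) =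
     mlog' (- 1/2 - real j) x) at_top" unfolding mlog'_def by (simp only: mult.assoc) simp
qed simp

text \<open>With \<open>k = 2 J + 4\<close> derivatives the unsmoothed saving is
  \<open>J + 2\<close>, which is more than \<open>J + 3/2\<close>.\<close>

lemma bigo_from_log_bound:
  assumes "\<And>x. x \<ge> exp 1 \<Longrightarrow> \<bar>f x\<bar> \<le> C * (x * ln x powr (- real (2 * J + 4) / 2))"
  shows "f \<in> O(\<lambda>x. x * ln x powr (- real J - 3/2))"
proof -
  have "f \<in> O(\<lambda>x. x * ln x powr (- real (2 * J + 4) / 2))"
  proof (rule bigoI[of _ C])
    show "eventually (\<lambda>x. norm (f x) \<le> C * norm (x * ln x powr (- real (2 * J + 4) / 2))) at_top"
      using eventually_ge_at_top[of "exp 1"]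
    proof eventually_elim
      case (elim x)
      hence "x \<ge> 0" using exp_gt_zero[of 1] by linarith
      thus ?case using assms[OF elim] by (simp add: abs_mult)
    qed
  qed
  also have "(\<lambda>x::real. x * ln x powr (- real (2 * J + 4) / 2)) \<in> O(\<lambda>x. x * ln x powr (- real J - 3/2))"
    by (rule ln_powr_bigo) simp
  finally show ?thesis .
qed

lemma countE_log_expansion: "\<exists>c. log_expansion countE c J \<and> c 0 = LR_K"
proof -
  define k where "k = 2 * J + 4"
  have k: "k > 0" by (simp add: k_def)
  obtain e p0 C where p0: "p0\<^sup>2 = Lfun chi4 4 1 * Hser (\<lambda>_. 1) 1" "p0 \<in> \<real>\<^sub>\<ge>\<^sub>0"
    and e0: "e 0 = (\<Prod>i<k. -1/2 - of_nat i) * (p0 / 2)" and C: "C \<ge> 0"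
    and bnd: "\<And>s. 1 < Re s \<and> Re s < 3 \<and> Im s \<noteq> 0 \<Longrightarrow> norm ((deriv ^^ k) (Ar (\<lambda>_. 1)) s -
        (\<Sum>j<k. e j * (s - 1) powr (of_nat j - of_nat k - 1/2))) \<le> C * Gmaj (Im s)"
    using Ar_one_expansion[OF k] by blast
  \<comment> \<open>The value at 0 is reset, since \<open>indE 0 = 1\<close> while the counting
    starts at 1.\<close>
  define a :: "nat \<Rightarrow> complex" where "a n = (if n = 0 then 0 else of_real (indE n))" for n
  \<comment> \<open>Dividing by the Gamma value turns powers of \<open>s - 1\<close> into Laplace
    transforms of \<open>pw\<close> times \<open>exp\<close>.\<close>
  define d :: "nat \<Rightarrow> complex" where "d j = (-1) ^ k * e j / of_real (Gamma (real k + 1/2 - real j))" for j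
  have as: "(\<lambda>s. dser a s * inverse (s * (s + 1))) = Ar (\<lambda>_. 1)"
  proof
    fix s
    have "dser a s = Aser (\<lambda>_. 1) s" unfolding dser_def Aser_def a_def by (intro suminf_cong) auto
    thus "dser a s * inverse (s * (s + 1)) = Ar (\<lambda>_. 1) s" unfolding Ar_def by simp
  qed
  have main: "\<exists>C'\<ge>0. \<forall>x\<ge>exp 1. norm ((\<Sum>n\<le>nat \<lfloor>x\<rfloor>. a n) - (\<Sum>j<k. d j * of_real (mlog' (- 1/2 - real j) x))) \<le> C' * (x * ln x powr (- real k/2))"
  proof (rule sum_asymptotics)
    show "a 0 = 0" by (simp add: a_def)
    show "norm (a n) \<le> 1" for n using norm_indE[of n] by (simp add: a_def)
    show "k > 0" "C \<ge> 0" by fact+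
    fix s :: complex assume s: "1 < Re s" "Re s < 3" "Im s \<noteq> 0"
    have t: "d j * (of_real (Gamma (real k + 1/2 - real j)) * (s - 1) powr (- of_real (real k + 1/2 - real j))) =
       (-1) ^ k * (e j * (s - 1) powr (of_nat j - of_nat k - 1/2))" if "j < k" for j
    proof -
      have "real k + 1/2 - real j > 0" using that by simp
      hence G: "Gamma (real k + 1/2 - real j) \<noteq> 0" using Gamma_real_pos[of "real k + 1/2 - real j"] by linarith
      have E: "(- of_real (real k + 1/2 - real j) :: complex) = of_nat j - of_nat k - 1/2" by simp
      show ?thesis unfolding E d_def using G by simp
    qed
    have "(\<Sum>j<k. d j * (of_real (Gamma (real k + 1/2 - real j)) * (s - 1) powr (- of_real (real k + 1/2 - real j)))) =
       (\<Sum>j<k. (-1) ^ k * (e j * (s - 1) powr (of_nat j - of_nat k - 1/2)))"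
      by (rule sum.cong) (use t in auto)
    also have "\<dots> = (-1) ^ k * (\<Sum>j<k. e j * (s - 1) powr (of_nat j - of_nat k - 1/2))"
      by (simp only: sum_distrib_left)
    finally have S: "(\<Sum>j<k. d j * (of_real (Gamma (real k + 1/2 - real j)) * (s - 1) powr (- of_real (real k + 1/2 - real j)))) =
       (-1) ^ k * (\<Sum>j<k. e j * (s - 1) powr (of_nat j - of_nat k - 1/2))" .
    show "norm ((-1) ^ k * (deriv ^^ k) (\<lambda>s. dser a s * inverse (s * (s + 1))) s -
      (\<Sum>j<k. d j * (of_real (Gamma (real k + 1/2 - real j)) * (s - 1) powr (- of_real (real k + 1/2 - real j))))) \<le> C * Gmaj (Im s)"
      unfolding as S right_diff_distrib[symmetric] norm_mult using bnd[of s] s by (simp add: norm_power)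
  qed
  then obtain C' where C': "\<And>x. x \<ge> exp 1 \<Longrightarrow> norm ((\<Sum>n\<le>nat \<lfloor>x\<rfloor>. a n) - (\<Sum>j<k. d j * of_real (mlog' (- 1/2 - real j) x))) \<le> C' * (x * ln x powr (- real k/2))"
    by blast
  define b where "b j i = 2 * (if i = j then 1 else 0) + (- 1/2 - real j) * (if i = Suc j then 1 else (0::real))" for i j :: nat
  define c where "c i = (\<Sum>j<k. Re (d j) * b j i) + 0" for i
  have 1: "log_expansion (\<lambda>x. \<Sum>j<k. Re (d j) * mlog' (- 1/2 - real j) x) (\<lambda>i. \<Sum>j<k. Re (d j) * b j i) J"
    unfolding b_def by (rule log_expansion_sum, rule log_expansion_cmult, rule log_expansion_mlog')
  have 2: "log_expansion (\<lambda>x. countE x - (\<Sum>j<k. Re (d j) * mlog' (- 1/2 - real j) x)) (\<lambda>_. 0) J"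
  proof (rule log_expansion_bigo, rule bigo_from_log_bound[of _ C'])
    fix x :: real assume x: "x \<ge> exp 1"
    define z where "z = (\<Sum>n\<le>nat \<lfloor>x\<rfloor>. a n) - (\<Sum>j<k. d j * of_real (mlog' (- 1/2 - real j) x))"
    have "Re z = countE x - (\<Sum>j<k. Re (d j) * mlog' (- 1/2 - real j) x)"
      unfolding z_def countE_eq a_def by (simp add: if_distrib cong: if_cong)
    hence "\<bar>countE x - (\<Sum>j<k. Re (d j) * mlog' (- 1/2 - real j) x)\<bar> \<le> norm z"
      using abs_Re_le_cmod[of z] by simp
    also have "\<dots> \<le> C' * (x * ln x powr (- real k/2))" unfolding z_def by (rule C'[OF x])
    finally show "\<bar>countE x - (\<Sum>j<k. Re (d j) * mlog' (- 1/2 - real j) x)\<bar> \<le> C' * (x * ln x powr (- real (2 * J + 4) / 2))"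
      by (simp only: k_def)
  qed
  have L: "log_expansion countE c J"
    unfolding c_def by (rule log_expansion_cong[OF log_expansion_add[OF 1 2]]) auto
  have "c 0 = (\<Sum>j\<in>{0}. Re (d j) * b j 0)" unfolding c_def
    by (subst sum.mono_neutral_right[of "{..<k}" "{0}"]) (use k in \<open>auto simp: b_def\<close>)
  hence c0: "c 0 = 2 * Re (d 0)" by (simp add: b_def)
  \<comment> \<open>The Euler factor at 2 is \<open>1 - 1/2\<close> and doubles the value
    \<open>2 * LR_K^2\<close> of \<open>Vser\<close>.\<close>
  have "Hser (\<lambda>_. 1) 1 = of_real (4 * LR_K\<^sup>2)"
    unfolding Hser_def Vser_one_eq_LR_K by (simp add: powr_minus)
  hence p2: "p0\<^sup>2 = of_real (pi * LR_K\<^sup>2)" using p0(1) unfolding Lfun_chi4_1 by simp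
  obtain r where r: "p0 = of_real r" "r \<ge> 0" using p0(2) by (auto elim: nonneg_Reals_cases)
  have "(of_real (r\<^sup>2) :: complex) = of_real (pi * LR_K\<^sup>2)" using p2 r by simp
  hence "r\<^sup>2 = pi * LR_K\<^sup>2" by (simp only: of_real_eq_iff)
  also have "\<dots> = (sqrt pi * LR_K)\<^sup>2" by (simp add: power_mult_distrib)
  finally have rv: "r = sqrt pi * LR_K" using r LR_K_pos by (simp add: power2_eq_iff_nonneg)
  have "(\<Prod>i<k. -1/2 - of_nat i :: complex) = (\<Prod>i<k. (-1) * of_real (1/2 + real i))"
    by (rule prod.cong) auto
  also have "\<dots> = (-1) ^ k * of_real (Gamma (real k + 1/2) / sqrt pi)"
    unfolding prod.distrib of_real_prod[symmetric] gamma_half_product by simp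
  finally have P: "(\<Prod>i<k. -1/2 - of_nat i :: complex) = (-1) ^ k * of_real (Gamma (real k + 1/2) / sqrt pi)" .
  have G: "Gamma (real k + 1/2) \<noteq> 0" using Gamma_real_pos[of "real k + 1/2"] by linarith
  \<comment> \<open>The half comes from \<open>s (s + 1)\<close> at 1; the derivative of
    \<open>x^2\<close> in \<open>mlog'\<close> doubles it again, so the leading coefficient is
    \<open>LR_K\<close>.\<close>
  have "d 0 = ((-1) ^ k * (-1) ^ k) * of_real (LR_K / 2)"
    unfolding d_def e0 P r(1) rv using G by (simp add: field_simps)
  also have "((-1) ^ k * (-1) ^ k :: complex) = 1" by (simp add: k_def)
  finally have "d 0 = of_real (LR_K / 2)" by (simp only: mult_1)
  hence "Re (d 0) = LR_K / 2" by (simp only: Re_complex_of_real)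
  hence "c 0 = LR_K" unfolding c0 by simp
  thus ?thesis using L by blast
qed

text \<open>Truncating the expansion to order 1 shows that the description defining
  \<open>classical_c1\<close> is met by \<open>c 1 / LR_K\<close>; uniqueness of the second
  coefficient makes it the described number.\<close>

lemma classical_c1_eq:
  assumes "log_expansion countE c J" "J \<ge> 1" "c 0 = LR_K"
  shows "c 1 = LR_K * classical_c1"
proof -
  have iff: "(\<lambda>x. countE x - LR_K * x * (ln x powr (-1/2) + c' * ln x powr (-3/2))) \<in> O(\<lambda>x. x * ln x powr (-5/2))
    \<longleftrightarrow> log_expansion countE (\<lambda>j. if j = 0 then LR_K else LR_K * c') 1" for c'
  proof -
    have "LR_K * x * (ln x powr (-1/2) + c' * ln x powr (-3/2)) = x * (\<Sum>j\<le>1. (if j = 0 then LR_K else LR_K * c') * ln x powr (- 1/2 - real j))" for x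
      by (simp add: algebra_simps)
    moreover have "- real 1 - 3/2 = - 5/2" by simp
    ultimately show ?thesis unfolding log_expansion_def by (simp only:)
  qed
  have 1: "log_expansion countE c 1" by (rule log_expansion_truncate[OF assms(1,2)])
  have u: "LR_K * c' = c 1" if "log_expansion countE (\<lambda>j. if j = 0 then LR_K else LR_K * c') 1" for c'
    using log_expansion_unique_1[OF that 1] assms(3) by simp
  have "classical_c1 = c 1 / LR_K"
    unfolding classical_c1_def iff
  proof (rule the_equality)
    show "log_expansion countE (\<lambda>j. if j = 0 then LR_K else LR_K * (c 1 / LR_K)) 1"
    proof (rule log_expansion_cong[OF 1])
      fix j :: nat assume "j \<le> 1"
      hence "j = 0 \<or> j = 1" by auto
      thus "c j = (if j = 0 then LR_K else LR_K * (c 1 / LR_K))" using assms(3) LR_K_pos by auto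
    qed simp
    show "c' = c 1 / LR_K" if "log_expansion countE (\<lambda>j. if j = 0 then LR_K else LR_K * c') 1" for c'
      using u[OF that] LR_K_pos by (simp add: field_simps)
  qed
  thus ?thesis using LR_K_pos by (simp add: field_simps)
qed

section \<open>Characters modulo a prime and arithmetic progressions\<close>

lemma bij_betw_unique:
  assumes "bij_betw f A B" "y \<in> B"
  shows "\<exists>!x. x \<in> A \<and> f x = y"
proof -
  obtain x where x: "x \<in> A" "f x = y" using assms unfolding bij_betw_def by blast
  show ?thesis
  proof (rule ex1I[of _ x])
    show "z = x" if "z \<in> A \<and> f z = y" for z
      using that x bij_betw_imp_inj_on[OF assms(1)] by (auto dest: inj_onD)
  qed (use x in simp)
qed

lemma Ex1_unique_eq: "\<exists>!x. P x \<Longrightarrow> P a \<Longrightarrow> P b \<Longrightarrow> a = b" by blast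

lemma cis_root_ne_1:
  assumes "0 < k" "k < M"
  shows "cis (2 * pi * real k / real M) \<noteq> 1"
proof
  assume "cis (2 * pi * real k / real M) = 1"
  hence "cos (2 * pi * real k / real M) = 1" by (metis cis.simps(1) one_complex.simps(1))
  then obtain n :: int where n: "2 * pi * real k / real M = of_int n * 2 * pi" using cos_one_2pi_int by blast
  hence "real k = of_int n * real M" using assms by (simp add: field_simps)
  hence "of_int (int k) = (of_int (n * int M) :: real)" by simp
  hence "int k = n * int M" by (simp only: of_int_eq_iff)
  hence "int M dvd int k" by simp
  hence "M dvd k" by simp
  thus False using assms by (auto dest: dvd_imp_le)
qed

locale prime_index =
  fixes q r :: nat
  assumes q: "prime q" and q2: "q > 2" and r: "residue_primroot q r"
begin

text \<open>The discrete logarithm to the base of the primitive root \<open>r\<close>. It is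
  specified only for \<open>n\<close> not divisible by \<open>q\<close>, and \<open>chr\<close>
  consults it only there.\<close>

definition ix :: "nat \<Rightarrow> nat" where
  "ix n = (THE i. i < q - 1 \<and> r ^ i mod q = n mod q)"

definition chr :: "nat \<Rightarrow> nat \<Rightarrow> complex" where
  "chr k n = (if q dvd n then 0 else cis (2 * pi * real k * real (ix n) / real (q - 1)))"

lemma ix_unique:
  assumes "\<not> q dvd n"
  shows "\<exists>!i. i < q - 1 \<and> r ^ i mod q = n mod q"
proof -
  have "bij_betw (\<lambda>i. r ^ i mod q) {..<q - 1} (totatives q)"
    using residue_primroot_is_generator[OF _ r] q2 totient_prime[OF q] by simp
  moreover have "n mod q \<in> totatives q"
    using assms q prime_imp_coprime[OF q, of "n mod q"]
    by (auto simp: totatives_def coprime_commute dvd_mod_iff mod_greater_zero_iff_not_dvd less_imp_le prime_gt_0_nat)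
  ultimately have "\<exists>!i. i \<in> {..<q - 1} \<and> r ^ i mod q = n mod q" by (rule bij_betw_unique)
  thus ?thesis by (simp only: lessThan_iff)
qed

lemma ix_props: assumes "\<not> q dvd n" shows "ix n < q - 1" "r ^ ix n mod q = n mod q"
proof -
  have "ix n < q - 1 \<and> r ^ ix n mod q = n mod q"
    unfolding ix_def by (rule theI'[OF ix_unique[OF assms]])
  thus "ix n < q - 1" "r ^ ix n mod q = n mod q" by simp_all
qed

lemma ix_eqI:
  assumes "\<not> q dvd n" "i < q - 1" "r ^ i mod q = n mod q"
  shows "ix n = i"
proof -
  have "\<exists>!i. i < q - 1 \<and> r ^ i mod q = n mod q" by (rule ix_unique[OF assms(1)])
  moreover have "ix n < q - 1 \<and> r ^ ix n mod q = n mod q" using ix_props[OF assms(1)] by (rule conjI)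
  moreover have "i < q - 1 \<and> r ^ i mod q = n mod q" using assms(2,3) by (rule conjI)
  ultimately show ?thesis by (rule Ex1_unique_eq)
qed

lemma ix_mod: "ix (n mod q) = ix n" by (simp only: ix_def mod_mod_trivial)

lemma r_power_mod: "r ^ (i mod (q - 1)) mod q = r ^ i mod q"
proof -
  have cop: "coprime q r" using r by (simp add: residue_primroot_def)
  have "[r ^ (q - 1) = 1] (mod q)" using euler_theorem[of r q] cop totient_prime[OF q] by (simp add: coprime_commute)
  hence "[(r ^ (q - 1)) ^ (i div (q - 1)) = 1 ^ (i div (q - 1))] (mod q)" by (rule cong_pow)
  hence "[(r ^ (q - 1)) ^ (i div (q - 1)) * r ^ (i mod (q - 1)) = 1 ^ (i div (q - 1)) * r ^ (i mod (q - 1))] (mod q)"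
    by (rule cong_mult) simp
  hence "[r ^ i = r ^ (i mod (q - 1))] (mod q)" by (simp flip: power_mult power_add)
  thus ?thesis by (simp add: cong_def)
qed

lemma ix_mult:
  assumes "\<not> q dvd a" "\<not> q dvd b"
  shows "ix (a * b) = (ix a + ix b) mod (q - 1)"
proof (rule ix_eqI)
  show "\<not> q dvd a * b" using assms q prime_dvd_mult_iff by blast
  show "(ix a + ix b) mod (q - 1) < q - 1" using q2 by simp
  have "r ^ ((ix a + ix b) mod (q - 1)) mod q = (r ^ ix a mod q) * (r ^ ix b mod q) mod q"
    unfolding r_power_mod by (simp add: power_add mod_mult_eq)
  also have "\<dots> = a * b mod q" using ix_props(2)[OF assms(1)] ix_props(2)[OF assms(2)] by (simp add: mod_mult_eq)
  finally show "r ^ ((ix a + ix b) mod (q - 1)) mod q = a * b mod q" .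
qed

lemma cis_mod: "cis (2 * pi * real k * real (i mod (q - 1)) / real (q - 1)) = cis (2 * pi * real k * real i / real (q - 1))"
proof -
  define M where "M = q - 1"
  have M: "M > 0" using q2 by (simp add: M_def)
  have "real i = real (M * (i div M) + i mod M)" by simp
  hence i: "real i = real M * real (i div M) + real (i mod M)" by (simp only: of_nat_add of_nat_mult)
  have "2 * pi * real k * real i / real M = 2 * pi * real k * real (i mod M) / real M + 2 * pi * real (k * (i div M))"
    by (subst i) (use M in \<open>simp add: field_simps\<close>)
  moreover have "cis (2 * pi * real (k * (i div M))) = 1"
    by (rule cis_multiple_2pi) auto
  ultimately show ?thesis unfolding M_def[symmetric] by (simp flip: cis_mult)
qed

lemma chr_dchar: "dchar q (chr k)"
  unfolding dchar_def
proof (intro conjI allI impI)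
  have nd1: "\<not> q dvd 1" using q2 by simp
  have "ix 1 = 0" by (rule ix_eqI) (use nd1 q2 in auto)
  thus "chr k 1 = 1" using nd1 by (simp add: chr_def)
  show "q > 0" using q2 by simp
  show "chr k (a * b) = chr k a * chr k b" for a b
  proof (cases "q dvd a \<or> q dvd b")
    case False
    hence "chr k (a * b) = cis (2 * pi * real k * real (ix a + ix b) / real (q - 1))"
      unfolding chr_def using prime_dvd_mult_iff[OF q] by (simp add: ix_mult cis_mod del: of_nat_add One_nat_def)
    also have "2 * pi * real k * real (ix a + ix b) / real (q - 1) =
      2 * pi * real k * real (ix a) / real (q - 1) + 2 * pi * real k * real (ix b) / real (q - 1)"
      by (simp add: distrib_left add_divide_distrib)
    finally show ?thesis using False by (simp add: chr_def cis_mult)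
  qed (auto simp: chr_def)
  show "chr k (n + q) = chr k n" for n
  proof -
    have "ix (n + q) = ix n" using ix_mod[of "n + q"] ix_mod[of n] by simp
    thus ?thesis unfolding chr_def by simp
  qed
  show "norm (chr k n) \<le> 1" for n by (simp add: chr_def)
  show "chr k n = 0" if "\<not> coprime n q" for n
    using that prime_imp_coprime[OF q, of n] by (auto simp: chr_def coprime_commute)
qed

text \<open>Each sum vanishes once a unit is found at which the character is not 1. For
  \<open>chr k\<close> this is the generator \<open>r\<close>.\<close>

lemma chr_nonprincipal:
  assumes k: "0 < k" "k < q - 1"
  shows "(\<Sum>n=1..q. chr k n) = 0" "(\<Sum>n=1..4*q. chi4 n * chr k n) = 0"
proof -
  have cop: "coprime r q" using r by (simp add: residue_primroot_def coprime_commute)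
  have nd: "\<not> q dvd r"
  proof
    assume "q dvd r"
    hence "is_unit q" using coprime_common_divisor[OF cop, of q] by simp
    thus False using q2 by simp
  qed
  have "ix r = 1" by (rule ix_eqI) (use nd q2 in auto)
  hence "chr k r \<noteq> 1" using nd cis_root_ne_1[OF k] by (simp add: chr_def)
  thus "(\<Sum>n=1..q. chr k n) = 0" by (rule dchar_sum_zero[OF chr_dchar cop])
  have oq: "odd q" using q q2 prime_odd_nat by blast
  \<comment> \<open>The witness \<open>1 + 2 q\<close> is 1 modulo \<open>q\<close> and, as
    \<open>q\<close> is odd, 3 modulo 4. So \<open>chr k\<close> is 1 and \<open>chi4\<close> is -1
    there.\<close>
  have m4: "(1 + 2 * q) mod 4 = 3" using oq by presburger
  have m1: "(1 + 2 * q) mod q = 1" using q2 by (subst mod_mult_self1) simp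
  hence nd2: "\<not> q dvd (1 + 2 * q)" by (simp only: dvd_eq_mod_eq_0)
  have "ix (1 + 2 * q) = 0" by (rule ix_eqI[OF nd2]) (use q2 m1 in auto)
  hence v: "chi4 (1 + 2 * q) * chr k (1 + 2 * q) = -1" using nd2 m4 by (simp add: chr_def chi4_def)
  have "coprime (1 + 2 * q) q" using prime_imp_coprime[OF q nd2] by (simp only: coprime_commute)
  moreover have "coprime (1 + 2 * q) 4" using coprime_4_imp_odd by simp
  ultimately have "coprime (1 + 2 * q) (4 * q)" by simp
  thus "(\<Sum>n=1..4*q. chi4 n * chr k n) = 0"
    by (rule dchar_sum_zero[OF dchar_chi4_mult[OF chr_dchar]]) (use v in simp)
qed

text \<open>The summands are the powers of one root of unity of order dividing \<open>q - 1\<close>,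
  determined by the difference of the indices; it is 1 exactly when the residues agree.\<close>

lemma chr_orthogonal:
  assumes "\<not> q dvd a" "\<not> q dvd n"
  shows "(\<Sum>k<q - 1. cnj (chr k a) * chr k n) = (if n mod q = a mod q then of_nat (q - 1) else 0)"
proof -
  define M where "M = q - 1"
  have M: "M > 0" using q2 by (simp add: M_def)
  define z where "z = cis (2 * pi * (real (ix n) - real (ix a)) / real M)"
  have t: "cnj (chr k a) * chr k n = z ^ k" for k
  proof -
    have "cnj (chr k a) * chr k n = cis (- (2 * pi * real k * real (ix a) / real M) + 2 * pi * real k * real (ix n) / real M)"
      unfolding chr_def M_def using assms by (simp add: cis_cnj cis_mult)
    also have "- (2 * pi * real k * real (ix a) / real M) + 2 * pi * real k * real (ix n) / real M =
       real k * (2 * pi * (real (ix n) - real (ix a)) / real M)" by (simp add: algebra_simps diff_divide_distrib)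
    finally show ?thesis unfolding z_def by (simp only: Complex.DeMoivre)
  qed
  have zM: "z ^ M = 1"
  proof -
    have "z ^ M = cis (real M * (2 * pi * (real (ix n) - real (ix a)) / real M))" unfolding z_def by (rule Complex.DeMoivre)
    also have "real M * (2 * pi * (real (ix n) - real (ix a)) / real M) = 2 * pi * of_int (int (ix n) - int (ix a))"
      using M by simp
    also have "cis \<dots> = 1" by (rule cis_multiple_2pi) auto
    finally show ?thesis .
  qed
  have S: "(\<Sum>k<q - 1. cnj (chr k a) * chr k n) = (\<Sum>k<M. z ^ k)" unfolding t M_def ..
  show ?thesis
  proof (cases "n mod q = a mod q")
    case True
    hence "ix n = ix a" using ix_mod[of n] ix_mod[of a] by simp
    hence "z = 1" by (simp add: z_def)
    thus ?thesis unfolding S using True M_def by simp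
  next
    case False
    have ne: "ix n \<noteq> ix a" using False ix_props(2)[OF assms(1)] ix_props(2)[OF assms(2)] by auto
    have lt: "ix n < M" "ix a < M" unfolding M_def using ix_props(1) assms by auto
    have "z \<noteq> 1"
    proof (cases "ix n > ix a")
      case True
      have "z = cis (2 * pi * real (ix n - ix a) / real M)" unfolding z_def using True by (simp add: of_nat_diff)
      thus ?thesis using cis_root_ne_1[of "ix n - ix a" M] True lt by simp
    next
      case f: False
      \<comment> \<open>Conjugation makes the difference of the indices positive, as
        \<open>cis_root_ne_1\<close> speaks of natural numbers.\<close>
      have "cnj z = cis (2 * pi * real (ix a - ix n) / real M)"
      proof -
        have "real (ix a - ix n) = - (real (ix n) - real (ix a))" using f by (simp add: of_nat_diff)
        hence "2 * pi * real (ix a - ix n) / real M = - (2 * pi * (real (ix n) - real (ix a)) / real M)"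
          by (simp only: mult_minus_right minus_divide_left)
        thus ?thesis unfolding z_def cis_cnj by (rule arg_cong[OF sym])
      qed
      hence "cnj z \<noteq> 1" using cis_root_ne_1[of "ix a - ix n" M] f ne lt by simp
      thus ?thesis by auto
    qed
    hence "(\<Sum>k<M. z ^ k) = 0" using geometric_sum[of z M] zM by simp
    thus ?thesis unfolding S using False by simp
  qed
qed

end

text \<open>In \<open>q * m = a * t^2\<close> the prime \<open>q\<close>, being 1 modulo 4, cannot
  divide the \<open>only3\<close> part \<open>t\<close>. It divides \<open>a\<close> and can be
  cancelled there without disturbing \<open>no3\<close>.\<close>

lemma sum_two_squares_prime_mult_iff:
  assumes q: "prime q" "q mod 4 = 1" and m: "m > 0"
  shows "sum_two_squares (q * m) \<longleftrightarrow> sum_two_squares m"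
proof
  assume "sum_two_squares m"
  thus "sum_two_squares (q * m)" by (rule sum_two_squares_mult[OF prime_1_mod_4_sum_two_squares[OF q]])
next
  assume "sum_two_squares (q * m)"
  moreover have "q * m > 0" using m prime_gt_0_nat[OF q(1)] by simp
  ultimately obtain a t where at: "no3 a" "only3 t" "q * m = a * t^2" using sum_two_squares_iff by blast
  have "\<not> q dvd t" using at(2) q unfolding only3_def by auto
  moreover have "q dvd a * t^2" using at(3)[symmetric] by simp
  ultimately have "q dvd a" using q(1) by (simp add: prime_dvd_mult_iff prime_dvd_power_iff)
  then obtain b where b: "a = q * b" by (elim dvdE)
  have "no3 b" using at(1) unfolding no3_def b by auto
  moreover have "m = b * t^2" using at(3) prime_gt_0_nat[OF q(1)] unfolding b by simp
  ultimately show "sum_two_squares m" using sum_two_squares_iff[OF m] at(2) by blast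
qed

lemma nat_floor_ge_iff: "n \<ge> 1 \<Longrightarrow> n \<le> nat \<lfloor>x\<rfloor> \<longleftrightarrow> real n \<le> x"
proof -
  assume n: "n \<ge> 1"
  have "n \<le> nat \<lfloor>x\<rfloor> \<longleftrightarrow> int n \<le> \<lfloor>x\<rfloor>" using n by linarith
  also have "\<dots> \<longleftrightarrow> real n \<le> x" by (simp add: le_floor_iff)
  finally show ?thesis .
qed

lemma sum_indE_multiples:
  assumes q: "prime q" "q mod 4 = 1"
  shows "(\<Sum>n\<in>{n\<in>{1..nat \<lfloor>x\<rfloor>}. q dvd n}. indE n) = countE (x / real q)"
  unfolding countE_def
proof (rule sum.reindex_bij_witness[of _ "\<lambda>m. q * m" "\<lambda>n. n div q"])
  have q0: "q > 0" using prime_gt_0_nat[OF q(1)] .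
  fix n assume n: "n \<in> {n\<in>{1..nat \<lfloor>x\<rfloor>}. q dvd n}"
  then obtain m where m: "n = q * m" by auto
  have m0: "m \<ge> 1" using n m by (cases m) auto
  have "real n \<le> x" using n nat_floor_ge_iff[of n x] by auto
  hence "real m \<le> x / real q" using q0 by (simp add: m field_simps)
  thus "n div q \<in> {1..nat \<lfloor>x / real q\<rfloor>}" using m0 nat_floor_ge_iff[of m "x / real q"] q0 by (simp add: m)
  show "q * (n div q) = n" using n by auto
  show "indE (n div q) = indE n" using sum_two_squares_prime_mult_iff[OF q, of m] m0 q0 by (simp add: indE_def m)
next
  have q0: "q > 0" using prime_gt_0_nat[OF q(1)] .
  fix m assume m: "m \<in> {1..nat \<lfloor>x / real q\<rfloor>}"
  hence "real m \<le> x / real q" using nat_floor_ge_iff[of m "x / real q"] by auto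
  hence "real (q * m) \<le> x" using q0 by (simp add: field_simps)
  thus "q * m \<in> {n\<in>{1..nat \<lfloor>x\<rfloor>}. q dvd n}" using nat_floor_ge_iff[of "q * m" x] m q0 by simp
  show "q * m div q = m" using q0 by simp
qed

lemma countE_ap_zero:
  assumes "prime q" "q mod 4 = 1" "[a = 0] (mod int q)"
  shows "countE_ap q a x = countE (x / real q)"
proof -
  have "[int n = a] (mod int q) \<longleftrightarrow> q dvd n" for n
  proof -
    have "[int n = a] (mod int q) \<longleftrightarrow> [int n = 0] (mod int q)" using assms(3) cong_trans cong_sym by blast
    thus ?thesis by (simp add: cong_0_iff)
  qed
  thus ?thesis unfolding countE_ap_def using sum_indE_multiples[OF assms(1,2), of x] by simp
qed

section \<open>Counting in residue classes with characters\<close>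

context prime_index
begin

definition chr_sum :: "nat \<Rightarrow> real \<Rightarrow> complex" where
  "chr_sum k x = (\<Sum>n\<le>nat \<lfloor>x\<rfloor>. chr k n * of_real (indE n))"

text \<open>The Tauberian theorem with all main coefficients equal to 0. The factor \<open>w\<close>
  will be a conjugate character value, and only the real part is kept because the count is
  real.\<close>

lemma chr_sum_bound:
  assumes k: "0 < k" "k < q - 1" and w: "norm w \<le> 1"
  shows "(\<lambda>x. Re (w * chr_sum k x)) \<in> O(\<lambda>x. x * ln x powr (- real J - 3/2))"
proof -
  define K where "K = 2 * J + 4"
  have K: "K > 0" by (simp add: K_def)
  define a where "a n = chr k n * of_real (indE n)" for n
  obtain C where C: "C \<ge> 0" "\<And>s. 1 < Re s \<and> Re s < 3 \<and> Im s \<noteq> 0 \<Longrightarrow> norm ((deriv ^^ K) (Ar (chr k)) s) \<le> C * Gmaj (Im s)"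
    using Ar_deriv_bound_nonprincipal[OF chr_dchar chr_nonprincipal[OF k], of K] by blast
  have as: "(\<lambda>s. dser a s * inverse (s * (s + 1))) = Ar (chr k)"
    by (simp add: fun_eq_iff Ar_def Aser_def a_def[abs_def])
  have "\<exists>C'\<ge>0. \<forall>x\<ge>exp 1. norm ((\<Sum>n\<le>nat \<lfloor>x\<rfloor>. a n) - (\<Sum>j<K. 0 * of_real (mlog' (- 1/2 - real j) x))) \<le> C' * (x * ln x powr (- real K/2))"
  proof (rule sum_asymptotics)
    show "a 0 = 0" by (simp add: a_def chr_def)
    show "norm (a n) \<le> 1" for n
      using norm_indE[of n] dcharD(5)[OF chr_dchar] by (simp add: a_def norm_mult mult_le_one)
    show "K > 0" "C \<ge> 0" by fact+
    fix s :: complex assume "1 < Re s" "Re s < 3" "Im s \<noteq> 0"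
    thus "norm ((-1) ^ K * (deriv ^^ K) (\<lambda>s. dser a s * inverse (s * (s + 1))) s -
      (\<Sum>j<K. 0 * (of_real (Gamma (real K + 1/2 - real j)) * (s - 1) powr (- of_real (real K + 1/2 - real j))))) \<le> C * Gmaj (Im s)"
      unfolding as using C(2)[of s] by (simp add: norm_mult norm_power)
  qed
  then obtain C' where C': "\<And>x. x \<ge> exp 1 \<Longrightarrow> norm (chr_sum k x) \<le> C' * (x * ln x powr (- real K/2))"
    unfolding chr_sum_def a_def by auto
  show ?thesis
  proof (rule bigo_from_log_bound[of _ C'])
    fix x :: real assume x: "x \<ge> exp 1"
    have "\<bar>Re (w * chr_sum k x)\<bar> \<le> norm w * norm (chr_sum k x)"
      using abs_Re_le_cmod[of "w * chr_sum k x"] by (simp add: norm_mult)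
    also have "\<dots> \<le> 1 * norm (chr_sum k x)" by (rule mult_right_mono[OF w]) simp
    finally show "\<bar>Re (w * chr_sum k x)\<bar> \<le> C' * (x * ln x powr (- real (2 * J + 4) / 2))"
      using C'[OF x] unfolding K_def by linarith
  qed
qed

lemma chr_sum_0:
  assumes "q mod 4 = 1"
  shows "chr_sum 0 x = of_real (countE x - countE (x / real q))"
proof -
  have "chr_sum 0 x = (\<Sum>n\<in>{1..nat \<lfloor>x\<rfloor>}. chr 0 n * of_real (indE n))"
    unfolding chr_sum_def by (rule sum.mono_neutral_right) (auto simp: chr_def not_less_eq_eq)
  also have "\<dots> = (\<Sum>n\<in>{1..nat \<lfloor>x\<rfloor>}. of_real (indE n - (if q dvd n then indE n else 0)))"
    by (rule sum.cong) (auto simp: chr_def)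
  also have "\<dots> = of_real (countE x - (\<Sum>n\<in>{1..nat \<lfloor>x\<rfloor>}. if q dvd n then indE n else 0))"
    unfolding countE_def by (simp add: sum_subtractf)
  also have "(\<Sum>n\<in>{1..nat \<lfloor>x\<rfloor>}. if q dvd n then indE n else 0) = (\<Sum>n\<in>{n\<in>{1..nat \<lfloor>x\<rfloor>}. q dvd n}. indE n)"
    by (rule sum.inter_filter[symmetric]) simp
  also have "\<dots> = countE (x / real q)" by (rule sum_indE_multiples[OF q assms])
  finally show ?thesis .
qed

text \<open>Orthogonality with weights \<open>w k = cnj (chr k b)\<close>, where \<open>b\<close> is
  the residue of \<open>a\<close>. The principal character supplies
  \<open>countE x - countE (x / q)\<close>. Of the other weights only their size matters, so they
  remain unspecified.\<close>

lemma countE_ap_by_characters: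
  assumes q4: "q mod 4 = 1" and a: "\<not> [a = 0] (mod int q)"
  shows "\<exists>w. (\<forall>k. norm (w k) \<le> 1) \<and> (\<forall>x. real (q - 1) * countE_ap q a x =
     countE x - countE (x / real q) + (\<Sum>k\<in>{1..<q - 1}. Re (w k * chr_sum k x)))"
proof -
  define b where "b = nat (a mod int q)"
  have q0: "int q > 0" using q2 by simp
  have ib: "int b = a mod int q" unfolding b_def using q0 by simp
  have nb: "\<not> q dvd b"
  proof
    assume "q dvd b"
    hence "int q dvd a mod int q" using ib by (metis int_dvd_int_iff)
    thus False using a by (simp add: cong_0_iff dvd_mod_iff)
  qed
  have cg: "[int n = a] (mod int q) \<longleftrightarrow> n mod q = b mod q" for n
  proof -
    have "[int n = a] (mod int q) \<longleftrightarrow> [int n = int b] (mod int q)" unfolding ib cong_def by simp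
    also have "\<dots> \<longleftrightarrow> [n = b] (mod q)" by (rule cong_int_iff)
    finally show ?thesis unfolding cong_def .
  qed
  define w where "w k = cnj (chr k b)" for k
  have wn: "norm (w k) \<le> 1" for k unfolding w_def using dcharD(5)[OF chr_dchar] by simp
  have "real (q - 1) * countE_ap q a x = countE x - countE (x / real q) + (\<Sum>k\<in>{1..<q - 1}. Re (w k * chr_sum k x))" for x
  proof -
    define N where "N = nat \<lfloor>x\<rfloor>"
    have char_term: "of_real (if n mod q = b mod q then real (q - 1) * indE n else 0) = (\<Sum>k<q - 1. w k * (chr k n * of_real (indE n)))" for n
    proof -
      have "(\<Sum>k<q - 1. w k * (chr k n * of_real (indE n))) = (\<Sum>k<q - 1. w k * chr k n) * of_real (indE n)"
        by (simp only: sum_distrib_right mult.assoc)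
      moreover have "(\<Sum>k<q - 1. w k * chr k n) = (if n mod q = b mod q then of_nat (q - 1) else 0)"
      proof (cases "q dvd n")
        case True
        hence "n mod q \<noteq> b mod q" using nb by (metis dvd_eq_mod_eq_0)
        thus ?thesis using True by (simp add: chr_def)
      next
        case False
        show ?thesis unfolding w_def by (rule chr_orthogonal[OF nb False])
      qed
      ultimately show ?thesis by simp
    qed
    have "of_real (real (q - 1) * countE_ap q a x) = (\<Sum>n\<in>{1..N}. of_real (if n mod q = b mod q then real (q - 1) * indE n else 0) :: complex)"
    proof -
      have "real (q - 1) * countE_ap q a x = (\<Sum>n\<in>{n\<in>{1..N}. n mod q = b mod q}. real (q - 1) * indE n)"
        unfolding countE_ap_def cg N_def by (simp only: sum_distrib_left)
      also have "\<dots> = (\<Sum>n\<in>{1..N}. if n mod q = b mod q then real (q - 1) * indE n else 0)"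
        by (rule sum.inter_filter) simp
      finally show ?thesis by (simp only: of_real_sum)
    qed
    also have "\<dots> = (\<Sum>n\<in>{1..N}. \<Sum>k<q - 1. w k * (chr k n * of_real (indE n)))" unfolding char_term ..
    also have "\<dots> = (\<Sum>n\<le>N. \<Sum>k<q - 1. w k * (chr k n * of_real (indE n)))"
      by (rule sum.mono_neutral_left) (auto simp: chr_def not_less_eq_eq)
    also have "\<dots> = (\<Sum>k<q - 1. \<Sum>n\<le>N. w k * (chr k n * of_real (indE n)))" by (rule sum.swap)
    also have "\<dots> = (\<Sum>k<q - 1. w k * chr_sum k x)" unfolding chr_sum_def N_def by (simp only: sum_distrib_left)
    also have "\<dots> = w 0 * chr_sum 0 x + (\<Sum>k\<in>{1..<q - 1}. w k * chr_sum k x)"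
      using q2 by (simp add: lessThan_atLeast0 sum.atLeast_Suc_lessThan)
    also have "w 0 = 1" unfolding w_def chr_def using nb by simp
    finally have "of_real (real (q - 1) * countE_ap q a x) = 1 * of_real (countE x - countE (x / real q)) + (\<Sum>k\<in>{1..<q - 1}. w k * chr_sum k x)"
      unfolding chr_sum_0[OF q4] .
    from arg_cong[OF this, of Re] show ?thesis by (simp only: mult_1 plus_complex.simps Re_complex_of_real Re_sum)
  qed
  thus ?thesis using wn by blast
qed

lemma countE_ap_nonzero_expansion:
  assumes "q mod 4 = 1" "\<not> [a = 0] (mod int q)"
    and "log_expansion countE c J" "log_expansion (\<lambda>x. countE (x / real q)) d J"
  shows "log_expansion (countE_ap q a) (\<lambda>j. (c j - d j) / real (q - 1)) J"
proof -
  obtain w where w: "\<And>k. norm (w k) \<le> 1" "\<And>x. real (q - 1) * countE_ap q a x =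
     countE x - countE (x / real q) + (\<Sum>k\<in>{1..<q - 1}. Re (w k * chr_sum k x))"
    using countE_ap_by_characters[OF assms(1,2)] by blast
  have "log_expansion (\<lambda>x. \<Sum>k\<in>{1..<q - 1}. Re (w k * chr_sum k x)) (\<lambda>j. \<Sum>k\<in>{1..<q - 1}. 0) J"
    by (rule log_expansion_sum, rule log_expansion_bigo, rule chr_sum_bound) (use w in auto)
  hence "log_expansion (\<lambda>x. (1 / real (q - 1)) * ((countE x + (-1) * countE (x / real q)) + (\<Sum>k\<in>{1..<q - 1}. Re (w k * chr_sum k x))))
    (\<lambda>j. (1 / real (q - 1)) * ((c j + (-1) * d j) + (\<Sum>k\<in>{1..<q - 1}. 0))) J"
    by (intro log_expansion_add log_expansion_cmult assms(3,4))
  moreover have "(1 / real (q - 1)) * ((countE x + (-1) * countE (x / real q)) + (\<Sum>k\<in>{1..<q - 1}. Re (w k * chr_sum k x))) = countE_ap q a x" for x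
  proof -
    have "real (q - 1) \<noteq> 0" using q2 by simp
    moreover have "(countE x + (-1) * countE (x / real q)) + (\<Sum>k\<in>{1..<q - 1}. Re (w k * chr_sum k x)) = real (q - 1) * countE_ap q a x"
      unfolding w(2) by simp
    ultimately show ?thesis by simp
  qed
  moreover have "(1 / real (q - 1)) * ((c j + (-1) * d j) + (\<Sum>k\<in>{1..<q - 1}. 0)) = (c j - d j) / real (q - 1)" for j by simp
  ultimately show ?thesis by (simp only:)
qed

end

theorem theorem2p7:
  fixes q :: nat and a :: int and J :: nat
  assumes "prime q" and "q mod 4 = 1" and "J \<ge> 1"
  shows "\<exists>c :: nat \<Rightarrow> real.
           c 0 = 1 \<and>
           c 1 = (if [a = 0] (mod int q) then classical_c1 + ln (real q) / 2
                  else classical_c1 - ln (real q) / (2 * (real q - 1))) \<and>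
           (\<lambda>x. countE_ap q a x
                 - LR_K / real q * x * (\<Sum>j\<le>J. c j / ln x powr (1/2 + real j)))
             \<in> O(\<lambda>x. x / ln x powr (real J + 3/2))"
proof -
  have q2: "q > 2" using assms(2) prime_ge_2_nat[OF assms(1)] by (cases "q = 2") auto
  define K where "K = LR_K"
  have K: "K > 0" unfolding K_def by (rule LR_K_pos)
  obtain g where g: "log_expansion countE g J" "g 0 = K" using countE_log_expansion unfolding K_def by blast
  have g1: "g 1 = K * classical_c1" using classical_c1_eq[OF g(1) assms(3)] g(2) unfolding K_def by blast
  obtain d where d: "log_expansion (\<lambda>x. countE (x / real q)) d J" "d 0 = K / real q"
     "d 1 = (K * classical_c1 + K * ln (real q) / 2) / real q"
    using log_expansion_scale[OF g(1) _ assms(3), of "real q"] q2 g(2) g1 by auto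
  have "\<exists>h. log_expansion (countE_ap q a) h J \<and> h 0 = K / real q \<and>
     h 1 = K / real q * (if [a = 0] (mod int q) then classical_c1 + ln (real q) / 2
                  else classical_c1 - ln (real q) / (2 * (real q - 1)))"
  proof (cases "[a = 0] (mod int q)")
    case True
    have "countE_ap q a = (\<lambda>x. countE (x / real q))" using countE_ap_zero[OF assms(1,2) True] by blast
    thus ?thesis using d True q2 by (intro exI[of _ d]) (simp add: field_simps)
  next
    case False
    obtain r :: nat where r: "residue_primroot q r" using prime_primitive_root_exists[of q] assms(1) prime_gt_1_nat by blast
    interpret prime_index q r by unfold_locales (fact assms(1) q2 r)+
    have Q: "real (q - 1) = real q - 1" "real q > 2" using q2 by (auto simp: of_nat_diff)
    have "log_expansion (countE_ap q a) (\<lambda>j. (g j - d j) / real (q - 1)) J"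
      by (rule countE_ap_nonzero_expansion[OF assms(2) False g(1) d(1)])
    moreover have "(g 0 - d 0) / real (q - 1) = K / real q"
      unfolding g(2) d(2) Q(1) using Q(2) by (simp add: field_simps)
    \<comment> \<open>With \<open>c\<close> the classical coefficient, \<open>g 1 - d 1\<close> is
      \<open>K c (1 - 1/q) - K log q / (2 q)\<close>; division by \<open>q - 1\<close> yields the
      claimed correction.\<close>
    moreover have "(g 1 - d 1) / real (q - 1) = K / real q * (classical_c1 - ln (real q) / (2 * (real q - 1)))"
      unfolding g1 d(3) Q(1) using Q(2) by (simp add: divide_simps) (simp add: algebra_simps)
    ultimately show ?thesis using False by (intro exI[of _ "\<lambda>j. (g j - d j) / real (q - 1)"]) simp
  qed
  then obtain h where h: "log_expansion (countE_ap q a) h J" "h 0 = K / real q"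
     "h 1 = K / real q * (if [a = 0] (mod int q) then classical_c1 + ln (real q) / 2
                  else classical_c1 - ln (real q) / (2 * (real q - 1)))" by blast
  \<comment> \<open>Normalisation by the leading coefficient \<open>K / q\<close>, which is nonzero
    by \<open>LR_K_pos\<close>.\<close>
  define c where "c j = real q / K * h j" for j
  have qK: "real q / K * (K / real q) = 1" using K q2 by simp
  have "h j * ln x powr (- 1/2 - real j) = K / real q * (c j / ln x powr (1/2 + real j))" for j x
  proof -
    have "- 1/2 - real j = - (1/2 + real j)" by simp
    hence "ln x powr (- 1/2 - real j) = 1 / ln x powr (1/2 + real j)" by (simp only: powr_minus_divide)
    thus ?thesis using K q2 by (simp add: c_def)
  qed
  hence e: "x * (\<Sum>j\<le>J. h j * ln x powr (- 1/2 - real j)) = K / real q * x * (\<Sum>j\<le>J. c j / ln x powr (1/2 + real j))" for x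
    by (simp only: sum_distrib_left[symmetric]) (simp only: mult_ac)
  have "- real J - 3/2 = - (real J + 3/2)" by simp
  hence b: "x * ln x powr (- real J - 3/2) = x / ln x powr (real J + 3/2)" for x
    by (simp only: powr_minus_divide) simp
  have "(\<lambda>x. countE_ap q a x - K / real q * x * (\<Sum>j\<le>J. c j / ln x powr (1/2 + real j))) \<in> O(\<lambda>x. x / ln x powr (real J + 3/2))"
    using h(1) unfolding log_expansion_def e b .
  moreover have "c 0 = 1" unfolding c_def h(2) by (rule qK)
  moreover have "c 1 = (if [a = 0] (mod int q) then classical_c1 + ln (real q) / 2
                  else classical_c1 - ln (real q) / (2 * (real q - 1)))"
    unfolding c_def h(3) mult.assoc[symmetric] qK by (simp only: mult_1)
  ultimately show ?thesis unfolding K_def by blast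
qed

end
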